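(* Orbispaces, together with the morphisms between them and the composition of morphisms, form a category.
   Context: **Orbispaces.** All spaces are locally connected. A $G$-structure on a connected, locally connected space $U$ is a triple $(\widehat U,G_U,\pi_U)$ where $\widehat U$ is a connected, locally connected space with a continuous (not necessarily effective) left action of a topological group $G_U$ and $\pi_U:\widehat U\to U$ is continuous and induces a homeomorphism $\widehat U/G_U\cong U$. An isomorphism of $G$-structures on $U$ is a pair $(\phi,\lambda)$, $\lambda$ an isomorphism of the groups, $\phi$ a $\lambda$-equivariant homeomorphism commuting with the projections to $U$. Each $g\in G_U$ is viewed as the automorphism $(x\mapsto g\cdot x,\ h\mapsto ghg^{-1})$; by convention the automorphism group is $G_U$ (distinct elements are distinct automorphisms). For a connected open $W\subset U$, each component $\widehat W$ of $\pi_U^{-1}(W)$ with $G_W=\{g\in G_U: g\widehat W=\widehat W\}$ and $\pi_U|_{\widehat W}$ is a $G$-structure on $W$ induced from that of $U$. An orbispace structure on a locally connected space $X$ is a base $\mathcal U$ of connected open sets (basic open sets), each with a $G$-structure, and for $U_\alpha\cap U_\beta\neq\emptyset$ a nonempty set $Tran(U_\alpha,U_\beta)$ of transition maps, such that: (a) each transition map is an isomorphism $(\phi,\lambda)$ from a $G$-structure of a component of $U_\alpha\cap U_\beta$ induced from $U_\alpha$ to one of the same component induced from $U_\beta$; (b) two transition maps over the same component satisfy $\xi_2=g_\beta^{-1}\circ\xi_1\circ g_\alpha$ for some $g_\alpha\in G_{U_\alpha}$, $g_\beta\in G_{U_\beta}$; all such composites are in $Tran(U_\alpha,U_\beta)$,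 and $g_\beta^{-1}\circ(\phi,\lambda)\circ g_\alpha$ equals $(\phi,\lambda)$ as an element iff $\lambda(g_\alpha)=g_\beta$; (c) the identity is in $Tran(U,U)$, so $Tran(U,U)=G_U$; (d) if $U_\alpha\cap U_\beta\cap U_\gamma\ne\emptyset$, $\xi\in Tran(U_\alpha,U_\beta)$, $\eta\in Tran(U_\beta,U_\gamma)$ and the range of $\xi$ meets the domain of $\eta$, a composition $\eta\circ\xi\in Tran(U_\alpha,U_\gamma)$ is given whose restriction to $\pi_{U_\alpha}^{-1}(U_\alpha\cap U_\beta\cap U_\gamma)$ is the composition as maps; composition is associative and agrees with that of (b) when $\alpha=\beta$ or $\beta=\gamma$. $Tran(U_\alpha,U_\beta)$ is topologized as the disjoint union, over components of $U_\alpha\cap U_\beta$, of the quotients of $G_{U_\alpha}\times G_{U_\beta}$ under $(g_\alpha,g_\beta)\mapsto g_\beta^{-1}\circ\xi\circ g_\alpha$. $\mathcal U$ is always enlarged by all connected open subsets of basic open sets (with chosen induced $G$-structures and restricted transition maps). $X_{top}$ is the underlying space. **Morphisms.** A system from $X$ to $X'$ consists of basic open sets $\{U_\alpha\}_{\alpha\in\Lambda}$ covering $X$, basic open sets $\{U'_\alpha\}_{\alpha\in\Lambda}$ of $X'$ (repetitions allowed), continuous $f_\alpha:\widehat{U_\alpha}\to\widehat{U'_\alpha}$ and continuous $\rho_{\beta\alpha}:Tran(U_\alpha,U_\beta)\to Tran(U'_\alpha,U'_\beta)$ with $f_\beta\circ\imath=\rho_{\beta\alpha}(\imath)\circ f_\alpha$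 and $\rho_{\gamma\alpha}(\jmath\circ\imath)=\rho_{\gamma\beta}(\jmath)\circ\rho_{\beta\alpha}(\imath)$. It induces $f:X_{top}\to X'_{top}$. Two systems over the same $(\{U_\alpha\},\{U_\alpha'\})$ are isomorphic if for some $\delta_\alpha\in G_{U'_\alpha}$: $f_{\alpha,2}=\delta_\alpha\circ f_{\alpha,1}$, $\rho_{\beta\alpha,2}(\imath)=\delta_\beta\circ\rho_{\beta\alpha,1}(\imath)\circ\delta_\alpha^{-1}$. Given a cover $\{U_i\}_{i\in I}$ by basic open sets, $\theta:I\to\Lambda$ with $U_i\subset U_{\theta(i)}$, and basic open $U'_i\supset f(U_i)$, a refinement is a system $f_i=(\imath_i')^{-1}\circ f_{\theta(i)}\circ\imath_i$, $\xi_{ji}(a)=(\imath_j')^{-1}\circ\rho_{\theta(j)\theta(i)}(\imath_j\circ a\circ\imath_i^{-1})\circ\imath_i'$ with $\imath_i\in Tran(U_i,U_{\theta(i)})$, $\imath_i'\in Tran(U'_i,U'_{\theta(i)})$ such that the image of $f_{\theta(i)}\circ\imath_i$ lies in the image of $\imath_i'$. Systems are equivalent if they have isomorphic refinements over a common $(\{U_i\},\{U_i'\})$. A morphism is an equivalence class. **Composition.** If $\tilde f:X\to Y$ and $\tilde g:Y\to Z$ are represented by systems over $(\{U_\alpha\},\{V_\alpha\})$ and $(\{V_a\},\{W_a\})$, refine the first over the components $U_{\alpha a}$ of $U_\alpha\cap f^{-1}(V_a)$ with targets components $V_{\alpha a}$ of $V_\alpha\cap V_a$, refine the second over $(\{V_{\alpha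 a}\},\{W_{\alpha a}\})$ with $W_{\alpha a}=W_a$, and compose componentwise; $\tilde g\circ\tilde f$ is the equivalence class of the result. *)

theory Defs
  imports "HOL-Analysis.Analysis" "HOL-Algebra.Group_Action"
begin

section \<open>G-structures\<close>

definition topological_group :: "'g monoid \<Rightarrow> 'g topology \<Rightarrow> bool" where
  "topological_group G T \<longleftrightarrow>
     group G \<and> topspace T = carrier G \<and>
     continuous_map (prod_topology T T) T (\<lambda>(g, h). g \<otimes>\<^bsub>G\<^esub> h) \<and>
     continuous_map T T (\<lambda>g. inv\<^bsub>G\<^esub> g)"

definition continuous_action ::
    "'g monoid \<Rightarrow> 'g topology \<Rightarrow> 'p topology \<Rightarrow> ('g \<Rightarrow> 'p \<Rightarrow> 'p) \<Rightarrow> bool" where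
  "continuous_action G T P a \<longleftrightarrow>
     continuous_map (prod_topology T P) P (\<lambda>(g, x). a g x) \<and>
     (\<forall>x\<in>topspace P. a \<one>\<^bsub>G\<^esub> x = x) \<and>
     (\<forall>g\<in>carrier G. \<forall>h\<in>carrier G. \<forall>x\<in>topspace P. a (g \<otimes>\<^bsub>G\<^esub> h) x = a g (a h x))"

definition orbit_space :: "'g monoid \<Rightarrow> 'p topology \<Rightarrow> ('g \<Rightarrow> 'p \<Rightarrow> 'p) \<Rightarrow> 'p set topology" where
  "orbit_space G P a =
     topology (\<lambda>Q. Q \<subseteq> orbits G (topspace P) a \<and> openin P {x \<in> topspace P. orbit G a x \<in> Q})"

lemma openin_orbit_space:
  "openin (orbit_space G P a) Q \<longleftrightarrow>
     Q \<subseteq> orbits G (topspace P) a \<and> openin P {x \<in> topspace P. orbit G a x \<in> Q}"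
proof -
  have "istopology (\<lambda>Q. Q \<subseteq> orbits G (topspace P) a \<and>
          openin P {x \<in> topspace P. orbit G a x \<in> Q})"
    unfolding istopology_def
  proof (intro conjI allI impI, goal_cases)
    case (2 S T)
    have "{x \<in> topspace P. orbit G a x \<in> S \<inter> T} =
        {x \<in> topspace P. orbit G a x \<in> S} \<inter> {x \<in> topspace P. orbit G a x \<in> T}" by auto
    with 2 show ?case by auto
  next
    case (4 \<K>)
    have "{x \<in> topspace P. orbit G a x \<in> \<Union>\<K>} =
        (\<Union>K\<in>\<K>. {x \<in> topspace P. orbit G a x \<in> K})" by auto
    with 4 show ?case by auto
  qed auto
  then show ?thesis unfolding orbit_space_def by (simp add: topology_inverse')
qed

record ('x, 'p, 'g) g_structure =
  hat :: "'p topology"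
  grp :: "'g monoid"
  grp_top :: "'g topology"
  act :: "'g \<Rightarrow> 'p \<Rightarrow> 'p"
  proj :: "'p \<Rightarrow> 'x"

definition g_structure_on :: "'x topology \<Rightarrow> ('x, 'p, 'g) g_structure \<Rightarrow> bool" where
  "g_structure_on U A \<longleftrightarrow>
     connected_space (hat A) \<and> locally_connected_space (hat A) \<and>
     topological_group (grp A) (grp_top A) \<and>
     continuous_action (grp A) (grp_top A) (hat A) (act A) \<and>
     continuous_map (hat A) U (proj A) \<and>
     (\<exists>h. homeomorphic_map (orbit_space (grp A) (hat A) (act A)) U h \<and>
          (\<forall>x\<in>topspace (hat A). h (orbit (grp A) (act A) x) = proj A x))"

definition g_structure_iso ::
    "('x, 'p, 'g) g_structure \<Rightarrow> ('x, 'p, 'g) g_structure \<Rightarrow> ('p \<Rightarrow> 'p) \<Rightarrow> ('g \<Rightarrow> 'g) \<Rightarrow> bool" where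
  "g_structure_iso A B \<phi> \<psi> \<longleftrightarrow>
     homeomorphic_map (hat A) (hat B) \<phi> \<and>
     \<psi> \<in> iso (grp A) (grp B) \<and> homeomorphic_map (grp_top A) (grp_top B) \<psi> \<and>
     (\<forall>g\<in>carrier (grp A). \<forall>x\<in>topspace (hat A). \<phi> (act A g x) = act B (\<psi> g) (\<phi> x)) \<and>
     (\<forall>x\<in>topspace (hat A). proj B (\<phi> x) = proj A x)"

definition hat_components :: "('x, 'p, 'g) g_structure \<Rightarrow> 'x set \<Rightarrow> 'p set set" where
  "hat_components A W =
     connected_components_of (subtopology (hat A) {x \<in> topspace (hat A). proj A x \<in> W})"

definition stab :: "('x, 'p, 'g) g_structure \<Rightarrow> 'p set \<Rightarrow> 'g set" where
  "stab A P = stabilizer (grp A) (\<lambda>g S. act A g ` S) P"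

definition induced :: "('x, 'p, 'g) g_structure \<Rightarrow> 'p set \<Rightarrow> ('x, 'p, 'g) g_structure" where
  "induced A P = A\<lparr>hat := subtopology (hat A) P,
                    grp := (grp A)\<lparr>carrier := stab A P\<rparr>,
                    grp_top := subtopology (grp_top A) (stab A P)\<rparr>"

section \<open>Orbispaces\<close>

text \<open>
  Since group actions need not be effective, a transition map is not determined by its underlying
  pair \<open>(\<phi>, \<lambda>)\<close>. The elements of \<open>Tran U V\<close> are therefore labels \<open>\<xi>\<close>, with \<open>tdom U V \<xi>\<close> the domain of
  \<open>\<phi>\<close> (a subset of the chart of \<open>U\<close>), \<open>tmap U V \<xi> = \<phi>\<close> and \<open>tiso U V \<xi> = \<lambda>\<close>. The map \<open>gtran U\<close> is
  the identification of the group of \<open>U\<close> with \<open>Tran U U\<close>.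

  The range of \<open>\<xi>\<close> may meet the domain of \<open>\<eta>\<close> in several components, lying over different components
  of \<open>U \<inter> W\<close>, and a transition map from \<open>U\<close> to \<open>W\<close> lives over one such component. So
  composition is taken along a component of the overlap: \<open>tcomp U V W \<eta> \<xi> x\<close> is the
  composition \<open>\<eta> \<circ> \<xi>\<close> along the component of the overlap that contains \<open>x\<close>.
\<close>

record ('x, 'p, 'g, 't) orbispace =
  top_space :: "'x topology"
  basics :: "'x set set"
  chart :: "'x set \<Rightarrow> ('x, 'p, 'g) g_structure"
  Tran :: "'x set \<Rightarrow> 'x set \<Rightarrow> 't set"
  tdom :: "'x set \<Rightarrow> 'x set \<Rightarrow> 't \<Rightarrow> 'p set"
  tmap :: "'x set \<Rightarrow> 'x set \<Rightarrow> 't \<Rightarrow> 'p \<Rightarrow> 'p"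
  tiso :: "'x set \<Rightarrow> 'x set \<Rightarrow> 't \<Rightarrow> 'g \<Rightarrow> 'g"
  gtran :: "'x set \<Rightarrow> 'g \<Rightarrow> 't"
  tcomp :: "'x set \<Rightarrow> 'x set \<Rightarrow> 'x set \<Rightarrow> 't \<Rightarrow> 't \<Rightarrow> 'p \<Rightarrow> 't"

abbreviation pts :: "('x, 'p, 'g, 't) orbispace \<Rightarrow> 'x set \<Rightarrow> 'p set" where
  "pts X U \<equiv> topspace (hat (chart X U))"

abbreviation gp :: "('x, 'p, 'g, 't) orbispace \<Rightarrow> 'x set \<Rightarrow> 'g monoid" where
  "gp X U \<equiv> grp (chart X U)"

definition components_in :: "('x, 'p, 'g, 't) orbispace \<Rightarrow> 'x set \<Rightarrow> 'x set set" where
  "components_in X A = connected_components_of (subtopology (top_space X) A)"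

definition tran_over ::
    "('x, 'p, 'g, 't) orbispace \<Rightarrow> 'x set \<Rightarrow> 'x set \<Rightarrow> 'x set \<Rightarrow> 't \<Rightarrow> bool" where
  "tran_over X U V W \<xi> \<longleftrightarrow>
     tdom X U V \<xi> \<in> hat_components (chart X U) W \<and>
     tmap X U V \<xi> ` tdom X U V \<xi> \<in> hat_components (chart X V) W \<and>
     g_structure_iso (induced (chart X U) (tdom X U V \<xi>))
       (induced (chart X V) (tmap X U V \<xi> ` tdom X U V \<xi>)) (tmap X U V \<xi>) (tiso X U V \<xi>)"

definition overlap ::
    "('x, 'p, 'g, 't) orbispace \<Rightarrow> 'x set \<Rightarrow> 'x set \<Rightarrow> 'x set \<Rightarrow> 't \<Rightarrow> 't \<Rightarrow> 'p set" where
  "overlap X U V W \<eta> \<xi> = {x \<in> tdom X U V \<xi>. tmap X U V \<xi> x \<in> tdom X V W \<eta>}"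

text \<open>
  \<open>twist X U V h \<xi> g\<close> is \<open>h \<circ> \<xi> \<circ> g\<close> for \<open>g\<close>, \<open>h\<close> in the groups of \<open>U\<close>, \<open>V\<close>. Its domain is the
  translate of that of \<open>\<xi>\<close> by the inverse of \<open>g\<close>, which is connected, so that the choice of the
  point is immaterial. Being defined by \<open>tcomp\<close>, it agrees with the composition of transition maps.
\<close>

definition twist ::
    "('x, 'p, 'g, 't) orbispace \<Rightarrow> 'x set \<Rightarrow> 'x set \<Rightarrow> 'g \<Rightarrow> 't \<Rightarrow> 'g \<Rightarrow> 't" where
  "twist X U V h \<xi> g =
     (let x = (SOME x. x \<in> pts X U \<and> act (chart X U) g x \<in> tdom X U V \<xi>)
      in tcomp X U V V (gtran X V h) (tcomp X U U V \<xi> (gtran X U g) x) x)"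

text \<open>
  The base is closed under passing to connected open subsets; that the chart of such a subset is an
  induced one, and its transition maps are restrictions, is expressed up to isomorphism by the
  transition maps between the subset and the larger set. \<open>Tran U V = {}\<close> for disjoint \<open>U\<close>, \<open>V\<close> is a
  convention.
\<close>

definition orbispace :: "('x, 'p, 'g, 't) orbispace \<Rightarrow> bool" where
  "orbispace X \<longleftrightarrow>
     locally_connected_space (top_space X) \<and>
     (\<forall>U\<in>basics X. openin (top_space X) U \<and> connectedin (top_space X) U \<and> U \<noteq> {}) \<and>
     (\<forall>A x. openin (top_space X) A \<and> x \<in> A \<longrightarrow> (\<exists>U\<in>basics X. x \<in> U \<and> U \<subseteq> A)) \<and>
     (\<forall>U\<in>basics X. \<forall>W. openin (top_space X) W \<and> connectedin (top_space X) W \<and> W \<noteq> {} \<and> W \<subseteq> U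
        \<longrightarrow> W \<in> basics X) \<and>
     (\<forall>U\<in>basics X. g_structure_on (subtopology (top_space X) U) (chart X U)) \<and>
     (\<forall>U\<in>basics X. \<forall>V\<in>basics X. Tran X U V \<noteq> {} \<longleftrightarrow> U \<inter> V \<noteq> {}) \<and>
     (\<forall>U\<in>basics X. \<forall>V\<in>basics X. \<forall>\<xi>\<in>Tran X U V. \<exists>W\<in>components_in X (U \<inter> V). tran_over X U V W \<xi>) \<and>
     (\<forall>U\<in>basics X. \<forall>V\<in>basics X. \<forall>W\<in>components_in X (U \<inter> V). \<forall>\<xi>\<^sub>1\<in>Tran X U V. \<forall>\<xi>\<^sub>2\<in>Tran X U V.
        tran_over X U V W \<xi>\<^sub>1 \<and> tran_over X U V W \<xi>\<^sub>2 \<longrightarrow>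
        (\<exists>g\<in>carrier (gp X U). \<exists>h\<in>carrier (gp X V). \<xi>\<^sub>2 = twist X U V (inv\<^bsub>gp X V\<^esub> h) \<xi>\<^sub>1 g)) \<and>
     (\<forall>U\<in>basics X. \<forall>V\<in>basics X. \<forall>\<xi>\<in>Tran X U V. \<forall>g\<in>carrier (gp X U). \<forall>h\<in>carrier (gp X V).
        twist X U V (inv\<^bsub>gp X V\<^esub> h) \<xi> g \<in> Tran X U V \<and>
        (twist X U V (inv\<^bsub>gp X V\<^esub> h) \<xi> g = \<xi> \<longleftrightarrow>
           g \<in> stab (chart X U) (tdom X U V \<xi>) \<and> tiso X U V \<xi> g = h)) \<and>
     (\<forall>U\<in>basics X. bij_betw (gtran X U) (carrier (gp X U)) (Tran X U U) \<and>
        (\<forall>g\<in>carrier (gp X U). tdom X U U (gtran X U g) = pts X U \<and>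
           (\<forall>x\<in>pts X U. tmap X U U (gtran X U g) x = act (chart X U) g x) \<and>
           (\<forall>h\<in>carrier (gp X U). tiso X U U (gtran X U g) h = g \<otimes>\<^bsub>gp X U\<^esub> h \<otimes>\<^bsub>gp X U\<^esub> inv\<^bsub>gp X U\<^esub> g) \<and>
           (\<forall>h\<in>carrier (gp X U). \<forall>x\<in>pts X U.
              tcomp X U U U (gtran X U g) (gtran X U h) x = gtran X U (g \<otimes>\<^bsub>gp X U\<^esub> h)))) \<and>
     (\<forall>U\<in>basics X. \<forall>V\<in>basics X. \<forall>W\<in>basics X. \<forall>\<xi>\<in>Tran X U V. \<forall>\<eta>\<in>Tran X V W.
        \<forall>C\<in>connected_components_of (subtopology (hat (chart X U)) (overlap X U V W \<eta> \<xi>)).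
        \<exists>\<zeta>\<in>Tran X U W. C \<subseteq> tdom X U W \<zeta> \<and>
          (\<forall>x\<in>C. tcomp X U V W \<eta> \<xi> x = \<zeta> \<and>
                 tmap X U W \<zeta> x = tmap X V W \<eta> (tmap X U V \<xi> x)) \<and>
          (\<forall>g\<in>stab (chart X U) C. tiso X U W \<zeta> g = tiso X V W \<eta> (tiso X U V \<xi> g))) \<and>
     (\<forall>U\<^sub>1\<in>basics X. \<forall>U\<^sub>2\<in>basics X. \<forall>U\<^sub>3\<in>basics X. \<forall>U\<^sub>4\<in>basics X.
        \<forall>\<xi>\<in>Tran X U\<^sub>1 U\<^sub>2. \<forall>\<eta>\<in>Tran X U\<^sub>2 U\<^sub>3. \<forall>\<zeta>\<in>Tran X U\<^sub>3 U\<^sub>4. \<forall>x\<in>overlap X U\<^sub>1 U\<^sub>2 U\<^sub>3 \<eta> \<xi>.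
        tmap X U\<^sub>2 U\<^sub>3 \<eta> (tmap X U\<^sub>1 U\<^sub>2 \<xi> x) \<in> tdom X U\<^sub>3 U\<^sub>4 \<zeta> \<longrightarrow>
        tcomp X U\<^sub>1 U\<^sub>3 U\<^sub>4 \<zeta> (tcomp X U\<^sub>1 U\<^sub>2 U\<^sub>3 \<eta> \<xi> x) x =
        tcomp X U\<^sub>1 U\<^sub>2 U\<^sub>4 (tcomp X U\<^sub>2 U\<^sub>3 U\<^sub>4 \<zeta> \<eta> (tmap X U\<^sub>1 U\<^sub>2 \<xi> x)) \<xi> x)"

text \<open>
  The topology on \<open>Tran X U V\<close>: the disjoint union, over the components of \<open>U \<inter> V\<close>, of the quotient
  topologies given by the maps \<open>(g, h) \<mapsto> h\<^sup>-\<^sup>1 \<circ> \<xi> \<circ> g\<close>; the image of this map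
  consists of the transition maps over the same component as \<open>\<xi>\<close>.
\<close>

definition tran_top :: "('x, 'p, 'g, 't) orbispace \<Rightarrow> 'x set \<Rightarrow> 'x set \<Rightarrow> 't topology" where
  "tran_top X U V = topology (\<lambda>S. S \<subseteq> Tran X U V \<and>
     (\<forall>\<xi>\<in>Tran X U V. openin (prod_topology (grp_top (chart X U)) (grp_top (chart X V)))
        {(g, h). g \<in> carrier (gp X U) \<and> h \<in> carrier (gp X V) \<and>
                 twist X U V (inv\<^bsub>gp X V\<^esub> h) \<xi> g \<in> S}))"

lemma openin_tran_top:
  "openin (tran_top X U V) S \<longleftrightarrow> S \<subseteq> Tran X U V \<and>
     (\<forall>\<xi>\<in>Tran X U V. openin (prod_topology (grp_top (chart X U)) (grp_top (chart X V)))
        {(g, h). g \<in> carrier (gp X U) \<and> h \<in> carrier (gp X V) \<and>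
                 twist X U V (inv\<^bsub>gp X V\<^esub> h) \<xi> g \<in> S})"
proof -
  define q where "q \<xi> S = {(g, h). g \<in> carrier (gp X U) \<and> h \<in> carrier (gp X V) \<and>
                 twist X U V (inv\<^bsub>gp X V\<^esub> h) \<xi> g \<in> S}" for \<xi> S
  have "istopology (\<lambda>S. S \<subseteq> Tran X U V \<and> (\<forall>\<xi>\<in>Tran X U V.
          openin (prod_topology (grp_top (chart X U)) (grp_top (chart X V))) (q \<xi> S)))"
    unfolding istopology_def
  proof (intro conjI allI impI ballI, goal_cases)
    case (2 S T \<xi>)
    have "q \<xi> (S \<inter> T) = q \<xi> S \<inter> q \<xi> T" by (auto simp: q_def)
    with 2 show ?case by auto
  next
    case (4 \<K> \<xi>)
    have "q \<xi> (\<Union>\<K>) = (\<Union>K\<in>\<K>. q \<xi> K)" by (auto simp: q_def)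
    with 4 show ?case by auto
  qed auto
  then show ?thesis unfolding tran_top_def q_def by (simp add: topology_inverse')
qed

definition tran_inv :: "('x, 'p, 'g, 't) orbispace \<Rightarrow> 'x set \<Rightarrow> 'x set \<Rightarrow> 't \<Rightarrow> 't" where
  "tran_inv X U V \<xi> = (THE \<eta>. \<eta> \<in> Tran X V U \<and>
     tdom X V U \<eta> = tmap X U V \<xi> ` tdom X U V \<xi> \<and>
     (\<forall>x\<in>tdom X U V \<xi>. tcomp X U V U \<eta> \<xi> x = gtran X U \<one>\<^bsub>gp X U\<^esub>))"

section \<open>Systems\<close>

text \<open>
  Index sets of systems are subsets of a type that contains arbitrary labels and is closed under
  the formation of the triples \<open>(\<alpha>, a, W)\<close> which index a composition.
\<close>

datatype ('x, 'l) index = Label 'l | Node "('x, 'l) index" "('x, 'l) index" "'x set"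

text \<open>\<open>smap S \<alpha>\<close> is \<open>f\<^sub>\<alpha>\<close>, and \<open>stran S \<beta> \<alpha>\<close> is \<open>\<rho>\<^sub>\<beta>\<^sub>\<alpha>\<close>.\<close>

record ('x, 'p, 't, 'i) system =
  idx :: "'i set"
  sdom :: "'i \<Rightarrow> 'x set"
  scod :: "'i \<Rightarrow> 'x set"
  smap :: "'i \<Rightarrow> 'p \<Rightarrow> 'p"
  stran :: "'i \<Rightarrow> 'i \<Rightarrow> 't \<Rightarrow> 't"

definition local_system ::
    "('x, 'p, 'g, 't) orbispace \<Rightarrow> ('x, 'p, 'g, 't) orbispace \<Rightarrow> ('x, 'p, 't, 'i) system \<Rightarrow> bool" where
  "local_system X X' S \<longleftrightarrow>
     (\<forall>\<alpha>\<in>idx S. sdom S \<alpha> \<in> basics X \<and> scod S \<alpha> \<in> basics X' \<and>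
        continuous_map (hat (chart X (sdom S \<alpha>))) (hat (chart X' (scod S \<alpha>))) (smap S \<alpha>)) \<and>
     (\<forall>\<alpha>\<in>idx S. \<forall>\<beta>\<in>idx S.
        continuous_map (tran_top X (sdom S \<alpha>) (sdom S \<beta>)) (tran_top X' (scod S \<alpha>) (scod S \<beta>))
          (stran S \<beta> \<alpha>) \<and>
        (\<forall>i\<in>Tran X (sdom S \<alpha>) (sdom S \<beta>).
           \<forall>x\<in>tdom X (sdom S \<alpha>) (sdom S \<beta>) i.
             smap S \<alpha> x \<in> tdom X' (scod S \<alpha>) (scod S \<beta>) (stran S \<beta> \<alpha> i) \<and>
             smap S \<beta> (tmap X (sdom S \<alpha>) (sdom S \<beta>) i x) =
             tmap X' (scod S \<alpha>) (scod S \<beta>) (stran S \<beta> \<alpha> i) (smap S \<alpha> x))) \<and>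
     (\<forall>\<alpha>\<in>idx S. \<forall>\<beta>\<in>idx S. \<forall>\<gamma>\<in>idx S.
        \<forall>i\<in>Tran X (sdom S \<alpha>) (sdom S \<beta>). \<forall>j\<in>Tran X (sdom S \<beta>) (sdom S \<gamma>).
        \<forall>x\<in>overlap X (sdom S \<alpha>) (sdom S \<beta>) (sdom S \<gamma>) j i.
          stran S \<gamma> \<alpha> (tcomp X (sdom S \<alpha>) (sdom S \<beta>) (sdom S \<gamma>) j i x) =
          tcomp X' (scod S \<alpha>) (scod S \<beta>) (scod S \<gamma>) (stran S \<gamma> \<beta> j) (stran S \<beta> \<alpha> i) (smap S \<alpha> x))"

definition system ::
    "('x, 'p, 'g, 't) orbispace \<Rightarrow> ('x, 'p, 'g, 't) orbispace \<Rightarrow> ('x, 'p, 't, 'i) system \<Rightarrow> bool" where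
  "system X X' S \<longleftrightarrow> local_system X X' S \<and> (\<Union>\<alpha>\<in>idx S. sdom S \<alpha>) = topspace (top_space X)"

text \<open>The induced map \<open>f\<close> of underlying spaces. For a system the value does not depend on \<open>\<alpha>\<close> and \<open>z\<close>.\<close>

definition base_map ::
    "('x, 'p, 'g, 't) orbispace \<Rightarrow> ('x, 'p, 'g, 't) orbispace \<Rightarrow> ('x, 'p, 't, 'i) system \<Rightarrow> 'x \<Rightarrow> 'x" where
  "base_map X X' S x =
     (THE y. \<exists>\<alpha>\<in>idx S. \<exists>z\<in>pts X (sdom S \<alpha>). proj (chart X (sdom S \<alpha>)) z = x \<and>
        y = proj (chart X' (scod S \<alpha>)) (smap S \<alpha> z))"

definition system_iso ::
    "('x, 'p, 'g, 't) orbispace \<Rightarrow> ('x, 'p, 'g, 't) orbispace \<Rightarrow>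
     ('x, 'p, 't, 'i) system \<Rightarrow> ('x, 'p, 't, 'i) system \<Rightarrow> bool" where
  "system_iso X X' S\<^sub>1 S\<^sub>2 \<longleftrightarrow>
     idx S\<^sub>1 = idx S\<^sub>2 \<and>
     (\<forall>\<alpha>\<in>idx S\<^sub>1. sdom S\<^sub>1 \<alpha> = sdom S\<^sub>2 \<alpha> \<and> scod S\<^sub>1 \<alpha> = scod S\<^sub>2 \<alpha>) \<and>
     (\<exists>\<delta>. (\<forall>\<alpha>\<in>idx S\<^sub>1. \<delta> \<alpha> \<in> carrier (gp X' (scod S\<^sub>1 \<alpha>)) \<and>
              (\<forall>x\<in>pts X (sdom S\<^sub>1 \<alpha>).
                 smap S\<^sub>2 \<alpha> x = act (chart X' (scod S\<^sub>1 \<alpha>)) (\<delta> \<alpha>) (smap S\<^sub>1 \<alpha> x))) \<and>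
          (\<forall>\<alpha>\<in>idx S\<^sub>1. \<forall>\<beta>\<in>idx S\<^sub>1. \<forall>i\<in>Tran X (sdom S\<^sub>1 \<alpha>) (sdom S\<^sub>1 \<beta>).
              stran S\<^sub>2 \<beta> \<alpha> i =
              twist X' (scod S\<^sub>1 \<alpha>) (scod S\<^sub>1 \<beta>) (\<delta> \<beta>) (stran S\<^sub>1 \<beta> \<alpha> i)
                (inv\<^bsub>gp X' (scod S\<^sub>1 \<alpha>)\<^esub> \<delta> \<alpha>)))"

text \<open>
  \<open>R\<close> is a refinement of \<open>S\<close> by means of \<open>\<theta>\<close>; here \<open>\<iota> i\<close> and \<open>\<iota>' i\<close> are the transition maps
  \<open>\<imath>\<^sub>i\<close> and \<open>\<imath>'\<^sub>i\<close>. The equation for \<open>stran R j i a\<close> spells out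
  \<open>\<imath>'\<^sub>j\<^sup>-\<^sup>1 \<circ> \<rho> (\<imath>\<^sub>j \<circ> a \<circ> \<imath>\<^sub>i\<^sup>-\<^sup>1) \<circ> \<imath>'\<^sub>i\<close>, each composition being taken along the component that
  contains the image of the (connected) domain of \<open>a\<close>.
  Whether the family \<open>sdom R\<close> covers the space is left open, because the second factor of
  a composition is refined over a family that need only cover the image of the first.
\<close>

definition refinement ::
    "('x, 'p, 'g, 't) orbispace \<Rightarrow> ('x, 'p, 'g, 't) orbispace \<Rightarrow>
     ('x, 'p, 't, 'i) system \<Rightarrow> ('i \<Rightarrow> 'i) \<Rightarrow> ('x, 'p, 't, 'i) system \<Rightarrow> bool" where
  "refinement X X' S \<theta> R \<longleftrightarrow>
     local_system X X' R \<and>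
     (\<forall>i\<in>idx R. \<theta> i \<in> idx S \<and> sdom R i \<subseteq> sdom S (\<theta> i) \<and>
        base_map X X' S ` sdom R i \<subseteq> scod R i) \<and>
     (\<exists>\<iota> \<iota>'.
        (\<forall>i\<in>idx R.
           \<iota> i \<in> Tran X (sdom R i) (sdom S (\<theta> i)) \<and>
           \<iota>' i \<in> Tran X' (scod R i) (scod S (\<theta> i)) \<and>
           (\<forall>x\<in>pts X (sdom R i).
              smap S (\<theta> i) (tmap X (sdom R i) (sdom S (\<theta> i)) (\<iota> i) x) \<in>
                tmap X' (scod R i) (scod S (\<theta> i)) (\<iota>' i) ` tdom X' (scod R i) (scod S (\<theta> i)) (\<iota>' i) \<and>
              smap R i x =
                tmap X' (scod S (\<theta> i)) (scod R i) (tran_inv X' (scod R i) (scod S (\<theta> i)) (\<iota>' i))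
                  (smap S (\<theta> i) (tmap X (sdom R i) (sdom S (\<theta> i)) (\<iota> i) x)))) \<and>
        (\<forall>i\<in>idx R. \<forall>j\<in>idx R. \<forall>a\<in>Tran X (sdom R i) (sdom R j).
           \<forall>x\<in>tdom X (sdom R i) (sdom R j) a.
             stran R j i a =
               (let U\<^sub>i = sdom R i; U\<^sub>j = sdom R j; V\<^sub>i = sdom S (\<theta> i); V\<^sub>j = sdom S (\<theta> j);
                    U\<^sub>i' = scod R i; U\<^sub>j' = scod R j; V\<^sub>i' = scod S (\<theta> i); V\<^sub>j' = scod S (\<theta> j);
                    b = tcomp X V\<^sub>i U\<^sub>i V\<^sub>j (tcomp X U\<^sub>i U\<^sub>j V\<^sub>j (\<iota> j) a x) (tran_inv X U\<^sub>i V\<^sub>i (\<iota> i))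
                          (tmap X U\<^sub>i V\<^sub>i (\<iota> i) x)
                in tcomp X' U\<^sub>i' V\<^sub>j' U\<^sub>j' (tran_inv X' U\<^sub>j' V\<^sub>j' (\<iota>' j))
                     (tcomp X' U\<^sub>i' V\<^sub>i' V\<^sub>j' (stran S (\<theta> j) (\<theta> i) b) (\<iota>' i) (smap R i x))
                     (smap R i x))))"

section \<open>Morphisms and their composition\<close>

definition system_rel ::
    "('x, 'p, 'g, 't) orbispace \<Rightarrow> ('x, 'p, 'g, 't) orbispace \<Rightarrow> ('x, 'p, 't, 'i) system rel" where
  "system_rel X X' = {(S, T). system X X' S \<and> system X X' T \<and>
     (\<exists>R Q \<theta> \<kappa>. system X X' R \<and> system X X' Q \<and>
        refinement X X' S \<theta> R \<and> refinement X X' T \<kappa> Q \<and> system_iso X X' R Q)}"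

definition orbi_hom ::
    "('x, 'p, 'g, 't) orbispace \<Rightarrow> ('x, 'p, 'g, 't) orbispace \<Rightarrow>
     ('x, 'p, 't, ('x, 'l) index) system set set" where
  "orbi_hom X X' = {S. system X X' S} // system_rel X X'"

definition compose_systems ::
    "('x, 'p, 't, 'i) system \<Rightarrow> ('x, 'p, 't, 'i) system \<Rightarrow> ('x, 'p, 't, 'i) system" where
  "compose_systems Q R =
     \<lparr>idx = idx R, sdom = sdom R, scod = scod Q,
      smap = (\<lambda>i. smap Q i \<circ> smap R i), stran = (\<lambda>j i. stran Q j i \<circ> stran R j i)\<rparr>"

primrec left_index :: "('x, 'l) index \<Rightarrow> ('x, 'l) index" where
  "left_index (Node \<alpha> a W) = \<alpha>" | "left_index (Label l) = Label l"

primrec right_index :: "('x, 'l) index \<Rightarrow> ('x, 'l) index" where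
  "right_index (Node \<alpha> a W) = a" | "right_index (Label l) = Label l"

text \<open>
  \<open>H\<close> is a composite of \<open>S\<close> over \<open>({U\<^sub>\<alpha>}, {V\<^sub>\<alpha>})\<close> and \<open>T\<close> over \<open>({V\<^sub>a}, {W\<^sub>a})\<close>. The index
  \<open>Node \<alpha> a W\<close> stands for a component \<open>W\<close> of \<open>U\<^sub>\<alpha> \<inter> f\<^sup>-\<^sup>1 V\<^sub>a\<close>, with target the component of
  \<open>V\<^sub>\<alpha> \<inter> V\<^sub>a\<close> that contains \<open>f W\<close>.
\<close>

definition is_composite ::
    "('x, 'p, 'g, 't) orbispace \<Rightarrow> ('x, 'p, 'g, 't) orbispace \<Rightarrow> ('x, 'p, 'g, 't) orbispace \<Rightarrow>
     ('x, 'p, 't, ('x, 'l) index) system \<Rightarrow> ('x, 'p, 't, ('x, 'l) index) system \<Rightarrow>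
     ('x, 'p, 't, ('x, 'l) index) system \<Rightarrow> bool" where
  "is_composite X Y Z T S H \<longleftrightarrow>
     (\<exists>R Q.
        refinement X Y S left_index R \<and>
        idx R = {Node \<alpha> a W | \<alpha> a W. \<alpha> \<in> idx S \<and> a \<in> idx T \<and>
                   W \<in> components_in X {x \<in> sdom S \<alpha>. base_map X Y S x \<in> sdom T a}} \<and>
        (\<forall>\<alpha> a W. Node \<alpha> a W \<in> idx R \<longrightarrow>
           sdom R (Node \<alpha> a W) = W \<and>
           scod R (Node \<alpha> a W) \<in> components_in Y (scod S \<alpha> \<inter> sdom T a)) \<and>
        refinement Y Z T right_index Q \<and>
        idx Q = idx R \<and>
        (\<forall>\<alpha> a W. Node \<alpha> a W \<in> idx R \<longrightarrow>
           sdom Q (Node \<alpha> a W) = scod R (Node \<alpha> a W) \<and>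
           scod Q (Node \<alpha> a W) = scod T a) \<and>
        H = compose_systems Q R)"

text \<open>
  The equivalence class of the composites of representatives of \<open>F\<close> and \<open>G\<close>. That this is
  a single class, independently of all choices, amounts to \<open>orbi_comp X Y Z G F\<close> being an
  element of \<open>orbi_hom X Z\<close>.
\<close>

definition orbi_comp ::
    "('x, 'p, 'g, 't) orbispace \<Rightarrow> ('x, 'p, 'g, 't) orbispace \<Rightarrow> ('x, 'p, 'g, 't) orbispace \<Rightarrow>
     ('x, 'p, 't, ('x, 'l) index) system set \<Rightarrow> ('x, 'p, 't, ('x, 'l) index) system set \<Rightarrow>
     ('x, 'p, 't, ('x, 'l) index) system set" where
  "orbi_comp X Y Z G F =
     system_rel X Z `` {H. \<exists>S\<in>F. \<exists>T\<in>G. is_composite X Y Z T S H}"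

text \<open>Composition takes the three objects as arguments, so hom-sets need not be disjoint.\<close>

locale category =
  fixes Obj :: "'o set"
    and Hom :: "'o \<Rightarrow> 'o \<Rightarrow> 'm set"
    and Comp :: "'o \<Rightarrow> 'o \<Rightarrow> 'o \<Rightarrow> 'm \<Rightarrow> 'm \<Rightarrow> 'm"
  assumes comp_closed:
      "\<lbrakk>X \<in> Obj; Y \<in> Obj; Z \<in> Obj; f \<in> Hom X Y; g \<in> Hom Y Z\<rbrakk> \<Longrightarrow> Comp X Y Z g f \<in> Hom X Z"
    and comp_assoc:
      "\<lbrakk>W \<in> Obj; X \<in> Obj; Y \<in> Obj; Z \<in> Obj; f \<in> Hom W X; g \<in> Hom X Y; h \<in> Hom Y Z\<rbrakk> \<Longrightarrow>
       Comp W Y Z h (Comp W X Y g f) = Comp W X Z (Comp X Y Z h g) f"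
    and ident_exists:
      "X \<in> Obj \<Longrightarrow> \<exists>e\<in>Hom X X.
         (\<forall>Y\<in>Obj. \<forall>f\<in>Hom X Y. Comp X X Y f e = f) \<and> (\<forall>Y\<in>Obj. \<forall>f\<in>Hom Y X. Comp Y X X e f = f)"

end

theory Submission
  imports Defs
begin

text \<open>
  An orbispace carries a groupoid. A \<^emph>\<open>germ\<close> is a transition map together with a point of its domain;
  since transition maps are composed along the component that contains a given point, germs have
  composites in the ordinary sense, and they form a groupoid whose objects are the points of all
  charts. Any two points over the same base point are joined by a germ (\<open>arrow_exists\<close>), and
  inverses exist because a transition map from a chart to itself is a group element
  (\<open>left_inverse_exists\<close>). A system is then a functor on germs whose effect on transition maps does
  not depend on the point (\<open>germ_functor\<close>), and its continuity amounts to the continuity of the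
  homomorphisms that it induces on the groups of the charts (\<open>local_systemI\<close>).

  Refinements involve many choices, so equivalence of systems is first replaced by a relation
  without choices: two systems are \<^emph>\<open>bridged\<close> if they are the restrictions of one functor on the
  disjoint union of their index sets. This relation is visibly symmetric, and bridges can be
  composed with bridges (\<open>compose_bridged\<close>). The core of the proof is that a functor can be recovered
  from its bridges to a functor \<open>S\<close> over a cover, the hub: on a germ \<open>a\<close> it takes the value
  \<open>n (e')\<^sup>-\<^sup>1 \<bullet> S (e' \<bullet> a \<bullet> e\<^sup>-\<^sup>1) \<bullet> n e\<close>, where the germs \<open>e\<close>, \<open>e'\<close> lead from the endpoints of \<open>a\<close> to
  charts of \<open>S\<close> and \<open>n\<close> is the bridge. Conversely this formula extends every compatible family of
  bridges to a functor: independence of \<open>e\<close> and \<open>e'\<close> is groupoid algebra (\<open>via_hub_unique\<close>), and the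
  resulting transition map does not depend on the point of the germ because it is locally constant
  on a connected domain (\<open>via_hub_label\<close>). It follows that being bridged is transitive over covering
  systems (\<open>bridged_trans\<close>), that refinements exist and are bridged to the original (\<open>refine_exists\<close>,
  \<open>refinement_bridged\<close>), and, in the other direction, that bridged systems over the same charts are
  isomorphic (\<open>bridged_system_iso\<close>). Hence two systems are equivalent if and only if they are bridged
  (\<open>system_rel_iff\<close>).

  A composite of two morphisms is bridged to the plain composite of any pair of systems with
  matching charts that are bridged to the factors (\<open>composite_bridged\<close>). So composition is well
  defined, and it may be computed from convenient representatives: three systems with matching
  charts (\<open>composable_triple\<close>), where composition is associative on the nose, and identity
  functors over the charts of a given system.
\<close>


section \<open>Connected components\<close>

lemma component_subset:
  "C \<in> connected_components_of (subtopology T A) \<Longrightarrow> C \<subseteq> A"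
  by (metis connected_components_of_subset le_inf_iff topspace_subtopology)

lemma component_connected:
  "C \<in> connected_components_of (subtopology T A) \<Longrightarrow> connectedin T C"
  by (meson connectedin_connected_components_of connectedin_subtopology)

lemma component_maximal:
  assumes "C \<in> connected_components_of (subtopology T A)"
    and "connectedin T K" "K \<subseteq> A" "x \<in> K" "x \<in> C"
  shows "K \<subseteq> C"
  using assms connected_components_of_maximal[of C "subtopology T A" K]
  by (auto simp: connectedin_subtopology disjnt_iff)

lemma component_unique:
  assumes "C \<in> connected_components_of (subtopology T A)"
    and "D \<in> connected_components_of (subtopology T A)" and "x \<in> C" "x \<in> D"
  shows "C = D"
  using assms connected_components_of_overlap by fastforce

lemma component_exists:
  assumes "x \<in> A" "A \<subseteq> topspace T"
  obtains C where "C \<in> connected_components_of (subtopology T A)" "x \<in> C"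
  using assms Union_connected_components_of[of "subtopology T A"]
  by (metis UnionE inf.absorb_iff2 topspace_subtopology)

lemma component_open:
  assumes "locally_connected_space T" "openin T A"
    and "C \<in> connected_components_of (subtopology T A)"
  shows "openin T C"
  using assms locally_connected_space_open_connected_components by blast

lemma component_of_connected:
  assumes "connectedin T A" "C \<in> connected_components_of (subtopology T A)"
  shows "C = A"
proof -
  obtain x where "x \<in> C" using assms nonempty_connected_components_of by fastforce
  then have "A \<subseteq> C" using component_maximal[OF assms(2) assms(1)] component_subset[OF assms(2)] by blast
  then show ?thesis using component_subset[OF assms(2)] by blast
qed

lemma connectedin_no_separation:
  assumes "connectedin T S" "openin T A" "openin T B" "S \<subseteq> A \<union> B" "A \<inter> B \<inter> S = {}"
    and "x \<in> A" "x \<in> S" "y \<in> B" "y \<in> S"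
  shows False
proof -
  have "A \<inter> S \<noteq> {}" "B \<inter> S \<noteq> {}" using assms by auto
  then show False using assms(1-5) unfolding connectedin by (elim conjE) metis
qed

text \<open>
  The neighbourhoods on which \<open>f\<close> takes the value \<open>f x\<close> and those on which it takes other values
  would separate \<open>D\<close>.
\<close>

lemma locally_constant_imp_constant:
  assumes "connectedin T D"
    and loc: "\<And>x. x \<in> D \<Longrightarrow> \<exists>K. openin T K \<and> x \<in> K \<and> (\<forall>y\<in>K \<inter> D. f y = f x)"
    and "x \<in> D" "y \<in> D"
  shows "f x = f y"
proof (rule ccontr)
  assume ne: "f x \<noteq> f y"
  obtain K where K: "\<And>x. x \<in> D \<Longrightarrow> openin T (K x) \<and> x \<in> K x \<and> (\<forall>y\<in>K x \<inter> D. f y = f x)"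
    using loc by metis
  define A B where "A = (\<Union>z\<in>{z\<in>D. f z = f x}. K z)" and "B = (\<Union>z\<in>{z\<in>D. f z \<noteq> f x}. K z)"
  have "openin T A" "openin T B" unfolding A_def B_def using K by auto
  moreover have "D \<subseteq> A \<union> B" unfolding A_def B_def using K by blast
  moreover have "A \<inter> B \<inter> D = {}"
  proof (rule equals0I)
    fix z assume "z \<in> A \<inter> B \<inter> D"
    then obtain a b where "a \<in> D" "f a = f x" "z \<in> K a" "b \<in> D" "f b \<noteq> f x" "z \<in> K b" "z \<in> D"
      unfolding A_def B_def by blast
    then show False using K[of a] K[of b] by (metis IntI)
  qed
  moreover have "x \<in> A" unfolding A_def by (rule UN_I[of x]) (use K[OF assms(3), THEN conjunct2, THEN conjunct1] assms(3) in simp_all)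
  moreover have "y \<in> B" unfolding B_def by (rule UN_I[of y]) (use K[OF assms(4), THEN conjunct2, THEN conjunct1] assms(4) ne in simp_all)
  ultimately show False using connectedin_no_separation[OF assms(1), of A B x y] assms(3,4) by simp
qed

section \<open>G-structures\<close>

locale g_struct =
  fixes U :: "'x topology" and A :: "('x, 'p, 'g) g_structure"
  assumes gs: "g_structure_on U A"
begin

lemma hat_connected: "connected_space (hat A)"
  and hat_locally_connected: "locally_connected_space (hat A)"
  and top_group: "topological_group (grp A) (grp_top A)"
  and proj_continuous: "continuous_map (hat A) U (proj A)"
  and action: "continuous_action (grp A) (grp_top A) (hat A) (act A)"
  using gs by (auto simp: g_structure_on_def)

lemma group_grp: "group (grp A)" and topspace_grp_top: "topspace (grp_top A) = carrier (grp A)"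
  using top_group by (auto simp: topological_group_def)

lemma action_continuous: "continuous_map (prod_topology (grp_top A) (hat A)) (hat A) (\<lambda>(g, x). act A g x)"
  using action by (auto simp: continuous_action_def)

lemma act_closed [simp]:
  assumes "g \<in> carrier (grp A)" "x \<in> topspace (hat A)"
  shows "act A g x \<in> topspace (hat A)"
proof -
  have "(g, x) \<in> topspace (prod_topology (grp_top A) (hat A))"
    using assms by (simp add: topspace_grp_top)
  from continuous_map_funspace[OF action_continuous, THEN funcset_mem, OF this] show ?thesis by simp
qed

lemma act_one [simp]: "x \<in> topspace (hat A) \<Longrightarrow> act A \<one>\<^bsub>grp A\<^esub> x = x"
  and act_mult: "\<lbrakk>g \<in> carrier (grp A); h \<in> carrier (grp A); x \<in> topspace (hat A)\<rbrakk>
     \<Longrightarrow> act A (g \<otimes>\<^bsub>grp A\<^esub> h) x = act A g (act A h x)"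
  using action by (auto simp: continuous_action_def)

lemma act_inv [simp]:
  assumes "g \<in> carrier (grp A)" "x \<in> topspace (hat A)"
  shows "act A (inv\<^bsub>grp A\<^esub> g) (act A g x) = x" "act A g (act A (inv\<^bsub>grp A\<^esub> g) x) = x"
  using assms group.inv_closed[OF group_grp] group.l_inv[OF group_grp] group.r_inv[OF group_grp]
  by (simp_all flip: act_mult)

lemma act_homeomorphic:
  assumes g: "g \<in> carrier (grp A)"
  shows "homeomorphic_map (hat A) (hat A) (act A g)"
proof -
  have c: "continuous_map (hat A) (hat A) (act A h)" if "h \<in> carrier (grp A)" for h
  proof -
    have "continuous_map (hat A) (hat A) ((\<lambda>(g, x). act A g x) \<circ> (\<lambda>x. (h, x)))"
      by (rule continuous_map_compose[OF _ action_continuous])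
        (use that in \<open>simp add: continuous_map_paired topspace_grp_top\<close>)
    then show ?thesis by (simp add: comp_def)
  qed
  show ?thesis
    unfolding homeomorphic_map_maps homeomorphic_maps_def
    using g c group.inv_closed[OF group_grp] by (intro exI[of _ "act A (inv\<^bsub>grp A\<^esub> g)"]) auto
qed

lemma orbit_homeo:
  obtains h where "homeomorphic_map (orbit_space (grp A) (hat A) (act A)) U h"
    "\<And>x. x \<in> topspace (hat A) \<Longrightarrow> h (orbit (grp A) (act A) x) = proj A x"
  using gs by (auto simp: g_structure_on_def)

lemma topspace_orbit_space:
  "topspace (orbit_space (grp A) (hat A) (act A)) = orbits (grp A) (topspace (hat A)) (act A)"
proof -
  have "openin (orbit_space (grp A) (hat A) (act A)) (orbits (grp A) (topspace (hat A)) (act A))"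
  proof -
    have "{x \<in> topspace (hat A). orbit (grp A) (act A) x \<in> orbits (grp A) (topspace (hat A)) (act A)}
        = topspace (hat A)" by (auto simp: orbits_def)
    then show ?thesis unfolding openin_orbit_space by simp
  qed
  then show ?thesis
    unfolding topspace_def openin_orbit_space by blast
qed

lemma self_orbit: "x \<in> topspace (hat A) \<Longrightarrow> x \<in> orbit (grp A) (act A) x"
  unfolding orbit_def using group.is_monoid[OF group_grp]
  by (force intro!: exI[of _ "\<one>\<^bsub>grp A\<^esub>"])

lemma proj_eq:
  assumes "x \<in> topspace (hat A)" "y \<in> topspace (hat A)" "proj A x = proj A y"
  obtains g where "g \<in> carrier (grp A)" "y = act A g x"
proof -
  obtain h where h: "homeomorphic_map (orbit_space (grp A) (hat A) (act A)) U h"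
    "\<And>x. x \<in> topspace (hat A) \<Longrightarrow> h (orbit (grp A) (act A) x) = proj A x"
    using orbit_homeo by blast
  have "inj_on h (orbits (grp A) (topspace (hat A)) (act A))"
    using h(1) topspace_orbit_space by (metis homeomorphic_imp_injective_map)
  then have "orbit (grp A) (act A) x = orbit (grp A) (act A) y"
    by (rule inj_onD) (use assms h(2) in \<open>auto simp: orbits_def\<close>)
  then show thesis using that self_orbit[OF assms(2)] by (auto simp: orbit_def)
qed

lemma orbit_act:
  assumes g: "g \<in> carrier (grp A)" and x: "x \<in> topspace (hat A)"
  shows "orbit (grp A) (act A) (act A g x) = orbit (grp A) (act A) x"
proof -
  interpret group "grp A" by (rule group_grp)
  show ?thesis unfolding orbit_def
  proof (safe, goal_cases)
    case (1 _ h)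
    then show ?case using g x by (intro exI[of _ "h \<otimes>\<^bsub>grp A\<^esub> g"]) (simp add: act_mult)
  next
    case (2 _ h)
    then show ?case using g x by (intro exI[of _ "h \<otimes>\<^bsub>grp A\<^esub> inv\<^bsub>grp A\<^esub> g"]) (simp add: act_mult)
  qed
qed

lemma proj_act [simp]:
  assumes "g \<in> carrier (grp A)" "x \<in> topspace (hat A)"
  shows "proj A (act A g x) = proj A x"
  using orbit_homeo orbit_act[OF assms] assms by (metis act_closed)

lemma proj_image: "proj A ` topspace (hat A) = topspace U"
proof -
  obtain h where h: "homeomorphic_map (orbit_space (grp A) (hat A) (act A)) U h"
    "\<And>x. x \<in> topspace (hat A) \<Longrightarrow> h (orbit (grp A) (act A) x) = proj A x"
    using orbit_homeo by blast
  have "topspace U = h ` orbits (grp A) (topspace (hat A)) (act A)"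
    using h(1) topspace_orbit_space by (metis homeomorphic_imp_surjective_map)
  also have "\<dots> = proj A ` topspace (hat A)"
    using h(2) unfolding orbits_def Setcompr_eq_image image_image by (rule image_cong[OF refl])
  finally show ?thesis by simp
qed

lemma proj_open:
  assumes V: "openin (hat A) V"
  shows "openin U (proj A ` V)"
proof -
  obtain h where h: "homeomorphic_map (orbit_space (grp A) (hat A) (act A)) U h"
    "\<And>x. x \<in> topspace (hat A) \<Longrightarrow> h (orbit (grp A) (act A) x) = proj A x"
    using orbit_homeo by blast
  have sub: "V \<subseteq> topspace (hat A)" using V openin_subset by blast
  interpret group "grp A" by (rule group_grp)
  let ?Q = "orbit (grp A) (act A) ` V"
  \<comment> \<open>The saturation of an open set is the union of its translates, hence open.\<close>
  have "{x \<in> topspace (hat A). orbit (grp A) (act A) x \<in> ?Q} = (\<Union>g\<in>carrier (grp A). act A g ` V)"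
  proof (intro equalityI subsetI, goal_cases)
    case (1 x)
    then obtain v where v: "v \<in> V" "orbit (grp A) (act A) x = orbit (grp A) (act A) v"
      and x: "x \<in> topspace (hat A)" by auto
    then have "x \<in> orbit (grp A) (act A) v" using self_orbit by metis
    then show ?case using v by (auto simp: orbit_def)
  next
    case (2 x)
    then show ?case using sub orbit_act by (auto intro!: act_closed)
  qed
  moreover have "openin (hat A) (act A g ` V)" if "g \<in> carrier (grp A)" for g
    using V act_homeomorphic[OF that] sub homeomorphic_map_openness by blast
  ultimately have "openin (orbit_space (grp A) (hat A) (act A)) ?Q"
    unfolding openin_orbit_space using sub by (auto simp: orbits_def)
  then have "openin U (h ` ?Q)"
    using h(1) homeomorphic_imp_open_map open_map_def by blast
  also have "h ` ?Q = proj A ` V" using h(2) sub by (force simp: image_iff)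
  finally show ?thesis .
qed

lemma hat_component_props:
  assumes D: "D \<in> hat_components A W" and W: "openin U W"
  shows "openin (hat A) D" "connectedin (hat A) D" "D \<noteq> {}" "D \<subseteq> topspace (hat A)"
    "x \<in> D \<Longrightarrow> proj A x \<in> W"
proof -
  have "openin (hat A) {x \<in> topspace (hat A). proj A x \<in> W}"
    using openin_continuous_map_preimage[OF proj_continuous W] .
  then show "openin (hat A) D"
    using D component_open[OF hat_locally_connected] unfolding hat_components_def by blast
  show "connectedin (hat A) D" using D component_connected unfolding hat_components_def by blast
  show "D \<noteq> {}" using D nonempty_connected_components_of unfolding hat_components_def by blast
  show "D \<subseteq> topspace (hat A)" "x \<in> D \<Longrightarrow> proj A x \<in> W"
    using D component_subset unfolding hat_components_def by blast+
qed

text \<open>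
  The translate of \<open>D\<close> lies in a component \<open>E\<close>; the inverse group element carries \<open>E\<close> back into \<open>D\<close>,
  so that the translate is all of \<open>E\<close>.
\<close>

lemma act_image_hat_component:
  assumes D: "D \<in> hat_components A W" and g: "g \<in> carrier (grp A)"
  shows "act A g ` D \<in> hat_components A W"
proof -
  interpret group "grp A" by (rule group_grp)
  have sub: "k \<in> carrier (grp A) \<Longrightarrow> E \<in> hat_components A W \<Longrightarrow>
      connectedin (hat A) (act A k ` E) \<and> act A k ` E \<subseteq> {x \<in> topspace (hat A). proj A x \<in> W}" for k E
    unfolding hat_components_def
    using act_homeomorphic[of k] component_subset[of E "hat A" "{x \<in> topspace (hat A). proj A x \<in> W}"]
      component_connected[of E "hat A"]
    by (fastforce intro!: connectedin_continuous_map_image homeomorphic_imp_continuous_map)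
  obtain x where x: "x \<in> D" using D nonempty_connected_components_of unfolding hat_components_def by blast
  have Dsub: "D \<subseteq> topspace (hat A)" using D component_subset unfolding hat_components_def by blast
  have "act A g x \<in> {x \<in> topspace (hat A). proj A x \<in> W}" using sub[OF g D] x by blast
  then obtain E where E: "E \<in> hat_components A W" "act A g x \<in> E"
    unfolding hat_components_def using component_exists by (metis (no_types, lifting) mem_Collect_eq subsetI)
  have Esub: "E \<subseteq> topspace (hat A)" using E component_subset unfolding hat_components_def by blast
  have "act A g ` D \<subseteq> E"
    using component_maximal[OF E(1)[unfolded hat_components_def], of "act A g ` D" "act A g x"]
      sub[OF g D] E(2) x by blast
  moreover have "act A (inv\<^bsub>grp A\<^esub> g) ` E \<subseteq> D"
  proof (rule component_maximal[OF D[unfolded hat_components_def], of _ x])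
    show "x \<in> act A (inv\<^bsub>grp A\<^esub> g) ` E" using E(2) x Dsub g by (force intro!: image_eqI[of _ _ "act A g x"])
  qed (use sub[OF inv_closed[OF g] E(1)] x in auto)
  then have "E \<subseteq> act A g ` D" using Esub g by (force simp: image_iff)
  ultimately show ?thesis using E(1) by simp
qed

text \<open>
  The images in the base of the components over \<open>W\<close> are open, and any two of them are equal or
  disjoint, because the group permutes the components. A connected set has no partition into several
  nonempty open sets.
\<close>

lemma proj_hat_component:
  assumes D: "D \<in> hat_components A W" and W: "openin U W" "connectedin U W"
  shows "proj A ` D = W"
proof (rule ccontr)
  assume ne: "proj A ` D \<noteq> W"
  let ?E = "{E \<in> hat_components A W. proj A ` E \<inter> proj A ` D = {}}"
  have "W \<subseteq> proj A ` D \<union> (\<Union>E\<in>?E. proj A ` E)"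
  proof
    fix w assume w: "w \<in> W"
    then have "w \<in> topspace U" using W(1) openin_subset by blast
    then obtain x where x: "x \<in> topspace (hat A)" "proj A x = w" using proj_image by (metis imageE)
    then obtain E where E: "E \<in> hat_components A W" "x \<in> E"
      unfolding hat_components_def using w component_exists[of x "{x \<in> topspace (hat A). proj A x \<in> W}" "hat A"] by auto
    show "w \<in> proj A ` D \<union> (\<Union>E\<in>?E. proj A ` E)"
    proof (cases "proj A ` E \<inter> proj A ` D = {}")
      case True
      then show ?thesis using E x by auto
    next
      case False
      then obtain e d where ed: "e \<in> E" "d \<in> D" "proj A e = proj A d" by auto
      moreover have "e \<in> topspace (hat A)" "d \<in> topspace (hat A)"
        using ed hat_component_props(4)[OF D W(1)] hat_component_props(4)[OF E(1) W(1)] by auto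
      ultimately obtain g where g: "g \<in> carrier (grp A)" "d = act A g e"
        using proj_eq by metis
      have "act A g ` E = D"
        using component_unique[OF act_image_hat_component[OF E(1) g(1), unfolded hat_components_def]
            D[unfolded hat_components_def], of d] ed g by auto
      then have "act A g x \<in> D" using E(2) by blast
      moreover have "proj A (act A g x) = w" using g x by simp
      ultimately show ?thesis by (intro UnI1 image_eqI[of w _ "act A g x"]) simp_all
    qed
  qed
  moreover have "proj A ` D \<inter> (\<Union>E\<in>?E. proj A ` E) \<inter> W = {}" by blast
  moreover have "openin U (proj A ` D)" "openin U (\<Union>E\<in>?E. proj A ` E)"
    using hat_component_props(1)[OF _ W(1)] D proj_open by auto
  moreover obtain d where "d \<in> proj A ` D" "d \<in> W"
    using hat_component_props(3,5)[OF D W(1)] by auto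
  moreover obtain e where "e \<in> W" "e \<notin> proj A ` D"
    using ne hat_component_props(5)[OF D W(1)] by blast
  moreover from this have "e \<in> (\<Union>E\<in>?E. proj A ` E)"
    using \<open>W \<subseteq> proj A ` D \<union> (\<Union>E\<in>?E. proj A ` E)\<close> by blast
  ultimately show False by (intro connectedin_no_separation[OF W(2), of "proj A ` D" "\<Union>E\<in>?E. proj A ` E" d e])
qed

end


section \<open>Groupoids\<close>

locale groupoid =
  fixes Ar :: "'a set" and src tgt :: "'a \<Rightarrow> 'o"
    and cmp :: "'a \<Rightarrow> 'a \<Rightarrow> 'a" and idn :: "'o \<Rightarrow> 'a" and ivt :: "'a \<Rightarrow> 'a"
  assumes cmp_in [simp]: "\<lbrakk>a \<in> Ar; b \<in> Ar; src b = tgt a\<rbrakk> \<Longrightarrow> cmp b a \<in> Ar"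
    and src_cmp [simp]: "\<lbrakk>a \<in> Ar; b \<in> Ar; src b = tgt a\<rbrakk> \<Longrightarrow> src (cmp b a) = src a"
    and tgt_cmp [simp]: "\<lbrakk>a \<in> Ar; b \<in> Ar; src b = tgt a\<rbrakk> \<Longrightarrow> tgt (cmp b a) = tgt b"
    and assoc: "\<lbrakk>a \<in> Ar; b \<in> Ar; c \<in> Ar; src b = tgt a; src c = tgt b\<rbrakk> \<Longrightarrow> cmp (cmp c b) a = cmp c (cmp b a)"
    and idn_in: "a \<in> Ar \<Longrightarrow> idn (src a) \<in> Ar"
    and src_idn: "a \<in> Ar \<Longrightarrow> src (idn (src a)) = src a"
    and tgt_idn: "a \<in> Ar \<Longrightarrow> tgt (idn (src a)) = src a"
    and cmp_idn_src: "a \<in> Ar \<Longrightarrow> cmp a (idn (src a)) = a"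
    and cmp_idn_tgt: "a \<in> Ar \<Longrightarrow> cmp (idn (tgt a)) a = a"
    and ivt_in [simp]: "a \<in> Ar \<Longrightarrow> ivt a \<in> Ar"
    and src_ivt [simp]: "a \<in> Ar \<Longrightarrow> src (ivt a) = tgt a"
    and tgt_ivt [simp]: "a \<in> Ar \<Longrightarrow> tgt (ivt a) = src a"
    and ivt_left [simp]: "a \<in> Ar \<Longrightarrow> cmp (ivt a) a = idn (src a)"
    and ivt_right [simp]: "a \<in> Ar \<Longrightarrow> cmp a (ivt a) = idn (tgt a)"
begin

lemma idn_at_src:
  assumes "a \<in> Ar" "src a = o'"
  shows "idn o' \<in> Ar" "src (idn o') = o'" "tgt (idn o') = o'"
  using assms idn_in src_idn tgt_idn by auto

lemma cmp_idn [simp]: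
  assumes "a \<in> Ar"
  shows "src a = o' \<Longrightarrow> cmp a (idn o') = a" "tgt a = o' \<Longrightarrow> cmp (idn o') a = a"
  using assms cmp_idn_src cmp_idn_tgt by auto

lemma cancel_left [simp]:
  assumes "a \<in> Ar" "b \<in> Ar"
  shows "src b = tgt a \<Longrightarrow> cmp (ivt b) (cmp b a) = a"
    and "tgt b = tgt a \<Longrightarrow> cmp b (cmp (ivt b) a) = a"
  using assms by (simp_all flip: assoc)

lemma cancel_right:
  assumes "a \<in> Ar" "b \<in> Ar" "c \<in> Ar" "src b = tgt a" "src c = tgt a" "cmp b a = cmp c a"
  shows "b = c"
proof -
  have "b = cmp (cmp b a) (ivt a)" using assms(1-5) by (simp add: assoc)
  moreover have "c = cmp (cmp c a) (ivt a)" using assms(1-5) by (simp add: assoc)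
  ultimately show ?thesis using assms(6) by simp
qed

lemma ivt_unique:
  assumes "a \<in> Ar" "b \<in> Ar" "src b = tgt a" "cmp b a = idn (src a)"
  shows "ivt a = b"
  using cancel_right[of a "ivt a" b] assms by simp

lemma ivt_ivt [simp]: "a \<in> Ar \<Longrightarrow> ivt (ivt a) = a"
  by (rule ivt_unique) auto

lemma ivt_cmp [simp]:
  assumes "a \<in> Ar" "b \<in> Ar" "src b = tgt a"
  shows "ivt (cmp b a) = cmp (ivt a) (ivt b)"
  by (rule ivt_unique) (use assms in \<open>simp_all add: assoc\<close>)

text \<open>
  A functor carries identities to idempotents, so preservation of identities, which the definition of
  a system does not mention, comes for free.
\<close>

lemma idempotent_idn:
  assumes "a \<in> Ar" "src a = tgt a" "cmp a a = a"
  shows "a = idn (src a)"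
  using cancel_right[of a a "idn (src a)"] assms idn_at_src[OF assms(1,2)] by simp

lemma ivt_idn:
  assumes "a \<in> Ar" "src a = o'"
  shows "ivt (idn o') = idn o'"
  by (rule ivt_unique) (use idn_at_src[OF assms] in \<open>simp_all\<close>)

end

section \<open>The groupoid of germs of transition maps\<close>

text \<open>
  The base point belongs to an arrow because transition maps have composites only along a component
  of the overlap: a point selects the component.
\<close>

datatype ('x, 'p, 't) arrow = Arrow (dchart: "'x set") (apt: 'p) (alab: 't) (cchart: "'x set")

definition src :: "('x, 'p, 't) arrow \<Rightarrow> 'x set \<times> 'p" where
  "src a = (dchart a, apt a)"

definition tgt :: "('x, 'p, 'g, 't) orbispace \<Rightarrow> ('x, 'p, 't) arrow \<Rightarrow> 'x set \<times> 'p" where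
  "tgt X a = (cchart a, tmap X (dchart a) (cchart a) (alab a) (apt a))"

definition arrows :: "('x, 'p, 'g, 't) orbispace \<Rightarrow> ('x, 'p, 't) arrow set" where
  "arrows X = {a. dchart a \<in> basics X \<and> cchart a \<in> basics X \<and>
     alab a \<in> Tran X (dchart a) (cchart a) \<and> apt a \<in> tdom X (dchart a) (cchart a) (alab a)}"

definition acomp :: "('x, 'p, 'g, 't) orbispace \<Rightarrow>
    ('x, 'p, 't) arrow \<Rightarrow> ('x, 'p, 't) arrow \<Rightarrow> ('x, 'p, 't) arrow" where
  "acomp X b a = Arrow (dchart a) (apt a)
     (tcomp X (dchart a) (cchart a) (cchart b) (alab b) (alab a) (apt a)) (cchart b)"

abbreviation acomp_infix ("(_ \<bullet>\<^bsub>_\<^esub>/ _)" [66, 0, 65] 65) where "b \<bullet>\<^bsub>X\<^esub> a \<equiv> acomp X b a"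

definition agrp :: "('x, 'p, 'g, 't) orbispace \<Rightarrow> 'x set \<Rightarrow> 'g \<Rightarrow> 'p \<Rightarrow> ('x, 'p, 't) arrow" where
  "agrp X U g x = Arrow U x (gtran X U g) U"

definition aid :: "('x, 'p, 'g, 't) orbispace \<Rightarrow> 'x set \<times> 'p \<Rightarrow> ('x, 'p, 't) arrow" where
  "aid X ux = agrp X (fst ux) \<one>\<^bsub>gp X (fst ux)\<^esub> (snd ux)"

definition ainv :: "('x, 'p, 'g, 't) orbispace \<Rightarrow> ('x, 'p, 't) arrow \<Rightarrow> ('x, 'p, 't) arrow" where
  "ainv X a = Arrow (cchart a) (snd (tgt X a)) (tran_inv X (dchart a) (cchart a) (alab a)) (dchart a)"

lemma arrow_simps [simp]:
  "fst (src a) = dchart a" "snd (src a) = apt a" "fst (tgt X a) = cchart a"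
  "dchart (acomp X b a) = dchart a" "cchart (acomp X b a) = cchart b" "apt (acomp X b a) = apt a"
  "dchart (agrp X U g x) = U" "cchart (agrp X U g x) = U" "apt (agrp X U g x) = x"
  "alab (agrp X U g x) = gtran X U g"
  "dchart (aid X ux) = fst ux" "cchart (aid X ux) = fst ux" "apt (aid X ux) = snd ux"
  "dchart (ainv X a) = cchart a" "cchart (ainv X a) = dchart a" "apt (ainv X a) = snd (tgt X a)"
  by (simp_all add: src_def tgt_def acomp_def agrp_def aid_def ainv_def)

lemma src_Arrow [simp]: "src (Arrow U x \<xi> V) = (U, x)" "src (agrp X U g x) = (U, x)"
  by (simp_all add: src_def)

lemma in_arrows:
  "a \<in> arrows X \<longleftrightarrow> dchart a \<in> basics X \<and> cchart a \<in> basics X \<and>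
     alab a \<in> Tran X (dchart a) (cchart a) \<and> apt a \<in> tdom X (dchart a) (cchart a) (alab a)"
  by (simp add: arrows_def)

lemma src_eq_tgt:
  "src b = tgt X a \<longleftrightarrow> dchart b = cchart a \<and> apt b = tmap X (dchart a) (cchart a) (alab a) (apt a)"
  by (simp add: src_def tgt_def)

locale orbi =
  fixes X :: "('x, 'p, 'g, 't) orbispace"
  assumes orbispace_X: "orbispace X"
begin

abbreviation "T \<equiv> top_space X"

lemmas ax1 = orbispace_X[unfolded orbispace_def]
lemmas ax2 = ax1[THEN conjunct2]
lemmas ax3 = ax2[THEN conjunct2]
lemmas ax4 = ax3[THEN conjunct2]
lemmas ax5 = ax4[THEN conjunct2]
lemmas ax6 = ax5[THEN conjunct2]
lemmas ax7 = ax6[THEN conjunct2]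
lemmas ax9 = ax7[THEN conjunct2, THEN conjunct2]
lemmas ax10 = ax9[THEN conjunct2]
lemmas ax11 = ax10[THEN conjunct2]
lemmas ax12 = ax11[THEN conjunct2]

lemma locally_connected_top: "locally_connected_space T"
  by (rule ax1[THEN conjunct1])

lemma basics_open: "U \<in> basics X \<Longrightarrow> openin T U"
  and basics_connected: "U \<in> basics X \<Longrightarrow> connectedin T U"
  and basics_nonempty: "U \<in> basics X \<Longrightarrow> U \<noteq> {}"
  using ax2[THEN conjunct1] by simp_all

lemma basics_base: "openin T A \<Longrightarrow> x \<in> A \<Longrightarrow> \<exists>U\<in>basics X. x \<in> U \<and> U \<subseteq> A"
  by (rule ax3[THEN conjunct1, rule_format, OF conjI])

lemma basics_subset:
  "\<lbrakk>U \<in> basics X; openin T W; connectedin T W; W \<noteq> {}; W \<subseteq> U\<rbrakk> \<Longrightarrow> W \<in> basics X"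
  using ax4[THEN conjunct1] by (elim ballE[of _ _ U] allE[of _ W]) simp_all

lemma chart_gs: "U \<in> basics X \<Longrightarrow> g_struct (subtopology T U) (chart X U)"
  using ax5[THEN conjunct1] by (simp add: g_struct.intro)

lemma Tran_nonempty: "\<lbrakk>U \<in> basics X; V \<in> basics X\<rbrakk> \<Longrightarrow> Tran X U V \<noteq> {} \<longleftrightarrow> U \<inter> V \<noteq> {}"
  by (rule ax6[THEN conjunct1, rule_format])

lemma Tran_over: "\<lbrakk>U \<in> basics X; V \<in> basics X; \<xi> \<in> Tran X U V\<rbrakk> \<Longrightarrow>
     \<exists>W\<in>components_in X (U \<inter> V). tran_over X U V W \<xi>"
  by (rule ax7[THEN conjunct1, rule_format])

lemma twist_Tran: "\<lbrakk>U \<in> basics X; V \<in> basics X; \<xi> \<in> Tran X U V; g \<in> carrier (gp X U); h \<in> carrier (gp X V)\<rbrakk> \<Longrightarrow>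
     twist X U V (inv\<^bsub>gp X V\<^esub> h) \<xi> g \<in> Tran X U V"
  by (rule ax9[THEN conjunct1, rule_format, THEN conjunct1])

lemma twist_eq_iff: "\<lbrakk>U \<in> basics X; V \<in> basics X; \<xi> \<in> Tran X U V; g \<in> carrier (gp X U); h \<in> carrier (gp X V)\<rbrakk> \<Longrightarrow>
     twist X U V (inv\<^bsub>gp X V\<^esub> h) \<xi> g = \<xi> \<longleftrightarrow> g \<in> stab (chart X U) (tdom X U V \<xi>) \<and> tiso X U V \<xi> g = h"
  by (rule ax9[THEN conjunct1, rule_format, THEN conjunct2])

lemma gtran_bij: "U \<in> basics X \<Longrightarrow> bij_betw (gtran X U) (carrier (gp X U)) (Tran X U U)"
  and tdom_gtran: "\<lbrakk>U \<in> basics X; g \<in> carrier (gp X U)\<rbrakk> \<Longrightarrow> tdom X U U (gtran X U g) = pts X U"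
  and tmap_gtran: "\<lbrakk>U \<in> basics X; g \<in> carrier (gp X U); x \<in> pts X U\<rbrakk> \<Longrightarrow>
     tmap X U U (gtran X U g) x = act (chart X U) g x"
  and tcomp_gtran: "\<lbrakk>U \<in> basics X; g \<in> carrier (gp X U); h \<in> carrier (gp X U); x \<in> pts X U\<rbrakk> \<Longrightarrow>
     tcomp X U U U (gtran X U g) (gtran X U h) x = gtran X U (g \<otimes>\<^bsub>gp X U\<^esub> h)"
  using ax10[THEN conjunct1, THEN bspec, of U] by simp_all

lemma tcomp_component:
  "\<lbrakk>U \<in> basics X; V \<in> basics X; W \<in> basics X; \<xi> \<in> Tran X U V; \<eta> \<in> Tran X V W;
    C \<in> connected_components_of (subtopology (hat (chart X U)) (overlap X U V W \<eta> \<xi>))\<rbrakk> \<Longrightarrow>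
    \<exists>\<zeta>\<in>Tran X U W. C \<subseteq> tdom X U W \<zeta> \<and>
          (\<forall>x\<in>C. tcomp X U V W \<eta> \<xi> x = \<zeta> \<and> tmap X U W \<zeta> x = tmap X V W \<eta> (tmap X U V \<xi> x)) \<and>
          (\<forall>g\<in>stab (chart X U) C. tiso X U W \<zeta> g = tiso X V W \<eta> (tiso X U V \<xi> g))"
  by (rule ax11[THEN conjunct1, THEN bspec, THEN bspec, THEN bspec, THEN bspec, THEN bspec, THEN bspec])

lemma tcomp_assoc:
  "\<lbrakk>U\<^sub>1 \<in> basics X; U\<^sub>2 \<in> basics X; U\<^sub>3 \<in> basics X; U\<^sub>4 \<in> basics X;
    \<xi> \<in> Tran X U\<^sub>1 U\<^sub>2; \<eta> \<in> Tran X U\<^sub>2 U\<^sub>3; \<zeta> \<in> Tran X U\<^sub>3 U\<^sub>4; x \<in> overlap X U\<^sub>1 U\<^sub>2 U\<^sub>3 \<eta> \<xi>;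
    tmap X U\<^sub>2 U\<^sub>3 \<eta> (tmap X U\<^sub>1 U\<^sub>2 \<xi> x) \<in> tdom X U\<^sub>3 U\<^sub>4 \<zeta>\<rbrakk> \<Longrightarrow>
        tcomp X U\<^sub>1 U\<^sub>3 U\<^sub>4 \<zeta> (tcomp X U\<^sub>1 U\<^sub>2 U\<^sub>3 \<eta> \<xi> x) x =
        tcomp X U\<^sub>1 U\<^sub>2 U\<^sub>4 (tcomp X U\<^sub>2 U\<^sub>3 U\<^sub>4 \<zeta> \<eta> (tmap X U\<^sub>1 U\<^sub>2 \<xi> x)) \<xi> x"
  by (rule ax12[rule_format])

lemma grp_chart: "U \<in> basics X \<Longrightarrow> group (gp X U)"
  using g_struct.group_grp[OF chart_gs] .

lemma pts_nonempty: "U \<in> basics X \<Longrightarrow> pts X U \<noteq> {}"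
  using g_struct.proj_image[OF chart_gs, of U] basics_nonempty[of U] basics_open[of U] openin_subset
  by (metis image_empty openin_subset topspace_subtopology_subset)

lemma proj_pts: "U \<in> basics X \<Longrightarrow> proj (chart X U) ` pts X U = U"
  using g_struct.proj_image[OF chart_gs, of U] basics_open[of U] openin_subset
  by (metis openin_subset topspace_subtopology_subset)

lemma components_props:
  assumes "W \<in> components_in X A" "openin T A"
  shows "openin T W" "connectedin T W" "W \<noteq> {}" "W \<subseteq> A"
proof -
  note W = assms(1)[unfolded components_in_def]
  show "openin T W" using component_open[OF locally_connected_top assms(2) W] .
  show "connectedin T W" using component_connected[OF W] .
  show "W \<noteq> {}" using nonempty_connected_components_of[OF W] .
  show "W \<subseteq> A" using component_subset[OF W] .
qed

lemma Tran_domain: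
  assumes UV: "U \<in> basics X" "V \<in> basics X" and \<xi>: "\<xi> \<in> Tran X U V"
  obtains W where "W \<in> components_in X (U \<inter> V)" "openin T W" "connectedin T W" "W \<noteq> {}" "W \<subseteq> U" "W \<subseteq> V"
    "tdom X U V \<xi> \<in> hat_components (chart X U) W"
    "tmap X U V \<xi> ` tdom X U V \<xi> \<in> hat_components (chart X V) W"
    "openin (subtopology T U) W" "connectedin (subtopology T U) W"
    "openin (subtopology T V) W" "connectedin (subtopology T V) W"
proof -
  obtain W where W: "W \<in> components_in X (U \<inter> V)" "tran_over X U V W \<xi>"
    using Tran_over[OF assms] by blast
  have "openin T (U \<inter> V)" using UV basics_open by blast
  note p = components_props[OF W(1) this]
  have "openin (subtopology T U) W" "connectedin (subtopology T U) W"
    "openin (subtopology T V) W" "connectedin (subtopology T V) W"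
    using p by (auto simp: openin_subtopology connectedin_subtopology)
  moreover have "tdom X U V \<xi> \<in> hat_components (chart X U) W"
    "tmap X U V \<xi> ` tdom X U V \<xi> \<in> hat_components (chart X V) W"
    using W(2) by (auto simp: tran_over_def)
  ultimately show thesis using p by (intro that[OF W(1)]) simp_all
qed

lemma Tran_iso:
  assumes "U \<in> basics X" "V \<in> basics X" "\<xi> \<in> Tran X U V"
  shows "g_structure_iso (induced (chart X U) (tdom X U V \<xi>))
       (induced (chart X V) (tmap X U V \<xi> ` tdom X U V \<xi>)) (tmap X U V \<xi>) (tiso X U V \<xi>)"
  using Tran_over[OF assms] by (auto simp: tran_over_def)

lemma tdom_props:
  assumes UV: "U \<in> basics X" "V \<in> basics X" and \<xi>: "\<xi> \<in> Tran X U V"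
  shows "openin (hat (chart X U)) (tdom X U V \<xi>)" "connectedin (hat (chart X U)) (tdom X U V \<xi>)"
    "tdom X U V \<xi> \<noteq> {}" "tdom X U V \<xi> \<subseteq> pts X U"
    "openin (hat (chart X V)) (tmap X U V \<xi> ` tdom X U V \<xi>)"
    "tmap X U V \<xi> ` tdom X U V \<xi> \<subseteq> pts X V"
proof -
  obtain W where W: "openin (subtopology T U) W" "openin (subtopology T V) W"
    "tdom X U V \<xi> \<in> hat_components (chart X U) W"
    "tmap X U V \<xi> ` tdom X U V \<xi> \<in> hat_components (chart X V) W"
    using Tran_domain[OF assms] by metis
  note p = g_struct.hat_component_props[OF chart_gs[OF UV(1)] W(3) W(1)]
    g_struct.hat_component_props[OF chart_gs[OF UV(2)] W(4) W(2)]
  show "openin (hat (chart X U)) (tdom X U V \<xi>)" "connectedin (hat (chart X U)) (tdom X U V \<xi>)"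
    "tdom X U V \<xi> \<noteq> {}" "tdom X U V \<xi> \<subseteq> pts X U"
    "openin (hat (chart X V)) (tmap X U V \<xi> ` tdom X U V \<xi>)"
    "tmap X U V \<xi> ` tdom X U V \<xi> \<subseteq> pts X V"
    by (fact p)+
qed

lemma tmap_continuous:
  assumes UV: "U \<in> basics X" "V \<in> basics X" and \<xi>: "\<xi> \<in> Tran X U V"
  shows "continuous_map (subtopology (hat (chart X U)) (tdom X U V \<xi>)) (hat (chart X V)) (tmap X U V \<xi>)"
proof -
  have "homeomorphic_map (subtopology (hat (chart X U)) (tdom X U V \<xi>))
      (subtopology (hat (chart X V)) (tmap X U V \<xi> ` tdom X U V \<xi>)) (tmap X U V \<xi>)"
    using Tran_iso[OF assms] by (simp add: g_structure_iso_def induced_def)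
  then show ?thesis
    using homeomorphic_imp_continuous_map continuous_map_into_fulltopology by blast
qed

lemma tmap_in_pts: 
  assumes "U \<in> basics X" "V \<in> basics X" "\<xi> \<in> Tran X U V" "x \<in> tdom X U V \<xi>"
  shows "x \<in> pts X U" "tmap X U V \<xi> x \<in> pts X V"
  using tdom_props[OF assms(1-3)] assms(4) by blast+

lemma proj_tmap:
  assumes "U \<in> basics X" "V \<in> basics X" "\<xi> \<in> Tran X U V" "x \<in> tdom X U V \<xi>"
  shows "proj (chart X V) (tmap X U V \<xi> x) = proj (chart X U) x"
  using Tran_iso[OF assms(1-3)] tmap_in_pts[OF assms] assms(4)
  by (simp add: g_structure_iso_def induced_def)

lemma tiso_continuous:
  assumes UV: "U \<in> basics X" "V \<in> basics X" and \<xi>: "\<xi> \<in> Tran X U V"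
  shows "continuous_map (subtopology (grp_top (chart X U)) (stab (chart X U) (tdom X U V \<xi>)))
      (grp_top (chart X V)) (tiso X U V \<xi>)"
proof -
  have "homeomorphic_map (subtopology (grp_top (chart X U)) (stab (chart X U) (tdom X U V \<xi>)))
      (subtopology (grp_top (chart X V)) (stab (chart X V) (tmap X U V \<xi> ` tdom X U V \<xi>))) (tiso X U V \<xi>)"
    using Tran_iso[OF assms] by (simp add: g_structure_iso_def induced_def)
  then show ?thesis
    using homeomorphic_imp_continuous_map continuous_map_into_fulltopology by blast
qed

lemma stab_subset: "stab A P \<subseteq> carrier (grp A)"
  by (auto simp: stab_def stabilizer_def)

lemma tiso_hom:
  assumes "U \<in> basics X" "V \<in> basics X" "\<xi> \<in> Tran X U V"
  shows "tiso X U V \<xi> \<in> hom ((gp X U)\<lparr>carrier := stab (chart X U) (tdom X U V \<xi>)\<rparr>) (gp X V)"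
  using Tran_iso[OF assms] stab_subset
  by (fastforce simp: g_structure_iso_def induced_def iso_def hom_def Pi_def)

lemma tiso_closed:
  assumes "U \<in> basics X" "V \<in> basics X" "\<xi> \<in> Tran X U V" "g \<in> stab (chart X U) (tdom X U V \<xi>)"
  shows "tiso X U V \<xi> g \<in> carrier (gp X V)"
  using tiso_hom[OF assms(1-3)] assms(4) by (auto simp: hom_def)

lemma one_in_stab:
  assumes "U \<in> basics X" "D \<subseteq> pts X U"
  shows "\<one>\<^bsub>gp X U\<^esub> \<in> stab (chart X U) D"
proof -
  have "act (chart X U) \<one>\<^bsub>gp X U\<^esub> ` D = (\<lambda>x. x) ` D"
    by (rule image_cong) (use assms(2) g_struct.act_one[OF chart_gs[OF assms(1)]] in auto)
  then show ?thesis
    by (simp add: stab_def stabilizer_def group.is_monoid[OF grp_chart[OF assms(1)]])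
qed

text \<open>
  The domain of \<open>tiso\<close> carries the multiplication of \<open>gp X U\<close>, so the image of its unit is an idempotent
  of a group.
\<close>

lemma tiso_one:
  assumes UV: "U \<in> basics X" "V \<in> basics X" and \<xi>: "\<xi> \<in> Tran X U V"
  shows "tiso X U V \<xi> \<one>\<^bsub>gp X U\<^esub> = \<one>\<^bsub>gp X V\<^esub>"
proof -
  interpret U: group "gp X U" by (rule grp_chart[OF UV(1)])
  interpret V: group "gp X V" by (rule grp_chart[OF UV(2)])
  have o: "\<one>\<^bsub>gp X U\<^esub> \<in> stab (chart X U) (tdom X U V \<xi>)"
    using one_in_stab[OF UV(1)] tdom_props[OF assms] by blast
  then have "tiso X U V \<xi> (\<one>\<^bsub>gp X U\<^esub> \<otimes>\<^bsub>gp X U\<^esub> \<one>\<^bsub>gp X U\<^esub>) =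
      tiso X U V \<xi> \<one>\<^bsub>gp X U\<^esub> \<otimes>\<^bsub>gp X V\<^esub> tiso X U V \<xi> \<one>\<^bsub>gp X U\<^esub>"
    using hom_mult[OF tiso_hom[OF assms], of "\<one>\<^bsub>gp X U\<^esub>" "\<one>\<^bsub>gp X U\<^esub>"] by simp
  then show ?thesis using tiso_closed[OF assms o] V.l_cancel_one' by simp
qed

lemma acomp_in_arrows:
  assumes a: "a \<in> arrows X" and b: "b \<in> arrows X" and ab: "src b = tgt X a"
  shows "b \<bullet>\<^bsub>X\<^esub> a \<in> arrows X" "src (b \<bullet>\<^bsub>X\<^esub> a) = src a" "tgt X (b \<bullet>\<^bsub>X\<^esub> a) = tgt X b"
proof -
  let ?U = "dchart a" and ?V = "cchart a" and ?W = "cchart b"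
  let ?O = "overlap X ?U ?V ?W (alab b) (alab a)"
  have d: "dchart b = ?V" and p: "apt b = tmap X ?U ?V (alab a) (apt a)" using ab by (auto simp: src_eq_tgt)
  have "?O \<subseteq> pts X ?U" using a tdom_props[of ?U ?V "alab a"] by (auto simp: in_arrows overlap_def)
  moreover have "apt a \<in> ?O" using a b d p by (auto simp: in_arrows overlap_def)
  ultimately obtain C where C: "C \<in> connected_components_of (subtopology (hat (chart X ?U)) ?O)" "apt a \<in> C"
    using component_exists by metis
  obtain \<zeta> where \<zeta>: "\<zeta> \<in> Tran X ?U ?W" "C \<subseteq> tdom X ?U ?W \<zeta>"
    "\<forall>x\<in>C. tcomp X ?U ?V ?W (alab b) (alab a) x = \<zeta> \<and> tmap X ?U ?W \<zeta> x = tmap X ?V ?W (alab b) (tmap X ?U ?V (alab a) x)"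
    using tcomp_component[OF _ _ _ _ _ C(1)] a b d by (auto simp: in_arrows)
  show "b \<bullet>\<^bsub>X\<^esub> a \<in> arrows X" "src (b \<bullet>\<^bsub>X\<^esub> a) = src a" "tgt X (b \<bullet>\<^bsub>X\<^esub> a) = tgt X b"
    using a b \<zeta> C(2) d p by (auto simp: in_arrows acomp_def src_def tgt_def)
qed

text \<open>
  A connected subset of the overlap is contained in one component, along which there is a single
  composite.
\<close>

lemma tcomp_constant:
  assumes U: "U \<in> basics X" "V \<in> basics X" "W \<in> basics X" "\<xi> \<in> Tran X U V" "\<eta> \<in> Tran X V W"
    and K: "connectedin (hat (chart X U)) K" "K \<subseteq> tdom X U V \<xi>" "tmap X U V \<xi> ` K \<subseteq> tdom X V W \<eta>"
    and xy: "x \<in> K" "y \<in> K"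
  shows "tcomp X U V W \<eta> \<xi> x = tcomp X U V W \<eta> \<xi> y"
proof -
  let ?O = "overlap X U V W \<eta> \<xi>"
  have "?O \<subseteq> pts X U" using tdom_props[OF U(1,2,4)] by (auto simp: overlap_def)
  moreover have KO: "K \<subseteq> ?O" using K by (auto simp: overlap_def)
  ultimately obtain C where C: "C \<in> connected_components_of (subtopology (hat (chart X U)) ?O)" "x \<in> C"
    using component_exists xy by (metis subsetD)
  have "K \<subseteq> C" using component_maximal[OF C(1) K(1) KO xy(1) C(2)] .
  then have "x \<in> C" "y \<in> C" using xy by auto
  then show ?thesis using tcomp_component[OF U C(1)] by metis
qed

lemma acomp_assoc:
  assumes "a \<in> arrows X" "b \<in> arrows X" "c \<in> arrows X" "src b = tgt X a" "src c = tgt X b"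
  shows "(c \<bullet>\<^bsub>X\<^esub> b) \<bullet>\<^bsub>X\<^esub> a = c \<bullet>\<^bsub>X\<^esub> (b \<bullet>\<^bsub>X\<^esub> a)"
proof -
  have "tcomp X (dchart a) (cchart b) (cchart c) (alab c) (tcomp X (dchart a) (cchart a) (cchart b) (alab b) (alab a) (apt a)) (apt a) =
    tcomp X (dchart a) (cchart a) (cchart c) (tcomp X (cchart a) (cchart b) (cchart c) (alab c) (alab b) (tmap X (dchart a) (cchart a) (alab a) (apt a))) (alab a) (apt a)"
    by (rule tcomp_assoc) (use assms in \<open>auto simp: in_arrows src_eq_tgt overlap_def\<close>)
  then show ?thesis using assms(4,5) by (auto simp: acomp_def src_eq_tgt)
qed

lemma agrp_in_arrows:
  assumes "U \<in> basics X" "g \<in> carrier (gp X U)" "x \<in> pts X U"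
  shows "agrp X U g x \<in> arrows X" "tgt X (agrp X U g x) = (U, act (chart X U) g x)"
  using assms tdom_gtran[OF assms(1,2)] tmap_gtran[OF assms] bij_betwE[OF gtran_bij[OF assms(1)]]
  by (auto simp: in_arrows tgt_def)

lemma agrp_comp:
  assumes "U \<in> basics X" "g \<in> carrier (gp X U)" "h \<in> carrier (gp X U)" "x \<in> pts X U"
  shows "agrp X U g y \<bullet>\<^bsub>X\<^esub> agrp X U h x = agrp X U (g \<otimes>\<^bsub>gp X U\<^esub> h) x"
  using tcomp_gtran[OF assms] by (simp add: acomp_def) (simp add: agrp_def)

lemma arrow_in_group:
  assumes "a \<in> arrows X" "cchart a = dchart a"
  obtains g where "g \<in> carrier (gp X (dchart a))" "a = agrp X (dchart a) g (apt a)"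
proof -
  have "alab a \<in> gtran X (dchart a) ` carrier (gp X (dchart a))"
    using assms gtran_bij[of "dchart a"] by (auto simp: in_arrows bij_betw_def)
  then show thesis using that assms(2) by (cases a) (auto simp: agrp_def)
qed

lemma arrow_pts:
  assumes "a \<in> arrows X"
  shows "dchart a \<in> basics X" "cchart a \<in> basics X" "apt a \<in> pts X (dchart a)" "snd (tgt X a) \<in> pts X (cchart a)"
    "tgt X a = (cchart a, snd (tgt X a))"
  using assms tmap_in_pts[of "dchart a" "cchart a" "alab a" "apt a"] by (auto simp: in_arrows tgt_def)

lemma act_image_vimage:
  assumes "U \<in> basics X" "g \<in> carrier (gp X U)" "D \<subseteq> pts X U"
  shows "{x \<in> pts X U. act (chart X U) g x \<in> D} = act (chart X U) (inv\<^bsub>gp X U\<^esub> g) ` D"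
proof -
  interpret g_struct "subtopology T U" "chart X U" by (rule chart_gs[OF assms(1)])
  interpret group "gp X U" by (rule group_grp)
  show ?thesis
  proof (intro equalityI subsetI)
    fix x assume "x \<in> {x \<in> pts X U. act (chart X U) g x \<in> D}"
    then show "x \<in> act (chart X U) (inv\<^bsub>gp X U\<^esub> g) ` D"
      using assms(2) by (intro image_eqI[of _ _ "act (chart X U) g x"]) auto
  qed (use assms(2,3) act_inv in \<open>auto simp: subset_iff\<close>)
qed

text \<open>
  The point that the definition of \<open>twist\<close> selects is immaterial: the points which \<open>g\<close> carries into the
  domain of \<open>\<xi>\<close> form a connected set \<open>K\<close>, and composites are constant on it.
\<close>

lemma twist_arrow:
  assumes U: "U \<in> basics X" "V \<in> basics X" and \<xi>: "\<xi> \<in> Tran X U V"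
    and g: "g \<in> carrier (gp X U)" and h: "h \<in> carrier (gp X V)"
    and x: "x \<in> pts X U" "act (chart X U) g x \<in> tdom X U V \<xi>"
  shows "Arrow U x (twist X U V h \<xi> g) V =
    agrp X V h (tmap X U V \<xi> (act (chart X U) g x)) \<bullet>\<^bsub>X\<^esub> (Arrow U (act (chart X U) g x) \<xi> V \<bullet>\<^bsub>X\<^esub> agrp X U g x)"
    (is "_ = ?r x")
proof -
  interpret g_struct "subtopology T U" "chart X U" by (rule chart_gs[OF U(1)])
  interpret group "gp X U" by (rule group_grp)
  define K where "K = {x \<in> pts X U. act (chart X U) g x \<in> tdom X U V \<xi>}"
  have K: "connectedin (hat (chart X U)) K"
    unfolding K_def act_image_vimage[OF U(1) g tdom_props(4)[OF U \<xi>]]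
    using act_homeomorphic[OF inv_closed[OF g]] tdom_props(2)[OF U \<xi>]
    by (intro connectedin_continuous_map_image homeomorphic_imp_continuous_map)
  have xK: "x \<in> K" using x by (simp add: K_def)
  have gt: "gtran X U g \<in> Tran X U U" "gtran X V h \<in> Tran X V V" using gtran_bij U g h by (auto simp: bij_betw_def)
  define z where "z = (SOME x. x \<in> pts X U \<and> act (chart X U) g x \<in> tdom X U V \<xi>)"
  have zK: "z \<in> K" unfolding K_def z_def mem_Collect_eq by (rule someI[of _ x]) (use x in simp)
  let ?b = "\<lambda>x. Arrow U (act (chart X U) g x) \<xi> V \<bullet>\<^bsub>X\<^esub> agrp X U g x"
  have b: "?b y \<in> arrows X" "tgt X (?b y) = (V, tmap X U V \<xi> (act (chart X U) g y))" if "y \<in> K" for y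
    using that U g \<xi> acomp_in_arrows[of "agrp X U g y" "Arrow U (act (chart X U) g y) \<xi> V"] agrp_in_arrows[of U g y]
    by (auto simp: K_def in_arrows tgt_def src_def)
  have lab: "alab (?b y) = alab (?b x)" if "y \<in> K" for y
    unfolding acomp_def using that xK K U g \<xi> gt
    by (auto simp: K_def tdom_gtran tmap_gtran intro!: tcomp_constant[where K=K])
  have "tcomp X U V V (gtran X V h) (alab (?b x)) z = tcomp X U V V (gtran X V h) (alab (?b x)) x"
  proof (rule tcomp_constant[where K=K])
    show "alab (?b x) \<in> Tran X U V" using b[OF xK] by (simp add: in_arrows)
    show "K \<subseteq> tdom X U V (alab (?b x))"
    proof
      fix y assume "y \<in> K"
      then show "y \<in> tdom X U V (alab (?b x))" using b[of y] lab[of y] by (simp add: in_arrows)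
    qed
    show "tmap X U V (alab (?b x)) ` K \<subseteq> tdom X V V (gtran X V h)"
    proof safe
      fix y assume y: "y \<in> K"
      then show "tmap X U V (alab (?b x)) y \<in> tdom X V V (gtran X V h)"
        using b[OF y] lab[OF y] arrow_pts(4)[OF b(1)[OF y]] U h by (simp add: tdom_gtran tgt_def)
    qed
  qed (use U gt K zK xK in auto)
  moreover have "twist X U V h \<xi> g = tcomp X U V V (gtran X V h) (alab (?b z)) z"
    unfolding twist_def z_def Let_def acomp_def by simp
  ultimately show ?thesis using lab[OF zK] by (simp add: acomp_def)
qed

text \<open>
  The pair \<open>(1, 1)\<close> fixes every transition map, which says \<open>f \<bullet> (a \<bullet> e) = a\<close> for the identities \<open>e\<close>, \<open>f\<close>
  at the two ends of \<open>a\<close>. Since \<open>e\<close> and \<open>f\<close> are idempotent, each of them can be absorbed separately.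
\<close>

lemma aid_neutral:
  assumes a: "a \<in> arrows X"
  shows "a \<bullet>\<^bsub>X\<^esub> aid X (src a) = a" "aid X (tgt X a) \<bullet>\<^bsub>X\<^esub> a = a"
proof -
  obtain U x \<xi> V where [simp]: "a = Arrow U x \<xi> V" by (cases a)
  have U: "U \<in> basics X" "V \<in> basics X" and \<xi>: "\<xi> \<in> Tran X U V" "x \<in> tdom X U V \<xi>" using a by (auto simp: in_arrows)
  interpret U: g_struct "subtopology T U" "chart X U" by (rule chart_gs[OF U(1)])
  interpret V: g_struct "subtopology T V" "chart X V" by (rule chart_gs[OF U(2)])
  interpret UG: group "gp X U" by (rule U.group_grp)
  interpret VG: group "gp X V" by (rule V.group_grp)
  have x: "x \<in> pts X U" "tmap X U V \<xi> x \<in> pts X V" using tmap_in_pts[OF U \<xi>] .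
  let ?e = "agrp X U \<one>\<^bsub>gp X U\<^esub> x" and ?f = "agrp X V \<one>\<^bsub>gp X V\<^esub> (tmap X U V \<xi> x)"
  note e = agrp_in_arrows[OF U(1) UG.one_closed x(1), unfolded U.act_one[OF x(1)]]
  note f = agrp_in_arrows[OF U(2) VG.one_closed x(2), unfolded V.act_one[OF x(2)]]
  have tg: "tgt X a = (V, tmap X U V \<xi> x)" by (simp add: tgt_def)
  have "twist X U V (inv\<^bsub>gp X V\<^esub> \<one>\<^bsub>gp X V\<^esub>) \<xi> \<one>\<^bsub>gp X U\<^esub> = \<xi>"
    using twist_eq_iff[OF U \<xi>(1) UG.one_closed VG.one_closed] one_in_stab[OF U(1)] tdom_props(4)[OF U \<xi>(1)]
      tiso_one[OF U \<xi>(1)] by simp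
  then have 1: "?f \<bullet>\<^bsub>X\<^esub> (a \<bullet>\<^bsub>X\<^esub> ?e) = a"
    using twist_arrow[OF U \<xi>(1) UG.one_closed VG.one_closed x(1)] x \<xi> by simp
  have ee: "?e \<bullet>\<^bsub>X\<^esub> ?e = ?e" using agrp_comp[OF U(1) UG.one_closed UG.one_closed x(1), of x] by simp
  have ff: "?f \<bullet>\<^bsub>X\<^esub> ?f = ?f" using agrp_comp[OF U(2) VG.one_closed VG.one_closed x(2), of "tmap X U V \<xi> x"] by simp
  note c = acomp_in_arrows acomp_assoc
  have ae: "a \<bullet>\<^bsub>X\<^esub> ?e \<in> arrows X" "src (a \<bullet>\<^bsub>X\<^esub> ?e) = (U, x)" "tgt X (a \<bullet>\<^bsub>X\<^esub> ?e) = tgt X a"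
    using acomp_in_arrows[OF e(1) a] e(2) by simp_all
  have fa: "?f \<bullet>\<^bsub>X\<^esub> a \<in> arrows X" "src (?f \<bullet>\<^bsub>X\<^esub> a) = (U, x)"
    using acomp_in_arrows[OF a f(1)] tg by simp_all
  have "?f \<bullet>\<^bsub>X\<^esub> a = ?f \<bullet>\<^bsub>X\<^esub> (?f \<bullet>\<^bsub>X\<^esub> (a \<bullet>\<^bsub>X\<^esub> ?e))" using 1 by simp
  also have "\<dots> = (?f \<bullet>\<^bsub>X\<^esub> ?f) \<bullet>\<^bsub>X\<^esub> (a \<bullet>\<^bsub>X\<^esub> ?e)"
    by (rule acomp_assoc[symmetric]) (use ae f tg in auto)
  finally have l: "?f \<bullet>\<^bsub>X\<^esub> a = a" using 1 ff by simp
  have "a \<bullet>\<^bsub>X\<^esub> ?e = (?f \<bullet>\<^bsub>X\<^esub> (a \<bullet>\<^bsub>X\<^esub> ?e)) \<bullet>\<^bsub>X\<^esub> ?e" using 1 by simp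
  also have "\<dots> = ?f \<bullet>\<^bsub>X\<^esub> ((a \<bullet>\<^bsub>X\<^esub> ?e) \<bullet>\<^bsub>X\<^esub> ?e)"
    by (rule acomp_assoc) (use ae e f tg in auto)
  also have "(a \<bullet>\<^bsub>X\<^esub> ?e) \<bullet>\<^bsub>X\<^esub> ?e = a \<bullet>\<^bsub>X\<^esub> (?e \<bullet>\<^bsub>X\<^esub> ?e)"
    by (rule acomp_assoc) (use a e in auto)
  finally have r: "a \<bullet>\<^bsub>X\<^esub> ?e = a" using 1 ee by simp
  show "a \<bullet>\<^bsub>X\<^esub> aid X (src a) = a" "aid X (tgt X a) \<bullet>\<^bsub>X\<^esub> a = a"
    using l r by (simp_all add: aid_def tgt_def)
qed


text \<open>
  When \<open>U \<inter> V\<close> is connected, every transition map lies over all of it. Its domain contains some point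
  over the given base point, and group elements on both sides correct the two endpoints.
\<close>

lemma arrow_exists_connected:
  assumes U: "U \<in> basics X" "V \<in> basics X" and x: "x \<in> pts X U" and y: "y \<in> pts X V"
    and xy: "proj (chart X U) x = proj (chart X V) y" and conn: "connectedin T (U \<inter> V)"
  shows "\<exists>a\<in>arrows X. src a = (U, x) \<and> tgt X a = (V, y)"
proof -
  interpret U: g_struct "subtopology T U" "chart X U" by (rule chart_gs[OF U(1)])
  interpret V: g_struct "subtopology T V" "chart X V" by (rule chart_gs[OF U(2)])
  let ?z = "proj (chart X U) x"
  have z: "?z \<in> U \<inter> V"
    using imageI[OF x, of "proj (chart X U)"] imageI[OF y, of "proj (chart X V)"] xy
    unfolding proj_pts[OF U(1)] proj_pts[OF U(2)] by simp
  then obtain \<xi> where \<xi>: "\<xi> \<in> Tran X U V" using Tran_nonempty[OF U] by blast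
  obtain W where W: "W \<in> components_in X (U \<inter> V)" "tdom X U V \<xi> \<in> hat_components (chart X U) W"
    "openin (subtopology T U) W" "connectedin (subtopology T U) W"
    using Tran_domain[OF U \<xi>] by metis
  have "W = U \<inter> V" using component_of_connected[OF conn] W(1) unfolding components_in_def .
  then obtain x' where x': "x' \<in> tdom X U V \<xi>" "proj (chart X U) x' = ?z"
    using U.proj_hat_component[OF W(2-4)] z by (metis imageE)
  note p = tmap_in_pts[OF U \<xi> x'(1)] and q = proj_tmap[OF U \<xi> x'(1)]
  obtain g where g: "g \<in> carrier (gp X U)" "x' = act (chart X U) g x"
    using U.proj_eq[OF x p(1)] x' by metis
  obtain h where h: "h \<in> carrier (gp X V)" "y = act (chart X V) h (tmap X U V \<xi> x')"
    using V.proj_eq[OF p(2) y] q x' xy by metis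
  let ?a = "agrp X U g x" and ?b = "Arrow U x' \<xi> V" and ?c = "agrp X V h (tmap X U V \<xi> x')"
  have a: "?a \<in> arrows X" "tgt X ?a = (U, x')" using agrp_in_arrows[OF U(1) g(1) x] g by auto
  have b: "?b \<in> arrows X" "tgt X ?b = (V, tmap X U V \<xi> x')" using U \<xi> x' by (auto simp: in_arrows tgt_def)
  have c: "?c \<in> arrows X" "tgt X ?c = (V, y)" using agrp_in_arrows[OF U(2) h(1) p(2)] h by auto
  note ba = acomp_in_arrows[OF a(1) b(1)]
  show ?thesis using acomp_in_arrows[of "?b \<bullet>\<^bsub>X\<^esub> ?a" ?c] ba a b c by auto
qed

text \<open>
  The axioms do not say directly that there is a transition map over every component of \<open>U \<inter> V\<close>. The
  component \<open>W\<close> that contains the base point is itself a basic open set, and the germ is composed of two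
  germs through the chart of \<open>W\<close>, for which the intersections \<open>U \<inter> W\<close> and \<open>W \<inter> V\<close> are connected.
\<close>

lemma arrow_exists:
  assumes U: "U \<in> basics X" "V \<in> basics X" and x: "x \<in> pts X U" and y: "y \<in> pts X V"
    and xy: "proj (chart X U) x = proj (chart X V) y"
  obtains a where "a \<in> arrows X" "src a = (U, x)" "tgt X a = (V, y)"
proof -
  let ?z = "proj (chart X U) x"
  have z: "?z \<in> U \<inter> V"
    using imageI[OF x, of "proj (chart X U)"] imageI[OF y, of "proj (chart X V)"] xy
    unfolding proj_pts[OF U(1)] proj_pts[OF U(2)] by simp
  have o: "openin T (U \<inter> V)" using U basics_open by blast
  then obtain W where W: "W \<in> components_in X (U \<inter> V)" "?z \<in> W"
    unfolding components_in_def using z component_exists openin_subset by metis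
  note Wp = components_props[OF W(1) o]
  have Wb: "W \<in> basics X" by (rule basics_subset[OF U(1)]) (use Wp in auto)
  then obtain w where w: "w \<in> pts X W" "proj (chart X W) w = ?z" using proj_pts[OF Wb] W(2) by (metis imageE)
  have i: "U \<inter> W = W" "W \<inter> V = W" using Wp(4) by auto
  obtain a where a: "a \<in> arrows X" "src a = (U, x)" "tgt X a = (W, w)"
    using arrow_exists_connected[OF U(1) Wb x w(1)] w(2) i Wp(2) by auto
  obtain b where b: "b \<in> arrows X" "src b = (W, w)" "tgt X b = (V, y)"
    using arrow_exists_connected[OF Wb U(2) w(1) y] w(2) xy i Wp(2) by auto
  show thesis using that acomp_in_arrows[OF a(1) b(1)] a b by auto
qed

text \<open>
  Both sets are components of the preimage of the same component of \<open>U \<inter> V\<close>, and they share a point.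
\<close>

lemma domain_eqI:
  assumes U: "U \<in> basics X" "V \<in> basics X" and \<xi>: "\<xi> \<in> Tran X U V" and \<eta>: "\<eta> \<in> Tran X V U"
    and x: "x \<in> tdom X U V \<xi>" "tmap X U V \<xi> x \<in> tdom X V U \<eta>"
  shows "tdom X V U \<eta> = tmap X U V \<xi> ` tdom X U V \<xi>"
proof -
  obtain W where W: "W \<in> components_in X (U \<inter> V)" "tdom X U V \<xi> \<in> hat_components (chart X U) W"
    "tmap X U V \<xi> ` tdom X U V \<xi> \<in> hat_components (chart X V) W" "openin (subtopology T U) W"
    using Tran_domain[OF U \<xi>] by metis
  obtain W' where W': "W' \<in> components_in X (V \<inter> U)" "tdom X V U \<eta> \<in> hat_components (chart X V) W'"
    "openin (subtopology T V) W'"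
    using Tran_domain[OF U(2,1) \<eta>] by metis
  have "proj (chart X U) x \<in> W" 
    using g_struct.hat_component_props(5)[OF chart_gs[OF U(1)] W(2) W(4) x(1)] .
  moreover have "proj (chart X U) x \<in> W'"
    using g_struct.hat_component_props(5)[OF chart_gs[OF U(2)] W'(2) W'(3) x(2)] proj_tmap[OF U \<xi> x(1)] by simp
  ultimately have "W = W'"
    using component_unique W(1) W'(1) unfolding components_in_def by (metis Int_commute)
  then show ?thesis using component_unique[OF W'(2)[unfolded hat_components_def], of _ "tmap X U V \<xi> x"]
      W(3) x unfolding hat_components_def by blast
qed

text \<open>
  A germ \<open>b\<close> from the endpoint of \<open>a\<close> back to its starting point gives \<open>b \<bullet> a\<close>, a germ of a transition map
  from a chart to itself and so a group element \<open>g\<close>; then \<open>g\<^sup>-\<^sup>1 \<bullet> b\<close> is a left inverse of \<open>a\<close>. It serves at all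
  points of the domain, which is connected.
\<close>

lemma left_inverse_exists:
  assumes U: "U \<in> basics X" "V \<in> basics X" and \<xi>: "\<xi> \<in> Tran X U V"
  obtains \<eta> where "\<eta> \<in> Tran X V U" "tdom X V U \<eta> = tmap X U V \<xi> ` tdom X U V \<xi>"
    "\<forall>x\<in>tdom X U V \<xi>. tcomp X U V U \<eta> \<xi> x = gtran X U \<one>\<^bsub>gp X U\<^esub>"
proof -
  interpret U: g_struct "subtopology T U" "chart X U" by (rule chart_gs[OF U(1)])
  interpret G: group "gp X U" by (rule U.group_grp)
  obtain x where x: "x \<in> tdom X U V \<xi>" using tdom_props(3)[OF U \<xi>] by blast
  note xp = tmap_in_pts[OF U \<xi> x]
  let ?a = "Arrow U x \<xi> V"
  have a: "?a \<in> arrows X" "tgt X ?a = (V, tmap X U V \<xi> x)" using U \<xi> x by (auto simp: in_arrows tgt_def)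
  obtain b where b: "b \<in> arrows X" "src b = tgt X ?a" "tgt X b = (U, x)"
    using arrow_exists[OF U(2,1) xp(2,1)] proj_tmap[OF U \<xi> x] a(2) by metis
  have db: "dchart b = V" "cchart b = U" "apt b = tmap X U V \<xi> x"
    using b a by (metis arrow_simps(1,2,3) fst_conv snd_conv)+
  note ba = acomp_in_arrows[OF a(1) b(1) b(2)]
  obtain g where g: "g \<in> carrier (gp X U)" "b \<bullet>\<^bsub>X\<^esub> ?a = agrp X U g x"
    using arrow_in_group[OF ba(1)] db by auto
  have gx: "act (chart X U) g x = x" using agrp_in_arrows(2)[OF U(1) g(1) xp(1)] g(2) ba(3) b(3) by simp
  let ?c = "agrp X U (inv\<^bsub>gp X U\<^esub> g) x"
  have c: "?c \<in> arrows X" using agrp_in_arrows(1)[OF U(1) G.inv_closed[OF g(1)] xp(1)] .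
  have sc: "src ?c = tgt X b" using b by simp
  define e where "e = ?c \<bullet>\<^bsub>X\<^esub> b"
  note cb = acomp_in_arrows[OF b(1) c sc, folded e_def]
  have de: "dchart e = V" "cchart e = U" "apt e = tmap X U V \<xi> x" using db by (simp_all add: e_def)
  have "e \<bullet>\<^bsub>X\<^esub> ?a = ?c \<bullet>\<^bsub>X\<^esub> (b \<bullet>\<^bsub>X\<^esub> ?a)" unfolding e_def using acomp_assoc a b c sc by metis
  also have "\<dots> = agrp X U \<one>\<^bsub>gp X U\<^esub> x"
    unfolding g(2) using agrp_comp[OF U(1) G.inv_closed[OF g(1)] g(1) xp(1)] g(1) by simp
  finally have one: "tcomp X U V U (alab e) \<xi> x = gtran X U \<one>\<^bsub>gp X U\<^esub>"
    using de by (simp add: acomp_def agrp_def)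
  have \<eta>: "alab e \<in> Tran X V U" "tmap X U V \<xi> x \<in> tdom X V U (alab e)" using cb(1) de by (auto simp: in_arrows)
  note dom = domain_eqI[OF U \<xi> \<eta>(1) x \<eta>(2)]
  have "tcomp X U V U (alab e) \<xi> y = gtran X U \<one>\<^bsub>gp X U\<^esub>" if "y \<in> tdom X U V \<xi>" for y
    using tcomp_constant[OF U U(1) \<xi> \<eta>(1) tdom_props(2)[OF U \<xi>] subset_refl _ that x] dom one by simp
  then show thesis using that[OF \<eta>(1) dom] by blast
qed

text \<open>
  The left inverse \<open>b\<close> has a left inverse \<open>c\<close> of its own, and \<open>c = c \<bullet> (b \<bullet> a) = (c \<bullet> b) \<bullet> a = a\<close>.
\<close>

lemma left_inverse_two_sided:
  assumes a: "a \<in> arrows X" and b: "b \<in> arrows X" "src b = tgt X a" and ba: "b \<bullet>\<^bsub>X\<^esub> a = aid X (src a)"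
  shows "a \<bullet>\<^bsub>X\<^esub> b = aid X (tgt X a)" "tgt X b = src a"
proof -
  have p: "dchart a \<in> basics X" "cchart a \<in> basics X" "alab a \<in> Tran X (dchart a) (cchart a)"
    "apt a \<in> tdom X (dchart a) (cchart a) (alab a)" using a by (auto simp: in_arrows)
  have ap: "apt a \<in> pts X (dchart a)" using tmap_in_pts p by blast
  have G: "group (gp X (dchart a))" by (rule grp_chart[OF p(1)])
  have gid: "aid X (src a) \<in> arrows X" "tgt X (aid X (src a)) = src a"
    using agrp_in_arrows[OF p(1) group.is_monoid[THEN monoid.one_closed, OF G] ap]
      g_struct.act_one[OF chart_gs[OF p(1)] ap] by (auto simp: aid_def src_def)
  show tb: "tgt X b = src a" using acomp_in_arrows(3)[OF a b] ba gid by simp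
  have q: "dchart b = cchart a" "cchart b = dchart a" 
    using b tb by (metis arrow_simps(1,3))+
  have r: "alab b \<in> Tran X (cchart a) (dchart a)" "apt b \<in> tdom X (cchart a) (dchart a) (alab b)"
    using b(1) q by (auto simp: in_arrows)
  obtain \<eta> where \<eta>: "\<eta> \<in> Tran X (dchart a) (cchart a)"
     "tdom X (dchart a) (cchart a) \<eta> = tmap X (cchart a) (dchart a) (alab b) ` tdom X (cchart a) (dchart a) (alab b)"
     "\<forall>x\<in>tdom X (cchart a) (dchart a) (alab b). tcomp X (cchart a) (dchart a) (cchart a) \<eta> (alab b) x = gtran X (cchart a) \<one>\<^bsub>gp X (cchart a)\<^esub>"
    using left_inverse_exists[OF p(2,1) r(1)] by metis
  define c where "c = Arrow (dchart a) (apt a) \<eta> (cchart a)"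
  have at: "apt a = tmap X (cchart a) (dchart a) (alab b) (apt b)" using tb q by (simp add: tgt_def src_def)
  have c: "c \<in> arrows X" "src c = tgt X b" using p \<eta> r at tb by (auto simp: c_def in_arrows src_def)
  have cb: "c \<bullet>\<^bsub>X\<^esub> b = aid X (src b)" using \<eta>(3) r q by (simp add: acomp_def c_def aid_def agrp_def src_def)
  have "c = c \<bullet>\<^bsub>X\<^esub> (b \<bullet>\<^bsub>X\<^esub> a)" using aid_neutral(1)[OF c(1)] ba c tb by simp
  also have "\<dots> = (c \<bullet>\<^bsub>X\<^esub> b) \<bullet>\<^bsub>X\<^esub> a" using acomp_assoc a b c by simp
  also have "\<dots> = a" using cb aid_neutral(2)[OF a] b by simp
  finally show "a \<bullet>\<^bsub>X\<^esub> b = aid X (tgt X a)" using cb b by simp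
qed

lemma tran_inv_props:
  assumes U: "U \<in> basics X" "V \<in> basics X" and \<xi>: "\<xi> \<in> Tran X U V"
  shows "tran_inv X U V \<xi> \<in> Tran X V U" "tdom X V U (tran_inv X U V \<xi>) = tmap X U V \<xi> ` tdom X U V \<xi>"
    "\<forall>x\<in>tdom X U V \<xi>. tcomp X U V U (tran_inv X U V \<xi>) \<xi> x = gtran X U \<one>\<^bsub>gp X U\<^esub>"
proof -
  let ?P = "\<lambda>\<eta>. \<eta> \<in> Tran X V U \<and> tdom X V U \<eta> = tmap X U V \<xi> ` tdom X U V \<xi> \<and>
     (\<forall>x\<in>tdom X U V \<xi>. tcomp X U V U \<eta> \<xi> x = gtran X U \<one>\<^bsub>gp X U\<^esub>)"
  have unique: "\<eta> = \<eta>'" if "?P \<eta>" "?P \<eta>'" for \<eta> \<eta>'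
  proof -
    obtain x where x: "x \<in> tdom X U V \<xi>" using tdom_props(3)[OF U \<xi>] by blast
    let ?a = "Arrow U x \<xi> V" and ?b = "Arrow V (tmap X U V \<xi> x) \<eta> U" and ?b' = "Arrow V (tmap X U V \<xi> x) \<eta>' U"
    have a: "?a \<in> arrows X" "tgt X ?a = (V, tmap X U V \<xi> x)" using U \<xi> x by (auto simp: in_arrows tgt_def)
    have b: "?b \<in> arrows X" "?b' \<in> arrows X" using that U x by (auto simp: in_arrows)
    have l: "?b \<bullet>\<^bsub>X\<^esub> ?a = aid X (src ?a)" "?b' \<bullet>\<^bsub>X\<^esub> ?a = aid X (src ?a)"
      using that x by (simp_all add: acomp_def aid_def agrp_def)
    note r = left_inverse_two_sided[OF a(1) b(1) _ l(1)] left_inverse_two_sided[OF a(1) b(2) _ l(2)]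
    have "?b = (?b' \<bullet>\<^bsub>X\<^esub> ?a) \<bullet>\<^bsub>X\<^esub> ?b" using aid_neutral(2)[OF b(1)] l r a by simp
    also have "\<dots> = ?b' \<bullet>\<^bsub>X\<^esub> (?a \<bullet>\<^bsub>X\<^esub> ?b)" using acomp_assoc[OF b(1) a(1) b(2)] r a by simp
    also have "\<dots> = ?b'" using aid_neutral(1)[OF b(2)] r a by simp
    finally show ?thesis by simp
  qed
  obtain \<eta> where "?P \<eta>" using left_inverse_exists[OF U \<xi>] by metis
  then have "?P (tran_inv X U V \<xi>)" unfolding tran_inv_def by (rule theI) (use unique \<open>?P \<eta>\<close> in blast)
  then show "tran_inv X U V \<xi> \<in> Tran X V U" "tdom X V U (tran_inv X U V \<xi>) = tmap X U V \<xi> ` tdom X U V \<xi>"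
    "\<forall>x\<in>tdom X U V \<xi>. tcomp X U V U (tran_inv X U V \<xi>) \<xi> x = gtran X U \<one>\<^bsub>gp X U\<^esub>" by auto
qed

lemma ainv_props:
  assumes a: "a \<in> arrows X"
  shows "ainv X a \<in> arrows X" "src (ainv X a) = tgt X a" "ainv X a \<bullet>\<^bsub>X\<^esub> a = aid X (src a)"
proof -
  have p: "dchart a \<in> basics X" "cchart a \<in> basics X" "alab a \<in> Tran X (dchart a) (cchart a)"
    "apt a \<in> tdom X (dchart a) (cchart a) (alab a)" using a by (auto simp: in_arrows)
  note t = tran_inv_props[OF p(1-3)]
  show "ainv X a \<in> arrows X" "src (ainv X a) = tgt X a"
    using p t by (auto simp: in_arrows ainv_def src_def tgt_def)
  show "ainv X a \<bullet>\<^bsub>X\<^esub> a = aid X (src a)" using t p by (simp add: acomp_def ainv_def aid_def agrp_def src_def)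
qed

sublocale groupoid "arrows X" src "tgt X" "acomp X" "aid X" "ainv X"
proof
  fix a b c assume a: "a \<in> arrows X"
  have p: "dchart a \<in> basics X" "apt a \<in> pts X (dchart a)" using arrow_pts a by blast+
  have "group (gp X (dchart a))" by (rule grp_chart[OF p(1)])
  note e = agrp_in_arrows[OF p(1) group.is_monoid[THEN monoid.one_closed, OF this] p(2)]
  show "aid X (src a) \<in> arrows X" "src (aid X (src a)) = src a" "tgt X (aid X (src a)) = src a"
    using e g_struct.act_one[OF chart_gs[OF p(1)] p(2)] by (auto simp: aid_def src_def)
  show "a \<bullet>\<^bsub>X\<^esub> aid X (src a) = a" "aid X (tgt X a) \<bullet>\<^bsub>X\<^esub> a = a" using aid_neutral[OF a] by auto
  note i = ainv_props[OF a]
  show "ainv X a \<in> arrows X" "src (ainv X a) = tgt X a" "ainv X a \<bullet>\<^bsub>X\<^esub> a = aid X (src a)" by fact+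
  show "tgt X (ainv X a) = src a" "a \<bullet>\<^bsub>X\<^esub> ainv X a = aid X (tgt X a)"
    using left_inverse_two_sided[OF a i] by auto
  assume b: "b \<in> arrows X" "src b = tgt X a"
  show "b \<bullet>\<^bsub>X\<^esub> a \<in> arrows X" "src (b \<bullet>\<^bsub>X\<^esub> a) = src a" "tgt X (b \<bullet>\<^bsub>X\<^esub> a) = tgt X b"
    using acomp_in_arrows[OF a b] by auto
  assume "c \<in> arrows X" "src c = tgt X b"
  then show "(c \<bullet>\<^bsub>X\<^esub> b) \<bullet>\<^bsub>X\<^esub> a = c \<bullet>\<^bsub>X\<^esub> (b \<bullet>\<^bsub>X\<^esub> a)" using acomp_assoc a b by blast
qed

end


section \<open>Families of germs with a constant label\<close>

context orbi
begin

text \<open>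
  A family of germs of one transition map whose base points vary continuously over a space \<open>S\<close>. Over a
  connected space such families are closed under composition, inversion and functors. This is how a
  construction that is made germ by germ is seen to produce a transition map.
\<close>

definition csec :: "'a topology \<Rightarrow> ('a \<Rightarrow> ('x, 'p, 't) arrow) \<Rightarrow> bool" where
  "csec S A \<longleftrightarrow> (\<exists>U V \<xi> p. U \<in> basics X \<and> V \<in> basics X \<and> \<xi> \<in> Tran X U V \<and> continuous_map S (hat (chart X U)) p \<and>
     (\<forall>t\<in>topspace S. p t \<in> tdom X U V \<xi> \<and> A t = Arrow U (p t) \<xi> V))"

lemma csecI:
  assumes "U \<in> basics X" "V \<in> basics X" "\<xi> \<in> Tran X U V" "continuous_map S (hat (chart X U)) p"
    and "\<And>t. t \<in> topspace S \<Longrightarrow> p t \<in> tdom X U V \<xi>" "\<And>t. t \<in> topspace S \<Longrightarrow> A t = Arrow U (p t) \<xi> V"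
  shows "csec S A"
  unfolding csec_def using assms by blast

lemma csec_in_arrows: "csec S A \<Longrightarrow> t \<in> topspace S \<Longrightarrow> A t \<in> arrows X"
  unfolding csec_def by (auto simp: in_arrows)

lemma csec_label: "csec S A \<Longrightarrow> s \<in> topspace S \<Longrightarrow> t \<in> topspace S \<Longrightarrow> alab (A s) = alab (A t)"
  unfolding csec_def by auto

lemma csec_tmap_continuous:
  assumes "U \<in> basics X" "V \<in> basics X" "\<xi> \<in> Tran X U V" "continuous_map S (hat (chart X U)) p"
    and "\<And>t. t \<in> topspace S \<Longrightarrow> p t \<in> tdom X U V \<xi>"
  shows "continuous_map S (hat (chart X V)) (\<lambda>t. tmap X U V \<xi> (p t))"
proof -
  have "continuous_map S (subtopology (hat (chart X U)) (tdom X U V \<xi>)) p"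
    using assms by (auto simp: continuous_map_in_subtopology)
  from continuous_map_compose[OF this tmap_continuous[OF assms(1-3)]] show ?thesis by (simp add: comp_def)
qed

lemma csec_comp:
  assumes S: "connected_space S" and A: "csec S A" and B: "csec S B"
    and AB: "\<And>t. t \<in> topspace S \<Longrightarrow> src (B t) = tgt X (A t)"
  shows "csec S (\<lambda>t. B t \<bullet>\<^bsub>X\<^esub> A t)"
proof -
  obtain U V \<xi> p where a: "U \<in> basics X" "V \<in> basics X" "\<xi> \<in> Tran X U V" "continuous_map S (hat (chart X U)) p"
    "\<And>t. t \<in> topspace S \<Longrightarrow> p t \<in> tdom X U V \<xi>" "\<And>t. t \<in> topspace S \<Longrightarrow> A t = Arrow U (p t) \<xi> V"
    using A unfolding csec_def by blast
  obtain V' W \<eta> q where b: "V' \<in> basics X" "W \<in> basics X" "\<eta> \<in> Tran X V' W"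
    "\<And>t. t \<in> topspace S \<Longrightarrow> q t \<in> tdom X V' W \<eta>" "\<And>t. t \<in> topspace S \<Longrightarrow> B t = Arrow V' (q t) \<eta> W"
    using B unfolding csec_def by blast
  show ?thesis
  proof (cases "topspace S = {}")
    \<comment> \<open>Over the empty space any transition map will do.\<close>
    case True
    then show ?thesis using a by (intro csecI[where p=p]) auto
  next
    case False
    then obtain t0 where t0: "t0 \<in> topspace S" by blast
    have V': "V' = V" using AB[OF t0] a(6)[OF t0] b(5)[OF t0] by (simp add: tgt_def)
    have q: "q t = tmap X U V \<xi> (p t)" if "t \<in> topspace S" for t
      using AB[OF that] a(6)[OF that] b(5)[OF that] by (simp add: tgt_def)
    define \<zeta> where "\<zeta> = tcomp X U V W \<eta> \<xi> (p t0)"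
    have K: "connectedin (hat (chart X U)) (p ` topspace S)"
      using S a(4) connectedin_continuous_map_image connectedin_topspace by blast
    have C: "B t \<bullet>\<^bsub>X\<^esub> A t = Arrow U (p t) \<zeta> W" if t: "t \<in> topspace S" for t
    proof -
      have "tcomp X U V W \<eta> \<xi> (p t) = \<zeta>" unfolding \<zeta>_def
        by (rule tcomp_constant[OF a(1,2) b(2) a(3) _ K]) (use a b V' q t t0 in auto)
      then show ?thesis using a(6)[OF t] b(5)[OF t] V' by (simp add: acomp_def)
    qed
    have "B t \<bullet>\<^bsub>X\<^esub> A t \<in> arrows X" if "t \<in> topspace S" for t
      using csec_in_arrows[OF A that] csec_in_arrows[OF B that] AB[OF that] by simp
    then have "\<zeta> \<in> Tran X U W" "\<And>t. t \<in> topspace S \<Longrightarrow> p t \<in> tdom X U W \<zeta>"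
      using C t0 by (auto simp: in_arrows)
    then show ?thesis by (intro csecI[OF a(1) b(2) _ a(4)]) (use C in auto)
  qed
qed

lemma csec_inv:
  assumes A: "csec S A"
  shows "csec S (\<lambda>t. ainv X (A t))"
proof -
  obtain U V \<xi> p where a: "U \<in> basics X" "V \<in> basics X" "\<xi> \<in> Tran X U V" "continuous_map S (hat (chart X U)) p"
    "\<And>t. t \<in> topspace S \<Longrightarrow> p t \<in> tdom X U V \<xi>" "\<And>t. t \<in> topspace S \<Longrightarrow> A t = Arrow U (p t) \<xi> V"
    using A unfolding csec_def by blast
  show ?thesis
    by (rule csecI[OF a(2,1) tran_inv_props(1)[OF a(1-3)] csec_tmap_continuous[OF a(1-5)]])
      (use a tran_inv_props(2)[OF a(1-3)] in \<open>auto simp: ainv_def tgt_def\<close>)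
qed

lemma csec_Arrow:
  assumes "U \<in> basics X" "V \<in> basics X" "\<xi> \<in> Tran X U V" "K \<subseteq> tdom X U V \<xi>"
  shows "csec (subtopology (hat (chart X U)) K) (\<lambda>x. Arrow U x \<xi> V)"
  by (rule csecI[OF assms(1-3), where p="\<lambda>x. x"])
    (use assms(4) continuous_map_id_subt[of "hat (chart X U)" K] in \<open>auto simp: id_def\<close>)

section \<open>The topology on transition maps\<close>

lemma topspace_tran_top:
  assumes U: "U \<in> basics X" "V \<in> basics X"
  shows "topspace (tran_top X U V) = Tran X U V"
proof -
  interpret U: g_struct "subtopology T U" "chart X U" by (rule chart_gs[OF U(1)])
  interpret V: g_struct "subtopology T V" "chart X V" by (rule chart_gs[OF U(2)])
  have "openin (tran_top X U V) (Tran X U V)"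
    unfolding openin_tran_top
  proof (intro conjI ballI subset_refl)
    fix \<xi> assume "\<xi> \<in> Tran X U V"
    then have "{(g, h). g \<in> carrier (gp X U) \<and> h \<in> carrier (gp X V) \<and>
         twist X U V (inv\<^bsub>gp X V\<^esub> h) \<xi> g \<in> Tran X U V} = carrier (gp X U) \<times> carrier (gp X V)"
      using twist_Tran[OF U] by auto
    then show "openin (prod_topology (grp_top (chart X U)) (grp_top (chart X V)))
        {(g, h). g \<in> carrier (gp X U) \<and> h \<in> carrier (gp X V) \<and>
         twist X U V (inv\<^bsub>gp X V\<^esub> h) \<xi> g \<in> Tran X U V}"
      by (simp flip: U.topspace_grp_top V.topspace_grp_top add: openin_prod_Times_iff)
  qed
  then show ?thesis unfolding topspace_def openin_tran_top by blast
qed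

lemma gtran_inj: "\<lbrakk>U \<in> basics X; g \<in> carrier (gp X U); h \<in> carrier (gp X U)\<rbrakk> \<Longrightarrow>
    gtran X U g = gtran X U h \<longleftrightarrow> g = h"
  using gtran_bij[of U] by (auto simp: bij_betw_def inj_on_def)

lemma gtran_in_Tran: "\<lbrakk>U \<in> basics X; g \<in> carrier (gp X U)\<rbrakk> \<Longrightarrow> gtran X U g \<in> Tran X U U"
  using gtran_bij[of U] by (auto simp: bij_betw_def)

lemma twist_gtran:
  assumes U: "U \<in> basics X" and ghk: "g \<in> carrier (gp X U)" "h \<in> carrier (gp X U)" "k \<in> carrier (gp X U)"
  shows "twist X U U h (gtran X U k) g = gtran X U (h \<otimes>\<^bsub>gp X U\<^esub> (k \<otimes>\<^bsub>gp X U\<^esub> g))"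
proof -
  interpret U: g_struct "subtopology T U" "chart X U" by (rule chart_gs[OF U])
  interpret group "gp X U" by (rule U.group_grp)
  obtain x where x: "x \<in> pts X U" using pts_nonempty[OF U] by blast
  let ?y = "act (chart X U) g x"
  have "Arrow U x (twist X U U h (gtran X U k) g) U =
    agrp X U h (tmap X U U (gtran X U k) ?y) \<bullet>\<^bsub>X\<^esub> (agrp X U k ?y \<bullet>\<^bsub>X\<^esub> agrp X U g x)"
    using twist_arrow[OF U U gtran_in_Tran[OF U ghk(3)] ghk(1,2) x] tdom_gtran[OF U ghk(3)] ghk x
    by (simp add: agrp_def)
  also have "\<dots> = agrp X U (h \<otimes>\<^bsub>gp X U\<^esub> (k \<otimes>\<^bsub>gp X U\<^esub> g)) x"
    using ghk x U by (simp add: agrp_comp)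
  finally show ?thesis by (simp add: agrp_def)
qed

text \<open>
  The slice \<open>h = 1\<close> of the quotient map \<open>(g, h) \<mapsto> h\<^sup>-\<^sup>1 \<circ> g\<close> is \<open>gtran\<close>. Together with the next lemma this says that
  the identification of the group of a chart with its transition maps to itself is a homeomorphism.
\<close>

lemma gtran_continuous:
  assumes U: "U \<in> basics X"
  shows "continuous_map (grp_top (chart X U)) (tran_top X U U) (gtran X U)"
  unfolding continuous_map
proof (intro conjI allI impI)
  interpret U: g_struct "subtopology T U" "chart X U" by (rule chart_gs[OF U])
  interpret group "gp X U" by (rule U.group_grp)
  show "gtran X U ` topspace (grp_top (chart X U)) \<subseteq> topspace (tran_top X U U)"
    using gtran_in_Tran[OF U] by (auto simp: U.topspace_grp_top topspace_tran_top[OF U U])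
  fix S assume S: "openin (tran_top X U U) S"
  let ?Q = "{(g, h). g \<in> carrier (gp X U) \<and> h \<in> carrier (gp X U) \<and>
        twist X U U (inv\<^bsub>gp X U\<^esub> h) (gtran X U \<one>\<^bsub>gp X U\<^esub>) g \<in> S}"
  have Q: "openin (prod_topology (grp_top (chart X U)) (grp_top (chart X U))) ?Q"
    using S gtran_in_Tran[OF U one_closed] unfolding openin_tran_top by blast
  have "continuous_map (grp_top (chart X U)) (prod_topology (grp_top (chart X U)) (grp_top (chart X U)))
      (\<lambda>g. (g, \<one>\<^bsub>gp X U\<^esub>))"
    by (simp add: continuous_map_paired U.topspace_grp_top)
  from openin_continuous_map_preimage[OF this Q]
  show "openin (grp_top (chart X U)) {g \<in> topspace (grp_top (chart X U)). gtran X U g \<in> S}"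
    by (rule back_subst[of "openin _"]) (use U in \<open>auto simp: U.topspace_grp_top twist_gtran\<close>)
qed

lemma gtran_open:
  assumes U: "U \<in> basics X" and O: "openin (grp_top (chart X U)) O'"
  shows "openin (tran_top X U U) (gtran X U ` O')"
  unfolding openin_tran_top
proof (intro conjI ballI)
  interpret U: g_struct "subtopology T U" "chart X U" by (rule chart_gs[OF U])
  interpret group "gp X U" by (rule U.group_grp)
  have sub: "O' \<subseteq> carrier (gp X U)" using openin_subset[OF O] U.topspace_grp_top by simp
  then show "gtran X U ` O' \<subseteq> Tran X U U" using gtran_in_Tran[OF U] by auto
  fix \<xi> assume "\<xi> \<in> Tran X U U"
  then obtain k where k: "k \<in> carrier (gp X U)" "\<xi> = gtran X U k" using gtran_bij[OF U] by (auto simp: bij_betw_def)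
  let ?T = "grp_top (chart X U)" and ?m = "\<lambda>(g, h). g \<otimes>\<^bsub>gp X U\<^esub> h"
  have m: "continuous_map (prod_topology ?T ?T) ?T ?m" and i: "continuous_map ?T ?T (\<lambda>g. inv\<^bsub>gp X U\<^esub> g)"
    using U.top_group by (auto simp: topological_group_def)
  have kg: "continuous_map (prod_topology ?T ?T) ?T (\<lambda>p. k \<otimes>\<^bsub>gp X U\<^esub> fst p)"
    using continuous_map_compose[OF _ m, of "prod_topology ?T ?T" "\<lambda>p. (k, fst p)"] k(1)
    by (simp add: continuous_map_paired U.topspace_grp_top continuous_map_fst comp_def)
  have hi: "continuous_map (prod_topology ?T ?T) ?T (\<lambda>p. inv\<^bsub>gp X U\<^esub> (snd p))"
    using continuous_map_compose[OF continuous_map_snd i] by (simp add: comp_def)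
  have c: "continuous_map (prod_topology ?T ?T) ?T (\<lambda>p. inv\<^bsub>gp X U\<^esub> (snd p) \<otimes>\<^bsub>gp X U\<^esub> (k \<otimes>\<^bsub>gp X U\<^esub> fst p))"
    using continuous_map_compose[OF _ m, of "prod_topology ?T ?T"
        "\<lambda>p. (inv\<^bsub>gp X U\<^esub> (snd p), k \<otimes>\<^bsub>gp X U\<^esub> fst p)"] kg hi
    by (simp add: continuous_map_paired comp_def)
  have eq: "gtran X U (inv\<^bsub>gp X U\<^esub> h \<otimes>\<^bsub>gp X U\<^esub> (k \<otimes>\<^bsub>gp X U\<^esub> g)) \<in> gtran X U ` O' \<longleftrightarrow>
      inv\<^bsub>gp X U\<^esub> h \<otimes>\<^bsub>gp X U\<^esub> (k \<otimes>\<^bsub>gp X U\<^esub> g) \<in> O'"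
    if "g \<in> carrier (gp X U)" "h \<in> carrier (gp X U)" for g h
    using sub gtran_inj[OF U, of "inv\<^bsub>gp X U\<^esub> h \<otimes>\<^bsub>gp X U\<^esub> (k \<otimes>\<^bsub>gp X U\<^esub> g)"] that k(1) by (auto simp: image_iff subset_iff)
  from openin_continuous_map_preimage[OF c O]
  show "openin (prod_topology ?T ?T) {(g, h). g \<in> carrier (gp X U) \<and> h \<in> carrier (gp X U) \<and>
        twist X U U (inv\<^bsub>gp X U\<^esub> h) \<xi> g \<in> gtran X U ` O'}"
  proof (rule back_subst[of "openin _"], intro Set.set_eqI, goal_cases)
    case (1 p)
    show ?case
      using U k eq[of "fst p" "snd p"] by (cases p) (auto simp: U.topspace_grp_top twist_gtran simp del: image_iff)
  qed
qed

text \<open>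
  This is the axiom on the pairs \<open>(g, h)\<close> that fix \<open>\<xi>\<close>, rewritten as an equation between germs: a
  transition map intertwines the stabilizers of its domain and range.
\<close>

lemma stab_commute:
  assumes U: "U \<in> basics X" "V \<in> basics X" and \<xi>: "\<xi> \<in> Tran X U V" and x: "x \<in> tdom X U V \<xi>"
    and g: "g \<in> stab (chart X U) (tdom X U V \<xi>)"
  shows "Arrow U (act (chart X U) g x) \<xi> V \<bullet>\<^bsub>X\<^esub> agrp X U g x
    = agrp X V (tiso X U V \<xi> g) (tmap X U V \<xi> x) \<bullet>\<^bsub>X\<^esub> Arrow U x \<xi> V"
proof -
  interpret U: g_struct "subtopology T U" "chart X U" by (rule chart_gs[OF U(1)])
  interpret V: g_struct "subtopology T V" "chart X V" by (rule chart_gs[OF U(2)])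
  interpret V: group "gp X V" by (rule V.group_grp)
  let ?h = "tiso X U V \<xi> g" and ?y = "tmap X U V \<xi> x" and ?gx = "act (chart X U) g x"
  have gc: "g \<in> carrier (gp X U)" and gx: "?gx \<in> tdom X U V \<xi>"
    using g x by (auto simp: stab_def stabilizer_def)
  have h: "?h \<in> carrier (gp X V)" by (rule tiso_closed[OF U \<xi> g])
  note p = tmap_in_pts[OF U \<xi> x] tmap_in_pts[OF U \<xi> gx]
  have tw: "twist X U V (inv\<^bsub>gp X V\<^esub> ?h) \<xi> g = \<xi>" using twist_eq_iff[OF U \<xi> gc h] g by simp
  let ?b = "Arrow U ?gx \<xi> V \<bullet>\<^bsub>X\<^esub> agrp X U g x"
  have e: "Arrow U x \<xi> V = agrp X V (inv\<^bsub>gp X V\<^esub> ?h) (tmap X U V \<xi> ?gx) \<bullet>\<^bsub>X\<^esub> ?b"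
    using twist_arrow[OF U \<xi> gc V.inv_closed[OF h] p(1) gx] tw by simp
  have b: "?b \<in> arrows X" "tgt X ?b = (V, tmap X U V \<xi> ?gx)"
    using acomp_in_arrows[of "agrp X U g x" "Arrow U ?gx \<xi> V"] agrp_in_arrows[OF U(1) gc p(1)] U \<xi> gx
    by (auto simp: in_arrows tgt_def)
  note i = agrp_in_arrows[OF U(2) V.inv_closed[OF h] p(4)]
  have t: "tgt X (Arrow U x \<xi> V) = (V, act (chart X V) (inv\<^bsub>gp X V\<^esub> ?h) (tmap X U V \<xi> ?gx))"
    unfolding e using b i by simp
  then have y: "?y = act (chart X V) (inv\<^bsub>gp X V\<^esub> ?h) (tmap X U V \<xi> ?gx)" by (simp add: tgt_def)
  note j = agrp_in_arrows[OF U(2) h p(2)]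
  have "agrp X V ?h ?y \<bullet>\<^bsub>X\<^esub> Arrow U x \<xi> V =
      (agrp X V ?h ?y \<bullet>\<^bsub>X\<^esub> agrp X V (inv\<^bsub>gp X V\<^esub> ?h) (tmap X U V \<xi> ?gx)) \<bullet>\<^bsub>X\<^esub> ?b"
    unfolding e using b i j y by (subst acomp_assoc) auto
  also have "\<dots> = aid X (tgt X ?b) \<bullet>\<^bsub>X\<^esub> ?b"
    using agrp_comp[OF U(2) h V.inv_closed[OF h] p(4), of ?y] h b by (simp add: aid_def)
  finally show ?thesis using b(1) by simp
qed

end


section \<open>Systems as functors\<close>

definition sar :: "('x, 'p, 't, 'i) system \<Rightarrow> 'i \<Rightarrow> 'i \<Rightarrow> ('x, 'p, 't) arrow \<Rightarrow> ('x, 'p, 't) arrow" where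
  "sar S \<beta> \<alpha> a = Arrow (scod S \<alpha>) (smap S \<alpha> (apt a)) (stran S \<beta> \<alpha> (alab a)) (scod S \<beta>)"

lemma sar_simps [simp]:
  "dchart (sar S \<beta> \<alpha> a) = scod S \<alpha>" "cchart (sar S \<beta> \<alpha> a) = scod S \<beta>" "apt (sar S \<beta> \<alpha> a) = smap S \<alpha> (apt a)"
  "src (sar S \<beta> \<alpha> a) = (scod S \<alpha>, smap S \<alpha> (apt a))"
  by (simp_all add: sar_def)

text \<open>
  A local system without the continuity of the maps \<open>\<rho>\<^sub>\<beta>\<^sub>\<alpha>\<close>, expressed by germs.
\<close>

definition germ_functor ::
    "('x, 'p, 'g, 't) orbispace \<Rightarrow> ('x, 'p, 'g, 't) orbispace \<Rightarrow> ('x, 'p, 't, 'i) system \<Rightarrow> bool" where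
  "germ_functor X Y S \<longleftrightarrow>
     (\<forall>\<alpha>\<in>idx S. sdom S \<alpha> \<in> basics X \<and> scod S \<alpha> \<in> basics Y \<and>
        continuous_map (hat (chart X (sdom S \<alpha>))) (hat (chart Y (scod S \<alpha>))) (smap S \<alpha>)) \<and>
     (\<forall>\<alpha>\<in>idx S. \<forall>\<beta>\<in>idx S. \<forall>a\<in>arrows X. dchart a = sdom S \<alpha> \<longrightarrow> cchart a = sdom S \<beta> \<longrightarrow>
        sar S \<beta> \<alpha> a \<in> arrows Y \<and> tgt Y (sar S \<beta> \<alpha> a) = (scod S \<beta>, smap S \<beta> (snd (tgt X a)))) \<and>
     (\<forall>\<alpha>\<in>idx S. \<forall>\<beta>\<in>idx S. \<forall>\<gamma>\<in>idx S. \<forall>a\<in>arrows X. \<forall>b\<in>arrows X.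
        dchart a = sdom S \<alpha> \<longrightarrow> cchart a = sdom S \<beta> \<longrightarrow> cchart b = sdom S \<gamma> \<longrightarrow> src b = tgt X a \<longrightarrow>
        sar S \<gamma> \<alpha> (b \<bullet>\<^bsub>X\<^esub> a) = sar S \<gamma> \<beta> b \<bullet>\<^bsub>Y\<^esub> sar S \<beta> \<alpha> a)"

text \<open>
  The homomorphism from the group of \<open>U\<^sub>\<alpha>\<close> to that of \<open>U'\<^sub>\<alpha>\<close> which \<open>\<rho>\<^sub>\<alpha>\<^sub>\<alpha>\<close> becomes when both groups are
  identified with transition maps.
\<close>

definition sgrp :: "('x, 'p, 'g, 't) orbispace \<Rightarrow> ('x, 'p, 'g, 't) orbispace \<Rightarrow>
    ('x, 'p, 't, 'i) system \<Rightarrow> 'i \<Rightarrow> 'g \<Rightarrow> 'g" where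
  "sgrp X Y S \<alpha> g = inv_into (carrier (gp Y (scod S \<alpha>))) (gtran Y (scod S \<alpha>))
     (stran S \<alpha> \<alpha> (gtran X (sdom S \<alpha>) g))"

locale orbi_pair = X: orbi X + Y: orbi Y for X Y :: "('x, 'p, 'g, 't) orbispace"
begin

lemma gf_charts:
  assumes "germ_functor X Y S" "\<alpha> \<in> idx S"
  shows "sdom S \<alpha> \<in> basics X" "scod S \<alpha> \<in> basics Y"
    "continuous_map (hat (chart X (sdom S \<alpha>))) (hat (chart Y (scod S \<alpha>))) (smap S \<alpha>)"
    "x \<in> pts X (sdom S \<alpha>) \<Longrightarrow> smap S \<alpha> x \<in> pts Y (scod S \<alpha>)"
proof -
  show c: "sdom S \<alpha> \<in> basics X" "scod S \<alpha> \<in> basics Y"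
    "continuous_map (hat (chart X (sdom S \<alpha>))) (hat (chart Y (scod S \<alpha>))) (smap S \<alpha>)"
    using assms unfolding germ_functor_def by simp_all
  show "x \<in> pts X (sdom S \<alpha>) \<Longrightarrow> smap S \<alpha> x \<in> pts Y (scod S \<alpha>)"
    using continuous_map_funspace[OF c(3)] by auto
qed

lemma gf_sar:
  assumes "germ_functor X Y S" "\<alpha> \<in> idx S" "\<beta> \<in> idx S" "a \<in> arrows X" "dchart a = sdom S \<alpha>" "cchart a = sdom S \<beta>"
  shows "sar S \<beta> \<alpha> a \<in> arrows Y" "tgt Y (sar S \<beta> \<alpha> a) = (scod S \<beta>, smap S \<beta> (snd (tgt X a)))"
proof -
  note * = assms(1)[unfolded germ_functor_def, THEN conjunct2, THEN conjunct1, THEN bspec, OF assms(2),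
      THEN bspec, OF assms(3), THEN bspec, OF assms(4), THEN mp, OF assms(5), THEN mp, OF assms(6)]
  show "sar S \<beta> \<alpha> a \<in> arrows Y" using * by (rule conjunct1)
  show "tgt Y (sar S \<beta> \<alpha> a) = (scod S \<beta>, smap S \<beta> (snd (tgt X a)))" using * by (rule conjunct2)
qed

lemma gf_comp:
  assumes "germ_functor X Y S" "\<alpha> \<in> idx S" "\<beta> \<in> idx S" "\<gamma> \<in> idx S" "a \<in> arrows X" "b \<in> arrows X"
    "dchart a = sdom S \<alpha>" "cchart a = sdom S \<beta>" "cchart b = sdom S \<gamma>" "src b = tgt X a"
  shows "sar S \<gamma> \<alpha> (b \<bullet>\<^bsub>X\<^esub> a) = sar S \<gamma> \<beta> b \<bullet>\<^bsub>Y\<^esub> sar S \<beta> \<alpha> a"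
  by (rule assms(1)[unfolded germ_functor_def, THEN conjunct2, THEN conjunct2, rule_format, OF assms(2-10)])

lemma gf_id:
  assumes S: "germ_functor X Y S" "\<alpha> \<in> idx S" and x: "x \<in> pts X (sdom S \<alpha>)"
  shows "sar S \<alpha> \<alpha> (aid X (sdom S \<alpha>, x)) = aid Y (scod S \<alpha>, smap S \<alpha> x)"
proof -
  let ?U = "sdom S \<alpha>" and ?e = "aid X (sdom S \<alpha>, x)"
  note U = gf_charts[OF S]
  note e = X.agrp_in_arrows[OF U(1) group.is_monoid[THEN monoid.one_closed, OF X.grp_chart[OF U(1)]] x]
  have e': "?e \<in> arrows X" "tgt X ?e = (?U, x)" "src ?e = (?U, x)"
    using e g_struct.act_one[OF X.chart_gs[OF U(1)] x] by (auto simp: aid_def)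
  note s = gf_sar[OF S S(2) e'(1)]
  have ee: "?e \<bullet>\<^bsub>X\<^esub> ?e = ?e" using X.cmp_idn_src[OF e'(1)] e' by simp
  have "sar S \<alpha> \<alpha> (?e \<bullet>\<^bsub>X\<^esub> ?e) = sar S \<alpha> \<alpha> ?e \<bullet>\<^bsub>Y\<^esub> sar S \<alpha> \<alpha> ?e"
    using gf_comp[OF S S(2) S(2) e'(1) e'(1)] e' by simp
  from Y.idempotent_idn[of "sar S \<alpha> \<alpha> ?e"] this s e' ee show ?thesis by simp
qed

lemma gf_agrp:
  assumes S: "germ_functor X Y S" "\<alpha> \<in> idx S" and g: "g \<in> carrier (gp X (sdom S \<alpha>))"
  shows "sgrp X Y S \<alpha> g \<in> carrier (gp Y (scod S \<alpha>))"
    "stran S \<alpha> \<alpha> (gtran X (sdom S \<alpha>) g) = gtran Y (scod S \<alpha>) (sgrp X Y S \<alpha> g)"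
    "sar S \<alpha> \<alpha> (agrp X (sdom S \<alpha>) g x) = agrp Y (scod S \<alpha>) (sgrp X Y S \<alpha> g) (smap S \<alpha> x)"
    "x \<in> pts X (sdom S \<alpha>) \<Longrightarrow>
      smap S \<alpha> (act (chart X (sdom S \<alpha>)) g x) = act (chart Y (scod S \<alpha>)) (sgrp X Y S \<alpha> g) (smap S \<alpha> x)"
proof -
  let ?U = "sdom S \<alpha>" and ?V = "scod S \<alpha>"
  note U = gf_charts[OF S]
  obtain z where z: "z \<in> pts X ?U" using X.pts_nonempty[OF U(1)] by blast
  note e = X.agrp_in_arrows[OF U(1) g]
  note s = gf_sar[OF S S(2) e(1), simplified]
  have "stran S \<alpha> \<alpha> (gtran X ?U g) \<in> Tran Y ?V ?V" using s(1)[OF z] by (simp add: in_arrows sar_def)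
  then have i: "stran S \<alpha> \<alpha> (gtran X ?U g) \<in> gtran Y ?V ` carrier (gp Y ?V)"
    using Y.gtran_bij[OF U(2)] by (simp add: bij_betw_def)
  show c: "sgrp X Y S \<alpha> g \<in> carrier (gp Y ?V)" unfolding sgrp_def by (rule inv_into_into[OF i])
  show l: "stran S \<alpha> \<alpha> (gtran X ?U g) = gtran Y ?V (sgrp X Y S \<alpha> g)"
    unfolding sgrp_def by (rule f_inv_into_f[OF i, symmetric])
  then show r: "sar S \<alpha> \<alpha> (agrp X ?U g x) = agrp Y ?V (sgrp X Y S \<alpha> g) (smap S \<alpha> x)" for x
    by (simp add: sar_def) (simp add: agrp_def)
  show "smap S \<alpha> (act (chart X ?U) g x) = act (chart Y ?V) (sgrp X Y S \<alpha> g) (smap S \<alpha> x)" if "x \<in> pts X ?U"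
    using s(2)[OF that] r e(2)[OF that] Y.agrp_in_arrows[OF U(2) c U(4)[OF that]] by simp
qed

lemma gf_sgrp_hom:
  assumes S: "germ_functor X Y S" "\<alpha> \<in> idx S"
  shows "sgrp X Y S \<alpha> \<in> hom (gp X (sdom S \<alpha>)) (gp Y (scod S \<alpha>))"
proof (rule homI)
  let ?U = "sdom S \<alpha>" and ?V = "scod S \<alpha>" and ?s = "sgrp X Y S \<alpha>"
  note U = gf_charts[OF S]
  note a = gf_agrp[OF S]
  show "?s g \<in> carrier (gp Y ?V)" if "g \<in> carrier (gp X ?U)" for g using a(1)[OF that] .
  fix g h assume gh: "g \<in> carrier (gp X ?U)" "h \<in> carrier (gp X ?U)"
  interpret U: g_struct "subtopology X.T ?U" "chart X ?U" by (rule X.chart_gs[OF U(1)])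
  interpret UG: group "gp X ?U" by (rule U.group_grp)
  interpret VG: group "gp Y ?V" by (rule Y.grp_chart[OF U(2)])
  obtain z where z: "z \<in> pts X ?U" using X.pts_nonempty[OF U(1)] by blast
  have "agrp Y ?V (?s (g \<otimes>\<^bsub>gp X ?U\<^esub> h)) (smap S \<alpha> z) = sar S \<alpha> \<alpha> (agrp X ?U g (act (chart X ?U) h z) \<bullet>\<^bsub>X\<^esub> agrp X ?U h z)"
    using gh z a by (simp add: X.agrp_comp[OF U(1)])
  also have "\<dots> = sar S \<alpha> \<alpha> (agrp X ?U g (act (chart X ?U) h z)) \<bullet>\<^bsub>Y\<^esub> sar S \<alpha> \<alpha> (agrp X ?U h z)"
    by (rule gf_comp[OF S S(2) S(2)]) (use gh z X.agrp_in_arrows[OF U(1)] in auto)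
  also have "\<dots> = agrp Y ?V (?s g \<otimes>\<^bsub>gp Y ?V\<^esub> ?s h) (smap S \<alpha> z)"
    using gh a U(4)[OF z] by (simp add: Y.agrp_comp[OF U(2)])
  finally show "?s (g \<otimes>\<^bsub>gp X ?U\<^esub> h) = ?s g \<otimes>\<^bsub>gp Y ?V\<^esub> ?s h"
    using Y.gtran_inj[OF U(2)] a(1) gh by (simp add: agrp_def)
qed

text \<open>
  Hence \<open>\<rho>\<^sub>\<beta>\<^sub>\<alpha>\<close> is covered, on the part of \<open>Tran U\<^sub>\<alpha> U\<^sub>\<beta>\<close> over one component, by the product of the two group
  homomorphisms.
\<close>

lemma gf_twist:
  assumes S: "germ_functor X Y S" "\<alpha> \<in> idx S" "\<beta> \<in> idx S" and \<xi>: "\<xi> \<in> Tran X (sdom S \<alpha>) (sdom S \<beta>)"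
    and g: "g \<in> carrier (gp X (sdom S \<alpha>))" and h: "h \<in> carrier (gp X (sdom S \<beta>))"
  shows "stran S \<beta> \<alpha> (twist X (sdom S \<alpha>) (sdom S \<beta>) (inv\<^bsub>gp X (sdom S \<beta>)\<^esub> h) \<xi> g) =
    twist Y (scod S \<alpha>) (scod S \<beta>) (inv\<^bsub>gp Y (scod S \<beta>)\<^esub> (sgrp X Y S \<beta> h)) (stran S \<beta> \<alpha> \<xi>) (sgrp X Y S \<alpha> g)"
proof -
  let ?U = "sdom S \<alpha>" and ?V = "sdom S \<beta>" and ?h = "inv\<^bsub>gp X (sdom S \<beta>)\<^esub> h"
  note U = gf_charts[OF S(1,2)] and V = gf_charts[OF S(1,3)]
  interpret U: g_struct "subtopology X.T ?U" "chart X ?U" by (rule X.chart_gs[OF U(1)])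
  interpret UG: group "gp X ?U" by (rule U.group_grp)
  interpret VG: group "gp X ?V" by (rule X.grp_chart[OF V(1)])
  interpret VG': group "gp Y (scod S \<beta>)" by (rule Y.grp_chart[OF V(2)])
  interpret hm: group_hom "gp X ?V" "gp Y (scod S \<beta>)" "sgrp X Y S \<beta>"
    by unfold_locales (rule gf_sgrp_hom[OF S(1,3)])
  have h': "?h \<in> carrier (gp X ?V)" using h by simp
  obtain y where y: "y \<in> tdom X ?U ?V \<xi>" using X.tdom_props(3)[OF U(1) V(1) \<xi>] by blast
  \<comment> \<open>A point in the domain of the twist, where it is a composite of germs.\<close>
  define x where "x = act (chart X ?U) (inv\<^bsub>gp X ?U\<^esub> g) y"
  note yp = X.tmap_in_pts[OF U(1) V(1) \<xi> y]
  have x: "x \<in> pts X ?U" "act (chart X ?U) g x = y" using yp g by (auto simp: x_def)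
  let ?a = "agrp X ?U g x" and ?b = "Arrow ?U y \<xi> ?V" and ?c = "agrp X ?V ?h (tmap X ?U ?V \<xi> y)"
  note a = X.agrp_in_arrows[OF U(1) g x(1)] and c = X.agrp_in_arrows[OF V(1) h' yp(2)]
  have b: "?b \<in> arrows X" "tgt X ?b = (?V, tmap X ?U ?V \<xi> y)" using U V \<xi> y by (auto simp: in_arrows tgt_def)
  note ba = X.acomp_in_arrows[OF a(1) b(1)]
  note sb = gf_sar[OF S b(1), simplified]
  have t: "stran S \<beta> \<alpha> \<xi> \<in> Tran Y (scod S \<alpha>) (scod S \<beta>)"
    "smap S \<alpha> y \<in> tdom Y (scod S \<alpha>) (scod S \<beta>) (stran S \<beta> \<alpha> \<xi>)"
    "tmap Y (scod S \<alpha>) (scod S \<beta>) (stran S \<beta> \<alpha> \<xi>) (smap S \<alpha> y) = smap S \<beta> (tmap X ?U ?V \<xi> y)"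
    using sb b by (auto simp: in_arrows sar_def tgt_def)
  have gy: "act (chart Y (scod S \<alpha>)) (sgrp X Y S \<alpha> g) (smap S \<alpha> x) = smap S \<alpha> y"
    using gf_agrp(4)[OF S(1,2) g x(1)] x(2) by simp
  have "sar S \<beta> \<alpha> (Arrow ?U x (twist X ?U ?V ?h \<xi> g) ?V) = sar S \<beta> \<alpha> (?c \<bullet>\<^bsub>X\<^esub> (?b \<bullet>\<^bsub>X\<^esub> ?a))"
    using X.twist_arrow[OF U(1) V(1) \<xi> g h' x(1)] y x by simp
  also have "\<dots> = sar S \<beta> \<beta> ?c \<bullet>\<^bsub>Y\<^esub> sar S \<beta> \<alpha> (?b \<bullet>\<^bsub>X\<^esub> ?a)"
    by (rule gf_comp[OF S S(3)]) (use a b c ba x in auto)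
  also have "sar S \<beta> \<alpha> (?b \<bullet>\<^bsub>X\<^esub> ?a) = sar S \<beta> \<alpha> ?b \<bullet>\<^bsub>Y\<^esub> sar S \<alpha> \<alpha> ?a"
    by (rule gf_comp[OF S(1,2,2,3)]) (use a b x in auto)
  also have "sar S \<beta> \<beta> ?c \<bullet>\<^bsub>Y\<^esub> (sar S \<beta> \<alpha> ?b \<bullet>\<^bsub>Y\<^esub> sar S \<alpha> \<alpha> ?a) =
    Arrow (scod S \<alpha>) (smap S \<alpha> x) (twist Y (scod S \<alpha>) (scod S \<beta>) (sgrp X Y S \<beta> ?h) (stran S \<beta> \<alpha> \<xi>) (sgrp X Y S \<alpha> g)) (scod S \<beta>)"
    unfolding gf_agrp(3)[OF S(1,2) g] gf_agrp(3)[OF S(1,3) h']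
    using Y.twist_arrow[OF U(2) V(2) t(1) gf_agrp(1)[OF S(1,2) g] gf_agrp(1)[OF S(1,3) h'] U(4)[OF x(1)]] t gy
    by (simp add: sar_def)
  finally show ?thesis using h by (simp add: sar_def)
qed

lemma local_system_gf:
  assumes S: "local_system X Y S"
  shows "germ_functor X Y S"
proof -
  have c: "sdom S \<alpha> \<in> basics X" "scod S \<alpha> \<in> basics Y"
    "continuous_map (hat (chart X (sdom S \<alpha>))) (hat (chart Y (scod S \<alpha>))) (smap S \<alpha>)" if "\<alpha> \<in> idx S" for \<alpha>
    using S[unfolded local_system_def, THEN conjunct1, rule_format, OF that] by auto
  have st: "stran S \<beta> \<alpha> i \<in> Tran Y (scod S \<alpha>) (scod S \<beta>)"
    if "\<alpha> \<in> idx S" "\<beta> \<in> idx S" "i \<in> Tran X (sdom S \<alpha>) (sdom S \<beta>)" for \<alpha> \<beta> i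
  proof -
    have "continuous_map (tran_top X (sdom S \<alpha>) (sdom S \<beta>)) (tran_top Y (scod S \<alpha>) (scod S \<beta>)) (stran S \<beta> \<alpha>)"
      using S[unfolded local_system_def, THEN conjunct2, THEN conjunct1, rule_format, OF that(1,2)] by blast
    from continuous_map_funspace[OF this] show ?thesis
      using that c by (auto simp: X.topspace_tran_top Y.topspace_tran_top)
  qed
  have m: "smap S \<alpha> x \<in> tdom Y (scod S \<alpha>) (scod S \<beta>) (stran S \<beta> \<alpha> i)"
    "tmap Y (scod S \<alpha>) (scod S \<beta>) (stran S \<beta> \<alpha> i) (smap S \<alpha> x) = smap S \<beta> (tmap X (sdom S \<alpha>) (sdom S \<beta>) i x)"
    if "\<alpha> \<in> idx S" "\<beta> \<in> idx S" "i \<in> Tran X (sdom S \<alpha>) (sdom S \<beta>)" "x \<in> tdom X (sdom S \<alpha>) (sdom S \<beta>) i" for \<alpha> \<beta> i x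
    using S[unfolded local_system_def, THEN conjunct2, THEN conjunct1, rule_format, OF that(1,2), THEN conjunct2,
        rule_format, OF that(3,4)] by auto
  have cmp: "stran S \<gamma> \<alpha> (tcomp X (sdom S \<alpha>) (sdom S \<beta>) (sdom S \<gamma>) j i x) =
          tcomp Y (scod S \<alpha>) (scod S \<beta>) (scod S \<gamma>) (stran S \<gamma> \<beta> j) (stran S \<beta> \<alpha> i) (smap S \<alpha> x)"
    if "\<alpha> \<in> idx S" "\<beta> \<in> idx S" "\<gamma> \<in> idx S" "i \<in> Tran X (sdom S \<alpha>) (sdom S \<beta>)" "j \<in> Tran X (sdom S \<beta>) (sdom S \<gamma>)"
      "x \<in> overlap X (sdom S \<alpha>) (sdom S \<beta>) (sdom S \<gamma>) j i" for \<alpha> \<beta> \<gamma> i j x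
    by (rule S[unfolded local_system_def, THEN conjunct2, THEN conjunct2, rule_format, OF that])
  show ?thesis
    unfolding germ_functor_def
  proof (intro conjI ballI impI)
    fix \<alpha> \<beta> \<gamma> a b
    assume "\<alpha> \<in> idx S" "\<beta> \<in> idx S" "\<gamma> \<in> idx S" "a \<in> arrows X" "b \<in> arrows X"
        "dchart a = sdom S \<alpha>" "cchart a = sdom S \<beta>" "cchart b = sdom S \<gamma>" "src b = tgt X a"
    then show "sar S \<gamma> \<alpha> (b \<bullet>\<^bsub>X\<^esub> a) = sar S \<gamma> \<beta> b \<bullet>\<^bsub>Y\<^esub> sar S \<beta> \<alpha> a"
      using cmp[of \<alpha> \<beta> \<gamma> "alab a" "alab b" "apt a"]
      by (auto simp: sar_def acomp_def in_arrows src_eq_tgt overlap_def)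
  qed (use c st m in \<open>auto simp: in_arrows sar_def tgt_def\<close>)
qed

lemma local_system_sgrp_continuous:
  assumes S: "local_system X Y S" and \<alpha>: "\<alpha> \<in> idx S"
  shows "continuous_map (grp_top (chart X (sdom S \<alpha>))) (grp_top (chart Y (scod S \<alpha>))) (sgrp X Y S \<alpha>)"
  unfolding continuous_map
proof (intro conjI allI impI)
  note F = local_system_gf[OF S]
  note U = gf_charts[OF F \<alpha>]
  interpret U: g_struct "subtopology X.T (sdom S \<alpha>)" "chart X (sdom S \<alpha>)" by (rule X.chart_gs[OF U(1)])
  interpret V: g_struct "subtopology Y.T (scod S \<alpha>)" "chart Y (scod S \<alpha>)" by (rule Y.chart_gs[OF U(2)])
  show "sgrp X Y S \<alpha> ` topspace (grp_top (chart X (sdom S \<alpha>))) \<subseteq> topspace (grp_top (chart Y (scod S \<alpha>)))"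
    using gf_agrp(1)[OF F \<alpha>] by (auto simp: U.topspace_grp_top V.topspace_grp_top)
  fix O' assume O': "openin (grp_top (chart Y (scod S \<alpha>))) O'"
  then have sub: "O' \<subseteq> carrier (gp Y (scod S \<alpha>))" using openin_subset V.topspace_grp_top by metis
  have "continuous_map (tran_top X (sdom S \<alpha>) (sdom S \<alpha>)) (tran_top Y (scod S \<alpha>) (scod S \<alpha>)) (stran S \<alpha> \<alpha>)"
    using S[unfolded local_system_def, THEN conjunct2, THEN conjunct1, rule_format, OF \<alpha> \<alpha>] by blast
  from openin_continuous_map_preimage[OF continuous_map_compose[OF X.gtran_continuous[OF U(1)] this]
    Y.gtran_open[OF U(2) O']]
  show "openin (grp_top (chart X (sdom S \<alpha>))) {x \<in> topspace (grp_top (chart X (sdom S \<alpha>))). sgrp X Y S \<alpha> x \<in> O'}"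
  proof (rule back_subst[of "openin _"])
    have "gtran Y (scod S \<alpha>) (sgrp X Y S \<alpha> g) \<in> gtran Y (scod S \<alpha>) ` O' \<longleftrightarrow> sgrp X Y S \<alpha> g \<in> O'"
      if "g \<in> carrier (gp X (sdom S \<alpha>))" for g
      using Y.gtran_inj[OF U(2) gf_agrp(1)[OF F \<alpha> that]] sub by (auto simp: image_iff subset_iff)
    then show "{x \<in> topspace (grp_top (chart X (sdom S \<alpha>))). (stran S \<alpha> \<alpha> \<circ> gtran X (sdom S \<alpha>)) x \<in> gtran Y (scod S \<alpha>) ` O'} =
      {x \<in> topspace (grp_top (chart X (sdom S \<alpha>))). sgrp X Y S \<alpha> x \<in> O'}"
      by (simp add: U.topspace_grp_top gf_agrp(2)[OF F \<alpha>] cong: conj_cong)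
  qed
qed

text \<open>
  As the topology of \<open>Tran U\<^sub>\<alpha> U\<^sub>\<beta>\<close> is a quotient of that of the product of the groups, continuity of the
  homomorphisms \<open>sgrp\<close> suffices for the continuity of all \<open>\<rho>\<^sub>\<beta>\<^sub>\<alpha>\<close>.
\<close>

lemma local_systemI:
  assumes F: "germ_functor X Y S"
    and c: "\<And>\<alpha>. \<alpha> \<in> idx S \<Longrightarrow>
      continuous_map (grp_top (chart X (sdom S \<alpha>))) (grp_top (chart Y (scod S \<alpha>))) (sgrp X Y S \<alpha>)"
  shows "local_system X Y S"
proof -
  have A: "Arrow (sdom S \<alpha>) x \<xi> (sdom S \<beta>) \<in> arrows X"
    if "\<alpha> \<in> idx S" "\<beta> \<in> idx S" "\<xi> \<in> Tran X (sdom S \<alpha>) (sdom S \<beta>)" "x \<in> tdom X (sdom S \<alpha>) (sdom S \<beta>) \<xi>" for \<alpha> \<beta> \<xi> x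
    using that gf_charts[OF F] by (simp add: in_arrows)
  have st: "stran S \<beta> \<alpha> \<xi> \<in> Tran Y (scod S \<alpha>) (scod S \<beta>)"
    if a: "\<alpha> \<in> idx S" "\<beta> \<in> idx S" "\<xi> \<in> Tran X (sdom S \<alpha>) (sdom S \<beta>)" for \<alpha> \<beta> \<xi>
  proof -
    obtain x where "x \<in> tdom X (sdom S \<alpha>) (sdom S \<beta>) \<xi>"
      using X.tdom_props(3)[OF gf_charts(1)[OF F a(1)] gf_charts(1)[OF F a(2)] a(3)] by blast
    from gf_sar(1)[OF F a(1,2) A[OF a this]] show ?thesis by (simp add: in_arrows sar_def)
  qed
  show ?thesis
    unfolding local_system_def
  proof (intro conjI ballI)
    fix \<alpha> \<beta> assume ab: "\<alpha> \<in> idx S" "\<beta> \<in> idx S"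
    note U = gf_charts[OF F ab(1)] and V = gf_charts[OF F ab(2)]
    interpret U: g_struct "subtopology X.T (sdom S \<alpha>)" "chart X (sdom S \<alpha>)" by (rule X.chart_gs[OF U(1)])
    interpret V: g_struct "subtopology X.T (sdom S \<beta>)" "chart X (sdom S \<beta>)" by (rule X.chart_gs[OF V(1)])
    let ?TX = "prod_topology (grp_top (chart X (sdom S \<alpha>))) (grp_top (chart X (sdom S \<beta>)))"
      and ?TY = "prod_topology (grp_top (chart Y (scod S \<alpha>))) (grp_top (chart Y (scod S \<beta>)))"
    show "continuous_map (tran_top X (sdom S \<alpha>) (sdom S \<beta>)) (tran_top Y (scod S \<alpha>) (scod S \<beta>)) (stran S \<beta> \<alpha>)"
      unfolding continuous_map
    proof (intro conjI allI impI)
      show "stran S \<beta> \<alpha> ` topspace (tran_top X (sdom S \<alpha>) (sdom S \<beta>)) \<subseteq> topspace (tran_top Y (scod S \<alpha>) (scod S \<beta>))"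
        using st[OF ab] U V by (auto simp: X.topspace_tran_top Y.topspace_tran_top)
      fix O' assume O': "openin (tran_top Y (scod S \<alpha>) (scod S \<beta>)) O'"
      let ?P = "{\<xi> \<in> Tran X (sdom S \<alpha>) (sdom S \<beta>). stran S \<beta> \<alpha> \<xi> \<in> O'}"
      have "openin (tran_top X (sdom S \<alpha>) (sdom S \<beta>)) ?P"
        unfolding openin_tran_top
      proof (intro conjI ballI)
        fix \<xi> assume \<xi>: "\<xi> \<in> Tran X (sdom S \<alpha>) (sdom S \<beta>)"
        let ?Q = "{(g, h). g \<in> carrier (gp Y (scod S \<alpha>)) \<and> h \<in> carrier (gp Y (scod S \<beta>)) \<and>
          twist Y (scod S \<alpha>) (scod S \<beta>) (inv\<^bsub>gp Y (scod S \<beta>)\<^esub> h) (stran S \<beta> \<alpha> \<xi>) g \<in> O'}"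
        have Q: "openin ?TY ?Q" using O' st[OF ab \<xi>] unfolding openin_tran_top by blast
        have "continuous_map ?TX ?TY (\<lambda>p. (sgrp X Y S \<alpha> (fst p), sgrp X Y S \<beta> (snd p)))"
          unfolding continuous_map_paired
          by (intro conjI continuous_map_compose[OF continuous_map_fst c[OF ab(1)], unfolded comp_def]
              continuous_map_compose[OF continuous_map_snd c[OF ab(2)], unfolded comp_def])
        from openin_continuous_map_preimage[OF this Q]
        show "openin ?TX {(g, h). g \<in> carrier (gp X (sdom S \<alpha>)) \<and> h \<in> carrier (gp X (sdom S \<beta>)) \<and>
            twist X (sdom S \<alpha>) (sdom S \<beta>) (inv\<^bsub>gp X (sdom S \<beta>)\<^esub> h) \<xi> g \<in> ?P}"
          by (rule back_subst[of "openin _"])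
            (rule Set.set_eqI, use X.twist_Tran[OF U(1) V(1) \<xi>] gf_twist[OF F ab \<xi>] gf_agrp(1)[OF F ab(1)] gf_agrp(1)[OF F ab(2)]
              in \<open>simp add: U.topspace_grp_top V.topspace_grp_top split_beta mem_Times_iff cong: conj_cong\<close>)
      qed blast
      then show "openin (tran_top X (sdom S \<alpha>) (sdom S \<beta>))
          {x \<in> topspace (tran_top X (sdom S \<alpha>) (sdom S \<beta>)). stran S \<beta> \<alpha> x \<in> O'}"
        by (simp add: X.topspace_tran_top U V)
    qed
    fix i x assume i: "i \<in> Tran X (sdom S \<alpha>) (sdom S \<beta>)" "x \<in> tdom X (sdom S \<alpha>) (sdom S \<beta>) i"
    show "smap S \<alpha> x \<in> tdom Y (scod S \<alpha>) (scod S \<beta>) (stran S \<beta> \<alpha> i)"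
      "smap S \<beta> (tmap X (sdom S \<alpha>) (sdom S \<beta>) i x) = tmap Y (scod S \<alpha>) (scod S \<beta>) (stran S \<beta> \<alpha> i) (smap S \<alpha> x)"
      using gf_sar[OF F ab A[OF ab i]] by (auto simp: in_arrows sar_def tgt_def)
  next
    fix \<alpha> \<beta> \<gamma> i j x
    assume a: "\<alpha> \<in> idx S" "\<beta> \<in> idx S" "\<gamma> \<in> idx S" "i \<in> Tran X (sdom S \<alpha>) (sdom S \<beta>)" "j \<in> Tran X (sdom S \<beta>) (sdom S \<gamma>)"
      "x \<in> overlap X (sdom S \<alpha>) (sdom S \<beta>) (sdom S \<gamma>) j i"
    then show "stran S \<gamma> \<alpha> (tcomp X (sdom S \<alpha>) (sdom S \<beta>) (sdom S \<gamma>) j i x) =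
          tcomp Y (scod S \<alpha>) (scod S \<beta>) (scod S \<gamma>) (stran S \<gamma> \<beta> j) (stran S \<beta> \<alpha> i) (smap S \<alpha> x)"
      using gf_comp[OF F a(1-3) A[OF a(1,2,4)] A[OF a(2,3,5)], of x "tmap X (sdom S \<alpha>) (sdom S \<beta>) i x"]
      by (auto simp: overlap_def sar_def acomp_def tgt_def)
  qed (use gf_charts[OF F] in auto)
qed

lemma sgrp_eqI:
  assumes "scod S \<alpha> \<in> basics Y" "g' \<in> carrier (gp Y (scod S \<alpha>))"
    "stran S \<alpha> \<alpha> (gtran X (sdom S \<alpha>) g) = gtran Y (scod S \<alpha>) g'"
  shows "sgrp X Y S \<alpha> g = g'"
  unfolding sgrp_def assms(3) using Y.gtran_bij[OF assms(1)] assms(2) by (simp add: bij_betw_def)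

end


section \<open>Extending a functor along bridges\<close>

lemma (in orbi_pair) csec_sar:
  assumes T: "germ_functor X Y T" "\<alpha> \<in> idx T" "\<beta> \<in> idx T" and A: "X.csec S A" and ne: "topspace S \<noteq> {}"
    and ch: "\<And>t. t \<in> topspace S \<Longrightarrow> dchart (A t) = sdom T \<alpha> \<and> cchart (A t) = sdom T \<beta>"
  shows "Y.csec S (\<lambda>t. sar T \<beta> \<alpha> (A t))"
proof -
  obtain U V \<xi> p where a: "U \<in> basics X" "V \<in> basics X" "\<xi> \<in> Tran X U V" "continuous_map S (hat (chart X U)) p"
    "\<And>t. t \<in> topspace S \<Longrightarrow> p t \<in> tdom X U V \<xi>" "\<And>t. t \<in> topspace S \<Longrightarrow> A t = Arrow U (p t) \<xi> V"
    using A unfolding X.csec_def by blast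
  obtain t0 where t0: "t0 \<in> topspace S" using ne by blast
  have UV: "U = sdom T \<alpha>" "V = sdom T \<beta>" using ch[OF t0] a(6)[OF t0] by auto
  note ca = gf_charts[OF T(1,2)] and cb = gf_charts[OF T(1,3)]
  have ar: "sar T \<beta> \<alpha> (A t) \<in> arrows Y" if "t \<in> topspace S" for t
    using gf_sar(1)[OF T X.csec_in_arrows[OF A that]] ch[OF that] by simp
  show ?thesis
  proof (rule Y.csecI[OF ca(2) cb(2)])
    show "stran T \<beta> \<alpha> \<xi> \<in> Tran Y (scod T \<alpha>) (scod T \<beta>)"
      using ar[OF t0] a(6)[OF t0] by (simp add: sar_def in_arrows)
    show "continuous_map S (hat (chart Y (scod T \<alpha>))) (\<lambda>t. smap T \<alpha> (p t))"
      using continuous_map_compose[OF a(4)[unfolded UV] ca(3)] by (simp add: comp_def)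
    show "smap T \<alpha> (p t) \<in> tdom Y (scod T \<alpha>) (scod T \<beta>) (stran T \<beta> \<alpha> \<xi>)" if "t \<in> topspace S" for t
      using ar[OF that] a(6)[OF that] by (simp add: sar_def in_arrows)
    show "sar T \<beta> \<alpha> (A t) = Arrow (scod T \<alpha>) (smap T \<alpha> (p t)) (stran T \<beta> \<alpha> \<xi>) (scod T \<beta>)" if "t \<in> topspace S" for t
      using a(6)[OF that] by (simp add: sar_def)
  qed
qed

text \<open>
  The functor \<open>S\<close>, the hub, is to be extended by charts \<open>U i\<close> with maps \<open>f i\<close> into charts \<open>V i\<close>. The data are
  the values of the desired functor on the germs from \<open>U i\<close> to the charts of \<open>S\<close>: \<open>N i \<beta>\<close> is its effect on
  transition maps and \<open>n i \<beta>\<close> that on germs, while \<open>s i\<close> is the homomorphism on the group of \<open>U i\<close>. The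
  values on germs between two of the new charts are determined by these.
\<close>

locale bridges = orbi_pair X Y for X Y :: "('x, 'p, 'g, 't) orbispace" +
  fixes S :: "('x, 'p, 't, 'j) system" and I :: "'i set" and U V :: "'i \<Rightarrow> 'x set"
    and f :: "'i \<Rightarrow> 'p \<Rightarrow> 'p" and N :: "'i \<Rightarrow> 'j \<Rightarrow> 't \<Rightarrow> 't" and s :: "'i \<Rightarrow> 'g \<Rightarrow> 'g"
    and n :: "'i \<Rightarrow> 'j \<Rightarrow> ('x, 'p, 't) arrow \<Rightarrow> ('x, 'p, 't) arrow"
  assumes S: "germ_functor X Y S"
    and cover: "i \<in> I \<Longrightarrow> U i \<subseteq> (\<Union>\<beta>\<in>idx S. sdom S \<beta>)"
    and U: "i \<in> I \<Longrightarrow> U i \<in> basics X" and V: "i \<in> I \<Longrightarrow> V i \<in> basics Y"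
    and f: "i \<in> I \<Longrightarrow> continuous_map (hat (chart X (U i))) (hat (chart Y (V i))) (f i)"
    and n_def: "n i \<beta> a = Arrow (V i) (f i (apt a)) (N i \<beta> (alab a)) (scod S \<beta>)"
    and n_arrow: "\<lbrakk>i \<in> I; \<beta> \<in> idx S; a \<in> arrows X; dchart a = U i; cchart a = sdom S \<beta>\<rbrakk> \<Longrightarrow> n i \<beta> a \<in> arrows Y"
    and n_tgt: "\<lbrakk>i \<in> I; \<beta> \<in> idx S; a \<in> arrows X; dchart a = U i; cchart a = sdom S \<beta>\<rbrakk> \<Longrightarrow>
        tgt Y (n i \<beta> a) = (scod S \<beta>, smap S \<beta> (snd (tgt X a)))"
    and n_comp: "\<lbrakk>i \<in> I; \<beta> \<in> idx S; \<gamma> \<in> idx S; a \<in> arrows X; dchart a = U i; cchart a = sdom S \<beta>;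
        b \<in> arrows X; cchart b = sdom S \<gamma>; src b = tgt X a\<rbrakk> \<Longrightarrow> n i \<gamma> (b \<bullet>\<^bsub>X\<^esub> a) = sar S \<gamma> \<beta> b \<bullet>\<^bsub>Y\<^esub> n i \<beta> a"
    and s_continuous: "i \<in> I \<Longrightarrow> continuous_map (grp_top (chart X (U i))) (grp_top (chart Y (V i))) (s i)"
    and f_act: "\<lbrakk>i \<in> I; g \<in> carrier (gp X (U i)); x \<in> pts X (U i)\<rbrakk> \<Longrightarrow>
        f i (act (chart X (U i)) g x) = act (chart Y (V i)) (s i g) (f i x)"
    and n_act: "\<lbrakk>i \<in> I; g \<in> carrier (gp X (U i)); x \<in> pts X (U i); \<beta> \<in> idx S; a \<in> arrows X;
        src a = (U i, act (chart X (U i)) g x); cchart a = sdom S \<beta>\<rbrakk> \<Longrightarrow>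
        n i \<beta> (a \<bullet>\<^bsub>X\<^esub> agrp X (U i) g x) = n i \<beta> a \<bullet>\<^bsub>Y\<^esub> agrp Y (V i) (s i g) (f i x)"
begin

lemma n_simps [simp]:
  "dchart (n i \<beta> a) = V i" "cchart (n i \<beta> a) = scod S \<beta>" "apt (n i \<beta> a) = f i (apt a)"
  "src (n i \<beta> a) = (V i, f i (apt a))"
  by (simp_all add: n_def)

definition via_hub :: "'i \<Rightarrow> 'i \<Rightarrow> 'j \<Rightarrow> 'j \<Rightarrow> ('x, 'p, 't) arrow \<Rightarrow> ('x, 'p, 't) arrow \<Rightarrow> ('x, 'p, 't) arrow \<Rightarrow> ('x, 'p, 't) arrow" where
  "via_hub j i \<gamma> \<beta> e' a e = ainv Y (n j \<gamma> e') \<bullet>\<^bsub>Y\<^esub> (sar S \<gamma> \<beta> (e' \<bullet>\<^bsub>X\<^esub> (a \<bullet>\<^bsub>X\<^esub> ainv X e)) \<bullet>\<^bsub>Y\<^esub> n i \<beta> e)"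

text \<open>
  A germ that leads from a point \<open>p\<close> of the chart \<open>U i\<close> to the hub.
\<close>

definition spoke :: "'i \<Rightarrow> 'x set \<times> 'p \<Rightarrow> 'j \<Rightarrow> ('x, 'p, 't) arrow \<Rightarrow> bool" where
  "spoke i p \<beta> e \<longleftrightarrow> i \<in> I \<and> \<beta> \<in> idx S \<and> e \<in> arrows X \<and> dchart e = U i \<and> src e = p \<and> cchart e = sdom S \<beta>"

lemma spoke_apt: "spoke i p \<beta> e \<Longrightarrow> apt e = snd p"
  by (auto simp: spoke_def src_def)

lemma spoke_exists:
  assumes "i \<in> I" "x \<in> pts X (U i)"
  obtains \<beta> e where "spoke i (U i, x) \<beta> e"
proof -
  have "proj (chart X (U i)) x \<in> U i" using X.proj_pts[OF U[OF assms(1)]] assms(2) by blast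
  then obtain \<beta> where \<beta>: "\<beta> \<in> idx S" "proj (chart X (U i)) x \<in> sdom S \<beta>" using cover[OF assms(1)] by blast
  note b = gf_charts(1)[OF S \<beta>(1)]
  obtain y where y: "y \<in> pts X (sdom S \<beta>)" "proj (chart X (sdom S \<beta>)) y = proj (chart X (U i)) x"
    using X.proj_pts[OF b] \<beta>(2) by (metis imageE)
  obtain e where "e \<in> arrows X" "src e = (U i, x)" "tgt X e = (sdom S \<beta>, y)"
    using X.arrow_exists[OF U[OF assms(1)] b assms(2) y(1) y(2)[symmetric]] by metis
  then have "spoke i (U i, x) \<beta> e" using assms \<beta> unfolding spoke_def
    by (metis arrow_simps(1,3) fst_conv)
  then show thesis by (rule that)
qed

lemma via_hub_props:
  assumes "a \<in> arrows X" "spoke i (src a) \<beta> e" "spoke j (tgt X a) \<gamma> e'"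
  shows "via_hub j i \<gamma> \<beta> e' a e \<in> arrows Y" "src (via_hub j i \<gamma> \<beta> e' a e) = (V i, f i (apt a))"
    "tgt Y (via_hub j i \<gamma> \<beta> e' a e) = (V j, f j (snd (tgt X a)))"
    "via_hub j i \<gamma> \<beta> e' a e = Arrow (V i) (f i (apt a)) (alab (via_hub j i \<gamma> \<beta> e' a e)) (V j)"
proof -
  have e: "i \<in> I" "\<beta> \<in> idx S" "e \<in> arrows X" "dchart e = U i" "src e = src a" "cchart e = sdom S \<beta>" "apt e = apt a"
    using assms(2) by (auto simp: spoke_def src_def)
  have e': "j \<in> I" "\<gamma> \<in> idx S" "e' \<in> arrows X" "dchart e' = U j" "src e' = tgt X a" "cchart e' = sdom S \<gamma>" "apt e' = snd (tgt X a)"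
    using assms(3) spoke_apt[OF assms(3)] by (auto simp: spoke_def)
  let ?b = "e' \<bullet>\<^bsub>X\<^esub> (a \<bullet>\<^bsub>X\<^esub> ainv X e)"
  have b: "?b \<in> arrows X" "tgt X ?b = tgt X e'" using assms(1) e e' by simp_all
  note Sb = gf_sar[OF S e(2) e'(2) b(1)]
  note ne = n_arrow[OF e(1-4,6)] n_tgt[OF e(1-4,6)] and ne' = n_arrow[OF e'(1-4,6)] n_tgt[OF e'(1-4,6)]
  show "via_hub j i \<gamma> \<beta> e' a e \<in> arrows Y" "src (via_hub j i \<gamma> \<beta> e' a e) = (V i, f i (apt a))"
    "tgt Y (via_hub j i \<gamma> \<beta> e' a e) = (V j, f j (snd (tgt X a)))"
    using Sb ne ne' e e' b by (simp_all add: via_hub_def)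
  then show "via_hub j i \<gamma> \<beta> e' a e = Arrow (V i) (f i (apt a)) (alab (via_hub j i \<gamma> \<beta> e' a e)) (V j)"
    by (cases "via_hub j i \<gamma> \<beta> e' a e") (auto simp: src_def tgt_def)
qed

lemma n_change:
  assumes "spoke i p \<beta> e" "spoke i p \<beta>' e'"
  shows "n i \<beta>' e' = sar S \<beta>' \<beta> (e' \<bullet>\<^bsub>X\<^esub> ainv X e) \<bullet>\<^bsub>Y\<^esub> n i \<beta> e"
proof -
  have e: "e' \<in> arrows X" "e \<in> arrows X" "src e' = src e" "dchart e = U i" "cchart e = sdom S \<beta>" "cchart e' = sdom S \<beta>'"
     "i \<in> I" "\<beta> \<in> idx S" "\<beta>' \<in> idx S"
    using assms by (auto simp: spoke_def)
  have "e' = (e' \<bullet>\<^bsub>X\<^esub> ainv X e) \<bullet>\<^bsub>X\<^esub> e" using e by (simp add: X.assoc)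
  then show ?thesis using n_comp[OF e(7-9) e(2,4,5), of "e' \<bullet>\<^bsub>X\<^esub> ainv X e"] e by simp
qed

text \<open>
  Replacing \<open>e\<close> by \<open>e1\<close> multiplies \<open>n e\<close> on the left by \<open>S (e1 \<bullet> e\<^sup>-\<^sup>1)\<close>, and likewise for \<open>e'\<close>. Both factors are
  absorbed, since \<open>(e1' \<bullet> a \<bullet> e1\<^sup>-\<^sup>1) \<bullet> (e1 \<bullet> e\<^sup>-\<^sup>1) = (e1' \<bullet> e'\<^sup>-\<^sup>1) \<bullet> (e' \<bullet> a \<bullet> e\<^sup>-\<^sup>1)\<close>.
\<close>

lemma via_hub_unique:
  assumes a: "a \<in> arrows X" and "spoke i (src a) \<beta> e" "spoke j (tgt X a) \<gamma> e'"
    and "spoke i (src a) \<beta>1 e1" "spoke j (tgt X a) \<gamma>1 e1'"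
  shows "via_hub j i \<gamma>1 \<beta>1 e1' a e1 = via_hub j i \<gamma> \<beta> e' a e"
proof -
  have e: "i \<in> I" "\<beta> \<in> idx S" "e \<in> arrows X" "dchart e = U i" "src e = src a" "cchart e = sdom S \<beta>" "apt e = apt a"
    "\<beta>1 \<in> idx S" "e1 \<in> arrows X" "dchart e1 = U i" "src e1 = src a" "cchart e1 = sdom S \<beta>1" "apt e1 = apt a"
    using assms(2,4) by (auto simp: spoke_def src_def)
  have e': "j \<in> I" "\<gamma> \<in> idx S" "e' \<in> arrows X" "dchart e' = U j" "src e' = tgt X a" "cchart e' = sdom S \<gamma>" "apt e' = snd (tgt X a)"
    "\<gamma>1 \<in> idx S" "e1' \<in> arrows X" "dchart e1' = U j" "src e1' = tgt X a" "cchart e1' = sdom S \<gamma>1" "apt e1' = snd (tgt X a)"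
    using assms(3,5) spoke_apt[OF assms(3)] spoke_apt[OF assms(5)] by (auto simp: spoke_def)
  let ?c = "e1 \<bullet>\<^bsub>X\<^esub> ainv X e" and ?c' = "e1' \<bullet>\<^bsub>X\<^esub> ainv X e'"
  let ?b = "e' \<bullet>\<^bsub>X\<^esub> (a \<bullet>\<^bsub>X\<^esub> ainv X e)" and ?b1 = "e1' \<bullet>\<^bsub>X\<^esub> (a \<bullet>\<^bsub>X\<^esub> ainv X e1)"
  have m: "?c \<in> arrows X" "?c' \<in> arrows X" "?b \<in> arrows X" "?b1 \<in> arrows X"
    "tgt X ?c = tgt X e1" "tgt X ?c' = tgt X e1'" "tgt X ?b = tgt X e'" "tgt X ?b1 = tgt X e1'"
    "src ?c = tgt X e" "src ?c' = tgt X e'" "src ?b = tgt X e" "src ?b1 = tgt X e1"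
    using a e e' by simp_all
  have "?b1 \<bullet>\<^bsub>X\<^esub> ?c = ?c' \<bullet>\<^bsub>X\<^esub> ?b" using a e e' by (simp add: X.assoc)
  then have F: "sar S \<gamma>1 \<beta>1 ?b1 \<bullet>\<^bsub>Y\<^esub> sar S \<beta>1 \<beta> ?c = sar S \<gamma>1 \<gamma> ?c' \<bullet>\<^bsub>Y\<^esub> sar S \<gamma> \<beta> ?b"
    using gf_comp[OF S e(2,8) e'(8) m(1,4)] gf_comp[OF S e(2) e'(2,8) m(3,2)] m e e' by simp
  note y = n_arrow[OF e(1-4,6)] n_tgt[OF e(1-4,6)] n_arrow[OF e'(1-4,6)] n_tgt[OF e'(1-4,6)]
    n_arrow[OF e(1,8,9,10,12)] n_tgt[OF e(1,8,9,10,12)] n_arrow[OF e'(1,8,9,10,12)] n_tgt[OF e'(1,8,9,10,12)]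
  note z = gf_sar[OF S e(2,8) m(1)] gf_sar[OF S e'(2,8) m(2)] gf_sar[OF S e(2) e'(2) m(3)] gf_sar[OF S e(8) e'(8) m(4)]
  have "via_hub j i \<gamma>1 \<beta>1 e1' a e1 = ainv Y (sar S \<gamma>1 \<gamma> ?c' \<bullet>\<^bsub>Y\<^esub> n j \<gamma> e') \<bullet>\<^bsub>Y\<^esub>
      (sar S \<gamma>1 \<beta>1 ?b1 \<bullet>\<^bsub>Y\<^esub> (sar S \<beta>1 \<beta> ?c \<bullet>\<^bsub>Y\<^esub> n i \<beta> e))"
    unfolding via_hub_def using n_change[OF assms(2,4)] n_change[OF assms(3,5)] by simp
  also have "\<dots> = ainv Y (sar S \<gamma>1 \<gamma> ?c' \<bullet>\<^bsub>Y\<^esub> n j \<gamma> e') \<bullet>\<^bsub>Y\<^esub>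
      ((sar S \<gamma>1 \<gamma> ?c' \<bullet>\<^bsub>Y\<^esub> sar S \<gamma> \<beta> ?b) \<bullet>\<^bsub>Y\<^esub> n i \<beta> e)"
    unfolding F[symmetric] using y z m e e' by (simp add: Y.assoc)
  also have "\<dots> = via_hub j i \<gamma> \<beta> e' a e"
    unfolding via_hub_def using y z m e e' by (simp add: Y.assoc)
  finally show ?thesis .
qed

lemma csec_n:
  assumes i: "i \<in> I" "\<beta> \<in> idx S" and A: "X.csec Z A" and ne: "topspace Z \<noteq> {}"
    and ch: "\<And>t. t \<in> topspace Z \<Longrightarrow> dchart (A t) = U i \<and> cchart (A t) = sdom S \<beta>"
  shows "Y.csec Z (\<lambda>t. n i \<beta> (A t))"
proof -
  obtain U' V' \<xi> p where a: "U' \<in> basics X" "V' \<in> basics X" "\<xi> \<in> Tran X U' V'" "continuous_map Z (hat (chart X U')) p"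
    "\<And>t. t \<in> topspace Z \<Longrightarrow> p t \<in> tdom X U' V' \<xi>" "\<And>t. t \<in> topspace Z \<Longrightarrow> A t = Arrow U' (p t) \<xi> V'"
    using A unfolding X.csec_def by blast
  obtain t0 where t0: "t0 \<in> topspace Z" using ne by blast
  have UV: "U' = U i" "V' = sdom S \<beta>" using ch[OF t0] a(6)[OF t0] by auto
  have ar: "n i \<beta> (A t) \<in> arrows Y" if "t \<in> topspace Z" for t
    using n_arrow[OF i X.csec_in_arrows[OF A that]] ch[OF that] by simp
  show ?thesis
  proof (rule Y.csecI[OF V[OF i(1)] gf_charts(2)[OF S i(2)]])
    show "N i \<beta> \<xi> \<in> Tran Y (V i) (scod S \<beta>)"
      using ar[OF t0] a(6)[OF t0] by (simp add: n_def in_arrows)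
    show "continuous_map Z (hat (chart Y (V i))) (\<lambda>t. f i (p t))"
      using continuous_map_compose[OF a(4)[unfolded UV] f[OF i(1)]] by (simp add: comp_def)
    show "f i (p t) \<in> tdom Y (V i) (scod S \<beta>) (N i \<beta> \<xi>)" if "t \<in> topspace Z" for t
      using ar[OF that] a(6)[OF that] by (simp add: n_def in_arrows)
    show "n i \<beta> (A t) = Arrow (V i) (f i (p t)) (N i \<beta> \<xi>) (scod S \<beta>)" if "t \<in> topspace Z" for t
      using a(6)[OF that] by (simp add: n_def)
  qed
qed

text \<open>
  The transition maps of two germs that lead from \<open>x0\<close> and its image to the hub also serve at all
  nearby points. Over a connected neighbourhood every factor of the formula is then a family of germs
  with a constant label, and so is their composite.
\<close>

lemma via_hub_label_locally_constant:
  assumes ij: "i \<in> I" "j \<in> I" and \<xi>: "\<xi> \<in> Tran X (U i) (U j)" and x0: "x0 \<in> tdom X (U i) (U j) \<xi>"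
  shows "\<exists>K \<beta> \<gamma> \<epsilon> \<epsilon>' l. openin (hat (chart X (U i))) K \<and> x0 \<in> K \<and>
     (\<forall>x\<in>K. spoke i (U i, x) \<beta> (Arrow (U i) x \<epsilon> (sdom S \<beta>)) \<and>
        spoke j (U j, tmap X (U i) (U j) \<xi> x) \<gamma> (Arrow (U j) (tmap X (U i) (U j) \<xi> x) \<epsilon>' (sdom S \<gamma>)) \<and>
        alab (via_hub j i \<gamma> \<beta> (Arrow (U j) (tmap X (U i) (U j) \<xi> x) \<epsilon>' (sdom S \<gamma>))
            (Arrow (U i) x \<xi> (U j)) (Arrow (U i) x \<epsilon> (sdom S \<beta>))) = l)"
proof -
  let ?t = "tmap X (U i) (U j) \<xi>" and ?H = "hat (chart X (U i))"
  note Ui = U[OF ij(1)] and Uj = U[OF ij(2)]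
  interpret H: g_struct "subtopology X.T (U i)" "chart X (U i)" by (rule X.chart_gs[OF Ui])
  note xp = X.tmap_in_pts[OF Ui Uj \<xi> x0]
  obtain \<beta> e where e0: "spoke i (U i, x0) \<beta> e" using spoke_exists[OF ij(1) xp(1)] .
  obtain \<gamma> e' where e0': "spoke j (U j, ?t x0) \<gamma> e'" using spoke_exists[OF ij(2) xp(2)] .
  have e: "e = Arrow (U i) x0 (alab e) (sdom S \<beta>)" and bi: "\<beta> \<in> idx S" "e \<in> arrows X"
    using e0 by (cases e; auto simp: spoke_def)+
  have e': "e' = Arrow (U j) (?t x0) (alab e') (sdom S \<gamma>)" and gi: "\<gamma> \<in> idx S" "e' \<in> arrows X"
    using e0' by (cases e'; auto simp: spoke_def)+
  note Ub = gf_charts(1)[OF S bi(1)] and Ug = gf_charts(1)[OF S gi(1)]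
  have \<epsilon>: "alab e \<in> Tran X (U i) (sdom S \<beta>)" "x0 \<in> tdom X (U i) (sdom S \<beta>) (alab e)"
    using bi(2) by (subst (asm) e, simp add: in_arrows)+
  have \<epsilon>': "alab e' \<in> Tran X (U j) (sdom S \<gamma>)" "?t x0 \<in> tdom X (U j) (sdom S \<gamma>) (alab e')"
    using gi(2) by (subst (asm) e', simp add: in_arrows)+
  let ?D = "tdom X (U i) (U j) \<xi>"
  let ?K0 = "tdom X (U i) (sdom S \<beta>) (alab e) \<inter> {x \<in> ?D. ?t x \<in> tdom X (U j) (sdom S \<gamma>) (alab e')}"
  have "openin (subtopology ?H ?D) {x \<in> topspace (subtopology ?H ?D). ?t x \<in> tdom X (U j) (sdom S \<gamma>) (alab e')}"
    by (rule openin_continuous_map_preimage[OF X.tmap_continuous[OF Ui Uj \<xi>] X.tdom_props(1)[OF Uj Ug \<epsilon>'(1)]])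
  also have "{x \<in> topspace (subtopology ?H ?D). ?t x \<in> tdom X (U j) (sdom S \<gamma>) (alab e')} =
      {x \<in> ?D. ?t x \<in> tdom X (U j) (sdom S \<gamma>) (alab e')}"
    using X.tdom_props(4)[OF Ui Uj \<xi>] by auto
  finally have "openin ?H {x \<in> ?D. ?t x \<in> tdom X (U j) (sdom S \<gamma>) (alab e')}"
    using openin_trans_full X.tdom_props(1)[OF Ui Uj \<xi>] by blast
  then have "openin ?H ?K0" using X.tdom_props(1)[OF Ui Ub \<epsilon>(1)] by blast
  moreover have "x0 \<in> ?K0" using x0 \<epsilon> \<epsilon>' by blast
  ultimately obtain K where K: "openin ?H K" "connectedin ?H K" "x0 \<in> K" "K \<subseteq> ?K0"
    using H.hat_locally_connected unfolding locally_connected_space by meson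
  have Kp: "K \<subseteq> pts X (U i)" using K(1) openin_subset by blast
  let ?Z = "subtopology ?H K"
  have tZ: "topspace ?Z = K" using Kp by auto
  have cZ: "connected_space ?Z" using K(2) by (simp add: connectedin_def)
  let ?A = "\<lambda>x. Arrow (U i) x \<xi> (U j)" and ?E = "\<lambda>x. Arrow (U i) x (alab e) (sdom S \<beta>)"
    and ?E' = "\<lambda>x. Arrow (U j) (?t x) (alab e') (sdom S \<gamma>)"
  have A: "X.csec ?Z ?A" by (rule X.csec_Arrow[OF Ui Uj \<xi>]) (use K in blast)
  have E: "X.csec ?Z ?E" by (rule X.csec_Arrow[OF Ui Ub \<epsilon>(1)]) (use K in blast)
  have E': "X.csec ?Z ?E'"
  proof (rule X.csecI[OF Uj Ug \<epsilon>'(1)])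
    have "continuous_map (subtopology ?H K) ?H (\<lambda>x. x)" using continuous_map_id_subt[of ?H K] by (simp add: id_def)
    from X.csec_tmap_continuous[OF Ui Uj \<xi> this] show "continuous_map ?Z (hat (chart X (U j))) ?t"
      using K(4) tZ by auto
  qed (use K(4) tZ in auto)
  have ar: "?A x \<in> arrows X" "?E x \<in> arrows X" "?E' x \<in> arrows X" if "x \<in> K" for x
    using X.csec_in_arrows[OF A, of x] X.csec_in_arrows[OF E, of x] X.csec_in_arrows[OF E', of x] that
    unfolding tZ by blast+
  have sp: "spoke i (U i, x) \<beta> (?E x)" "spoke j (U j, ?t x) \<gamma> (?E' x)" if "x \<in> K" for x
    using ar[OF that] ij bi gi by (auto simp: spoke_def)
  have t: "tgt X (?A x) = (U j, ?t x)" for x by (simp add: tgt_def)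
  have ne: "topspace ?Z \<noteq> {}" using K(3) tZ by blast
  let ?B = "\<lambda>x. ?E' x \<bullet>\<^bsub>X\<^esub> (?A x \<bullet>\<^bsub>X\<^esub> ainv X (?E x))"
  have "X.csec ?Z (\<lambda>x. ?A x \<bullet>\<^bsub>X\<^esub> ainv X (?E x))"
    by (rule X.csec_comp[OF cZ X.csec_inv[OF E] A]) (use ar tZ in simp)
  then have B: "X.csec ?Z ?B" by (rule X.csec_comp[OF cZ _ E']) (use ar tZ t in simp)
  have SB: "Y.csec ?Z (\<lambda>x. sar S \<gamma> \<beta> (?B x))" by (rule csec_sar[OF S bi(1) gi(1) B ne]) simp
  have nE: "Y.csec ?Z (\<lambda>x. n i \<beta> (?E x))" by (rule csec_n[OF ij(1) bi(1) E ne]) simp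
  have nE': "Y.csec ?Z (\<lambda>x. n j \<gamma> (?E' x))" by (rule csec_n[OF ij(2) gi(1) E' ne]) simp
  have SnE: "Y.csec ?Z (\<lambda>x. sar S \<gamma> \<beta> (?B x) \<bullet>\<^bsub>Y\<^esub> n i \<beta> (?E x))"
    by (rule Y.csec_comp[OF cZ nE SB]) (use n_tgt[OF ij(1) bi(1)] ar tZ in simp)
  have "Y.csec ?Z (\<lambda>x. via_hub j i \<gamma> \<beta> (?E' x) (?A x) (?E x))"
    unfolding via_hub_def
  proof (rule Y.csec_comp[OF cZ SnE Y.csec_inv[OF nE']])
    fix x assume "x \<in> topspace ?Z"
    then have x: "x \<in> K" using tZ by simp
    have b: "?B x \<in> arrows X" "tgt X (?B x) = tgt X (?E' x)" using ar[OF x] t by simp_all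
    have "tgt Y (sar S \<gamma> \<beta> (?B x) \<bullet>\<^bsub>Y\<^esub> n i \<beta> (?E x)) = tgt Y (sar S \<gamma> \<beta> (?B x))"
      using gf_sar[OF S bi(1) gi(1) b(1)] n_arrow[OF ij(1) bi(1) ar(2)[OF x]] n_tgt[OF ij(1) bi(1) ar(2)[OF x]] by simp
    then show "src (ainv Y (n j \<gamma> (?E' x))) = tgt Y (sar S \<gamma> \<beta> (?B x) \<bullet>\<^bsub>Y\<^esub> n i \<beta> (?E x))"
      using gf_sar(2)[OF S bi(1) gi(1) b(1)] b(2) n_arrow[OF ij(2) gi(1) ar(3)[OF x]] n_tgt[OF ij(2) gi(1) ar(3)[OF x]] by simp
  qed
  then have lab: "alab (via_hub j i \<gamma> \<beta> (?E' x) (?A x) (?E x)) = alab (via_hub j i \<gamma> \<beta> (?E' x0) (?A x0) (?E x0))"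
    if "x \<in> K" for x
    by (rule Y.csec_label) (use that K(3) in \<open>simp_all only: tZ\<close>)
  show ?thesis
    by (rule exI[of _ K], rule exI[of _ \<beta>], rule exI[of _ \<gamma>], rule exI[of _ "alab e"], rule exI[of _ "alab e'"],
        rule exI[of _ "alab (via_hub j i \<gamma> \<beta> (?E' x0) (?A x0) (?E x0))"], intro conjI ballI K(1,3) sp lab)
qed

lemma via_hub_label:
  assumes ij: "i \<in> I" "j \<in> I" and \<xi>: "\<xi> \<in> Tran X (U i) (U j)"
  obtains l where "\<And>x \<beta> \<gamma> e e'. \<lbrakk>x \<in> tdom X (U i) (U j) \<xi>; spoke i (U i, x) \<beta> e;
     spoke j (U j, tmap X (U i) (U j) \<xi> x) \<gamma> e'\<rbrakk> \<Longrightarrow> alab (via_hub j i \<gamma> \<beta> e' (Arrow (U i) x \<xi> (U j)) e) = l"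
proof -
  let ?t = "tmap X (U i) (U j) \<xi>" and ?A = "\<lambda>x. Arrow (U i) x \<xi> (U j)" and ?D = "tdom X (U i) (U j) \<xi>"
  note Ui = U[OF ij(1)] and Uj = U[OF ij(2)]
  have ar: "?A x \<in> arrows X" "src (?A x) = (U i, x)" "tgt X (?A x) = (U j, ?t x)" if "x \<in> ?D" for x
    using that \<xi> Ui Uj by (auto simp: in_arrows tgt_def)
  define L where "L x l \<longleftrightarrow> (\<exists>\<beta> \<gamma> e e'. spoke i (U i, x) \<beta> e \<and> spoke j (U j, ?t x) \<gamma> e' \<and> alab (via_hub j i \<gamma> \<beta> e' (?A x) e) = l)" for x l
  have L1: "l = l'" if "x \<in> ?D" "L x l" "L x l'" for x l l'
    using that ar[OF that(1)] via_hub_unique[OF ar(1)[OF that(1)]] unfolding L_def by metis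
  have L2: "\<exists>K l. openin (hat (chart X (U i))) K \<and> x0 \<in> K \<and> (\<forall>x\<in>K. L x l)" if "x0 \<in> ?D" for x0
    using via_hub_label_locally_constant[OF ij \<xi> that] unfolding L_def by meson
  define F where "F x = (SOME l. L x l)" for x
  have F: "L x (F x)" if "x \<in> ?D" for x
    unfolding F_def using L2[OF that] by (metis someI_ex)
  obtain x0 where x0: "x0 \<in> ?D" using X.tdom_props(3)[OF Ui Uj \<xi>] by blast
  have "F x = F x0" if "x \<in> ?D" for x
  proof (rule locally_constant_imp_constant[OF X.tdom_props(2)[OF Ui Uj \<xi>] _ that x0])
    fix y assume y: "y \<in> ?D"
    obtain K l where K: "openin (hat (chart X (U i))) K" "y \<in> K" "\<forall>x\<in>K. L x l" using L2[OF y] by blast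
    have "F z = l" if "z \<in> K \<inter> ?D" for z using L1[of z "F z" l] F[of z] K(3) that by blast
    then show "\<exists>K. openin (hat (chart X (U i))) K \<and> y \<in> K \<and> (\<forall>z\<in>K \<inter> ?D. F z = F y)"
      using K(1,2) y by (metis IntI)
  qed
  then show thesis using that[of "F x0"] L1 F unfolding L_def by metis
qed

text \<open>
  The label that is chosen is the only one with this property: every domain is nonempty and germs to
  the hub exist at all points.
\<close>

definition ext :: "('x, 'p, 't, 'i) system" where
  "ext = \<lparr>idx = I, sdom = U, scod = V, smap = f,
     stran = (\<lambda>j i \<xi>. SOME l. \<forall>x \<beta> \<gamma> e e'. x \<in> tdom X (U i) (U j) \<xi> \<longrightarrow> spoke i (U i, x) \<beta> e \<longrightarrow>
       spoke j (U j, tmap X (U i) (U j) \<xi> x) \<gamma> e' \<longrightarrow> alab (via_hub j i \<gamma> \<beta> e' (Arrow (U i) x \<xi> (U j)) e) = l)\<rparr>"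

lemma ext_simps [simp]: "idx ext = I" "sdom ext = U" "scod ext = V" "smap ext = f"
  by (simp_all add: ext_def)

lemma sar_ext:
  assumes a: "a \<in> arrows X" and "dchart a = U i" "cchart a = U j" and e: "spoke i (src a) \<beta> e" and e': "spoke j (tgt X a) \<gamma> e'"
  shows "sar ext j i a = via_hub j i \<gamma> \<beta> e' a e"
proof -
  have ij: "i \<in> I" "j \<in> I" using e e' by (auto simp: spoke_def)
  obtain x \<xi> where A: "a = Arrow (U i) x \<xi> (U j)" using assms(2,3) by (cases a) auto
  have \<xi>: "\<xi> \<in> Tran X (U i) (U j)" "x \<in> tdom X (U i) (U j) \<xi>" using a A by (auto simp: in_arrows)
  obtain l where l: "\<And>x \<beta> \<gamma> e e'. \<lbrakk>x \<in> tdom X (U i) (U j) \<xi>; spoke i (U i, x) \<beta> e;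
     spoke j (U j, tmap X (U i) (U j) \<xi> x) \<gamma> e'\<rbrakk> \<Longrightarrow> alab (via_hub j i \<gamma> \<beta> e' (Arrow (U i) x \<xi> (U j)) e) = l"
    using via_hub_label[OF ij \<xi>(1)] by metis
  have "\<forall>x \<beta> \<gamma> e e'. x \<in> tdom X (U i) (U j) \<xi> \<longrightarrow> spoke i (U i, x) \<beta> e \<longrightarrow>
       spoke j (U j, tmap X (U i) (U j) \<xi> x) \<gamma> e' \<longrightarrow> alab (via_hub j i \<gamma> \<beta> e' (Arrow (U i) x \<xi> (U j)) e) = stran ext j i \<xi>"
    unfolding ext_def system.simps by (rule someI[of _ l]) (use l in blast)
  then have "alab (via_hub j i \<gamma> \<beta> e' a e) = stran ext j i \<xi>"
    using \<xi> e e' A by (simp add: tgt_def)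
  then show ?thesis using via_hub_props(4)[OF a e e'] A by (simp add: sar_def)
qed

lemma ext_spokes:
  assumes "i \<in> I" "j \<in> I" "a \<in> arrows X" "dchart a = U i" "cchart a = U j"
  obtains \<beta> \<gamma> e e' where "spoke i (src a) \<beta> e" "spoke j (tgt X a) \<gamma> e'" "sar ext j i a = via_hub j i \<gamma> \<beta> e' a e"
proof -
  have "apt a \<in> pts X (U i)" "snd (tgt X a) \<in> pts X (U j)" using X.arrow_pts[OF assms(3)] assms(4,5) by auto
  then show thesis using spoke_exists[OF assms(1)] spoke_exists[OF assms(2)] that sar_ext[OF assms(3-5)] assms(4,5)
    unfolding src_def tgt_def by (metis snd_conv)
qed

lemma ext_functor: "germ_functor X Y ext"
  unfolding germ_functor_def
proof (intro conjI ballI impI; simp only: ext_simps)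
  fix i j a assume a: "i \<in> I" "j \<in> I" "a \<in> arrows X" "dchart a = U i" "cchart a = U j"
  obtain \<beta> \<gamma> e e' where *: "spoke i (src a) \<beta> e" "spoke j (tgt X a) \<gamma> e'" "sar ext j i a = via_hub j i \<gamma> \<beta> e' a e"
    using ext_spokes[OF a] .
  show "sar ext j i a \<in> arrows Y" "tgt Y (sar ext j i a) = (V j, f j (snd (tgt X a)))"
    using via_hub_props[OF a(3) *(1,2)] *(3) by auto
next
  fix i j k a b
  assume a: "i \<in> I" "j \<in> I" "k \<in> I" "a \<in> arrows X" "b \<in> arrows X" "dchart a = U i" "cchart a = U j" "cchart b = U k"
    "src b = tgt X a"
  have db: "dchart b = U j" using a by (auto simp: src_eq_tgt)
  obtain \<beta> \<gamma> e e' where *: "spoke i (src a) \<beta> e" "spoke j (tgt X a) \<gamma> e'" "sar ext j i a = via_hub j i \<gamma> \<beta> e' a e"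
    using ext_spokes[OF a(1,2,4,6,7)] .
  obtain \<delta> e'' where e'': "spoke k (tgt X b) \<delta> e''"
    using ext_spokes[OF a(2,3,5) db a(8)] .
  have ba: "b \<bullet>\<^bsub>X\<^esub> a \<in> arrows X" "src (b \<bullet>\<^bsub>X\<^esub> a) = src a" "tgt X (b \<bullet>\<^bsub>X\<^esub> a) = tgt X b" using a by simp_all
  have sb: "sar ext k j b = via_hub k j \<delta> \<gamma> e'' b e'" using sar_ext[OF a(5) db a(8)] * e'' a by simp
  have sba: "sar ext k i (b \<bullet>\<^bsub>X\<^esub> a) = via_hub k i \<delta> \<beta> e'' (b \<bullet>\<^bsub>X\<^esub> a) e"
    using sar_ext[OF ba(1), of i k] * e'' ba a by simp
  have e: "\<beta> \<in> idx S" "e \<in> arrows X" "dchart e = U i" "src e = src a" "cchart e = sdom S \<beta>" "apt e = apt a"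
    using * by (auto simp: spoke_def src_def)
  have e': "\<gamma> \<in> idx S" "e' \<in> arrows X" "dchart e' = U j" "src e' = tgt X a" "cchart e' = sdom S \<gamma>" "apt e' = snd (tgt X a)"
    using *(2) spoke_apt[OF *(2)] by (auto simp: spoke_def)
  have f: "\<delta> \<in> idx S" "e'' \<in> arrows X" "dchart e'' = U k" "src e'' = tgt X b" "cchart e'' = sdom S \<delta>" "apt e'' = snd (tgt X b)"
    using e'' spoke_apt[OF e''] by (auto simp: spoke_def)
  let ?p = "e' \<bullet>\<^bsub>X\<^esub> (a \<bullet>\<^bsub>X\<^esub> ainv X e)" and ?q = "e'' \<bullet>\<^bsub>X\<^esub> (b \<bullet>\<^bsub>X\<^esub> ainv X e')"
  have pq: "?p \<in> arrows X" "?q \<in> arrows X" "tgt X ?p = tgt X e'" "tgt X ?q = tgt X e''" "src ?q = tgt X ?p"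
    using a e e' f by simp_all
  have "e'' \<bullet>\<^bsub>X\<^esub> ((b \<bullet>\<^bsub>X\<^esub> a) \<bullet>\<^bsub>X\<^esub> ainv X e) = ?q \<bullet>\<^bsub>X\<^esub> ?p"
    using a e e' f by (simp add: X.assoc)
  then have F: "sar S \<delta> \<beta> (e'' \<bullet>\<^bsub>X\<^esub> ((b \<bullet>\<^bsub>X\<^esub> a) \<bullet>\<^bsub>X\<^esub> ainv X e)) = sar S \<delta> \<gamma> ?q \<bullet>\<^bsub>Y\<^esub> sar S \<gamma> \<beta> ?p"
    using gf_comp[OF S e(1) e'(1) f(1) pq(1,2)] pq e e' f by simp
  note y = n_arrow[OF a(1) e(1-3,5)] n_tgt[OF a(1) e(1-3,5)] n_arrow[OF a(2) e'(1-3,5)] n_tgt[OF a(2) e'(1-3,5)]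
    n_arrow[OF a(3) f(1-3,5)] n_tgt[OF a(3) f(1-3,5)] gf_sar[OF S e(1) e'(1) pq(1)] gf_sar[OF S e'(1) f(1) pq(2)]
  show "sar ext k i (b \<bullet>\<^bsub>X\<^esub> a) = sar ext k j b \<bullet>\<^bsub>Y\<^esub> sar ext j i a"
    unfolding sba sb *(3) via_hub_def F using y e e' f pq by (simp add: Y.assoc)
qed (use U V f in auto)

text \<open>
  If \<open>e\<close> leads from \<open>g x\<close> to the hub, then \<open>e \<bullet> g\<close> does so from \<open>x\<close>, and with this choice the middle factor
  of the formula for the germ of \<open>g\<close> at \<open>x\<close> is an identity.
\<close>

lemma ext_sgrp:
  assumes i: "i \<in> I" and g: "g \<in> carrier (gp X (U i))"
  shows "sgrp X Y ext i g = s i g"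
proof -
  interpret U: g_struct "subtopology X.T (U i)" "chart X (U i)" by (rule X.chart_gs[OF U[OF i]])
  interpret V: g_struct "subtopology Y.T (V i)" "chart Y (V i)" by (rule Y.chart_gs[OF V[OF i]])
  have sg: "s i g \<in> carrier (gp Y (V i))"
    using continuous_map_funspace[OF s_continuous[OF i]] g by (auto simp: U.topspace_grp_top V.topspace_grp_top)
  obtain x where x: "x \<in> pts X (U i)" using X.pts_nonempty[OF U[OF i]] by blast
  let ?a = "agrp X (U i) g x"
  have gx: "act (chart X (U i)) g x \<in> pts X (U i)" using g x by simp
  note a = X.agrp_in_arrows[OF U[OF i] g x]
  obtain \<beta> e where e0: "spoke i (U i, act (chart X (U i)) g x) \<beta> e" using spoke_exists[OF i gx] .
  then have e: "\<beta> \<in> idx S" "e \<in> arrows X" "src e = (U i, act (chart X (U i)) g x)" "dchart e = U i" "cchart e = sdom S \<beta>"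
     "apt e = act (chart X (U i)) g x"
    by (auto simp: spoke_def src_def)
  let ?d = "e \<bullet>\<^bsub>X\<^esub> ?a"
  have d: "?d \<in> arrows X" "src ?d = (U i, x)" using a e by simp_all
  have "spoke i (src ?a) \<beta> ?d" using d e i by (simp add: spoke_def)
  then have "sar ext i i ?a = via_hub i i \<beta> \<beta> e ?a ?d" using sar_ext[OF a(1)] e0 a(2) by simp
  also have "\<dots> = ainv Y (n i \<beta> e) \<bullet>\<^bsub>Y\<^esub> (sar S \<beta> \<beta> (aid X (tgt X e)) \<bullet>\<^bsub>Y\<^esub> (n i \<beta> e \<bullet>\<^bsub>Y\<^esub> agrp Y (V i) (s i g) (f i x)))"
  proof -
    have "e \<bullet>\<^bsub>X\<^esub> (?a \<bullet>\<^bsub>X\<^esub> ainv X ?d) = aid X (tgt X e)" using a e by simp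
    then show ?thesis unfolding via_hub_def using n_act[OF i g x e(1,2,3,5)] by simp
  qed
  also have "sar S \<beta> \<beta> (aid X (tgt X e)) = aid Y (tgt Y (n i \<beta> e))"
    using gf_id[OF S e(1), of "snd (tgt X e)"] X.arrow_pts[OF e(2)] n_tgt[OF i e(1,2,4,5)] e by simp
  also have "ainv Y (n i \<beta> e) \<bullet>\<^bsub>Y\<^esub> (aid Y (tgt Y (n i \<beta> e)) \<bullet>\<^bsub>Y\<^esub> (n i \<beta> e \<bullet>\<^bsub>Y\<^esub> agrp Y (V i) (s i g) (f i x)))
      = agrp Y (V i) (s i g) (f i x)"
  proof -
    have "f i x \<in> pts Y (V i)" using funcset_mem[OF continuous_map_funspace[OF f[OF i]] x] .
    note b = Y.agrp_in_arrows[OF V[OF i] sg this]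
    show ?thesis using b n_arrow[OF i e(1,2,4,5)] f_act[OF i g x] e(6) by simp
  qed
  finally have "stran ext i i (gtran X (U i) g) = gtran Y (V i) (s i g)"
    by (simp add: sar_def) (simp add: agrp_def)
  then show ?thesis using sgrp_eqI[of ext i] V[OF i] sg by simp
qed

lemma ext_local_system: "local_system X Y ext"
proof (rule local_systemI[OF ext_functor])
  fix i assume "i \<in> idx ext"
  then have i: "i \<in> I" by simp
  interpret U: g_struct "subtopology X.T (U i)" "chart X (U i)" by (rule X.chart_gs[OF U[OF i]])
  show "continuous_map (grp_top (chart X (sdom ext i))) (grp_top (chart Y (scod ext i))) (sgrp X Y ext i)"
    unfolding ext_simps
    by (rule continuous_map_eq[OF s_continuous[OF i]]) (simp add: ext_sgrp[OF i] U.topspace_grp_top)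
qed

end


section \<open>Bridged systems\<close>

text \<open>
  Agreement is required only at the points and transition maps of the charts, as the values of a
  system elsewhere are arbitrary.
\<close>

definition embeds :: "('x, 'p, 'g, 't) orbispace \<Rightarrow> ('i \<Rightarrow> 'k) \<Rightarrow>
    ('x, 'p, 't, 'i) system \<Rightarrow> ('x, 'p, 't, 'k) system \<Rightarrow> bool" where
  "embeds X e S B \<longleftrightarrow> (\<forall>\<alpha>\<in>idx S. e \<alpha> \<in> idx B \<and> sdom B (e \<alpha>) = sdom S \<alpha> \<and> scod B (e \<alpha>) = scod S \<alpha> \<and>
     (\<forall>x\<in>pts X (sdom S \<alpha>). smap B (e \<alpha>) x = smap S \<alpha> x) \<and>
     (\<forall>\<beta>\<in>idx S. \<forall>\<xi>\<in>Tran X (sdom S \<alpha>) (sdom S \<beta>). stran B (e \<beta>) (e \<alpha>) \<xi> = stran S \<beta> \<alpha> \<xi>))"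

text \<open>
  The system \<open>B\<close> on the disjoint union contains, besides \<open>S\<close> and \<open>R\<close>, compatible values on the transition
  maps between charts of \<open>S\<close> and charts of \<open>R\<close>; these replace the choices in an equivalence of systems.
\<close>

definition bridged :: "('x, 'p, 'g, 't) orbispace \<Rightarrow> ('x, 'p, 'g, 't) orbispace \<Rightarrow>
    ('x, 'p, 't, 'i) system \<Rightarrow> ('x, 'p, 't, 'j) system \<Rightarrow> bool" where
  "bridged X Y S R \<longleftrightarrow> (\<exists>B :: ('x, 'p, 't, 'i + 'j) system.
     local_system X Y B \<and> embeds X Inl S B \<and> embeds X Inr R B)"

definition reindex :: "'k set \<Rightarrow> ('k \<Rightarrow> 'i) \<Rightarrow> ('x, 'p, 't, 'i) system \<Rightarrow> ('x, 'p, 't, 'k) system" where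
  "reindex J e B = \<lparr>idx = J, sdom = sdom B \<circ> e, scod = scod B \<circ> e, smap = smap B \<circ> e,
     stran = (\<lambda>j i. stran B (e j) (e i))\<rparr>"

lemma reindex_simps [simp]: "idx (reindex J e B) = J" "sdom (reindex J e B) i = sdom B (e i)"
  "scod (reindex J e B) i = scod B (e i)" "smap (reindex J e B) i = smap B (e i)"
  "stran (reindex J e B) j i = stran B (e j) (e i)"
  by (simp_all add: reindex_def)

lemma embedsD:
  assumes "embeds X e S B" "\<alpha> \<in> idx S"
  shows "e \<alpha> \<in> idx B" "sdom B (e \<alpha>) = sdom S \<alpha>" "scod B (e \<alpha>) = scod S \<alpha>"
    "x \<in> pts X (sdom S \<alpha>) \<Longrightarrow> smap B (e \<alpha>) x = smap S \<alpha> x"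
    "\<beta> \<in> idx S \<Longrightarrow> \<xi> \<in> Tran X (sdom S \<alpha>) (sdom S \<beta>) \<Longrightarrow> stran B (e \<beta>) (e \<alpha>) \<xi> = stran S \<beta> \<alpha> \<xi>"
  using assms unfolding embeds_def by simp_all

lemma embeds_reindex: "e ` J \<subseteq> idx B \<Longrightarrow> embeds X e (reindex J e B) B"
  by (auto simp: embeds_def)

lemma embeds_into_reindex:
  assumes "embeds X d S B" "\<And>\<alpha>. \<alpha> \<in> idx S \<Longrightarrow> k \<alpha> \<in> J \<and> e (k \<alpha>) = d \<alpha>"
  shows "embeds X k S (reindex J e B)"
  using assms by (simp add: embeds_def)

lemma embeds_trans:
  assumes "embeds X e S B" "embeds X d B C"
  shows "embeds X (d \<circ> e) S C"
  using embedsD[OF assms(1)] embedsD[OF assms(2)] by (simp add: embeds_def)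

context orbi_pair
begin

lemma embeds_sar:
  assumes "embeds X e S B" "\<alpha> \<in> idx S" "\<beta> \<in> idx S" "a \<in> arrows X" "dchart a = sdom S \<alpha>" "cchart a = sdom S \<beta>"
  shows "sar B (e \<beta>) (e \<alpha>) a = sar S \<beta> \<alpha> a"
  using embedsD[OF assms(1,2)] embedsD[OF assms(1,3)] assms(3-6) X.arrow_pts(3)[OF assms(4)]
  by (simp add: sar_def in_arrows)

lemma embedsI:
  assumes "\<And>\<alpha>. \<alpha> \<in> idx S \<Longrightarrow> e \<alpha> \<in> idx B \<and> sdom S \<alpha> \<in> basics X \<and> sdom B (e \<alpha>) = sdom S \<alpha> \<and> scod B (e \<alpha>) = scod S \<alpha>"
    and "\<And>\<alpha> x. \<alpha> \<in> idx S \<Longrightarrow> x \<in> pts X (sdom S \<alpha>) \<Longrightarrow> smap B (e \<alpha>) x = smap S \<alpha> x"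
    and "\<And>\<alpha> \<beta> a. \<lbrakk>\<alpha> \<in> idx S; \<beta> \<in> idx S; a \<in> arrows X; dchart a = sdom S \<alpha>; cchart a = sdom S \<beta>\<rbrakk> \<Longrightarrow>
       sar B (e \<beta>) (e \<alpha>) a = sar S \<beta> \<alpha> a"
  shows "embeds X e S B"
proof -
  have "stran B (e \<beta>) (e \<alpha>) \<xi> = stran S \<beta> \<alpha> \<xi>"
    if a: "\<alpha> \<in> idx S" "\<beta> \<in> idx S" "\<xi> \<in> Tran X (sdom S \<alpha>) (sdom S \<beta>)" for \<alpha> \<beta> \<xi>
  proof -
    have b: "sdom S \<alpha> \<in> basics X" "sdom S \<beta> \<in> basics X" using assms(1) a by auto
    obtain x where "x \<in> tdom X (sdom S \<alpha>) (sdom S \<beta>) \<xi>" using X.tdom_props(3)[OF b a(3)] by blast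
    then show ?thesis using assms(3)[of \<alpha> \<beta> "Arrow (sdom S \<alpha>) x \<xi> (sdom S \<beta>)"] a b
      by (simp add: in_arrows sar_def)
  qed
  then show ?thesis using assms(1,2) by (simp add: embeds_def)
qed

lemma embeds_local_system:
  assumes B: "local_system X Y B" and e: "embeds X e S B"
  shows "local_system X Y S"
proof -
  note F = local_system_gf[OF B]
  note d = embedsD[OF e]
  have FS: "germ_functor X Y S"
    unfolding germ_functor_def
  proof (intro conjI ballI impI)
    fix \<alpha> assume a: "\<alpha> \<in> idx S"
    show "sdom S \<alpha> \<in> basics X" "scod S \<alpha> \<in> basics Y"
      using gf_charts[OF F d(1)[OF a]] d[OF a] by auto
    show "continuous_map (hat (chart X (sdom S \<alpha>))) (hat (chart Y (scod S \<alpha>))) (smap S \<alpha>)"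
      using continuous_map_eq[OF gf_charts(3)[OF F d(1)[OF a]]] d[OF a] by simp
  next
    fix \<alpha> \<beta> a
    assume a: "\<alpha> \<in> idx S" "\<beta> \<in> idx S" "a \<in> arrows X" "dchart a = sdom S \<alpha>" "cchart a = sdom S \<beta>"
    have "snd (tgt X a) \<in> pts X (sdom S \<beta>)" using X.arrow_pts[OF a(3)] a by simp
    then show "sar S \<beta> \<alpha> a \<in> arrows Y" "tgt Y (sar S \<beta> \<alpha> a) = (scod S \<beta>, smap S \<beta> (snd (tgt X a)))"
      using gf_sar[OF F d(1)[OF a(1)] d(1)[OF a(2)] a(3)] embeds_sar[OF e a] d[OF a(1)] d[OF a(2)] a by simp_all
  next
    fix \<alpha> \<beta> \<gamma> a b
    assume a: "\<alpha> \<in> idx S" "\<beta> \<in> idx S" "\<gamma> \<in> idx S" "a \<in> arrows X" "b \<in> arrows X"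
        "dchart a = sdom S \<alpha>" "cchart a = sdom S \<beta>" "cchart b = sdom S \<gamma>" "src b = tgt X a"
    have b: "dchart b = sdom S \<beta>" using a by (simp add: src_eq_tgt)
    show "sar S \<gamma> \<alpha> (b \<bullet>\<^bsub>X\<^esub> a) = sar S \<gamma> \<beta> b \<bullet>\<^bsub>Y\<^esub> sar S \<beta> \<alpha> a"
      using gf_comp[OF F d(1)[OF a(1)] d(1)[OF a(2)] d(1)[OF a(3)] a(4,5)] d(2)[OF a(1)] d(2)[OF a(2)] d(2)[OF a(3)]
        embeds_sar[OF e a(1,2,4,6,7)] embeds_sar[OF e a(2,3,5) b a(8)] embeds_sar[OF e a(1,3), of "b \<bullet>\<^bsub>X\<^esub> a"] a
      by simp
  qed
  show ?thesis
  proof (rule local_systemI[OF FS])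
    fix \<alpha> assume a: "\<alpha> \<in> idx S"
    interpret U: g_struct "subtopology X.T (sdom S \<alpha>)" "chart X (sdom S \<alpha>)" by (rule X.chart_gs[OF gf_charts(1)[OF FS a]])
    have "sgrp X Y S \<alpha> g = sgrp X Y B (e \<alpha>) g" if "g \<in> carrier (gp X (sdom S \<alpha>))" for g
      unfolding sgrp_def using d[OF a] a X.gtran_in_Tran[OF gf_charts(1)[OF FS a] that] by simp
    then show "continuous_map (grp_top (chart X (sdom S \<alpha>))) (grp_top (chart Y (scod S \<alpha>))) (sgrp X Y S \<alpha>)"
      using continuous_map_eq[OF local_system_sgrp_continuous[OF B d(1)[OF a]]] d[OF a] U.topspace_grp_top by simp
  qed
qed

lemma local_system_reindex: "local_system X Y B \<Longrightarrow> e ` J \<subseteq> idx B \<Longrightarrow> local_system X Y (reindex J e B)"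
  using embeds_local_system embeds_reindex by blast

lemma bridgedI:
  assumes "local_system X Y B" "embeds X e S B" "embeds X d R B"
  shows "bridged X Y S R"
proof -
  let ?J = "Inl ` idx S \<union> Inr ` idx R"
  have "case_sum e d ` ?J \<subseteq> idx B" using embedsD(1)[OF assms(2)] embedsD(1)[OF assms(3)] by auto
  then have "local_system X Y (reindex ?J (case_sum e d) B)" by (rule local_system_reindex[OF assms(1)])
  then show ?thesis unfolding bridged_def
    using embeds_into_reindex[OF assms(2), of Inl ?J "case_sum e d"]
      embeds_into_reindex[OF assms(3), of Inr ?J "case_sum e d"] by auto
qed

lemma bridged_refl: "local_system X Y S \<Longrightarrow> bridged X Y S S"
  by (rule bridgedI[of S "\<lambda>i. i" _ "\<lambda>i. i"]) (auto simp: embeds_def)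

lemma bridged_sym: "bridged X Y S R \<Longrightarrow> bridged X Y R S"
  unfolding bridged_def[of _ _ S] using bridgedI by blast

lemma bridged_local: "bridged X Y S R \<Longrightarrow> local_system X Y S" "bridged X Y S R \<Longrightarrow> local_system X Y R"
  unfolding bridged_def using embeds_local_system by blast+

text \<open>
  Families of bridges to the same hub may be put side by side, since no compatibility between them
  enters the conditions.
\<close>

lemma bridges_sum:
  assumes "bridges X Y S I U V f N s n" "bridges X Y S I' U' V' f' N' s' n'"
  shows "bridges X Y S (Inl ` I \<union> Inr ` I') (case_sum U U') (case_sum V V') (case_sum f f')
    (case_sum N N') (case_sum s s') (case_sum n n')"
proof -
  interpret A: bridges X Y S I U V f N s n by fact
  interpret B: bridges X Y S I' U' V' f' N' s' n' by fact
  show ?thesis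
  proof (unfold_locales, goal_cases)
    case 1 then show ?case by (rule A.S)
  next
    case (2 i) then show ?case using A.cover[of "projl i"] B.cover[of "projr i"] by (cases i) (auto simp del: Union_iff UN_iff)
  next
    case (3 i) then show ?case using A.U B.U by (cases i) auto
  next
    case (4 i) then show ?case using A.V B.V by (cases i) auto
  next
    case (5 i) then show ?case using A.f B.f by (cases i) auto
  next
    case (6 i) then show ?case using A.n_def B.n_def by (cases i) simp_all
  next
    case (7 i) then show ?case using A.n_arrow B.n_arrow by (cases i) auto
  next
    case (8 i) then show ?case using A.n_tgt B.n_tgt by (cases i) auto
  next
    case (9 i) then show ?case using A.n_comp B.n_comp by (cases i) auto
  next
    case (10 i) then show ?case using A.s_continuous B.s_continuous by (cases i) auto
  next
    case (11 i) then show ?case using A.f_act B.f_act by (cases i) auto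
  next
    case (12 i) then show ?case using A.n_act B.n_act by (cases i) auto
  qed
qed

text \<open>
  Both functors are restrictions of the extension that belongs to the union of the two families of
  bridges.
\<close>

lemma ext_bridged:
  assumes "bridges X Y S I U V f N s n" "bridges X Y S I' U' V' f' N' s' n'"
  shows "bridged X Y (bridges.ext X Y S I U V f n) (bridges.ext X Y S I' U' V' f' n')"
proof -
  interpret A: bridges X Y S I U V f N s n by fact
  interpret B: bridges X Y S I' U' V' f' N' s' n' by fact
  interpret C: bridges X Y S "Inl ` I \<union> Inr ` I'" "case_sum U U'" "case_sum V V'" "case_sum f f'"
    "case_sum N N'" "case_sum s s'" "case_sum n n'" by (rule bridges_sum[OF assms])
  have spA: "C.spoke (Inl i) p \<beta> e \<longleftrightarrow> A.spoke i p \<beta> e" for i p \<beta> e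
    by (auto simp: A.spoke_def C.spoke_def)
  have spB: "C.spoke (Inr i) p \<beta> e \<longleftrightarrow> B.spoke i p \<beta> e" for i p \<beta> e
    by (auto simp: B.spoke_def C.spoke_def)
  have "embeds X Inl A.ext C.ext"
  proof (rule embedsI)
    fix i j a assume "i \<in> idx A.ext" "j \<in> idx A.ext" and a: "a \<in> arrows X" "dchart a = sdom A.ext i" "cchart a = sdom A.ext j"
    then have ij: "i \<in> I" "j \<in> I" by auto
    obtain \<beta> \<gamma> e e' where *: "A.spoke i (src a) \<beta> e" "A.spoke j (tgt X a) \<gamma> e'" "sar A.ext j i a = A.via_hub j i \<gamma> \<beta> e' a e"
      using A.ext_spokes[OF ij a(1) a(2,3)[unfolded A.ext_simps]] .
    show "sar C.ext (Inl j) (Inl i) a = sar A.ext j i a"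
      using C.sar_ext[OF a(1), of "Inl i" "Inl j"] * a(2,3) by (simp add: spA A.via_hub_def C.via_hub_def)
  qed (use A.U in auto)
  moreover have "embeds X Inr B.ext C.ext"
  proof (rule embedsI)
    fix i j a assume "i \<in> idx B.ext" "j \<in> idx B.ext" and a: "a \<in> arrows X" "dchart a = sdom B.ext i" "cchart a = sdom B.ext j"
    then have ij: "i \<in> I'" "j \<in> I'" by auto
    obtain \<beta> \<gamma> e e' where *: "B.spoke i (src a) \<beta> e" "B.spoke j (tgt X a) \<gamma> e'" "sar B.ext j i a = B.via_hub j i \<gamma> \<beta> e' a e"
      using B.ext_spokes[OF ij a(1) a(2,3)[unfolded B.ext_simps]] .
    show "sar C.ext (Inr j) (Inr i) a = sar B.ext j i a"
      using C.sar_ext[OF a(1), of "Inr i" "Inr j"] * a(2,3) by (simp add: spB B.via_hub_def C.via_hub_def)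
  qed (use B.U in auto)
  ultimately show ?thesis using bridgedI[OF C.ext_local_system] by blast
qed

text \<open>
  A functor \<open>R\<close> that shares an ambient functor \<open>B\<close> with a covering one is the extension along its own
  bridges: functoriality of \<open>B\<close> turns the formula for the extension into \<open>B a\<close>.
\<close>

lemma bridges_of_embeds:
  assumes B: "local_system X Y B" and e: "embeds X e R B" and d: "embeds X d S B"
    and cover: "\<And>i. i \<in> idx R \<Longrightarrow> sdom R i \<subseteq> (\<Union>\<beta>\<in>idx S. sdom S \<beta>)"
  defines "n \<equiv> \<lambda>i \<beta> a. Arrow (scod R i) (smap R i (apt a)) (stran B (d \<beta>) (e i) (alab a)) (scod S \<beta>)"
  shows "bridges X Y S (idx R) (sdom R) (scod R) (smap R) (\<lambda>i \<beta>. stran B (d \<beta>) (e i)) (sgrp X Y R) n"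
    and "embeds X (\<lambda>i. i) R (bridges.ext X Y S (idx R) (sdom R) (scod R) (smap R) n)"
proof -
  note R = embeds_local_system[OF B e] and S = embeds_local_system[OF B d]
  note F = local_system_gf[OF B] and FR = local_system_gf[OF R] and FS = local_system_gf[OF S]
  note de = embedsD[OF e] and dd = embedsD[OF d]
  have n: "n i \<beta> a = sar B (d \<beta>) (e i) a" if "i \<in> idx R" "\<beta> \<in> idx S" "a \<in> arrows X" "dchart a = sdom R i" for i \<beta> a
    using de[OF that(1)] dd[OF that(2)] X.arrow_pts(3)[OF that(3)] that(4) by (simp add: n_def sar_def)
  show br: "bridges X Y S (idx R) (sdom R) (scod R) (smap R) (\<lambda>i \<beta>. stran B (d \<beta>) (e i)) (sgrp X Y R) n"
  proof (unfold_locales, goal_cases)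
    case 1 then show ?case by (rule FS)
  next
    case (2 i) then show ?case by (rule cover)
  next
    case (3 i) then show ?case by (rule gf_charts(1)[OF FR])
  next
    case (4 i) then show ?case by (rule gf_charts(2)[OF FR])
  next
    case (5 i) then show ?case by (rule gf_charts(3)[OF FR])
  next
    case (6 i) then show ?case by (simp add: n_def)
  next
    case (7 i \<beta> a)
    then show ?case using gf_sar(1)[OF F de(1)[OF 7(1)] dd(1)[OF 7(2)] 7(3)] n[OF 7(1-4)] de(2) dd(2) by simp
  next
    case (8 i \<beta> a)
    have "snd (tgt X a) \<in> pts X (sdom S \<beta>)" using X.arrow_pts[OF 8(3)] 8(5) by simp
    then show ?case using 8 gf_sar(2)[OF F de(1)[OF 8(1)] dd(1)[OF 8(2)] 8(3)] n[OF 8(1-4)] de(2) dd(2-4) by simp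
  next
    case (9 i \<beta> \<gamma> a b)
    have db: "dchart b = sdom S \<beta>" using 9 by (simp add: src_eq_tgt)
    show ?case using 9 n[OF 9(1,2,4,5)] n[OF 9(1,3), of "b \<bullet>\<^bsub>X\<^esub> a"] embeds_sar[OF d 9(2,3,7) db 9(8)]
        gf_comp[OF F de(1)[OF 9(1)] dd(1)[OF 9(2)] dd(1)[OF 9(3)] 9(4,7)] de(2) dd(2) by simp
  next
    case (10 i) then show ?case by (rule local_system_sgrp_continuous[OF R])
  next
    case (11 i g x) then show ?case using gf_agrp(4)[OF FR 11] by simp
  next
    case (12 i g x \<beta> a)
    note ag = X.agrp_in_arrows[OF gf_charts(1)[OF FR 12(1)] 12(2,3)]
    have da: "dchart a = sdom R i" "apt a = act (chart X (sdom R i)) g x" using 12(6) by (auto simp: src_def)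
    have "n i \<beta> (a \<bullet>\<^bsub>X\<^esub> agrp X (sdom R i) g x) = sar B (d \<beta>) (e i) a \<bullet>\<^bsub>Y\<^esub> sar B (e i) (e i) (agrp X (sdom R i) g x)"
      using 12 n[OF 12(1,4), of "a \<bullet>\<^bsub>X\<^esub> agrp X (sdom R i) g x"] ag de(2) dd(2)
        gf_comp[OF F de(1)[OF 12(1)] de(1)[OF 12(1)] dd(1)[OF 12(4)] ag(1) 12(5)] by simp
    also have "sar B (e i) (e i) (agrp X (sdom R i) g x) = agrp Y (scod R i) (sgrp X Y R i g) (smap R i x)"
      using embeds_sar[OF e 12(1,1) ag(1)] gf_agrp(3)[OF FR 12(1,2)] by simp
    finally show ?case using n[OF 12(1,4,5) da(1)] by simp
  qed
  interpret bridges X Y S "idx R" "sdom R" "scod R" "smap R" "\<lambda>i \<beta>. stran B (d \<beta>) (e i)" "sgrp X Y R" n by (rule br)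
  show "embeds X (\<lambda>i. i) R ext"
  proof (rule embedsI)
    fix i j a assume ij: "i \<in> idx R" "j \<in> idx R" and a: "a \<in> arrows X" "dchart a = sdom R i" "cchart a = sdom R j"
    obtain \<beta> \<gamma> c c' where *: "spoke i (src a) \<beta> c" "spoke j (tgt X a) \<gamma> c'" "sar ext j i a = via_hub j i \<gamma> \<beta> c' a c"
      using ext_spokes[OF ij a] .
    have c: "\<beta> \<in> idx S" "c \<in> arrows X" "dchart c = sdom R i" "src c = src a" "cchart c = sdom S \<beta>"
      using * by (auto simp: spoke_def)
    have c': "\<gamma> \<in> idx S" "c' \<in> arrows X" "dchart c' = sdom R j" "src c' = tgt X a" "cchart c' = sdom S \<gamma>"
      using * by (auto simp: spoke_def)
    let ?b = "c' \<bullet>\<^bsub>X\<^esub> (a \<bullet>\<^bsub>X\<^esub> ainv X c)"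
    have b: "?b \<in> arrows X" "src ?b = tgt X c" using a c c' by simp_all
    have db: "dchart ?b = sdom S \<beta>" "cchart ?b = sdom S \<gamma>" using c c' by simp_all
    have "?b \<bullet>\<^bsub>X\<^esub> c = c' \<bullet>\<^bsub>X\<^esub> a" using a c c' by (simp add: X.assoc)
    then have 1: "sar B (d \<gamma>) (d \<beta>) ?b \<bullet>\<^bsub>Y\<^esub> sar B (d \<beta>) (e i) c = sar B (d \<gamma>) (e j) c' \<bullet>\<^bsub>Y\<^esub> sar B (e j) (e i) a"
      using gf_comp[OF F de(1)[OF ij(1)] dd(1)[OF c(1)] dd(1)[OF c'(1)] c(2) b(1)]
        gf_comp[OF F de(1)[OF ij(1)] de(1)[OF ij(2)] dd(1)[OF c'(1)] a(1) c'(2)] b db c c' a de(2) dd(2) ij by simp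
    have y: "sar B (d \<gamma>) (e j) c' \<in> arrows Y" "sar B (e j) (e i) a \<in> arrows Y" 
        "src (sar B (d \<gamma>) (e j) c') = tgt Y (sar B (e j) (e i) a)"
    proof -
      have p: "dchart c' = sdom B (e j)" "cchart c' = sdom B (d \<gamma>)" "dchart a = sdom B (e i)" "cchart a = sdom B (e j)"
        using c' a de(2)[OF ij(1)] de(2)[OF ij(2)] dd(2)[OF c'(1)] by simp_all
      have "apt c' = snd (tgt X a)" using c'(4) by (metis arrow_simps(2))
      then show "sar B (d \<gamma>) (e j) c' \<in> arrows Y" "sar B (e j) (e i) a \<in> arrows Y"
        "src (sar B (d \<gamma>) (e j) c') = tgt Y (sar B (e j) (e i) a)"
        using gf_sar[OF F de(1)[OF ij(2)] dd(1)[OF c'(1)] c'(2) p(1,2)]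
          gf_sar[OF F de(1)[OF ij(1)] de(1)[OF ij(2)] a(1) p(3,4)] by simp_all
    qed
    have "sar ext j i a = ainv Y (sar B (d \<gamma>) (e j) c') \<bullet>\<^bsub>Y\<^esub> (sar B (d \<gamma>) (d \<beta>) ?b \<bullet>\<^bsub>Y\<^esub> sar B (d \<beta>) (e i) c)"
      unfolding *(3) via_hub_def n[OF ij(1) c(1-3)] n[OF ij(2) c'(1-3)] embeds_sar[OF d c(1) c'(1) b(1) db] ..
    also have "\<dots> = sar B (e j) (e i) a" unfolding 1 using y by simp
    finally show "sar ext j i a = sar R j i a" using embeds_sar[OF e ij a] by simp
  qed (use gf_charts[OF FR] in auto)
qed

lemma system_cover:
  assumes "system X Y S" "U \<in> basics X"
  shows "U \<subseteq> (\<Union>\<beta>\<in>idx S. sdom S \<beta>)"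
  using openin_subset[OF X.basics_open[OF assms(2)]] assms(1) unfolding system_def by simp

text \<open>
  Both \<open>R\<close> and \<open>Q\<close> are extensions along bridges to \<open>S\<close>, which is where the charts of \<open>S\<close> have to cover.
\<close>

lemma bridged_trans:
  assumes S: "system X Y S" and RS: "bridged X Y R S" and SQ: "bridged X Y S Q"
  shows "bridged X Y R Q"
proof -
  obtain B where B: "local_system X Y B" "embeds X Inl R B" "embeds X Inr S B" using RS unfolding bridged_def by blast
  obtain C where C: "local_system X Y C" "embeds X Inl S C" "embeds X Inr Q C" using SQ unfolding bridged_def by blast
  have cR: "sdom R i \<subseteq> (\<Union>\<beta>\<in>idx S. sdom S \<beta>)" if "i \<in> idx R" for i
    using system_cover[OF S gf_charts(1)[OF local_system_gf[OF bridged_local(1)[OF RS]] that]] .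
  have cQ: "sdom Q i \<subseteq> (\<Union>\<beta>\<in>idx S. sdom S \<beta>)" if "i \<in> idx Q" for i
    using system_cover[OF S gf_charts(1)[OF local_system_gf[OF bridged_local(2)[OF SQ]] that]] .
  note b = bridges_of_embeds[OF B cR] and c = bridges_of_embeds[OF C(1,3,2) cQ]
  obtain D where D: "local_system X Y D" 
    "embeds X Inl (bridges.ext X Y S (idx R) (sdom R) (scod R) (smap R)
     (\<lambda>i \<beta> a. Arrow (scod R i) (smap R i (apt a)) (stran B (Inr \<beta>) (Inl i) (alab a)) (scod S \<beta>))) D"
    "embeds X Inr (bridges.ext X Y S (idx Q) (sdom Q) (scod Q) (smap Q)
     (\<lambda>i \<beta> a. Arrow (scod Q i) (smap Q i (apt a)) (stran C (Inl \<beta>) (Inr i) (alab a)) (scod S \<beta>))) D"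
    using ext_bridged[OF b(1) c(1)] unfolding bridged_def by blast
  show ?thesis by (rule bridgedI[OF D(1) embeds_trans[OF b(2) D(2)] embeds_trans[OF c(2) D(3)]])
qed

end


section \<open>Refinements and isomorphisms of systems\<close>

context orbi
begin

text \<open>
  Over a basic open set contained in \<open>V\<close> the only component of the intersection is the set itself, and
  its chart is connected.
\<close>

lemma full_domain:
  assumes U: "U \<in> basics X" "V \<in> basics X" and UV: "U \<subseteq> V" and \<xi>: "\<xi> \<in> Tran X U V"
  shows "tdom X U V \<xi> = pts X U"
proof -
  interpret U: g_struct "subtopology T U" "chart X U" by (rule chart_gs[OF U(1)])
  obtain W where W: "W \<in> components_in X (U \<inter> V)" "tdom X U V \<xi> \<in> hat_components (chart X U) W"
    using Tran_domain[OF U \<xi>] by metis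
  have "W = U" using component_of_connected[OF basics_connected[OF U(1)]] W(1) UV unfolding components_in_def
    by (simp add: inf.absorb1)
  moreover have "{x \<in> pts X U. proj (chart X U) x \<in> U} = pts X U" using proj_pts[OF U(1)] by blast
  ultimately have "tdom X U V \<xi> \<in> connected_components_of (subtopology (hat (chart X U)) (pts X U))"
    using W(2) by (simp add: hat_components_def)
  moreover have "connectedin (hat (chart X U)) (pts X U)" using U.hat_connected by (simp add: connectedin_topspace)
  ultimately show ?thesis using component_of_connected by blast
qed

text \<open>
  The translate of a component by \<open>g\<close> is a component, and it meets the original one.
\<close>

lemma stab_of_point:
  assumes U: "U \<in> basics X" "V \<in> basics X" and \<xi>: "\<xi> \<in> Tran X U V"
    and g: "g \<in> carrier (gp X U)" and x: "x \<in> tdom X U V \<xi>" "act (chart X U) g x \<in> tdom X U V \<xi>"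
  shows "g \<in> stab (chart X U) (tdom X U V \<xi>)"
proof -
  interpret U: g_struct "subtopology T U" "chart X U" by (rule chart_gs[OF U(1)])
  obtain W where W: "tdom X U V \<xi> \<in> hat_components (chart X U) W"
    using Tran_domain[OF U \<xi>] by metis
  have "act (chart X U) g ` tdom X U V \<xi> = tdom X U V \<xi>"
    using component_unique[OF U.act_image_hat_component[OF W g, unfolded hat_components_def]
        W[unfolded hat_components_def] imageI[OF x(1)] x(2)] .
  then show ?thesis using g by (simp add: stab_def stabilizer_def)
qed

lemma ainv_agrp:
  assumes "U \<in> basics X" "g \<in> carrier (gp X U)" "x \<in> pts X U"
  shows "ainv X (agrp X U g x) = agrp X U (inv\<^bsub>gp X U\<^esub> g) (act (chart X U) g x)"
proof -
  interpret U: g_struct "subtopology T U" "chart X U" by (rule chart_gs[OF assms(1)])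
  interpret group "gp X U" by (rule U.group_grp)
  show ?thesis
  proof (rule ivt_unique)
    show "agrp X U (inv\<^bsub>gp X U\<^esub> g) (act (chart X U) g x) \<bullet>\<^bsub>X\<^esub> agrp X U g x = aid X (src (agrp X U g x))"
      using assms by (simp add: agrp_comp aid_def)
  qed (use assms agrp_in_arrows[of U] in auto)
qed

text \<open>
  This provides the transition maps \<open>\<imath>'\<^sub>i\<close> of a refinement. The base points of \<open>K\<close> lie in one component of
  \<open>V \<inter> W\<close>, so \<open>K\<close> lies in one component of its preimage, and some germ ends there.
\<close>

lemma transition_onto_connected:
  assumes U: "V \<in> basics X" "W \<in> basics X" and K: "connectedin (hat (chart X W)) K" "y \<in> K"
    and KV: "\<And>x. x \<in> K \<Longrightarrow> proj (chart X W) x \<in> V"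
  obtains \<xi> where "\<xi> \<in> Tran X V W" "K \<subseteq> tmap X V W \<xi> ` tdom X V W \<xi>"
proof -
  interpret W: g_struct "subtopology T W" "chart X W" by (rule chart_gs[OF U(2)])
  have Kp: "K \<subseteq> pts X W" using K(1) connectedin_subset_topspace by blast
  obtain z where z: "z \<in> pts X V" "proj (chart X V) z = proj (chart X W) y"
    using proj_pts[OF U(1)] KV[OF K(2)] by (metis imageE)
  obtain a where a: "a \<in> arrows X" "src a = (V, z)" "tgt X a = (W, y)"
    using arrow_exists[OF U z(1) _ z(2)] Kp K(2) by blast
  have ch: "dchart a = V" "cchart a = W" "apt a = z" using a(2,3) by (auto simp: src_def tgt_def)
  have \<xi>: "alab a \<in> Tran X V W" "z \<in> tdom X V W (alab a)" "tmap X V W (alab a) z = y"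
    using a ch by (auto simp: in_arrows tgt_def)
  obtain C where C: "C \<in> components_in X (V \<inter> W)" 
    "tmap X V W (alab a) ` tdom X V W (alab a) \<in> hat_components (chart X W) C" "openin (subtopology T W) C"
    using Tran_domain[OF U \<xi>(1)] by metis
  have yr: "y \<in> tmap X V W (alab a) ` tdom X V W (alab a)" using \<xi> by blast
  have yC: "proj (chart X W) y \<in> C" by (rule W.hat_component_props(5)[OF C(2,3) yr])
  have "connectedin (subtopology T W) (proj (chart X W) ` K)"
    using connectedin_continuous_map_image[OF W.proj_continuous K(1)] .
  then have c: "connectedin T (proj (chart X W) ` K)" "proj (chart X W) ` K \<subseteq> W"
    by (auto simp: connectedin_subtopology)
  have "proj (chart X W) ` K \<subseteq> C"
    by (rule component_maximal[OF C(1)[unfolded components_in_def] c(1) _ imageI[OF K(2)] yC]) (use c(2) KV in blast)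
  then have "K \<subseteq> {x \<in> pts X W. proj (chart X W) x \<in> C}" using Kp by blast
  from component_maximal[OF C(2)[unfolded hat_components_def] K(1) this K(2) yr] show thesis
    using that[OF \<xi>(1)] by blast
qed

end

context orbi_pair
begin

text \<open>
  Two lifts of a point to charts are joined by a germ. The functor carries it to a germ between their
  images, whose endpoints lie over the same point.
\<close>

lemma base_map_eq:
  assumes S: "germ_functor X Y S" and \<alpha>: "\<alpha> \<in> idx S" and z: "z \<in> pts X (sdom S \<alpha>)"
  shows "base_map X Y S (proj (chart X (sdom S \<alpha>)) z) = proj (chart Y (scod S \<alpha>)) (smap S \<alpha> z)"
  unfolding base_map_def
proof (rule the_equality)
  show "\<exists>\<alpha>'\<in>idx S. \<exists>z'\<in>pts X (sdom S \<alpha>'). proj (chart X (sdom S \<alpha>')) z' = proj (chart X (sdom S \<alpha>)) z \<and>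
      proj (chart Y (scod S \<alpha>)) (smap S \<alpha> z) = proj (chart Y (scod S \<alpha>')) (smap S \<alpha>' z')"
    using \<alpha> z by blast
  fix y assume "\<exists>\<alpha>'\<in>idx S. \<exists>z'\<in>pts X (sdom S \<alpha>'). proj (chart X (sdom S \<alpha>')) z' = proj (chart X (sdom S \<alpha>)) z \<and>
      y = proj (chart Y (scod S \<alpha>')) (smap S \<alpha>' z')"
  then obtain \<beta> w where w: "\<beta> \<in> idx S" "w \<in> pts X (sdom S \<beta>)" "proj (chart X (sdom S \<beta>)) w = proj (chart X (sdom S \<alpha>)) z"
    "y = proj (chart Y (scod S \<beta>)) (smap S \<beta> w)" by blast
  obtain a where a: "a \<in> arrows X" "src a = (sdom S \<alpha>, z)" "tgt X a = (sdom S \<beta>, w)"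
    using X.arrow_exists[OF gf_charts(1)[OF S \<alpha>] gf_charts(1)[OF S w(1)] z w(2) w(3)[symmetric]] by metis
  have ch: "dchart a = sdom S \<alpha>" "cchart a = sdom S \<beta>" "apt a = z" using a(2,3) by (auto simp: src_def tgt_def)
  note s = gf_sar[OF S \<alpha> w(1) a(1) ch(1,2)]
  have "proj (chart Y (scod S \<beta>)) (smap S \<beta> w) = proj (chart Y (scod S \<alpha>)) (smap S \<alpha> z)"
    using s Y.proj_tmap[of "scod S \<alpha>" "scod S \<beta>" "stran S \<beta> \<alpha> (alab a)" "smap S \<alpha> z"] gf_charts(2)[OF S \<alpha>] gf_charts(2)[OF S w(1)]
      a(3) ch by (simp add: sar_def in_arrows tgt_def)
  then show "y = proj (chart Y (scod S \<alpha>)) (smap S \<alpha> z)" using w(4) by simp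
qed

lemma base_map_in_scod:
  assumes S: "germ_functor X Y S" and \<alpha>: "\<alpha> \<in> idx S" and x: "x \<in> sdom S \<alpha>"
  shows "base_map X Y S x \<in> scod S \<alpha>"
proof -
  note c = gf_charts[OF S \<alpha>]
  obtain z where z: "z \<in> pts X (sdom S \<alpha>)" "proj (chart X (sdom S \<alpha>)) z = x" using X.proj_pts[OF c(1)] x by (metis imageE)
  then show ?thesis using base_map_eq[OF S \<alpha> z(1)] Y.proj_pts[OF c(2)] c(4)[OF z(1)] by blast
qed

lemma base_map_embeds:
  assumes B: "germ_functor X Y B" and S: "germ_functor X Y S" and e: "embeds X e S B" and \<alpha>: "\<alpha> \<in> idx S" and x: "x \<in> sdom S \<alpha>"
  shows "base_map X Y B x = base_map X Y S x"
proof -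
  note d = embedsD[OF e \<alpha>]
  obtain z where z: "z \<in> pts X (sdom S \<alpha>)" "proj (chart X (sdom S \<alpha>)) z = x"
    using X.proj_pts[OF gf_charts(1)[OF S \<alpha>]] x by (metis imageE)
  then show ?thesis using base_map_eq[OF S \<alpha> z(1)] base_map_eq[OF B d(1), of z] d by simp
qed

lemma base_map_bridged:
  assumes b: "bridged X Y R S" and i: "i \<in> idx R" "x \<in> sdom R i" and \<alpha>: "\<alpha> \<in> idx S" "x \<in> sdom S \<alpha>"
  shows "base_map X Y R x = base_map X Y S x"
proof -
  obtain B where B: "local_system X Y B" "embeds X Inl R B" "embeds X Inr S B" using b unfolding bridged_def by blast
  note F = local_system_gf[OF B(1)] local_system_gf[OF bridged_local(1)[OF b]] local_system_gf[OF bridged_local(2)[OF b]]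
  show ?thesis using base_map_embeds[OF F(1,2) B(2) i] base_map_embeds[OF F(1,3) B(3) \<alpha>] by simp
qed

text \<open>
  The hub is an extension along its own values.
\<close>

lemma ext_bridged_hub:
  assumes br: "bridges X Y S I U V f N s n" and S: "local_system X Y S"
  shows "bridged X Y (bridges.ext X Y S I U V f n) S"
proof -
  have e: "embeds X (\<lambda>i. i) S S" by (simp add: embeds_def)
  note c = bridges_of_embeds[OF S e e, of, OF UN_upper]
  obtain B where B: "local_system X Y B" "embeds X Inl (bridges.ext X Y S I U V f n) B"
    "embeds X Inr (bridges.ext X Y S (idx S) (sdom S) (scod S) (smap S)
     (\<lambda>i \<beta> a. Arrow (scod S i) (smap S i (apt a)) (stran S \<beta> i (alab a)) (scod S \<beta>))) B"
    using ext_bridged[OF br c(1)] unfolding bridged_def by blast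
  show ?thesis by (rule bridgedI[OF B(1,2) embeds_trans[OF c(2) B(3)]])
qed

end

text \<open>
  The choices that determine a refinement of \<open>S\<close> over the charts \<open>U i\<close>, \<open>V i\<close>. They are turned into bridges
  to \<open>S\<close>: a germ \<open>a\<close> from \<open>U i\<close> to a chart of \<open>S\<close> goes to \<open>S (a \<bullet> \<imath>\<^sub>i\<^sup>-\<^sup>1) \<bullet> \<imath>'\<^sub>i\<close>. The extension along them is the
  refinement.
\<close>

locale refining = orbi_pair X Y for X Y :: "('x, 'p, 'g, 't) orbispace" +
  fixes S :: "('x, 'p, 't, 'j) system" and I :: "'i set" and \<theta> :: "'i \<Rightarrow> 'j" and U V :: "'i \<Rightarrow> 'x set"
    and \<iota> \<iota>' :: "'i \<Rightarrow> 't"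
  assumes S: "local_system X Y S"
    and \<theta>: "i \<in> I \<Longrightarrow> \<theta> i \<in> idx S"
    and U: "i \<in> I \<Longrightarrow> U i \<in> basics X" and V: "i \<in> I \<Longrightarrow> V i \<in> basics Y"
    and U_subset: "i \<in> I \<Longrightarrow> U i \<subseteq> sdom S (\<theta> i)"
    and \<iota>: "i \<in> I \<Longrightarrow> \<iota> i \<in> Tran X (U i) (sdom S (\<theta> i))"
    and \<iota>': "i \<in> I \<Longrightarrow> \<iota>' i \<in> Tran Y (V i) (scod S (\<theta> i))"
    and range: "\<lbrakk>i \<in> I; x \<in> pts X (U i)\<rbrakk> \<Longrightarrow> smap S (\<theta> i) (tmap X (U i) (sdom S (\<theta> i)) (\<iota> i) x) \<in>
      tmap Y (V i) (scod S (\<theta> i)) (\<iota>' i) ` tdom Y (V i) (scod S (\<theta> i)) (\<iota>' i)"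
begin

lemmas F = local_system_gf[OF S]

definition F0 :: "'i \<Rightarrow> 'p \<Rightarrow> 'p" where
  "F0 i x = smap S (\<theta> i) (tmap X (U i) (sdom S (\<theta> i)) (\<iota> i) x)"

definition f :: "'i \<Rightarrow> 'p \<Rightarrow> 'p" where
  "f i x = tmap Y (scod S (\<theta> i)) (V i) (tran_inv Y (V i) (scod S (\<theta> i)) (\<iota>' i)) (F0 i x)"

definition A :: "'i \<Rightarrow> 'p \<Rightarrow> ('x, 'p, 't) arrow" where "A i x = Arrow (U i) x (\<iota> i) (sdom S (\<theta> i))"

definition A' :: "'i \<Rightarrow> 'p \<Rightarrow> ('x, 'p, 't) arrow" where "A' i x = Arrow (V i) (f i x) (\<iota>' i) (scod S (\<theta> i))"

definition m :: "'i \<Rightarrow> 'j \<Rightarrow> ('x, 'p, 't) arrow \<Rightarrow> ('x, 'p, 't) arrow" where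
  "m i \<beta> a = sar S \<beta> (\<theta> i) (a \<bullet>\<^bsub>X\<^esub> ainv X (A i (apt a))) \<bullet>\<^bsub>Y\<^esub> A' i (apt a)"

text \<open>
  The label of the germ \<open>m i \<beta> a\<close> has to be a function of the label of \<open>a\<close> alone, so it is read off at an
  arbitrary point.
\<close>

definition N :: "'i \<Rightarrow> 'j \<Rightarrow> 't \<Rightarrow> 't" where
  "N i \<beta> \<xi> = alab (m i \<beta> (Arrow (U i) (SOME x. x \<in> tdom X (U i) (sdom S \<beta>) \<xi>) \<xi> (sdom S \<beta>)))"

definition n :: "'i \<Rightarrow> 'j \<Rightarrow> ('x, 'p, 't) arrow \<Rightarrow> ('x, 'p, 't) arrow" where
  "n i \<beta> a = Arrow (V i) (f i (apt a)) (N i \<beta> (alab a)) (scod S \<beta>)"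

definition s :: "'i \<Rightarrow> 'g \<Rightarrow> 'g" where
  "s i g = tiso Y (scod S (\<theta> i)) (V i) (tran_inv Y (V i) (scod S (\<theta> i)) (\<iota>' i))
     (sgrp X Y S (\<theta> i) (tiso X (U i) (sdom S (\<theta> i)) (\<iota> i) g))"

lemma charts:
  assumes "i \<in> I"
  shows "sdom S (\<theta> i) \<in> basics X" "scod S (\<theta> i) \<in> basics Y"
  using gf_charts(1,2)[OF F \<theta>[OF assms]] .

lemma domain: "i \<in> I \<Longrightarrow> tdom X (U i) (sdom S (\<theta> i)) (\<iota> i) = pts X (U i)"
  using X.full_domain[OF U charts(1) U_subset \<iota>] .

lemma A_arrow:
  assumes "i \<in> I" "x \<in> pts X (U i)"
  shows "A i x \<in> arrows X" "tgt X (A i x) = (sdom S (\<theta> i), tmap X (U i) (sdom S (\<theta> i)) (\<iota> i) x)"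
  using assms U charts \<iota> domain by (auto simp: A_def in_arrows tgt_def)

lemma A_simps [simp]: "src (A i x) = (U i, x)" "dchart (A i x) = U i" "cchart (A i x) = sdom S (\<theta> i)" "apt (A i x) = x"
  "src (A' i x) = (V i, f i x)" "dchart (A' i x) = V i" "cchart (A' i x) = scod S (\<theta> i)" "apt (A' i x) = f i x"
  by (simp_all add: A_def A'_def)

lemma tmap_\<iota>_pts: "\<lbrakk>i \<in> I; x \<in> pts X (U i)\<rbrakk> \<Longrightarrow> tmap X (U i) (sdom S (\<theta> i)) (\<iota> i) x \<in> pts X (sdom S (\<theta> i))"
  using X.tmap_in_pts(2)[OF U charts(1) \<iota>] domain by blast

text \<open>
  If \<open>y\<close> is the preimage under \<open>\<imath>'\<^sub>i\<close> of the point \<open>F0 i x\<close>, then inverting the germ of \<open>\<imath>'\<^sub>i\<close> at \<open>y\<close> shows \<open>f i x = y\<close>.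
\<close>

lemma A'_arrow:
  assumes i: "i \<in> I" and x: "x \<in> pts X (U i)"
  shows "A' i x \<in> arrows Y" "tgt Y (A' i x) = (scod S (\<theta> i), F0 i x)" "f i x \<in> pts Y (V i)"
    "ainv Y (A' i x) = Arrow (scod S (\<theta> i)) (F0 i x) (tran_inv Y (V i) (scod S (\<theta> i)) (\<iota>' i)) (V i)"
proof -
  obtain y where y: "y \<in> tdom Y (V i) (scod S (\<theta> i)) (\<iota>' i)" "F0 i x = tmap Y (V i) (scod S (\<theta> i)) (\<iota>' i) y"
    using range[OF assms] unfolding F0_def by blast
  let ?a = "Arrow (V i) y (\<iota>' i) (scod S (\<theta> i))"
  have a: "?a \<in> arrows Y" "tgt Y ?a = (scod S (\<theta> i), F0 i x)" using y V[OF i] charts[OF i] \<iota>'[OF i]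
    by (auto simp: in_arrows tgt_def)
  have iv: "ainv Y ?a = Arrow (scod S (\<theta> i)) (F0 i x) (tran_inv Y (V i) (scod S (\<theta> i)) (\<iota>' i)) (V i)"
    using a(2) by (simp add: ainv_def)
  have "tgt Y (ainv Y ?a) = (V i, y)" using a(1) by simp
  then have "f i x = y" unfolding iv by (simp add: tgt_def f_def)
  then have "A' i x = ?a" by (simp add: A'_def)
  then show "A' i x \<in> arrows Y" "tgt Y (A' i x) = (scod S (\<theta> i), F0 i x)" "f i x \<in> pts Y (V i)"
    "ainv Y (A' i x) = Arrow (scod S (\<theta> i)) (F0 i x) (tran_inv Y (V i) (scod S (\<theta> i)) (\<iota>' i)) (V i)"
    using a iv Y.arrow_pts(3)[OF a(1)] \<open>f i x = y\<close> by auto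
qed

lemma F0_continuous:
  assumes i: "i \<in> I"
  shows "continuous_map (hat (chart X (U i))) (hat (chart Y (scod S (\<theta> i)))) (F0 i)"
proof -
  have "continuous_map (hat (chart X (U i))) (hat (chart X (sdom S (\<theta> i)))) (tmap X (U i) (sdom S (\<theta> i)) (\<iota> i))"
    using X.csec_tmap_continuous[OF U[OF i] charts(1)[OF i] \<iota>[OF i], of _ "\<lambda>x. x"] domain[OF i] continuous_map_id
    by (simp add: id_def)
  from continuous_map_compose[OF this gf_charts(3)[OF F \<theta>[OF i]]] show ?thesis
    by (rule continuous_map_eq) (simp add: F0_def)
qed

lemma f_continuous:
  assumes i: "i \<in> I"
  shows "continuous_map (hat (chart X (U i))) (hat (chart Y (V i))) (f i)"
proof -
  note t = Y.tran_inv_props(1,2)[OF V[OF i] charts(2)[OF i] \<iota>'[OF i]]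
  have "continuous_map (hat (chart X (U i))) (hat (chart Y (V i)))
     (\<lambda>x. tmap Y (scod S (\<theta> i)) (V i) (tran_inv Y (V i) (scod S (\<theta> i)) (\<iota>' i)) (F0 i x))"
    using Y.csec_tmap_continuous[OF charts(2)[OF i] V[OF i] t(1) F0_continuous[OF i]] t(2) range[OF i]
    by (simp add: F0_def)
  then show ?thesis by (rule continuous_map_eq) (simp add: f_def)
qed

lemma m_props:
  assumes i: "i \<in> I" and \<beta>: "\<beta> \<in> idx S" and a: "a \<in> arrows X" "dchart a = U i" "cchart a = sdom S \<beta>"
  shows "a \<bullet>\<^bsub>X\<^esub> ainv X (A i (apt a)) \<in> arrows X" "src (a \<bullet>\<^bsub>X\<^esub> ainv X (A i (apt a))) = tgt X (A i (apt a))"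
    "tgt X (a \<bullet>\<^bsub>X\<^esub> ainv X (A i (apt a))) = tgt X a"
    "m i \<beta> a \<in> arrows Y" "src (m i \<beta> a) = (V i, f i (apt a))" "tgt Y (m i \<beta> a) = (scod S \<beta>, smap S \<beta> (snd (tgt X a)))"
proof -
  have x: "apt a \<in> pts X (U i)" using X.arrow_pts[OF a(1)] a(2) by simp
  have sa: "src a = (U i, apt a)" using a(2) by (simp add: src_def)
  note A = A_arrow[OF i x] and A' = A'_arrow[OF i x]
  show b: "a \<bullet>\<^bsub>X\<^esub> ainv X (A i (apt a)) \<in> arrows X" "src (a \<bullet>\<^bsub>X\<^esub> ainv X (A i (apt a))) = tgt X (A i (apt a))"
    "tgt X (a \<bullet>\<^bsub>X\<^esub> ainv X (A i (apt a))) = tgt X a"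
    using a A sa by simp_all
  note s = gf_sar[OF F \<theta>[OF i] \<beta> b(1)]
  show "m i \<beta> a \<in> arrows Y" "src (m i \<beta> a) = (V i, f i (apt a))" "tgt Y (m i \<beta> a) = (scod S \<beta>, smap S \<beta> (snd (tgt X a)))"
    using s A A' a b by (simp_all add: m_def F0_def)
qed

text \<open>
  As \<open>a\<close> moves over the connected domain of its transition map, all factors of \<open>m i \<beta> a\<close> have constant
  labels.
\<close>

lemma n_eq:
  assumes i: "i \<in> I" and \<beta>: "\<beta> \<in> idx S" and a: "a \<in> arrows X" "dchart a = U i" "cchart a = sdom S \<beta>"
  shows "n i \<beta> a = m i \<beta> a"
proof -
  obtain x \<xi> where ax: "a = Arrow (U i) x \<xi> (sdom S \<beta>)" using a by (cases a) auto
  have \<xi>: "\<xi> \<in> Tran X (U i) (sdom S \<beta>)" "x \<in> tdom X (U i) (sdom S \<beta>) \<xi>" using a(1) ax by (auto simp: in_arrows)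
  let ?D = "tdom X (U i) (sdom S \<beta>) \<xi>" let ?Z = "subtopology (hat (chart X (U i))) ?D"
  let ?a = "\<lambda>x. Arrow (U i) x \<xi> (sdom S \<beta>)"
  note b = gf_charts(1)[OF F \<beta>]
  note D = X.tdom_props[OF U[OF i] b \<xi>(1)]
  have cZ: "connected_space ?Z" using D(2) by (simp add: connectedin_def)
  have tZ: "topspace ?Z = ?D" using D(4) by auto
  have ne: "topspace ?Z \<noteq> {}" using D(3) tZ by simp
  have ca: "X.csec ?Z ?a" by (rule X.csec_Arrow[OF U[OF i] b \<xi>(1)]) simp
  have cA: "X.csec ?Z (A i)" unfolding A_def
    by (rule X.csec_Arrow[OF U[OF i] charts(1)[OF i] \<iota>[OF i]]) (use D(4) domain[OF i] in simp)
  have ar: "?a y \<in> arrows X" "y \<in> pts X (U i)" if "y \<in> ?D" for y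
    using X.csec_in_arrows[OF ca] that tZ D(4) by auto
  have "X.csec ?Z (\<lambda>y. ?a y \<bullet>\<^bsub>X\<^esub> ainv X (A i y))"
    by (rule X.csec_comp[OF cZ X.csec_inv[OF cA] ca]) (use A_arrow[OF i] ar tZ in simp)
  then have cS: "Y.csec ?Z (\<lambda>y. sar S \<beta> (\<theta> i) (?a y \<bullet>\<^bsub>X\<^esub> ainv X (A i y)))"
    by (rule csec_sar[OF F \<theta>[OF i] \<beta> _ ne]) simp
  have cA': "Y.csec ?Z (A' i)"
  proof (rule Y.csecI[OF V[OF i] charts(2)[OF i] \<iota>'[OF i]])
    show "continuous_map ?Z (hat (chart Y (V i))) (f i)"
      using f_continuous[OF i] continuous_map_from_subtopology by blast
    show "f i y \<in> tdom Y (V i) (scod S (\<theta> i)) (\<iota>' i)" if "y \<in> topspace ?Z" for y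
      using A'_arrow(1)[OF i ar(2)] that tZ by (simp add: A'_def in_arrows)
  qed (simp add: A'_def)
  have "Y.csec ?Z (\<lambda>y. m i \<beta> (?a y))"
    unfolding m_def arrow.sel
  proof (rule Y.csec_comp[OF cZ cA' cS])
    fix y assume "y \<in> topspace ?Z"
    then have y: "y \<in> ?D" using tZ by simp
    show "src (sar S \<beta> (\<theta> i) (?a y \<bullet>\<^bsub>X\<^esub> ainv X (A i y))) = tgt Y (A' i y)"
      using A'_arrow[OF i ar(2)[OF y]] A_arrow[OF i ar(2)[OF y]] by (simp add: F0_def)
  qed
  moreover have "(SOME x. x \<in> ?D) \<in> ?D" using \<xi>(2) by (rule someI)
  ultimately have "alab (m i \<beta> (?a (SOME x. x \<in> ?D))) = alab (m i \<beta> (?a x))"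
    using X.csec_label Y.csec_label \<xi>(2) tZ by metis
  then have "N i \<beta> \<xi> = alab (m i \<beta> a)" unfolding N_def ax .
  moreover have "dchart (m i \<beta> a) = V i" "cchart (m i \<beta> a) = scod S \<beta>" "apt (m i \<beta> a) = f i x"
    using m_props(5,6)[OF i \<beta> a] ax by (auto simp: src_def tgt_def)
  ultimately show ?thesis unfolding n_def ax by (cases "m i \<beta> (Arrow (U i) x \<xi> (sdom S \<beta>))") simp
qed

text \<open>
  A group element \<open>g\<close> of \<open>U i\<close> passes through \<open>\<imath>\<^sub>i\<close>, the functor \<open>S\<close> and the inverse of \<open>\<imath>'\<^sub>i\<close>. The last step
  needs that its image \<open>k\<close> under the first two stabilizes the range of \<open>\<imath>'\<^sub>i\<close>; it does, because it carries
  the point \<open>F0 i x\<close> of this range to another of its points, namely the one that belongs to \<open>g x\<close>.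
\<close>

lemma act_props:
  assumes i: "i \<in> I" and g: "g \<in> carrier (gp X (U i))" and x: "x \<in> pts X (U i)"
  defines "h \<equiv> tiso X (U i) (sdom S (\<theta> i)) (\<iota> i) g"
  shows "h \<in> carrier (gp X (sdom S (\<theta> i)))"
    "A i (act (chart X (U i)) g x) \<bullet>\<^bsub>X\<^esub> agrp X (U i) g x = agrp X (sdom S (\<theta> i)) h (tmap X (U i) (sdom S (\<theta> i)) (\<iota> i) x) \<bullet>\<^bsub>X\<^esub> A i x"
    "sgrp X Y S (\<theta> i) h \<in> carrier (gp Y (scod S (\<theta> i)))"
    "sgrp X Y S (\<theta> i) h \<in> stab (chart Y (scod S (\<theta> i))) (tdom Y (scod S (\<theta> i)) (V i) (tran_inv Y (V i) (scod S (\<theta> i)) (\<iota>' i)))"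
    "s i g \<in> carrier (gp Y (V i))"
    "f i (act (chart X (U i)) g x) = act (chart Y (V i)) (s i g) (f i x)"
    "A' i (act (chart X (U i)) g x) \<bullet>\<^bsub>Y\<^esub> agrp Y (V i) (s i g) (f i x) = agrp Y (scod S (\<theta> i)) (sgrp X Y S (\<theta> i) h) (F0 i x) \<bullet>\<^bsub>Y\<^esub> A' i x"
proof -
  interpret U: g_struct "subtopology X.T (U i)" "chart X (U i)" by (rule X.chart_gs[OF U[OF i]])
  let ?gx = "act (chart X (U i)) g x" and ?t = "tmap X (U i) (sdom S (\<theta> i)) (\<iota> i)"
  let ?\<zeta> = "tran_inv Y (V i) (scod S (\<theta> i)) (\<iota>' i)" and ?k = "sgrp X Y S (\<theta> i) h"
  have gx: "?gx \<in> pts X (U i)" using g x by simp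
  have gst: "g \<in> stab (chart X (U i)) (tdom X (U i) (sdom S (\<theta> i)) (\<iota> i))"
    by (rule X.stab_of_point[OF U[OF i] charts(1)[OF i] \<iota>[OF i] g, of x]) (use gx x domain[OF i] in simp_all)
  show h: "h \<in> carrier (gp X (sdom S (\<theta> i)))" unfolding h_def by (rule X.tiso_closed[OF U[OF i] charts(1)[OF i] \<iota>[OF i] gst])
  show c: "A i ?gx \<bullet>\<^bsub>X\<^esub> agrp X (U i) g x = agrp X (sdom S (\<theta> i)) h (?t x) \<bullet>\<^bsub>X\<^esub> A i x"
    unfolding A_def h_def by (rule X.stab_commute[OF U[OF i] charts(1)[OF i] \<iota>[OF i] _ gst]) (use x domain[OF i] in simp)
  note ag = X.agrp_in_arrows[OF U[OF i] g x] and ah = X.agrp_in_arrows[OF charts(1)[OF i] h tmap_\<iota>_pts[OF i x]]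
  have "tgt X (A i ?gx \<bullet>\<^bsub>X\<^esub> agrp X (U i) g x) = tgt X (agrp X (sdom S (\<theta> i)) h (?t x) \<bullet>\<^bsub>X\<^esub> A i x)" using c by simp
  then have th: "?t ?gx = act (chart X (sdom S (\<theta> i))) h (?t x)"
    using A_arrow[OF i gx] A_arrow[OF i x] ag ah by simp
  show k: "?k \<in> carrier (gp Y (scod S (\<theta> i)))" by (rule gf_agrp(1)[OF F \<theta>[OF i] h])
  have Fk: "F0 i ?gx = act (chart Y (scod S (\<theta> i))) ?k (F0 i x)"
    unfolding F0_def th by (rule gf_agrp(4)[OF F \<theta>[OF i] h tmap_\<iota>_pts[OF i x]])
  note ti = Y.tran_inv_props(1,2)[OF V[OF i] charts(2)[OF i] \<iota>'[OF i]]
  have Fd: "F0 i y \<in> tdom Y (scod S (\<theta> i)) (V i) ?\<zeta>" if "y \<in> pts X (U i)" for y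
    using range[OF i that] ti(2) by (simp add: F0_def)
  show kst: "?k \<in> stab (chart Y (scod S (\<theta> i))) (tdom Y (scod S (\<theta> i)) (V i) ?\<zeta>)"
    by (rule Y.stab_of_point[OF charts(2)[OF i] V[OF i] ti(1) k Fd[OF x]]) (use Fd[OF gx] Fk in simp)
  show sg: "s i g \<in> carrier (gp Y (V i))" unfolding s_def h_def[symmetric]
    by (rule Y.tiso_closed[OF charts(2)[OF i] V[OF i] ti(1) kst])
  note A'x = A'_arrow[OF i x] and A'gx = A'_arrow[OF i gx]
  note ak = Y.agrp_in_arrows[OF charts(2)[OF i] k, of "F0 i x"] and as = Y.agrp_in_arrows[OF V[OF i] sg A'x(3)]
  have Fp: "F0 i x \<in> pts Y (scod S (\<theta> i))" using Y.arrow_pts(4)[OF A'x(1)] A'x(2) by simp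
  have cm: "ainv Y (A' i ?gx) \<bullet>\<^bsub>Y\<^esub> agrp Y (scod S (\<theta> i)) ?k (F0 i x) = agrp Y (V i) (s i g) (f i x) \<bullet>\<^bsub>Y\<^esub> ainv Y (A' i x)"
    using Y.stab_commute[OF charts(2)[OF i] V[OF i] ti(1) Fd[OF x] kst] A'x(4) A'gx(4) Fk
    by (simp add: s_def h_def f_def)
  have "tgt Y (ainv Y (A' i ?gx) \<bullet>\<^bsub>Y\<^esub> agrp Y (scod S (\<theta> i)) ?k (F0 i x)) = tgt Y (agrp Y (V i) (s i g) (f i x) \<bullet>\<^bsub>Y\<^esub> ainv Y (A' i x))"
    using cm by simp
  then show fs: "f i ?gx = act (chart Y (V i)) (s i g) (f i x)"
    using A'x(1-3) A'gx(1-3) ak[OF Fp] as Fk by simp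
  have "A' i ?gx \<bullet>\<^bsub>Y\<^esub> ((agrp Y (V i) (s i g) (f i x) \<bullet>\<^bsub>Y\<^esub> ainv Y (A' i x)) \<bullet>\<^bsub>Y\<^esub> A' i x) =
      A' i ?gx \<bullet>\<^bsub>Y\<^esub> ((ainv Y (A' i ?gx) \<bullet>\<^bsub>Y\<^esub> agrp Y (scod S (\<theta> i)) ?k (F0 i x)) \<bullet>\<^bsub>Y\<^esub> A' i x)"
    using cm by simp
  then show "A' i ?gx \<bullet>\<^bsub>Y\<^esub> agrp Y (V i) (s i g) (f i x) = agrp Y (scod S (\<theta> i)) ?k (F0 i x) \<bullet>\<^bsub>Y\<^esub> A' i x"
    using A'x(1-3) A'gx(1-3) ak[OF Fp] as Fk fs by (simp add: Y.assoc)
qed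

lemma s_continuous:
  assumes i: "i \<in> I"
  shows "continuous_map (grp_top (chart X (U i))) (grp_top (chart Y (V i))) (s i)"
proof -
  interpret U: g_struct "subtopology X.T (U i)" "chart X (U i)" by (rule X.chart_gs[OF U[OF i]])
  let ?\<zeta> = "tran_inv Y (V i) (scod S (\<theta> i)) (\<iota>' i)"
  obtain x where x: "x \<in> pts X (U i)" using X.pts_nonempty[OF U[OF i]] by blast
  have "stab (chart X (U i)) (tdom X (U i) (sdom S (\<theta> i)) (\<iota> i)) = carrier (gp X (U i))"
    using X.stab_of_point[OF U[OF i] charts(1)[OF i] \<iota>[OF i], of _ x] x domain[OF i] X.stab_subset[of "chart X (U i)"]
    by (intro equalityI subsetI) (auto simp: subset_iff)
  then have "continuous_map (grp_top (chart X (U i))) (grp_top (chart X (sdom S (\<theta> i)))) (tiso X (U i) (sdom S (\<theta> i)) (\<iota> i))"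
    using X.tiso_continuous[OF U[OF i] charts(1)[OF i] \<iota>[OF i]] by (simp flip: U.topspace_grp_top)
  from continuous_map_compose[OF this local_system_sgrp_continuous[OF S \<theta>[OF i]]]
  have "continuous_map (grp_top (chart X (U i))) (subtopology (grp_top (chart Y (scod S (\<theta> i))))
      (stab (chart Y (scod S (\<theta> i))) (tdom Y (scod S (\<theta> i)) (V i) ?\<zeta>)))
     (sgrp X Y S (\<theta> i) \<circ> tiso X (U i) (sdom S (\<theta> i)) (\<iota> i))"
    using act_props(4)[OF i _ x] by (auto simp: continuous_map_in_subtopology U.topspace_grp_top)
  from continuous_map_compose[OF this Y.tiso_continuous[OF charts(2)[OF i] V[OF i] Y.tran_inv_props(1)[OF V[OF i] charts(2)[OF i] \<iota>'[OF i]]]]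
  show ?thesis by (rule continuous_map_eq) (simp add: s_def)
qed

lemma refining_bridges: "bridges X Y S I U V f N s n"
proof (unfold_locales, goal_cases)
  case 1 show ?case by (rule F)
next
  case (2 i) then show ?case using U_subset \<theta> by blast
next
  case (3 i) then show ?case by (rule U)
next
  case (4 i) then show ?case by (rule V)
next
  case (5 i) then show ?case by (rule f_continuous)
next
  case (6 i) show ?case by (rule n_def)
next
  case (7 i \<beta> a) then show ?case using n_eq m_props(4) by simp
next
  case (8 i \<beta> a) then show ?case using n_eq m_props(6) by simp
next
  case (9 i \<beta> \<gamma> a b)
  have x: "apt a \<in> pts X (U i)" using X.arrow_pts[OF 9(4)] 9(5) by simp
  note A = A_arrow[OF 9(1) x] and A' = A'_arrow[OF 9(1) x]
  have sa: "src a = (U i, apt a)" using 9(5) by (simp add: src_def)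
  have db: "dchart b = sdom S \<beta>" using 9 by (simp add: src_eq_tgt)
  note mp = m_props[OF 9(1,2,4,5,6)]
  let ?c = "a \<bullet>\<^bsub>X\<^esub> ainv X (A i (apt a))"
  note sc = gf_sar[OF F \<theta>[OF 9(1)] 9(2) mp(1)] and sb = gf_sar[OF F 9(2,3,7) db 9(8)]
  have "(b \<bullet>\<^bsub>X\<^esub> a) \<bullet>\<^bsub>X\<^esub> ainv X (A i (apt a)) = b \<bullet>\<^bsub>X\<^esub> ?c" using 9 A sa by (simp add: X.assoc)
  then have "m i \<gamma> (b \<bullet>\<^bsub>X\<^esub> a) = (sar S \<gamma> \<beta> b \<bullet>\<^bsub>Y\<^esub> sar S \<beta> (\<theta> i) ?c) \<bullet>\<^bsub>Y\<^esub> A' i (apt a)"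
    unfolding m_def using gf_comp[OF F \<theta>[OF 9(1)] 9(2,3) mp(1) 9(7)] 9 mp by simp
  also have "\<dots> = sar S \<gamma> \<beta> b \<bullet>\<^bsub>Y\<^esub> m i \<beta> a"
    unfolding m_def
  proof (rule Y.assoc)
    show "src (sar S \<gamma> \<beta> b) = tgt Y (sar S \<beta> (\<theta> i) ?c)"
    proof -
      have "apt b = snd (tgt X a)" using 9(9) by (metis arrow_simps(2))
      then show ?thesis using sc(2) mp(3) 9(6) by simp
    qed
  qed (use sb sc A A' 9 in \<open>simp_all add: F0_def\<close>)
  finally show ?case using n_eq[OF 9(1,2,4,5,6)] n_eq[OF 9(1,3), of "b \<bullet>\<^bsub>X\<^esub> a"] 9 by simp
next
  case (10 i) then show ?case by (rule s_continuous)
next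
  case (11 i g x) then show ?case by (rule act_props(6))
next
  case (12 i g x \<beta> a)
  interpret U: g_struct "subtopology X.T (U i)" "chart X (U i)" by (rule X.chart_gs[OF U[OF 12(1)]])
  let ?gx = "act (chart X (U i)) g x" and ?ag = "agrp X (U i) g x"
  let ?h = "tiso X (U i) (sdom S (\<theta> i)) (\<iota> i) g" and ?tx = "tmap X (U i) (sdom S (\<theta> i)) (\<iota> i) x"
  have gx: "?gx \<in> pts X (U i)" using 12 by simp
  note ap = act_props[OF 12(1-3)]
  note ag = X.agrp_in_arrows[OF U[OF 12(1)] 12(2,3)]
  note ah = X.agrp_in_arrows[OF charts(1)[OF 12(1)] ap(1) tmap_\<iota>_pts[OF 12(1,3)]]
  note as = Y.agrp_in_arrows[OF V[OF 12(1)] ap(5)]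
  note Ax = A_arrow[OF 12(1,3)] and Agx = A_arrow[OF 12(1) gx] and A'x = A'_arrow[OF 12(1,3)] and A'gx = A'_arrow[OF 12(1) gx]
  have da: "dchart a = U i" "apt a = ?gx" using 12(6) by (auto simp: src_def)
  note mp = m_props[OF 12(1,4,5) da(1) 12(7), unfolded da(2)]
  have b: "a \<bullet>\<^bsub>X\<^esub> ?ag \<in> arrows X" using 12 ag by simp
  have "ainv X (A i ?gx) \<bullet>\<^bsub>X\<^esub> ((A i ?gx \<bullet>\<^bsub>X\<^esub> ?ag) \<bullet>\<^bsub>X\<^esub> ainv X (A i x)) = ainv X (A i ?gx) \<bullet>\<^bsub>X\<^esub> ((agrp X (sdom S (\<theta> i)) ?h ?tx \<bullet>\<^bsub>X\<^esub> A i x) \<bullet>\<^bsub>X\<^esub> ainv X (A i x))"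
    using ap(2) by simp
  moreover have "tgt X (A i ?gx) = (sdom S (\<theta> i), act (chart X (sdom S (\<theta> i))) ?h ?tx)"
  proof -
    have "tgt X (A i ?gx \<bullet>\<^bsub>X\<^esub> ?ag) = tgt X (agrp X (sdom S (\<theta> i)) ?h ?tx \<bullet>\<^bsub>X\<^esub> A i x)" using ap(2) by simp
    then show ?thesis using Ax Agx ag ah by simp
  qed
  ultimately have e: "?ag \<bullet>\<^bsub>X\<^esub> ainv X (A i x) = ainv X (A i ?gx) \<bullet>\<^bsub>X\<^esub> agrp X (sdom S (\<theta> i)) ?h ?tx"
    using Ax Agx(1) ag ah by (simp add: X.assoc)
  have t: "tgt X (A i ?gx) = tgt X (agrp X (sdom S (\<theta> i)) ?h ?tx)" 
    using \<open>tgt X (A i ?gx) = (sdom S (\<theta> i), act (chart X (sdom S (\<theta> i))) ?h ?tx)\<close> ah by simp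
  have "(a \<bullet>\<^bsub>X\<^esub> ?ag) \<bullet>\<^bsub>X\<^esub> ainv X (A i x) = a \<bullet>\<^bsub>X\<^esub> (ainv X (A i ?gx) \<bullet>\<^bsub>X\<^esub> agrp X (sdom S (\<theta> i)) ?h ?tx)"
    unfolding e[symmetric] by (rule X.assoc) (use 12 ag Ax in auto)
  also have "\<dots> = (a \<bullet>\<^bsub>X\<^esub> ainv X (A i ?gx)) \<bullet>\<^bsub>X\<^esub> agrp X (sdom S (\<theta> i)) ?h ?tx"
    by (rule X.assoc[symmetric]) (use 12 ah Agx(1) t in \<open>simp_all\<close>)
  finally have "sar S \<beta> (\<theta> i) ((a \<bullet>\<^bsub>X\<^esub> ?ag) \<bullet>\<^bsub>X\<^esub> ainv X (A i x)) =
      sar S \<beta> (\<theta> i) (a \<bullet>\<^bsub>X\<^esub> ainv X (A i ?gx)) \<bullet>\<^bsub>Y\<^esub> agrp Y (scod S (\<theta> i)) (sgrp X Y S (\<theta> i) ?h) (F0 i x)"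
    using gf_comp[OF F \<theta>[OF 12(1)] \<theta>[OF 12(1)] 12(4) ah(1) mp(1)] mp(2) t 12(7)
      gf_agrp(3)[OF F \<theta>[OF 12(1)] ap(1), of ?tx] by (simp add: F0_def)
  then have "m i \<beta> (a \<bullet>\<^bsub>X\<^esub> ?ag) = (sar S \<beta> (\<theta> i) (a \<bullet>\<^bsub>X\<^esub> ainv X (A i ?gx)) \<bullet>\<^bsub>Y\<^esub>
      agrp Y (scod S (\<theta> i)) (sgrp X Y S (\<theta> i) ?h) (F0 i x)) \<bullet>\<^bsub>Y\<^esub> A' i x"
    unfolding m_def by simp
  also have "\<dots> = sar S \<beta> (\<theta> i) (a \<bullet>\<^bsub>X\<^esub> ainv X (A i ?gx)) \<bullet>\<^bsub>Y\<^esub> (agrp Y (scod S (\<theta> i)) (sgrp X Y S (\<theta> i) ?h) (F0 i x) \<bullet>\<^bsub>Y\<^esub> A' i x)"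
  proof (rule Y.assoc)
    have Fp: "F0 i x \<in> pts Y (scod S (\<theta> i))" using Y.arrow_pts(4)[OF A'x(1)] A'x(2) by simp
    note ak = Y.agrp_in_arrows[OF charts(2)[OF 12(1)] ap(3) Fp]
    show "A' i x \<in> arrows Y" "agrp Y (scod S (\<theta> i)) (sgrp X Y S (\<theta> i) ?h) (F0 i x) \<in> arrows Y"
      "src (agrp Y (scod S (\<theta> i)) (sgrp X Y S (\<theta> i) ?h) (F0 i x)) = tgt Y (A' i x)"
      using A'x ak by simp_all
    show "sar S \<beta> (\<theta> i) (a \<bullet>\<^bsub>X\<^esub> ainv X (A i ?gx)) \<in> arrows Y"
      using gf_sar(1)[OF F \<theta>[OF 12(1)] 12(4) mp(1)] 12(7) by simp
    show "src (sar S \<beta> (\<theta> i) (a \<bullet>\<^bsub>X\<^esub> ainv X (A i ?gx))) = tgt Y (agrp Y (scod S (\<theta> i)) (sgrp X Y S (\<theta> i) ?h) (F0 i x))"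
      using ak(2) t ah gf_agrp(4)[OF F \<theta>[OF 12(1)] ap(1) tmap_\<iota>_pts[OF 12(1,3)]] by (simp add: F0_def)
  qed
  also have "\<dots> = m i \<beta> a \<bullet>\<^bsub>Y\<^esub> agrp Y (V i) (s i g) (f i x)"
    unfolding ap(7)[symmetric] m_def da(2)
    by (rule Y.assoc[symmetric]) (use as A'x A'gx ap(6) gf_sar[OF F \<theta>[OF 12(1)] 12(4) mp(1)] 12(7) Agx in \<open>simp_all add: F0_def\<close>)
  finally show ?case using n_eq[OF 12(1,4) b] n_eq[OF 12(1,4,5) da(1) 12(7)] 12 by simp
qed

definition refined :: "('x, 'p, 't, 'i) system" where "refined = bridges.ext X Y S I U V f n"

lemma refined_props: "local_system X Y refined" "idx refined = I" "sdom refined = U" "scod refined = V" "smap refined = f"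
  "bridged X Y refined S"
  unfolding refined_def
  using bridges.ext_local_system[OF refining_bridges] bridges.ext_simps[OF refining_bridges] ext_bridged_hub[OF refining_bridges S]
  by simp_all

text \<open>
  The germs of \<open>\<imath>\<^sub>i\<close> and \<open>\<imath>\<^sub>j\<close> may be used as the germs to the hub; their bridges are those of \<open>\<imath>'\<^sub>i\<close> and \<open>\<imath>'\<^sub>j\<close>.
\<close>

lemma sar_refined:
  assumes ij: "i \<in> I" "j \<in> I" and a: "a \<in> arrows X" "dchart a = U i" "cchart a = U j"
  defines "y \<equiv> snd (tgt X a)"
  shows "sar refined j i a =
    ainv Y (A' j y) \<bullet>\<^bsub>Y\<^esub> (sar S (\<theta> j) (\<theta> i) (A j y \<bullet>\<^bsub>X\<^esub> (a \<bullet>\<^bsub>X\<^esub> ainv X (A i (apt a)))) \<bullet>\<^bsub>Y\<^esub> A' i (apt a))"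
proof -
  interpret B: bridges X Y S I U V f N s n by (rule refining_bridges)
  have nA: "n k (\<theta> k) (A k z) = A' k z" if k: "k \<in> I" "z \<in> pts X (U k)" for k z
  proof -
    note A = A_arrow[OF k] and A' = A'_arrow[OF k]
    have "m k (\<theta> k) (A k z) = A' k z"
      using A A' gf_id[OF F \<theta>[OF k(1)] tmap_\<iota>_pts[OF k]] by (simp add: m_def F0_def)
    then show ?thesis using n_eq[OF k(1) \<theta>[OF k(1)] A(1)] by simp
  qed
  have x: "apt a \<in> pts X (U i)" and y: "y \<in> pts X (U j)" using X.arrow_pts[OF a(1)] a by (simp_all add: y_def)
  have "sar B.ext j i a = B.via_hub j i (\<theta> j) (\<theta> i) (A j y) a (A i (apt a))"
  proof (rule B.sar_ext[OF a])
    show "B.spoke i (src a) (\<theta> i) (A i (apt a))" using ij A_arrow[OF ij(1) x] \<theta> a by (auto simp: B.spoke_def src_def)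
    show "B.spoke j (tgt X a) (\<theta> j) (A j y)" using ij A_arrow[OF ij(2) y] \<theta> a by (auto simp: B.spoke_def y_def tgt_def)
  qed
  then show ?thesis unfolding refined_def B.via_hub_def nA[OF ij(1) x] nA[OF ij(2) y] .
qed

end


context orbi_pair
begin

text \<open>
  The conditions on a refinement say that \<open>R\<close> agrees with the extension along the bridges that belong
  to its \<open>\<imath>\<close> and \<open>\<imath>'\<close>.
\<close>

lemma refinement_bridged:
  assumes S: "local_system X Y S" and ref: "refinement X Y S \<theta> R"
  shows "bridged X Y R S"
proof -
  have R: "local_system X Y R"
    and idx: "\<And>i. i \<in> idx R \<Longrightarrow> \<theta> i \<in> idx S \<and> sdom R i \<subseteq> sdom S (\<theta> i)"
    using ref unfolding refinement_def by auto
  note FR = local_system_gf[OF R]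
  obtain \<iota> \<iota>' where i1: "\<And>i. i \<in> idx R \<Longrightarrow>
           \<iota> i \<in> Tran X (sdom R i) (sdom S (\<theta> i)) \<and>
           \<iota>' i \<in> Tran Y (scod R i) (scod S (\<theta> i)) \<and>
           (\<forall>x\<in>pts X (sdom R i).
              smap S (\<theta> i) (tmap X (sdom R i) (sdom S (\<theta> i)) (\<iota> i) x) \<in>
                tmap Y (scod R i) (scod S (\<theta> i)) (\<iota>' i) ` tdom Y (scod R i) (scod S (\<theta> i)) (\<iota>' i) \<and>
              smap R i x =
                tmap Y (scod S (\<theta> i)) (scod R i) (tran_inv Y (scod R i) (scod S (\<theta> i)) (\<iota>' i))
                  (smap S (\<theta> i) (tmap X (sdom R i) (sdom S (\<theta> i)) (\<iota> i) x)))"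
    and i2: "\<And>i j a x. \<lbrakk>i\<in>idx R; j\<in>idx R; a\<in>Tran X (sdom R i) (sdom R j); x\<in>tdom X (sdom R i) (sdom R j) a\<rbrakk> \<Longrightarrow>
             stran R j i a =
               (let U\<^sub>i = sdom R i; U\<^sub>j = sdom R j; V\<^sub>i = sdom S (\<theta> i); V\<^sub>j = sdom S (\<theta> j);
                    U\<^sub>i' = scod R i; U\<^sub>j' = scod R j; V\<^sub>i' = scod S (\<theta> i); V\<^sub>j' = scod S (\<theta> j);
                    b = tcomp X V\<^sub>i U\<^sub>i V\<^sub>j (tcomp X U\<^sub>i U\<^sub>j V\<^sub>j (\<iota> j) a x) (tran_inv X U\<^sub>i V\<^sub>i (\<iota> i))
                          (tmap X U\<^sub>i V\<^sub>i (\<iota> i) x)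
                in tcomp Y U\<^sub>i' V\<^sub>j' U\<^sub>j' (tran_inv Y U\<^sub>j' V\<^sub>j' (\<iota>' j))
                     (tcomp Y U\<^sub>i' V\<^sub>i' V\<^sub>j' (stran S (\<theta> j) (\<theta> i) b) (\<iota>' i) (smap R i x))
                     (smap R i x))"
  proof (rule exE[OF ref[unfolded refinement_def, THEN conjunct2, THEN conjunct2]], erule exE, goal_cases)
    case (1 \<iota> \<iota>')
    show ?case
      by (rule 1(1)[OF 1(2)[THEN conjunct1, THEN bspec] 1(2)[THEN conjunct2, THEN bspec, THEN bspec, THEN bspec, THEN bspec]])
  qed
  interpret refining X Y S "idx R" \<theta> "sdom R" "scod R" \<iota> \<iota>'
    using S idx gf_charts[OF FR] i1 by unfold_locales blast+
  have f: "f i x = smap R i x" if "i \<in> idx R" "x \<in> pts X (sdom R i)" for i x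
    using i1[OF that(1)] that(2) by (simp add: f_def F0_def)
  have "embeds X (\<lambda>i. i) R refined"
  proof (rule embedsI)
    fix i j a assume ij: "i \<in> idx R" "j \<in> idx R" and a: "a \<in> arrows X" "dchart a = sdom R i" "cchart a = sdom R j"
    obtain x \<xi> where ax: "a = Arrow (sdom R i) x \<xi> (sdom R j)" using a by (cases a) auto
    have \<xi>: "\<xi> \<in> Tran X (sdom R i) (sdom R j)" "x \<in> tdom X (sdom R i) (sdom R j) \<xi>" using a(1) ax by (auto simp: in_arrows)
    have x: "x \<in> pts X (sdom R i)" using X.arrow_pts[OF a(1)] ax by simp
    have y: "snd (tgt X a) \<in> pts X (sdom R j)" using X.arrow_pts[OF a(1)] a by simp
    let ?y = "snd (tgt X a)"
    have "A j ?y \<bullet>\<^bsub>X\<^esub> (a \<bullet>\<^bsub>X\<^esub> ainv X (A i x)) = (A j ?y \<bullet>\<^bsub>X\<^esub> a) \<bullet>\<^bsub>X\<^esub> ainv X (A i x)"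
    proof (rule X.assoc[symmetric])
      have "src a = (sdom R i, x)" "tgt X a = (sdom R j, ?y)" using ax by (simp_all add: tgt_def)
      then show "ainv X (A i x) \<in> arrows X" "a \<in> arrows X" "A j ?y \<in> arrows X" "src a = tgt X (ainv X (A i x))" "src (A j ?y) = tgt X a"
        using A_arrow[OF ij(1) x] A_arrow[OF ij(2) y] a by simp_all
    qed
    then have "sar refined j i a = ainv Y (A' j ?y) \<bullet>\<^bsub>Y\<^esub> (sar S (\<theta> j) (\<theta> i) ((A j ?y \<bullet>\<^bsub>X\<^esub> a) \<bullet>\<^bsub>X\<^esub> ainv X (A i x)) \<bullet>\<^bsub>Y\<^esub> A' i x)"
      using sar_refined[OF ij a] ax by simp
    also have "\<dots> = sar R j i a"
      using i2[OF ij \<xi>] f[OF ij(1) x]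
      by (simp add: acomp_def ainv_def A_def A'_def sar_def tgt_def Let_def ax)
    finally show "sar refined j i a = sar R j i a" .
  qed (use gf_charts[OF FR] refined_props f in auto)
  moreover obtain B where "local_system X Y B" "embeds X Inl refined B" "embeds X Inr S B"
    using refined_props(6) unfolding bridged_def by blast
  ultimately show ?thesis using bridgedI embeds_trans by blast
qed

text \<open>
  Any transition map to the larger chart may serve as \<open>\<imath>\<^sub>i\<close>, and its value under the bridge as \<open>\<imath>'\<^sub>i\<close>. The
  formula for a refinement is then the functoriality of the bridge.
\<close>

lemma bridged_refinement:
  assumes b: "bridged X Y R S"
    and idx: "\<And>i. i \<in> idx R \<Longrightarrow> \<theta> i \<in> idx S \<and> sdom R i \<subseteq> sdom S (\<theta> i) \<and> base_map X Y S ` sdom R i \<subseteq> scod R i"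
  shows "refinement X Y S \<theta> R"
proof -
  note R = bridged_local(1)[OF b] and S = bridged_local(2)[OF b]
  note FR = local_system_gf[OF R] and FS = local_system_gf[OF S]
  obtain B where B: "local_system X Y B" "embeds X Inl R B" "embeds X Inr S B" using b unfolding bridged_def by blast
  note F = local_system_gf[OF B(1)] and dR = embedsD[OF B(2)] and dS = embedsD[OF B(3)]
  define \<iota> where "\<iota> i = (SOME \<xi>. \<xi> \<in> Tran X (sdom R i) (sdom S (\<theta> i)))" for i
  define \<iota>' where "\<iota>' i = stran B (Inr (\<theta> i)) (Inl i) (\<iota> i)" for i
  define A where "A i x = Arrow (sdom R i) x (\<iota> i) (sdom S (\<theta> i))" for i and x :: 'p
  define A' where "A' i x = Arrow (scod R i) (smap R i x) (\<iota>' i) (scod S (\<theta> i))" for i x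
  have \<theta>: "\<theta> i \<in> idx S" if "i \<in> idx R" for i using idx that by blast
  have \<iota>: "\<iota> i \<in> Tran X (sdom R i) (sdom S (\<theta> i))" if i: "i \<in> idx R" for i
  proof -
    have "sdom R i \<inter> sdom S (\<theta> i) \<noteq> {}" using X.basics_nonempty[OF gf_charts(1)[OF FR i]] idx[OF i] by blast
    then have "Tran X (sdom R i) (sdom S (\<theta> i)) \<noteq> {}"
      using X.Tran_nonempty[OF gf_charts(1)[OF FR i] gf_charts(1)[OF FS \<theta>[OF i]]] by simp
    then show ?thesis unfolding \<iota>_def by (metis someI_ex ex_in_conv)
  qed
  have A: "A i x \<in> arrows X" "tgt X (A i x) = (sdom S (\<theta> i), tmap X (sdom R i) (sdom S (\<theta> i)) (\<iota> i) x)"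
    "sar B (Inr (\<theta> i)) (Inl i) (A i x) = A' i x"
    "A' i x \<in> arrows Y" "tgt Y (A' i x) = (scod S (\<theta> i), smap S (\<theta> i) (tmap X (sdom R i) (sdom S (\<theta> i)) (\<iota> i) x))"
    if i: "i \<in> idx R" and x: "x \<in> pts X (sdom R i)" for i x
  proof -
    note U = gf_charts(1)[OF FR i] and V = gf_charts(1)[OF FS \<theta>[OF i]]
    show a: "A i x \<in> arrows X" "tgt X (A i x) = (sdom S (\<theta> i), tmap X (sdom R i) (sdom S (\<theta> i)) (\<iota> i) x)"
      using U V \<iota>[OF i] X.full_domain[OF U V _ \<iota>[OF i]] idx[OF i] x by (auto simp: A_def in_arrows tgt_def)
    show s: "sar B (Inr (\<theta> i)) (Inl i) (A i x) = A' i x"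
      using dR[OF i] dS[OF \<theta>[OF i]] x by (simp add: sar_def A_def A'_def \<iota>'_def)
    have p: "tmap X (sdom R i) (sdom S (\<theta> i)) (\<iota> i) x \<in> pts X (sdom S (\<theta> i))"
      using X.arrow_pts(4)[OF a(1)] a(2) by (simp add: A_def)
    show "A' i x \<in> arrows Y" "tgt Y (A' i x) = (scod S (\<theta> i), smap S (\<theta> i) (tmap X (sdom R i) (sdom S (\<theta> i)) (\<iota> i) x))"
      using gf_sar[OF F dR(1)[OF i] dS(1)[OF \<theta>[OF i]] a(1)] a(2) s dR[OF i] dS[OF \<theta>[OF i]] p by (simp_all add: A_def)
  qed
  have sA: "src (A i x) = (sdom R i, x)" "dchart (A i x) = sdom R i" "cchart (A i x) = sdom S (\<theta> i)" "apt (A i x) = x" for i x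
    by (simp_all add: A_def)
  have sA': "src (A' i x) = (scod R i, smap R i x)" "dchart (A' i x) = scod R i" "cchart (A' i x) = scod S (\<theta> i)" for i x
    by (simp_all add: A'_def)
  have P1: "\<iota> i \<in> Tran X (sdom R i) (sdom S (\<theta> i)) \<and> \<iota>' i \<in> Tran Y (scod R i) (scod S (\<theta> i)) \<and>
           (\<forall>x\<in>pts X (sdom R i).
              smap S (\<theta> i) (tmap X (sdom R i) (sdom S (\<theta> i)) (\<iota> i) x) \<in>
                tmap Y (scod R i) (scod S (\<theta> i)) (\<iota>' i) ` tdom Y (scod R i) (scod S (\<theta> i)) (\<iota>' i) \<and>
              smap R i x =
                tmap Y (scod S (\<theta> i)) (scod R i) (tran_inv Y (scod R i) (scod S (\<theta> i)) (\<iota>' i))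
                  (smap S (\<theta> i) (tmap X (sdom R i) (sdom S (\<theta> i)) (\<iota> i) x)))" if i: "i \<in> idx R" for i
  proof (intro conjI ballI)
    show "\<iota> i \<in> Tran X (sdom R i) (sdom S (\<theta> i))" by (rule \<iota>[OF i])
    obtain z where z: "z \<in> pts X (sdom R i)" using X.pts_nonempty[OF gf_charts(1)[OF FR i]] by blast
    show "\<iota>' i \<in> Tran Y (scod R i) (scod S (\<theta> i))" using A(4)[OF i z] by (simp add: in_arrows A'_def)
    fix x assume x: "x \<in> pts X (sdom R i)"
    let ?F = "smap S (\<theta> i) (tmap X (sdom R i) (sdom S (\<theta> i)) (\<iota> i) x)"
    have t: "?F = tmap Y (scod R i) (scod S (\<theta> i)) (\<iota>' i) (smap R i x)" using A(5)[OF i x] by (simp add: A'_def tgt_def)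
    moreover have "smap R i x \<in> tdom Y (scod R i) (scod S (\<theta> i)) (\<iota>' i)" using A(4)[OF i x] by (simp add: in_arrows A'_def)
    ultimately show "?F \<in> tmap Y (scod R i) (scod S (\<theta> i)) (\<iota>' i) ` tdom Y (scod R i) (scod S (\<theta> i)) (\<iota>' i)" by blast
    have "tgt Y (ainv Y (A' i x)) = src (A' i x)" using A(4)[OF i x] by simp
    then show "smap R i x = tmap Y (scod S (\<theta> i)) (scod R i) (tran_inv Y (scod R i) (scod S (\<theta> i)) (\<iota>' i)) ?F"
      using t by (simp add: tgt_def ainv_def A'_def)
  qed
  have P2: "stran R j i \<xi> =
               (let U\<^sub>i = sdom R i; U\<^sub>j = sdom R j; V\<^sub>i = sdom S (\<theta> i); V\<^sub>j = sdom S (\<theta> j);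
                    U\<^sub>i' = scod R i; U\<^sub>j' = scod R j; V\<^sub>i' = scod S (\<theta> i); V\<^sub>j' = scod S (\<theta> j);
                    b = tcomp X V\<^sub>i U\<^sub>i V\<^sub>j (tcomp X U\<^sub>i U\<^sub>j V\<^sub>j (\<iota> j) \<xi> x) (tran_inv X U\<^sub>i V\<^sub>i (\<iota> i))
                          (tmap X U\<^sub>i V\<^sub>i (\<iota> i) x)
                in tcomp Y U\<^sub>i' V\<^sub>j' U\<^sub>j' (tran_inv Y U\<^sub>j' V\<^sub>j' (\<iota>' j))
                     (tcomp Y U\<^sub>i' V\<^sub>i' V\<^sub>j' (stran S (\<theta> j) (\<theta> i) b) (\<iota>' i) (smap R i x))
                     (smap R i x))"
    if ij: "i \<in> idx R" "j \<in> idx R" and \<xi>: "\<xi> \<in> Tran X (sdom R i) (sdom R j)" "x \<in> tdom X (sdom R i) (sdom R j) \<xi>" for i j \<xi> x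
  proof -
    note Ui = gf_charts(1)[OF FR ij(1)] and Uj = gf_charts(1)[OF FR ij(2)]
    let ?a = "Arrow (sdom R i) x \<xi> (sdom R j)" and ?y = "tmap X (sdom R i) (sdom R j) \<xi> x"
    have a: "?a \<in> arrows X" "tgt X ?a = (sdom R j, ?y)" using Ui Uj \<xi> by (auto simp: in_arrows tgt_def)
    have x: "x \<in> pts X (sdom R i)" "?y \<in> pts X (sdom R j)" using X.tmap_in_pts[OF Ui Uj \<xi>] .
    note Ai = A[OF ij(1) x(1)] and Aj = A[OF ij(2) x(2)]
    let ?c = "(A j ?y \<bullet>\<^bsub>X\<^esub> ?a) \<bullet>\<^bsub>X\<^esub> ainv X (A i x)"
    have c: "?c \<in> arrows X" "src ?c = tgt X (A i x)" "?c \<bullet>\<^bsub>X\<^esub> A i x = A j ?y \<bullet>\<^bsub>X\<^esub> ?a"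
      using Ai(1) Aj(1) a by (simp_all add: sA X.assoc)
    have ch: "dchart ?c = sdom S (\<theta> i)" "cchart ?c = sdom S (\<theta> j)" by (simp_all add: sA)
    have 1: "sar S (\<theta> j) (\<theta> i) ?c \<bullet>\<^bsub>Y\<^esub> A' i x = A' j ?y \<bullet>\<^bsub>Y\<^esub> sar R j i ?a"
    proof -
      have "sar B (Inr (\<theta> j)) (Inl i) (?c \<bullet>\<^bsub>X\<^esub> A i x) = sar B (Inr (\<theta> j)) (Inr (\<theta> i)) ?c \<bullet>\<^bsub>Y\<^esub> sar B (Inr (\<theta> i)) (Inl i) (A i x)"
        by (rule gf_comp[OF F dR(1)[OF ij(1)] dS(1)[OF \<theta>[OF ij(1)]] dS(1)[OF \<theta>[OF ij(2)]] Ai(1) c(1) _ _ _ c(2)])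
          (use dR(2)[OF ij(1)] dS(2)[OF \<theta>[OF ij(1)]] dS(2)[OF \<theta>[OF ij(2)]] in \<open>simp_all add: sA\<close>)
      moreover have "sar B (Inr (\<theta> j)) (Inl i) (A j ?y \<bullet>\<^bsub>X\<^esub> ?a) = sar B (Inr (\<theta> j)) (Inl j) (A j ?y) \<bullet>\<^bsub>Y\<^esub> sar B (Inl j) (Inl i) ?a"
        by (rule gf_comp[OF F dR(1)[OF ij(1)] dR(1)[OF ij(2)] dS(1)[OF \<theta>[OF ij(2)]] a(1) Aj(1)])
          (use dR(2)[OF ij(1)] dR(2)[OF ij(2)] dS(2)[OF \<theta>[OF ij(2)]] a in \<open>simp_all add: sA\<close>)
      ultimately show ?thesis
        using c(3) Ai(3) Aj(3) embeds_sar[OF B(2) ij a(1)] embeds_sar[OF B(3) \<theta>[OF ij(1)] \<theta>[OF ij(2)] c(1) ch] by simp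
    qed
    have "sar R j i ?a = ainv Y (A' j ?y) \<bullet>\<^bsub>Y\<^esub> (A' j ?y \<bullet>\<^bsub>Y\<^esub> sar R j i ?a)"
      using gf_sar[OF FR ij a(1)] Aj(4) a(2) by (simp add: sA')
    also have "\<dots> = ainv Y (A' j ?y) \<bullet>\<^bsub>Y\<^esub> (sar S (\<theta> j) (\<theta> i) ?c \<bullet>\<^bsub>Y\<^esub> A' i x)" unfolding 1 ..
    finally have "stran R j i \<xi> = alab \<dots>" by (metis arrow.sel(3) sar_def)
    then show ?thesis by (simp add: acomp_def ainv_def A_def A'_def sar_def tgt_def Let_def)
  qed
  show ?thesis
    unfolding refinement_def
  proof (rule conjI[OF R], rule conjI)
    show "\<forall>i\<in>idx R. \<theta> i \<in> idx S \<and> sdom R i \<subseteq> sdom S (\<theta> i) \<and> base_map X Y S ` sdom R i \<subseteq> scod R i"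
      using idx by (rule ballI)
  qed (rule exI[of _ \<iota>], rule exI[of _ \<iota>'], rule conjI, (rule ballI, rule P1, assumption), (intro ballI, rule P2, assumption+))
qed

text \<open>
  As the chart of \<open>U i\<close> is connected, its image in the chart of \<open>scod S (\<theta> i)\<close> lies in the range of a
  single transition map from \<open>V i\<close>, which serves as \<open>\<imath>'\<^sub>i\<close>.
\<close>

lemma refine_exists:
  fixes I :: "'i set"
  assumes S: "local_system X Y S" and \<theta>: "\<And>i. i \<in> I \<Longrightarrow> \<theta> i \<in> idx S"
    and U: "\<And>i. i \<in> I \<Longrightarrow> U i \<in> basics X" "\<And>i. i \<in> I \<Longrightarrow> U i \<subseteq> sdom S (\<theta> i)"
    and V: "\<And>i. i \<in> I \<Longrightarrow> V i \<in> basics Y" "\<And>i. i \<in> I \<Longrightarrow> base_map X Y S ` U i \<subseteq> V i"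
  obtains R where "local_system X Y R" "idx R = I" "sdom R = U" "scod R = V" "bridged X Y R S"
proof -
  note F = local_system_gf[OF S]
  have "\<exists>\<iota> \<iota>'. \<iota> \<in> Tran X (U i) (sdom S (\<theta> i)) \<and> \<iota>' \<in> Tran Y (V i) (scod S (\<theta> i)) \<and>
    (\<forall>x\<in>pts X (U i). smap S (\<theta> i) (tmap X (U i) (sdom S (\<theta> i)) \<iota> x) \<in>
      tmap Y (V i) (scod S (\<theta> i)) \<iota>' ` tdom Y (V i) (scod S (\<theta> i)) \<iota>')" if i: "i \<in> I" for i
  proof -
    note c = gf_charts[OF F \<theta>[OF i]]
    interpret U: g_struct "subtopology X.T (U i)" "chart X (U i)" by (rule X.chart_gs[OF U(1)[OF i]])
    have "U i \<inter> sdom S (\<theta> i) \<noteq> {}" using X.basics_nonempty[OF U(1)[OF i]] U(2)[OF i] by blast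
    then obtain \<iota> where \<iota>: "\<iota> \<in> Tran X (U i) (sdom S (\<theta> i))"
      using X.Tran_nonempty[OF U(1)[OF i] c(1)] by blast
    note dom = X.full_domain[OF U(1)[OF i] c(1) U(2)[OF i] \<iota>]
    let ?t = "tmap X (U i) (sdom S (\<theta> i)) \<iota>"
    have "continuous_map (hat (chart X (U i))) (hat (chart X (sdom S (\<theta> i)))) ?t"
      using X.csec_tmap_continuous[OF U(1)[OF i] c(1) \<iota>, of _ "\<lambda>x. x"] dom continuous_map_id by (simp add: id_def)
    from continuous_map_compose[OF this c(3)]
    have conn: "connectedin (hat (chart Y (scod S (\<theta> i)))) ((smap S (\<theta> i) \<circ> ?t) ` pts X (U i))"
      using U.hat_connected connectedin_continuous_map_image connectedin_topspace by blast
    obtain z where z: "z \<in> pts X (U i)" using X.pts_nonempty[OF U(1)[OF i]] by blast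
    have "proj (chart Y (scod S (\<theta> i))) w \<in> V i" if w: "w \<in> (smap S (\<theta> i) \<circ> ?t) ` pts X (U i)" for w
    proof -
      obtain x where x: "x \<in> pts X (U i)" "w = smap S (\<theta> i) (?t x)"
        using w by auto
      have xp: "x \<in> tdom X (U i) (sdom S (\<theta> i)) \<iota>" using x(1) dom by simp
      have "proj (chart Y (scod S (\<theta> i))) w = base_map X Y S (proj (chart X (sdom S (\<theta> i))) (?t x))"
        using base_map_eq[OF F \<theta>[OF i] X.tmap_in_pts(2)[OF U(1)[OF i] c(1) \<iota> xp]] x(2) by simp
      also have "\<dots> = base_map X Y S (proj (chart X (U i)) x)" using X.proj_tmap[OF U(1)[OF i] c(1) \<iota> xp] by simp
      also have "\<dots> \<in> V i" using V(2)[OF i] X.proj_pts[OF U(1)[OF i]] x(1) by blast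
      finally show ?thesis .
    qed
    from Y.transition_onto_connected[OF V(1)[OF i] c(2) conn imageI[OF z] this]
    obtain \<iota>' where \<iota>': "\<iota>' \<in> Tran Y (V i) (scod S (\<theta> i))"
      "(smap S (\<theta> i) \<circ> ?t) ` pts X (U i) \<subseteq> tmap Y (V i) (scod S (\<theta> i)) \<iota>' ` tdom Y (V i) (scod S (\<theta> i)) \<iota>'" by blast
    then have "\<forall>x\<in>pts X (U i). smap S (\<theta> i) (?t x) \<in> tmap Y (V i) (scod S (\<theta> i)) \<iota>' ` tdom Y (V i) (scod S (\<theta> i)) \<iota>'"
      by (simp add: image_subset_iff)
    with \<iota> \<iota>'(1) show ?thesis by blast
  qed
  then obtain \<iota> \<iota>' where i: "\<And>i. i \<in> I \<Longrightarrow> \<iota> i \<in> Tran X (U i) (sdom S (\<theta> i)) \<and> \<iota>' i \<in> Tran Y (V i) (scod S (\<theta> i)) \<and>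
    (\<forall>x\<in>pts X (U i). smap S (\<theta> i) (tmap X (U i) (sdom S (\<theta> i)) (\<iota> i) x) \<in>
      tmap Y (V i) (scod S (\<theta> i)) (\<iota>' i) ` tdom Y (V i) (scod S (\<theta> i)) (\<iota>' i))" by metis
  interpret refining X Y S I \<theta> U V \<iota> \<iota>'
    using S \<theta> U V i by unfold_locales blast+
  show thesis using that[of refined] refined_props by blast
qed

text \<open>
  An isomorphism of systems is a refinement over the same charts, with \<open>\<imath>\<^sub>i = 1\<close> and \<open>\<imath>'\<^sub>i = \<delta>\<^sub>i\<^sup>-\<^sup>1\<close>.
\<close>

lemma system_iso_bridged:
  assumes R: "local_system X Y R" and Q: "local_system X Y Q" and iso: "system_iso X Y R Q"
  shows "bridged X Y R Q"
proof -
  note FR = local_system_gf[OF R] and FQ = local_system_gf[OF Q]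
  have ix: "idx Q = idx R" and ch: "\<And>i. i \<in> idx R \<Longrightarrow> sdom Q i = sdom R i \<and> scod Q i = scod R i"
    using iso unfolding system_iso_def by auto
  obtain \<delta> where \<delta>: "\<And>i. i \<in> idx R \<Longrightarrow> \<delta> i \<in> carrier (gp Y (scod R i))"
    and sm: "\<And>i x. i \<in> idx R \<Longrightarrow> x \<in> pts X (sdom R i) \<Longrightarrow> smap Q i x = act (chart Y (scod R i)) (\<delta> i) (smap R i x)"
    and st: "\<And>i j \<xi>. i \<in> idx R \<Longrightarrow> j \<in> idx R \<Longrightarrow> \<xi> \<in> Tran X (sdom R i) (sdom R j) \<Longrightarrow>
       stran Q j i \<xi> = twist Y (scod R i) (scod R j) (\<delta> j) (stran R j i \<xi>) (inv\<^bsub>gp Y (scod R i)\<^esub> \<delta> i)"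
    using iso unfolding system_iso_def by blast
  define \<iota> where "\<iota> i = gtran X (sdom R i) \<one>\<^bsub>gp X (sdom R i)\<^esub>" for i
  define \<iota>' where "\<iota>' i = gtran Y (scod R i) (inv\<^bsub>gp Y (scod R i)\<^esub> \<delta> i)" for i
  have one: "\<one>\<^bsub>gp X (sdom R i)\<^esub> \<in> carrier (gp X (sdom R i))" if "i \<in> idx R" for i
    using group.is_monoid[THEN monoid.one_closed, OF X.grp_chart[OF gf_charts(1)[OF FR that]]] .
  have di: "inv\<^bsub>gp Y (scod R i)\<^esub> \<delta> i \<in> carrier (gp Y (scod R i))" if "i \<in> idx R" for i
    using group.inv_closed[OF Y.grp_chart[OF gf_charts(2)[OF FR that]] \<delta>[OF that]] .
  have \<iota>x: "tmap X (sdom R i) (sdom R i) (\<iota> i) x = x" if "i \<in> idx R" "x \<in> pts X (sdom R i)" for i x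
    unfolding \<iota>_def using X.tmap_gtran[OF gf_charts(1)[OF FR that(1)] one[OF that(1)] that(2)]
      g_struct.act_one[OF X.chart_gs[OF gf_charts(1)[OF FR that(1)]] that(2)] by simp
  have \<iota>'x: "smap Q i x \<in> pts Y (scod R i)"
    "tmap Y (scod R i) (scod R i) (\<iota>' i) (smap Q i x) = smap R i x"
    if "i \<in> idx R" "x \<in> pts X (sdom R i)" for i x
  proof -
    show p: "smap Q i x \<in> pts Y (scod R i)" using gf_charts(4)[OF FQ, of i x] that ix ch by simp
    show "tmap Y (scod R i) (scod R i) (\<iota>' i) (smap Q i x) = smap R i x"
      unfolding \<iota>'_def using Y.tmap_gtran[OF gf_charts(2)[OF FR that(1)] di[OF that(1)] p] sm[OF that]
        g_struct.act_inv(1)[OF Y.chart_gs[OF gf_charts(2)[OF FR that(1)]] \<delta>[OF that(1)] gf_charts(4)[OF FR that]] by simp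
  qed
  interpret refining X Y R "idx R" "\<lambda>i. i" "sdom R" "scod R" \<iota> \<iota>'
  proof unfold_locales
    fix i assume i: "i \<in> idx R"
    show "\<iota> i \<in> Tran X (sdom R i) (sdom R i)" unfolding \<iota>_def by (rule X.gtran_in_Tran[OF gf_charts(1)[OF FR i] one[OF i]])
    show "\<iota>' i \<in> Tran Y (scod R i) (scod R i)" unfolding \<iota>'_def by (rule Y.gtran_in_Tran[OF gf_charts(2)[OF FR i] di[OF i]])
    fix x assume x: "x \<in> pts X (sdom R i)"
    have "tdom Y (scod R i) (scod R i) (\<iota>' i) = pts Y (scod R i)"
      unfolding \<iota>'_def by (rule Y.tdom_gtran[OF gf_charts(2)[OF FR i] di[OF i]])
    then show "smap R i (tmap X (sdom R i) (sdom R i) (\<iota> i) x) \<in> tmap Y (scod R i) (scod R i) (\<iota>' i) ` tdom Y (scod R i) (scod R i) (\<iota>' i)"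
      using \<iota>x[OF i x] \<iota>'x[OF i x] by (metis imageI)
  qed (use R gf_charts[OF FR] in auto)
  have Aid: "A i x = aid X (sdom R i, x)" for i x by (simp add: A_def aid_def agrp_def \<iota>_def)
  have f: "f i x = smap Q i x" if "i \<in> idx R" "x \<in> pts X (sdom R i)" for i x
  proof -
    have "act (chart Y (scod R i)) (inv\<^bsub>gp Y (scod R i)\<^esub> \<delta> i) (f i x) = smap R i x"
      using A'_arrow(2,3)[OF that] Y.tmap_gtran[OF gf_charts(2)[OF FR that(1)] di[OF that(1)]] \<iota>x[OF that]
      by (simp add: A'_def tgt_def \<iota>'_def F0_def)
    then show ?thesis using sm[OF that]
      g_struct.act_inv(2)[OF Y.chart_gs[OF gf_charts(2)[OF FR that(1)]] \<delta>[OF that(1)] A'_arrow(3)[OF that]] by simp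
  qed
  have A'g: "A' i x = agrp Y (scod R i) (inv\<^bsub>gp Y (scod R i)\<^esub> \<delta> i) (smap Q i x)" if "i \<in> idx R" "x \<in> pts X (sdom R i)" for i x
    using f[OF that] by (simp add: A'_def agrp_def \<iota>'_def)
  have "embeds X (\<lambda>i. i) Q refined"
  proof (rule embedsI)
    fix i j a assume "i \<in> idx Q" "j \<in> idx Q" and a': "a \<in> arrows X" "dchart a = sdom Q i" "cchart a = sdom Q j"
    then have ij: "i \<in> idx R" "j \<in> idx R" and a: "a \<in> arrows X" "dchart a = sdom R i" "cchart a = sdom R j"
      using ix ch by auto
    let ?y = "snd (tgt X a)" and ?x = "apt a"
    have x: "?x \<in> pts X (sdom R i)" "?y \<in> pts X (sdom R j)" using X.arrow_pts[OF a(1)] a by simp_all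
    note g = Y.grp_chart[OF gf_charts(2)[OF FR ij(2)]]
    note s = gf_sar[OF FR ij a]
    have ta: "tgt X a = (sdom R j, ?y)" using X.arrow_pts(5)[OF a(1)] a by simp
    have sa: "src a = (sdom R i, ?x)" using a by (simp add: src_def)
    have "A j ?y \<bullet>\<^bsub>X\<^esub> (a \<bullet>\<^bsub>X\<^esub> ainv X (A i ?x)) = a"
      using a(1) sa ta X.ivt_idn[OF a(1) sa] by (simp add: Aid)
    then have "sar refined j i a = ainv Y (A' j ?y) \<bullet>\<^bsub>Y\<^esub> (sar R j i a \<bullet>\<^bsub>Y\<^esub> A' i ?x)"
      using sar_refined[OF ij a] by simp
    also have "ainv Y (A' j ?y) = agrp Y (scod R j) (\<delta> j) (smap R j ?y)"
      using A'g[OF ij(2) x(2)] Y.ainv_agrp[OF gf_charts(2)[OF FR ij(2)] di[OF ij(2)] \<iota>'x(1)[OF ij(2) x(2)]]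
        group.inv_inv[OF g \<delta>[OF ij(2)]] sm[OF ij(2) x(2)]
        g_struct.act_inv(1)[OF Y.chart_gs[OF gf_charts(2)[OF FR ij(2)]] \<delta>[OF ij(2)] gf_charts(4)[OF FR ij(2) x(2)]] by simp
    also have "agrp Y (scod R j) (\<delta> j) (smap R j ?y) \<bullet>\<^bsub>Y\<^esub> (sar R j i a \<bullet>\<^bsub>Y\<^esub> A' i ?x) =
      Arrow (scod R i) (smap Q i ?x) (twist Y (scod R i) (scod R j) (\<delta> j) (stran R j i (alab a)) (inv\<^bsub>gp Y (scod R i)\<^esub> \<delta> i)) (scod R j)"
    proof -
      have e: "act (chart Y (scod R i)) (inv\<^bsub>gp Y (scod R i)\<^esub> \<delta> i) (smap Q i ?x) = smap R i ?x"
        using sm[OF ij(1) x(1)] g_struct.act_inv(1)[OF Y.chart_gs[OF gf_charts(2)[OF FR ij(1)]] \<delta>[OF ij(1)] gf_charts(4)[OF FR ij(1) x(1)]] by simp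
      have t: "stran R j i (alab a) \<in> Tran Y (scod R i) (scod R j)" "smap R i ?x \<in> tdom Y (scod R i) (scod R j) (stran R j i (alab a))"
        "tmap Y (scod R i) (scod R j) (stran R j i (alab a)) (smap R i ?x) = smap R j ?y"
        using s by (auto simp: sar_def in_arrows tgt_def)
      show ?thesis
        using Y.twist_arrow[OF gf_charts(2)[OF FR ij(1)] gf_charts(2)[OF FR ij(2)] t(1) di[OF ij(1)] \<delta>[OF ij(2)] \<iota>'x(1)[OF ij(1) x(1)]]
          e t A'g[OF ij(1) x(1)] by (simp add: sar_def)
    qed
    also have "\<dots> = sar Q j i a"
      using st[OF ij, of "alab a"] a ch[OF ij(1)] ch[OF ij(2)] by (simp add: sar_def in_arrows)
    finally show "sar refined j i a = sar Q j i a" .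
  qed (use refined_props f ix ch gf_charts[OF FR] in auto)
  moreover obtain B where "local_system X Y B" "embeds X Inl refined B" "embeds X Inr R B"
    using refined_props(6) unfolding bridged_def by blast
  ultimately show ?thesis using bridgedI embeds_trans by blast
qed

text \<open>
  The group element \<open>\<delta>\<^sub>i\<close> is the value of the bridge on the identity of the chart with index \<open>i\<close>, read as a
  transition map from its copy in \<open>R\<close> to its copy in \<open>Q\<close>.
\<close>

lemma bridged_system_iso:
  assumes b: "bridged X Y R Q" and ix: "idx Q = idx R"
    and ch: "\<And>i. i \<in> idx R \<Longrightarrow> sdom Q i = sdom R i" "\<And>i. i \<in> idx R \<Longrightarrow> scod Q i = scod R i"
  shows "system_iso X Y R Q"
proof -
  note FR = local_system_gf[OF bridged_local(1)[OF b]] and FQ = local_system_gf[OF bridged_local(2)[OF b]]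
  obtain B where B: "local_system X Y B" "embeds X Inl R B" "embeds X Inr Q B" using b unfolding bridged_def by blast
  note F = local_system_gf[OF B(1)] and dR = embedsD[OF B(2)] and dQ = embedsD[OF B(3), unfolded ix]
  define D where "D i x = sar B (Inr i) (Inl i) (aid X (sdom R i, x))" for i x
  have aid: "aid X (sdom R i, x) \<in> arrows X" "tgt X (aid X (sdom R i, x)) = (sdom R i, x)"
    "src (aid X (sdom R i, x)) = (sdom R i, x)" if "i \<in> idx R" "x \<in> pts X (sdom R i)" for i x
  proof -
    note U = gf_charts(1)[OF FR that(1)]
    note a = X.agrp_in_arrows[OF U group.is_monoid[THEN monoid.one_closed, OF X.grp_chart[OF U]] that(2)]
    then show "aid X (sdom R i, x) \<in> arrows X" "tgt X (aid X (sdom R i, x)) = (sdom R i, x)"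
      "src (aid X (sdom R i, x)) = (sdom R i, x)"
      using g_struct.act_one[OF X.chart_gs[OF U] that(2)] by (auto simp: aid_def)
  qed
  have D: "D i x \<in> arrows Y" "src (D i x) = (scod R i, smap R i x)" "tgt Y (D i x) = (scod R i, smap Q i x)"
    if i: "i \<in> idx R" and x: "x \<in> pts X (sdom R i)" for i x
    using gf_sar[OF F dR(1)[OF i] dQ(1)[OF i] aid(1)[OF i x]] aid(2)[OF i x] dR(2,3)[OF i] dR(4)[OF i x]
      dQ(2,3)[OF i] dQ(4)[OF i, of x] ch[OF i] x by (simp_all add: D_def)
  have "\<exists>\<delta>. \<delta> \<in> carrier (gp Y (scod R i)) \<and> (\<forall>x\<in>pts X (sdom R i). D i x = agrp Y (scod R i) \<delta> (smap R i x))"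
    if i: "i \<in> idx R" for i
  proof -
    obtain z where z: "z \<in> pts X (sdom R i)" using X.pts_nonempty[OF gf_charts(1)[OF FR i]] by blast
    have c: "dchart (D i x) = scod R i" "cchart (D i x) = scod R i" "apt (D i x) = smap R i x" if "x \<in> pts X (sdom R i)" for x
      using D(2,3)[OF i that] by (auto simp: src_def tgt_def)
    have l: "alab (D i x) = alab (D i z)" for x by (simp add: D_def sar_def aid_def)
    obtain \<delta> where \<delta>: "\<delta> \<in> carrier (gp Y (scod R i))" "D i z = agrp Y (scod R i) \<delta> (smap R i z)"
      using Y.arrow_in_group[OF D(1)[OF i z]] c[OF z] by metis
    have "D i x = agrp Y (scod R i) \<delta> (smap R i x)" if "x \<in> pts X (sdom R i)" for x
      using c[OF that] l[of x] \<delta>(2) by (cases "D i x") (simp add: agrp_def)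
    then show ?thesis using \<delta>(1) by blast
  qed
  then obtain \<delta> where \<delta>: "\<And>i. i \<in> idx R \<Longrightarrow> \<delta> i \<in> carrier (gp Y (scod R i))"
    "\<And>i x. i \<in> idx R \<Longrightarrow> x \<in> pts X (sdom R i) \<Longrightarrow> D i x = agrp Y (scod R i) (\<delta> i) (smap R i x)" by metis
  have sm: "smap Q i x = act (chart Y (scod R i)) (\<delta> i) (smap R i x)" if "i \<in> idx R" "x \<in> pts X (sdom R i)" for i x
    using D(3)[OF that] \<delta>(2)[OF that] Y.agrp_in_arrows(2)[OF gf_charts(2)[OF FR that(1)] \<delta>(1)[OF that(1)] gf_charts(4)[OF FR that]] by simp
  have "stran Q j i \<xi> = twist Y (scod R i) (scod R j) (\<delta> j) (stran R j i \<xi>) (inv\<^bsub>gp Y (scod R i)\<^esub> \<delta> i)"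
    if ij: "i \<in> idx R" "j \<in> idx R" and \<xi>: "\<xi> \<in> Tran X (sdom R i) (sdom R j)" for i j \<xi>
  proof -
    note Ui = gf_charts(1)[OF FR ij(1)] and Uj = gf_charts(1)[OF FR ij(2)]
    obtain x where x: "x \<in> tdom X (sdom R i) (sdom R j) \<xi>" using X.tdom_props(3)[OF Ui Uj \<xi>] by blast
    let ?a = "Arrow (sdom R i) x \<xi> (sdom R j)" and ?y = "tmap X (sdom R i) (sdom R j) \<xi> x"
    have a: "?a \<in> arrows X" "tgt X ?a = (sdom R j, ?y)" using Ui Uj \<xi> x by (auto simp: in_arrows tgt_def)
    note p = X.tmap_in_pts[OF Ui Uj \<xi> x]
    note ai = aid[OF ij(1) p(1)] and aj = aid[OF ij(2) p(2)]
    have "sar Q j i ?a \<bullet>\<^bsub>Y\<^esub> D i x = D j ?y \<bullet>\<^bsub>Y\<^esub> sar R j i ?a"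
    proof -
      have "sar B (Inr j) (Inl i) (?a \<bullet>\<^bsub>X\<^esub> aid X (sdom R i, x)) = sar B (Inr j) (Inr i) ?a \<bullet>\<^bsub>Y\<^esub> D i x" unfolding D_def
        by (rule gf_comp[OF F dR(1)[OF ij(1)] dQ(1)[OF ij(1)] dQ(1)[OF ij(2)] ai(1) a(1)])
          (use dR(2)[OF ij(1)] dQ(2)[OF ij(1)] dQ(2)[OF ij(2)] ch ij ai in simp_all)
      moreover have "sar B (Inr j) (Inl i) (aid X (sdom R j, ?y) \<bullet>\<^bsub>X\<^esub> ?a) = D j ?y \<bullet>\<^bsub>Y\<^esub> sar B (Inl j) (Inl i) ?a" unfolding D_def
        by (rule gf_comp[OF F dR(1)[OF ij(1)] dR(1)[OF ij(2)] dQ(1)[OF ij(2)] a(1) aj(1)])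
          (use dR(2)[OF ij(1)] dR(2)[OF ij(2)] dQ(2)[OF ij(2)] ch ij aj a in simp_all)
      moreover have "?a \<bullet>\<^bsub>X\<^esub> aid X (sdom R i, x) = ?a" "aid X (sdom R j, ?y) \<bullet>\<^bsub>X\<^esub> ?a = ?a" using a by simp_all
      moreover have "sar B (Inl j) (Inl i) ?a = sar R j i ?a" using embeds_sar[OF B(2) ij a(1)] by simp
      moreover have "sar B (Inr j) (Inr i) ?a = sar Q j i ?a" using embeds_sar[OF B(3), unfolded ix, OF ij a(1)] ch ij by simp
      ultimately show ?thesis by simp
    qed
    have sQ: "sar Q j i ?a \<in> arrows Y" "src (sar Q j i ?a) = (scod R i, smap Q i x)"
      using gf_sar[OF FQ _ _ a(1), of i j] ij ix ch by simp_all
    note sR = gf_sar[OF FR ij a(1)]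
    note Di = D[OF ij(1) p(1)] and Dj = D[OF ij(2) p(2)]
    have "(sar Q j i ?a \<bullet>\<^bsub>Y\<^esub> D i x) \<bullet>\<^bsub>Y\<^esub> ainv Y (D i x) = sar Q j i ?a \<bullet>\<^bsub>Y\<^esub> (D i x \<bullet>\<^bsub>Y\<^esub> ainv Y (D i x))"
      by (rule Y.assoc) (use Di sQ in \<open>simp_all only: Y.ivt_in Y.tgt_ivt\<close>)
    also have "\<dots> = sar Q j i ?a"
      using Y.cmp_idn(1)[OF sQ] Di(1,3) by simp
    finally have "sar Q j i ?a = (D j ?y \<bullet>\<^bsub>Y\<^esub> sar R j i ?a) \<bullet>\<^bsub>Y\<^esub> ainv Y (D i x)"
      using \<open>sar Q j i ?a \<bullet>\<^bsub>Y\<^esub> D i x = D j ?y \<bullet>\<^bsub>Y\<^esub> sar R j i ?a\<close> by simp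
    also have "\<dots> = D j ?y \<bullet>\<^bsub>Y\<^esub> (sar R j i ?a \<bullet>\<^bsub>Y\<^esub> ainv Y (D i x))"
      by (rule Y.assoc) (use Di Dj sR a(2) in simp_all)
    also have "ainv Y (D i x) = agrp Y (scod R i) (inv\<^bsub>gp Y (scod R i)\<^esub> \<delta> i) (smap Q i x)"
      using \<delta>(2)[OF ij(1) p(1)] Y.ainv_agrp[OF gf_charts(2)[OF FR ij(1)] \<delta>(1)[OF ij(1)] gf_charts(4)[OF FR ij(1) p(1)]]
        sm[OF ij(1) p(1)] by simp
    also have "D j ?y = agrp Y (scod R j) (\<delta> j) (smap R j ?y)" by (rule \<delta>(2)[OF ij(2) p(2)])
    also have "agrp Y (scod R j) (\<delta> j) (smap R j ?y) \<bullet>\<^bsub>Y\<^esub> (sar R j i ?a \<bullet>\<^bsub>Y\<^esub> agrp Y (scod R i) (inv\<^bsub>gp Y (scod R i)\<^esub> \<delta> i) (smap Q i x)) =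
      Arrow (scod R i) (smap Q i x) (twist Y (scod R i) (scod R j) (\<delta> j) (stran R j i \<xi>) (inv\<^bsub>gp Y (scod R i)\<^esub> \<delta> i)) (scod R j)"
    proof -
      have e: "act (chart Y (scod R i)) (inv\<^bsub>gp Y (scod R i)\<^esub> \<delta> i) (smap Q i x) = smap R i x"
        using sm[OF ij(1) p(1)] g_struct.act_inv(1)[OF Y.chart_gs[OF gf_charts(2)[OF FR ij(1)]] \<delta>(1)[OF ij(1)] gf_charts(4)[OF FR ij(1) p(1)]] by simp
      have t: "stran R j i \<xi> \<in> Tran Y (scod R i) (scod R j)" "smap R i x \<in> tdom Y (scod R i) (scod R j) (stran R j i \<xi>)"
        "tmap Y (scod R i) (scod R j) (stran R j i \<xi>) (smap R i x) = smap R j ?y"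
        using sR a(2) by (auto simp: sar_def in_arrows tgt_def)
      have q: "smap Q i x \<in> pts Y (scod R i)" using gf_charts(4)[OF FQ, of i x] ij(1) ix ch p(1) by simp
      show ?thesis
        using Y.twist_arrow[OF gf_charts(2)[OF FR ij(1)] gf_charts(2)[OF FR ij(2)] t(1)
            group.inv_closed[OF Y.grp_chart[OF gf_charts(2)[OF FR ij(1)]] \<delta>(1)[OF ij(1)]] \<delta>(1)[OF ij(2)] q]
          e t by (simp add: sar_def)
    qed
    finally show ?thesis by (simp add: sar_def)
  qed
  note st = this
  show ?thesis unfolding system_iso_def
  proof (intro conjI exI[of _ \<delta>] ballI)
    show "idx R = idx Q" using ix ..
    show "sdom R i = sdom Q i" "scod R i = scod Q i" if "i \<in> idx R" for i using ch[OF that] by simp_all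
  qed (fact \<delta>(1) sm st)+
qed

end


section \<open>Equivalence of systems\<close>

context orbi_pair
begin

text \<open>
  Both systems are refined over the components of the intersections of their charts. The targets of
  the first one serve for both, since bridged systems induce the same map of underlying spaces; the
  refinements are bridged, and they have the same charts.
\<close>

lemma bridged_common_refinement:
  fixes S R :: "('x, 'p, 't, ('x, 'l) index) system"
  assumes S: "system X Y S" and R: "system X Y R" and b: "bridged X Y S R"
  shows "(S, R) \<in> system_rel X Y"
proof -
  have LS: "local_system X Y S" and LR: "local_system X Y R" using S R by (auto simp: system_def)
  note FS = local_system_gf[OF LS] and FR = local_system_gf[OF LR]
  define I where "I = {Node \<alpha> \<beta> W | \<alpha> \<beta> W. \<alpha> \<in> idx S \<and> \<beta> \<in> idx R \<and> W \<in> components_in X (sdom S \<alpha> \<inter> sdom R \<beta>)}"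
  define U where "U i = (case i of Node \<alpha> \<beta> W \<Rightarrow> W | Label l \<Rightarrow> {})" for i :: "('x, 'l) index"
  define V where "V i = scod S (left_index i)" for i
  have I: "left_index i \<in> idx S" "right_index i \<in> idx R" "U i \<in> basics X" "U i \<subseteq> sdom S (left_index i)"
    "U i \<subseteq> sdom R (right_index i)" "V i \<in> basics Y" "base_map X Y S ` U i \<subseteq> V i" "base_map X Y R ` U i \<subseteq> V i"
    if i: "i \<in> I" for i
  proof -
    obtain \<alpha> \<beta> W where *: "i = Node \<alpha> \<beta> W" "\<alpha> \<in> idx S" "\<beta> \<in> idx R" "W \<in> components_in X (sdom S \<alpha> \<inter> sdom R \<beta>)"
      using i unfolding I_def by blast
    note c = gf_charts(1)[OF FS *(2)] gf_charts(1)[OF FR *(3)]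
    have "openin X.T (sdom S \<alpha> \<inter> sdom R \<beta>)" using X.basics_open c by blast
    note W = X.components_props[OF *(4) this]
    show 1: "left_index i \<in> idx S" "right_index i \<in> idx R" "U i \<subseteq> sdom S (left_index i)"
      "U i \<subseteq> sdom R (right_index i)" "V i \<in> basics Y" 
      using * W gf_charts(2)[OF FS *(2)] by (auto simp: U_def V_def)
    show "U i \<in> basics X" using X.basics_subset[OF c(1) W(1-3)] W(4) * by (simp add: U_def)
    show 2: "base_map X Y S ` U i \<subseteq> V i" using base_map_in_scod[OF FS 1(1)] 1 by (auto simp: V_def)
    show "base_map X Y R ` U i \<subseteq> V i"
    proof safe
      fix x assume x: "x \<in> U i"
      have "base_map X Y S x = base_map X Y R x" by (rule base_map_bridged[OF b 1(1) _ 1(2)]) (use x 1 in auto)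
      then show "base_map X Y R x \<in> V i" using 2 x by auto
    qed
  qed
  have cover: "(\<Union>i\<in>I. U i) = topspace X.T"
  proof (intro equalityI subsetI)
    fix x assume "x \<in> (\<Union>i\<in>I. U i)"
    then show "x \<in> topspace X.T" using I(3) X.basics_open openin_subset by fast
  next
    fix x assume "x \<in> topspace X.T"
    then have "x \<in> (\<Union>\<alpha>\<in>idx S. sdom S \<alpha>)" "x \<in> (\<Union>\<beta>\<in>idx R. sdom R \<beta>)" using S R by (auto simp: system_def)
    then obtain \<alpha> \<beta> where a: "\<alpha> \<in> idx S" "x \<in> sdom S \<alpha>" "\<beta> \<in> idx R" "x \<in> sdom R \<beta>" by blast
    have "sdom S \<alpha> \<inter> sdom R \<beta> \<subseteq> topspace X.T"
      using openin_subset[OF X.basics_open[OF gf_charts(1)[OF FS a(1)]]] by blast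
    then obtain W where "W \<in> components_in X (sdom S \<alpha> \<inter> sdom R \<beta>)" "x \<in> W"
      using component_exists[of x "sdom S \<alpha> \<inter> sdom R \<beta>" X.T] a unfolding components_in_def by blast
    then have "Node \<alpha> \<beta> W \<in> I" "x \<in> U (Node \<alpha> \<beta> W)" using a by (auto simp: I_def U_def)
    then show "x \<in> (\<Union>i\<in>I. U i)" by blast
  qed
  obtain S' where S': "local_system X Y S'" "idx S' = I" "sdom S' = U" "scod S' = V" "bridged X Y S' S"
    using refine_exists[OF LS I(1,3,4,6,7)] .
  obtain R' where R': "local_system X Y R'" "idx R' = I" "sdom R' = U" "scod R' = V" "bridged X Y R' R"
    using refine_exists[OF LR I(2,3,5,6,8)] .
  have sys: "system X Y S'" "system X Y R'" using S' R' cover by (auto simp: system_def)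
  have "refinement X Y S left_index S'" by (rule bridged_refinement[OF S'(5)]) (use I S' in auto)
  moreover have "refinement X Y R right_index R'" by (rule bridged_refinement[OF R'(5)]) (use I R' in auto)
  moreover have "bridged X Y S' R'"
    using bridged_trans[OF R bridged_trans[OF S S'(5) b] bridged_sym[OF R'(5)]] .
  then have "system_iso X Y S' R'" by (rule bridged_system_iso) (use S' R' in auto)
  ultimately show ?thesis unfolding system_rel_def using S R sys by blast
qed

lemma system_rel_iff:
  fixes S R :: "('x, 'p, 't, ('x, 'l) index) system"
  shows "(S, R) \<in> system_rel X Y \<longleftrightarrow> system X Y S \<and> system X Y R \<and> bridged X Y S R"
proof
  assume "(S, R) \<in> system_rel X Y"
  then obtain S' R' \<theta> \<kappa> where *: "system X Y S" "system X Y R" "system X Y S'" "system X Y R'"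
     "refinement X Y S \<theta> S'" "refinement X Y R \<kappa> R'" "system_iso X Y S' R'"
    unfolding system_rel_def by blast
  have L: "local_system X Y S" "local_system X Y R" "local_system X Y S'" "local_system X Y R'"
    using * by (auto simp: system_def)
  note b = bridged_sym[OF refinement_bridged[OF L(1) *(5)]] system_iso_bridged[OF L(3,4) *(7)] refinement_bridged[OF L(2) *(6)]
  show "system X Y S \<and> system X Y R \<and> bridged X Y S R"
    using * bridged_trans[OF *(4) bridged_trans[OF *(3) b(1,2)] b(3)] by blast
qed (use bridged_common_refinement in blast)

lemma equiv_system_rel: "equiv {S :: ('x, 'p, 't, ('x, 'l) index) system. system X Y S} (system_rel X Y)"
proof (rule equivI)
  show "system_rel X Y \<subseteq> {S :: ('x, 'p, 't, ('x, 'l) index) system. system X Y S} \<times> {S. system X Y S}"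
    by (auto simp: system_rel_iff)
  show "refl_on {S :: ('x, 'p, 't, ('x, 'l) index) system. system X Y S} (system_rel X Y)"
    by (auto simp: refl_on_def system_rel_iff system_def intro: bridged_refl)
  show "sym (system_rel X Y :: ('x, 'p, 't, ('x, 'l) index) system rel)"
    by (auto simp: sym_def system_rel_iff intro: bridged_sym)
  show "trans (system_rel X Y :: ('x, 'p, 't, ('x, 'l) index) system rel)"
    by (auto simp: trans_def system_rel_iff intro: bridged_trans)
qed

text \<open>
  The preimage is the projection of an open set of points of the chart, and projections are open.
\<close>

lemma base_map_preimage_open:
  assumes F: "germ_functor X Y S" and \<alpha>: "\<alpha> \<in> idx S" and W: "openin Y.T W"
  shows "openin X.T {x \<in> sdom S \<alpha>. base_map X Y S x \<in> W}"
proof -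
  note c = gf_charts[OF F \<alpha>]
  interpret U: g_struct "subtopology X.T (sdom S \<alpha>)" "chart X (sdom S \<alpha>)" by (rule X.chart_gs[OF c(1)])
  interpret V: g_struct "subtopology Y.T (scod S \<alpha>)" "chart Y (scod S \<alpha>)" by (rule Y.chart_gs[OF c(2)])
  have "openin (subtopology Y.T (scod S \<alpha>)) (W \<inter> scod S \<alpha>)" using W by (auto simp: openin_subtopology)
  from openin_continuous_map_preimage[OF continuous_map_compose[OF c(3) V.proj_continuous] this]
  have "openin (hat (chart X (sdom S \<alpha>))) {z \<in> pts X (sdom S \<alpha>). base_map X Y S (proj (chart X (sdom S \<alpha>)) z) \<in> W}"
    by (rule back_subst[of "openin _"])
      (use base_map_eq[OF F \<alpha>] Y.proj_pts[OF c(2)] c(4) in \<open>auto simp: image_iff\<close>)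
  from U.proj_open[OF this]
  have "openin (subtopology X.T (sdom S \<alpha>)) {x \<in> sdom S \<alpha>. base_map X Y S x \<in> W}"
    by (rule back_subst[of "openin _"]) (use X.proj_pts[OF c(1)] in \<open>auto simp: set_eq_iff image_iff; metis\<close>)
  then show ?thesis using openin_trans_full X.basics_open[OF c(1)] by blast
qed

lemma base_map_continuous:
  assumes F: "germ_functor X Y S" and \<alpha>: "\<alpha> \<in> idx S"
  shows "continuous_map (subtopology X.T (sdom S \<alpha>)) Y.T (base_map X Y S)"
proof -
  have t: "topspace (subtopology X.T (sdom S \<alpha>)) = sdom S \<alpha>"
    using openin_subset[OF X.basics_open[OF gf_charts(1)[OF F \<alpha>]]] by auto
  show ?thesis
    unfolding continuous_map t
  proof (intro conjI allI impI)
    show "base_map X Y S ` sdom S \<alpha> \<subseteq> topspace Y.T"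
      using base_map_in_scod[OF F \<alpha>] openin_subset[OF Y.basics_open[OF gf_charts(2)[OF F \<alpha>]]] by blast
    fix W assume "openin Y.T W"
    from base_map_preimage_open[OF F \<alpha> this]
    show "openin (subtopology X.T (sdom S \<alpha>)) {x \<in> sdom S \<alpha>. base_map X Y S x \<in> W}"
      unfolding openin_subtopology by blast
  qed
qed

end

section \<open>Composition\<close>

lemma orbi_pairI: "orbispace X \<Longrightarrow> orbispace Y \<Longrightarrow> orbi_pair X Y"
  by (simp add: orbi_pair_def orbi_def)

definition composable :: "('x, 'p, 't, 'i) system \<Rightarrow> ('x, 'p, 't, 'i) system \<Rightarrow> bool" where
  "composable Q R \<longleftrightarrow> idx Q = idx R \<and> (\<forall>i\<in>idx R. sdom Q i = scod R i)"

lemma compose_simps [simp]: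
  "idx (compose_systems Q R) = idx R" "sdom (compose_systems Q R) = sdom R" "scod (compose_systems Q R) = scod Q"
  "smap (compose_systems Q R) i x = smap Q i (smap R i x)" "stran (compose_systems Q R) j i \<xi> = stran Q j i (stran R j i \<xi>)"
  by (simp_all add: compose_systems_def)

lemma sar_compose: "scod R i = sdom Q i \<Longrightarrow> sar (compose_systems Q R) j i a = sar Q j i (sar R j i a)"
  by (simp add: sar_def)

lemma compose_systems_assoc: "compose_systems (compose_systems P Q) R = compose_systems P (compose_systems Q R)"
  by (simp add: compose_systems_def fun_eq_iff)

lemma compose_local_system:
  assumes O: "orbispace X" "orbispace Y" "orbispace Z"
    and R: "local_system X Y R" and Q: "local_system Y Z Q"
    and idx: "\<And>i. i \<in> idx R \<Longrightarrow> i \<in> idx Q \<and> sdom Q i = scod R i"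
  shows "local_system X Z (compose_systems Q R)"
proof -
  interpret XY: orbi_pair X Y by (rule orbi_pairI[OF O(1,2)])
  interpret YZ: orbi_pair Y Z by (rule orbi_pairI[OF O(2,3)])
  interpret XZ: orbi_pair X Z by (rule orbi_pairI[OF O(1,3)])
  note FR = XY.local_system_gf[OF R] and FQ = YZ.local_system_gf[OF Q]
  have sc: "sar (compose_systems Q R) j i a = sar Q j i (sar R j i a)" if "i \<in> idx R" for i j a
    using sar_compose idx[OF that] by metis
  have F: "germ_functor X Z (compose_systems Q R)"
    unfolding germ_functor_def compose_simps(1-3)
  proof (intro conjI ballI impI)
    fix i assume i: "i \<in> idx R"
    show "sdom R i \<in> basics X" "scod Q i \<in> basics Z"
      using XY.gf_charts(1)[OF FR i] YZ.gf_charts(2)[OF FQ] idx[OF i] by auto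
    show "continuous_map (hat (chart X (sdom R i))) (hat (chart Z (scod Q i))) (smap (compose_systems Q R) i)"
      using continuous_map_compose[OF XY.gf_charts(3)[OF FR i]] YZ.gf_charts(3)[OF FQ, of i] idx[OF i]
      by (simp add: compose_systems_def)
  next
    fix i j a assume i: "i \<in> idx R" "j \<in> idx R" and a: "a \<in> arrows X" "dchart a = sdom R i" "cchart a = sdom R j"
    note s = XY.gf_sar[OF FR i a]
    show "sar (compose_systems Q R) j i a \<in> arrows Z"
      "tgt Z (sar (compose_systems Q R) j i a) = (scod Q j, smap (compose_systems Q R) j (snd (tgt X a)))"
      unfolding sc[OF i(1)] using YZ.gf_sar[OF FQ _ _ s(1), of i j] idx[OF i(1)] idx[OF i(2)] s(2) by simp_all
  next
    fix i j k a b assume i: "i \<in> idx R" "j \<in> idx R" "k \<in> idx R" and a: "a \<in> arrows X" "b \<in> arrows X" "dchart a = sdom R i" "cchart a = sdom R j"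
      "cchart b = sdom R k" "src b = tgt X a"
    have b: "dchart b = sdom R j" "apt b = snd (tgt X a)" using a by (metis arrow_simps(1-3))+
    note s = XY.gf_sar[OF FR i(1,2) a(1,3,4)] and t = XY.gf_sar[OF FR i(2,3) a(2) b(1) a(5)]
    show "sar (compose_systems Q R) k i (b \<bullet>\<^bsub>X\<^esub> a) =
        sar (compose_systems Q R) k j b \<bullet>\<^bsub>Z\<^esub> sar (compose_systems Q R) j i a"
      unfolding sc[OF i(1)] sc[OF i(2)] XY.gf_comp[OF FR i a]
      by (rule YZ.gf_comp[OF FQ _ _ _ s(1) t(1)]) (use idx i s(2) b in auto)
  qed
  show ?thesis
  proof (rule XZ.local_systemI[OF F]; simp only: compose_simps(1-3))
    fix i assume i: "i \<in> idx R"
    have iQ: "i \<in> idx Q" "sdom Q i = scod R i" using idx[OF i] by auto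
    interpret U: g_struct "subtopology XY.X.T (sdom R i)" "chart X (sdom R i)" by (rule XY.X.chart_gs[OF XY.gf_charts(1)[OF FR i]])
    have "sgrp X Z (compose_systems Q R) i g = sgrp Y Z Q i (sgrp X Y R i g)" if g: "g \<in> carrier (gp X (sdom R i))" for g
      by (rule XZ.sgrp_eqI) (use YZ.gf_charts(2)[OF FQ iQ(1)] XY.gf_agrp(1,2)[OF FR i g]
        YZ.gf_agrp(1,2)[OF FQ iQ(1), of "sgrp X Y R i g"] iQ in simp_all)
    then show "continuous_map (grp_top (chart X (sdom R i))) (grp_top (chart Z (scod Q i))) (sgrp X Z (compose_systems Q R) i)"
      using continuous_map_eq[OF continuous_map_compose[OF XY.local_system_sgrp_continuous[OF R i]
          YZ.local_system_sgrp_continuous[OF Q iQ(1), unfolded iQ(2)]]] by (simp add: U.topspace_grp_top)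
  qed
qed

text \<open>
  The composite of a bridge between \<open>R\<close> and \<open>R'\<close> and one between \<open>Q\<close> and \<open>Q'\<close> is a functor on the disjoint
  union which restricts to both composites.
\<close>

lemma compose_bridged:
  fixes R Q :: "('x, 'p, 't, 'i) system" and R' Q' :: "('x, 'p, 't, 'j) system"
  assumes O: "orbispace X" "orbispace Y" "orbispace Z"
    and R: "bridged X Y R R'" and Q: "bridged Y Z Q Q'" and c: "composable Q R" "composable Q' R'"
  shows "bridged X Z (compose_systems Q R) (compose_systems Q' R')"
proof -
  interpret XY: orbi_pair X Y by (rule orbi_pairI[OF O(1,2)])
  interpret YZ: orbi_pair Y Z by (rule orbi_pairI[OF O(2,3)])
  interpret XZ: orbi_pair X Z by (rule orbi_pairI[OF O(1,3)])
  obtain B0 :: "('x, 'p, 't, 'i + 'j) system" where B0: "local_system X Y B0" "embeds X Inl R B0" "embeds X Inr R' B0"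
    using R unfolding bridged_def by blast
  obtain C :: "('x, 'p, 't, 'i + 'j) system" where C: "local_system Y Z C" "embeds Y Inl Q C" "embeds Y Inr Q' C"
    using Q unfolding bridged_def by blast
  \<comment> \<open>An ambient system may have further indices, at which the charts need not match.\<close>
  define B where "B = reindex (Inl ` idx R \<union> Inr ` idx R') (\<lambda>i. i) B0"
  have B: "local_system X Y B" unfolding B_def
    by (rule XY.local_system_reindex[OF B0(1)]) (use embedsD(1)[OF B0(2)] embedsD(1)[OF B0(3)] in auto)
  have e: "embeds X Inl R B" "embeds X Inr R' B" unfolding B_def
    by (rule embeds_into_reindex[OF B0(2)], simp) (rule embeds_into_reindex[OF B0(3)], simp)
  have iB: "idx B = Inl ` idx R \<union> Inr ` idx R'" by (simp add: B_def)
  have "local_system X Z (compose_systems C B)"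
  proof (rule compose_local_system[OF O B C(1)])
    fix k assume "k \<in> idx B"
    then consider (l) i where "k = Inl i" "i \<in> idx R" | (r) i where "k = Inr i" "i \<in> idx R'" using iB by blast
    then show "k \<in> idx C \<and> sdom C k = scod B k"
      using c embedsD(1-3)[OF e(1)] embedsD(1-3)[OF e(2)] embedsD(1-3)[OF C(2)] embedsD(1-3)[OF C(3)]
      unfolding composable_def by cases auto
  qed
  moreover have emb: "embeds X k (compose_systems Q'' R'') (compose_systems C B)"
    if e: "embeds X k R'' B" and C': "embeds Y k Q'' C" and c: "composable Q'' R''" for k and Q'' R'' :: "('x, 'p, 't, 'k) system"
  proof -
    have L: "local_system X Y R''" "local_system Y Z Q''"
      using XY.embeds_local_system[OF B e] YZ.embeds_local_system[OF C(1) C'] .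
    note FR = XY.local_system_gf[OF L(1)] and d = embedsD[OF e] and d' = embedsD[OF C']
    have c': "i \<in> idx Q''" "sdom Q'' i = scod R'' i" if "i \<in> idx R''" for i using c that by (auto simp: composable_def)
    show ?thesis
    proof (rule XZ.embedsI; simp only: compose_simps)
      fix i assume i: "i \<in> idx R''"
      show "k i \<in> idx B \<and> sdom R'' i \<in> basics X \<and> sdom B (k i) = sdom R'' i \<and> scod C (k i) = scod Q'' i"
        using d(1,2)[OF i] d'(3)[OF c'(1)[OF i]] XY.gf_charts(1)[OF FR i] by simp
      fix x assume "x \<in> pts X (sdom R'' i)"
      then show "smap C (k i) (smap B (k i) x) = smap Q'' i (smap R'' i x)"
        using d(4)[OF i] d'(4)[OF c'(1)[OF i]] c'(2)[OF i] XY.gf_charts(4)[OF FR i] by simp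
    next
      fix i j a assume i: "i \<in> idx R''" "j \<in> idx R''" and a: "a \<in> arrows X" "dchart a = sdom R'' i" "cchart a = sdom R'' j"
      have "sar (compose_systems C B) (k j) (k i) a = sar C (k j) (k i) (sar R'' j i a)"
        using sar_compose[of B "k i" C] d(3)[OF i(1)] d'(2)[OF c'(1)[OF i(1)]] c'(2)[OF i(1)] XY.embeds_sar[OF e i a] by simp
      also have "\<dots> = sar Q'' j i (sar R'' j i a)"
        by (rule YZ.embeds_sar[OF C' c'(1)[OF i(1)] c'(1)[OF i(2)] XY.gf_sar(1)[OF FR i a]]) (use c'(2) i in simp_all)
      also have "\<dots> = sar (compose_systems Q'' R'') j i a" using sar_compose[of R'' i Q''] c'(2)[OF i(1)] by simp
      finally show "sar (compose_systems C B) (k j) (k i) a = sar (compose_systems Q'' R'') j i a" .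
    qed
  qed
  ultimately show ?thesis using XZ.bridgedI[OF _ emb[OF e(1) C(2) c(1)] emb[OF e(2) C(3) c(2)]] by blast
qed

lemma compose_system:
  assumes O: "orbispace X" "orbispace Y" "orbispace Z"
    and R: "system X Y R" and Q: "local_system Y Z Q" and c: "composable Q R"
  shows "system X Z (compose_systems Q R)"
  using compose_local_system[OF O _ Q, of R] R c by (auto simp: system_def composable_def)

text \<open>
  What remains of a composite when the choice of its charts is forgotten.
\<close>

lemma composite_data:
  assumes O: "orbispace X" "orbispace Y" "orbispace Z"
    and S: "system X Y S" and T: "system Y Z T" and H: "is_composite X Y Z T S H"
  obtains R Q where "system X Y R" "local_system Y Z Q" "bridged X Y R S" "bridged Y Z Q T" "composable Q R"
    "H = compose_systems Q R"
proof -
  interpret XY: orbi_pair X Y by (rule orbi_pairI[OF O(1,2)])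
  interpret YZ: orbi_pair Y Z by (rule orbi_pairI[OF O(2,3)])
  have LS: "local_system X Y S" and LT: "local_system Y Z T" using S T by (auto simp: system_def)
  note FS = XY.local_system_gf[OF LS]
  obtain R Q where ref: "refinement X Y S left_index R" "refinement Y Z T right_index Q"
    and ix: "idx R = {Node \<alpha> a W | \<alpha> a W. \<alpha> \<in> idx S \<and> a \<in> idx T \<and>
                   W \<in> components_in X {x \<in> sdom S \<alpha>. base_map X Y S x \<in> sdom T a}}" "idx Q = idx R"
    and dR: "\<forall>\<alpha> a W. Node \<alpha> a W \<in> idx R \<longrightarrow> sdom R (Node \<alpha> a W) = W \<and>
           scod R (Node \<alpha> a W) \<in> components_in Y (scod S \<alpha> \<inter> sdom T a)"
    and dQ: "\<forall>\<alpha> a W. Node \<alpha> a W \<in> idx R \<longrightarrow> sdom Q (Node \<alpha> a W) = scod R (Node \<alpha> a W) \<and> scod Q (Node \<alpha> a W) = scod T a"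
    and H': "H = compose_systems Q R"
    using H unfolding is_composite_def by (elim exE conjE)
  have LR: "local_system X Y R" and LQ: "local_system Y Z Q" using ref by (auto simp: refinement_def)
  have "topspace XY.X.T \<subseteq> (\<Union>i\<in>idx R. sdom R i)"
  proof
    fix x assume x: "x \<in> topspace XY.X.T"
    then have "x \<in> (\<Union>\<alpha>\<in>idx S. sdom S \<alpha>)" using S by (simp add: system_def)
    then obtain \<alpha> where \<alpha>: "\<alpha> \<in> idx S" "x \<in> sdom S \<alpha>" by blast
    have "base_map X Y S x \<in> topspace XY.Y.T"
      using XY.base_map_in_scod[OF FS \<alpha>] openin_subset[OF XY.Y.basics_open[OF XY.gf_charts(2)[OF FS \<alpha>(1)]]] by blast
    then have "base_map X Y S x \<in> (\<Union>a\<in>idx T. sdom T a)" using T by (simp add: system_def)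
    then obtain a where a: "a \<in> idx T" "base_map X Y S x \<in> sdom T a" by blast
    have "{x \<in> sdom S \<alpha>. base_map X Y S x \<in> sdom T a} \<subseteq> topspace XY.X.T"
      using openin_subset[OF XY.X.basics_open[OF XY.gf_charts(1)[OF FS \<alpha>(1)]]] by blast
    then obtain W where W: "W \<in> components_in X {x \<in> sdom S \<alpha>. base_map X Y S x \<in> sdom T a}" "x \<in> W"
      using component_exists[of x "{x \<in> sdom S \<alpha>. base_map X Y S x \<in> sdom T a}" XY.X.T] a \<alpha> unfolding components_in_def by blast
    then have "Node \<alpha> a W \<in> idx R" using \<alpha> a by (auto simp: ix(1))
    then show "x \<in> (\<Union>i\<in>idx R. sdom R i)" using dR W(2) by blast
  qed
  moreover have "(\<Union>i\<in>idx R. sdom R i) \<subseteq> topspace XY.X.T"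
    using XY.gf_charts(1)[OF XY.local_system_gf[OF LR]] XY.X.basics_open openin_subset by fast
  ultimately have "system X Y R" using LR by (simp add: system_def)
  moreover have "sdom Q i = scod R i" if "i \<in> idx R" for i using that dQ unfolding ix(1) by blast
  then have "composable Q R" using ix(2) by (simp add: composable_def)
  ultimately show thesis
    using that LQ XY.refinement_bridged[OF LS ref(1)] YZ.refinement_bridged[OF LT ref(2)] H' by blast
qed

text \<open>
  The charts of the first factor are components of open sets because the underlying map \<open>f\<close> is
  continuous. It carries each of them onto a connected set, which selects the target component.
\<close>

lemma composite_exists:
  fixes S T :: "('x, 'p, 't, ('x, 'l) index) system"
  assumes O: "orbispace X" "orbispace Y" "orbispace Z"
    and S: "system X Y S" and T: "system Y Z T"
  obtains H where "is_composite X Y Z T S H"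
proof -
  interpret XY: orbi_pair X Y by (rule orbi_pairI[OF O(1,2)])
  interpret YZ: orbi_pair Y Z by (rule orbi_pairI[OF O(2,3)])
  have LS: "local_system X Y S" and LT: "local_system Y Z T" using S T by (auto simp: system_def)
  note FS = XY.local_system_gf[OF LS] and FT = YZ.local_system_gf[OF LT]
  let ?P = "\<lambda>\<alpha> a. {x \<in> sdom S \<alpha>. base_map X Y S x \<in> sdom T a}"
  define I where "I = {Node \<alpha> a W | \<alpha> a W. \<alpha> \<in> idx S \<and> a \<in> idx T \<and> W \<in> components_in X (?P \<alpha> a)}"
  define U where "U i = (case i of Node \<alpha> a W \<Rightarrow> W | Label l \<Rightarrow> {})" for i :: "('x, 'l) index"
  define target where "target i C \<longleftrightarrow> C \<in> components_in Y (scod S (left_index i) \<inter> sdom T (right_index i)) \<and>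
     base_map X Y S ` U i \<subseteq> C" for i C
  define V where "V i = (SOME C. target i C)" for i
  have I: "left_index i \<in> idx S" "right_index i \<in> idx T" "U i \<in> basics X" "U i \<subseteq> sdom S (left_index i)"
    "V i \<in> components_in Y (scod S (left_index i) \<inter> sdom T (right_index i))" "base_map X Y S ` U i \<subseteq> V i"
    "V i \<in> basics Y" "V i \<subseteq> sdom T (right_index i)" "scod T (right_index i) \<in> basics Z"
    "base_map Y Z T ` V i \<subseteq> scod T (right_index i)"
    if i: "i \<in> I" for i
  proof -
    obtain \<alpha> a W where *: "i = Node \<alpha> a W" "\<alpha> \<in> idx S" "a \<in> idx T" "W \<in> components_in X (?P \<alpha> a)"
      using i unfolding I_def by blast
    note c = XY.gf_charts(1,2)[OF FS *(2)] YZ.gf_charts(1,2)[OF FT *(3)]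
    note W = XY.X.components_props[OF *(4) XY.base_map_preimage_open[OF FS *(2) XY.Y.basics_open[OF c(3)]]]
    show 1: "left_index i \<in> idx S" "right_index i \<in> idx T" "U i \<subseteq> sdom S (left_index i)" "scod T (right_index i) \<in> basics Z"
      using * W c by (auto simp: U_def)
    have "W \<subseteq> sdom S \<alpha>" using W(4) by blast
    then show "U i \<in> basics X" using XY.X.basics_subset[OF c(1) W(1-3)] * by (simp add: U_def)
    have o: "openin XY.Y.T (scod S \<alpha> \<inter> sdom T a)" using XY.Y.basics_open c by blast
    obtain x where x: "x \<in> W" using W(3) by blast
    have im: "base_map X Y S ` W \<subseteq> scod S \<alpha> \<inter> sdom T a" using W(4) XY.base_map_in_scod[OF FS *(2)] by blast
    then obtain C where C: "C \<in> components_in Y (scod S \<alpha> \<inter> sdom T a)" "base_map X Y S x \<in> C"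
      using x component_exists[OF _ openin_subset[OF o]] unfolding components_in_def by blast
    have "connectedin (subtopology XY.X.T (sdom S \<alpha>)) W" using W by (auto simp: connectedin_subtopology)
    from connectedin_continuous_map_image[OF XY.base_map_continuous[OF FS *(2)] this]
    have "base_map X Y S ` W \<subseteq> C"
      using component_maximal[OF C(1)[unfolded components_in_def] _ im imageI[OF x] C(2)] by blast
    then have "target i C" using C * by (simp add: target_def U_def)
    then have "target i (V i)" unfolding V_def by (rule someI)
    then show v: "V i \<in> components_in Y (scod S (left_index i) \<inter> sdom T (right_index i))" "base_map X Y S ` U i \<subseteq> V i"
      by (auto simp: target_def)
    note Vp = XY.Y.components_props[OF v(1)[unfolded *(1), simplified] o]
    show "V i \<in> basics Y" "V i \<subseteq> sdom T (right_index i)"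
      using XY.Y.basics_subset[OF c(2) Vp(1-3)] Vp(4) * by auto
    then show "base_map Y Z T ` V i \<subseteq> scod T (right_index i)"
      using YZ.base_map_in_scod[OF FT 1(2)] by blast
  qed
  obtain R where R: "local_system X Y R" "idx R = I" "sdom R = U" "scod R = V" "bridged X Y R S"
    using XY.refine_exists[OF LS I(1,3,4,7,6)] .
  obtain Q where Q: "local_system Y Z Q" "idx Q = I" "sdom Q = V" "scod Q = (\<lambda>i. scod T (right_index i))" "bridged Y Z Q T"
    using YZ.refine_exists[OF LT I(2,7,8,9,10)] .
  have "refinement X Y S left_index R" by (rule XY.bridged_refinement[OF R(5)]) (use I R in auto)
  moreover have "refinement Y Z T right_index Q" by (rule YZ.bridged_refinement[OF Q(5)]) (use I Q in auto)
  moreover have "\<forall>\<alpha> a W. Node \<alpha> a W \<in> idx R \<longrightarrow> sdom R (Node \<alpha> a W) = W \<and>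
           scod R (Node \<alpha> a W) \<in> components_in Y (scod S \<alpha> \<inter> sdom T a)"
  proof (intro allI impI)
    fix \<alpha> a W assume "Node \<alpha> a W \<in> idx R"
    then show "sdom R (Node \<alpha> a W) = W \<and> scod R (Node \<alpha> a W) \<in> components_in Y (scod S \<alpha> \<inter> sdom T a)"
      using I(5)[of "Node \<alpha> a W"] R by (simp add: U_def)
  qed
  ultimately have "is_composite X Y Z T S (compose_systems Q R)"
    unfolding is_composite_def using R(2-4) Q(2-4) by (intro exI[of _ R] exI[of _ Q]) (simp add: I_def)
  then show thesis by (rule that)
qed

text \<open>
  The factors of the composite \<open>H\<close> are bridged to \<open>S\<close> and \<open>T\<close>, hence to \<open>R\<close> and \<open>Q\<close>, and bridges can be composed.
\<close>

lemma composite_bridged: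
  assumes O: "orbispace X" "orbispace Y" "orbispace Z"
    and S: "system X Y S" and T: "system Y Z T" and H: "is_composite X Y Z T S H"
    and R: "bridged X Y R S" and Q: "bridged Y Z Q T" and c: "composable Q R"
  shows "system X Z H" "bridged X Z H (compose_systems Q R)"
proof -
  interpret XY: orbi_pair X Y by (rule orbi_pairI[OF O(1,2)])
  interpret YZ: orbi_pair Y Z by (rule orbi_pairI[OF O(2,3)])
  obtain R' Q' where *: "system X Y R'" "local_system Y Z Q'" "bridged X Y R' S" "bridged Y Z Q' T" "composable Q' R'"
    "H = compose_systems Q' R'" using composite_data[OF O S T H] .
  show "system X Z H" using compose_system[OF O *(1,2,5)] *(6) by simp
  have "bridged X Y R' R" by (rule XY.bridged_trans[OF S *(3) XY.bridged_sym[OF R]])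
  moreover have "bridged Y Z Q' Q" by (rule YZ.bridged_trans[OF T *(4) YZ.bridged_sym[OF Q]])
  ultimately show "bridged X Z H (compose_systems Q R)" using compose_bridged[OF O _ _ *(5) c] *(6) by simp
qed

lemma Image_constant:
  assumes "\<And>y. y \<in> C \<Longrightarrow> r `` {y} = r `` {x}" "y \<in> C"
  shows "r `` C = r `` {x}"
  using assms by (auto simp: Image_def set_eq_iff)

text \<open>
  Composition of morphisms on classes: all composites of representatives are bridged to \<open>compose_systems Q R\<close>,
  and there is at least one.
\<close>

lemma orbi_comp_eq:
  fixes S T :: "('x, 'p, 't, ('x, 'l) index) system"
  assumes O: "orbispace X" "orbispace Y" "orbispace Z"
    and S: "system X Y S" and T: "system Y Z T"
    and R: "system X Y R" "bridged X Y R S" and Q: "bridged Y Z Q T" and c: "composable Q R"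
    and K: "system X Z K" "bridged X Z K (compose_systems Q R)"
  shows "orbi_comp X Y Z (system_rel Y Z `` {T}) (system_rel X Y `` {S}) = system_rel X Z `` {K}"
proof -
  interpret XY: orbi_pair X Y by (rule orbi_pairI[OF O(1,2)])
  interpret YZ: orbi_pair Y Z by (rule orbi_pairI[OF O(2,3)])
  interpret XZ: orbi_pair X Z by (rule orbi_pairI[OF O(1,3)])
  have QR: "system X Z (compose_systems Q R)" by (rule compose_system[OF O R(1) YZ.bridged_local(1)[OF Q] c])
  let ?C = "{H. \<exists>S'\<in>system_rel X Y `` {S}. \<exists>T'\<in>system_rel Y Z `` {T}. is_composite X Y Z T' S' H}"
  have 1: "(K, H) \<in> system_rel X Z" if H': "H \<in> ?C" for H
  proof -
    obtain S' T' where *: "(S, S') \<in> system_rel X Y" "(T, T') \<in> system_rel Y Z" "is_composite X Y Z T' S' H"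
      using H' by blast
    have S': "system X Y S'" "bridged X Y S S'" and T': "system Y Z T'" "bridged Y Z T T'"
      using *(1,2) by (auto simp: XY.system_rel_iff YZ.system_rel_iff)
    note H = composite_bridged[OF O S'(1) T'(1) *(3) XY.bridged_trans[OF S R(2) S'(2)] YZ.bridged_trans[OF T Q T'(2)] c]
    then show ?thesis using XZ.bridged_trans[OF QR K(2) XZ.bridged_sym[OF H(2)]] K(1) by (simp add: XZ.system_rel_iff)
  qed
  obtain H where "is_composite X Y Z T S H" using composite_exists[OF O S T] .
  moreover have "(S, S) \<in> system_rel X Y" "(T, T) \<in> system_rel Y Z"
    using S T XY.bridged_refl YZ.bridged_refl by (auto simp: XY.system_rel_iff YZ.system_rel_iff system_def)
  ultimately have H: "H \<in> ?C" by blast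
  note E = equiv_class_eq[OF XZ.equiv_system_rel]
  have "system_rel X Z `` ?C = system_rel X Z `` {K}"
    by (rule Image_constant[OF E[OF 1, symmetric] H])
  then show ?thesis unfolding orbi_comp_def .
qed


text \<open>
  Around each point of \<open>W\<close> there is a basic open set that is small enough to be carried successively
  into charts of the three systems. The points of \<open>W\<close> serve as indices, as the systems only have to be
  bridged to the given ones.
\<close>

lemma composable_triple:
  fixes S T P :: "('x, 'p, 't, 'i) system"
  assumes O: "orbispace W" "orbispace X" "orbispace Y" "orbispace Z"
    and S: "system W X S" and T: "system X Y T" and P: "system Y Z P"
  obtains A B C :: "('x, 'p, 't, 'x) system" where "system W X A" "bridged W X A S" "bridged X Y B T" "bridged Y Z C P"
    "composable B A" "composable C B"
proof -
  interpret WX: orbi_pair W X by (rule orbi_pairI[OF O(1,2)])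
  interpret XY: orbi_pair X Y by (rule orbi_pairI[OF O(2,3)])
  interpret YZ: orbi_pair Y Z by (rule orbi_pairI[OF O(3,4)])
  have LS: "local_system W X S" and LT: "local_system X Y T" and LP: "local_system Y Z P"
    using S T P by (auto simp: system_def)
  note FS = WX.local_system_gf[OF LS] and FT = XY.local_system_gf[OF LT] and FP = YZ.local_system_gf[OF LP]
  let ?f = "base_map W X S" and ?g = "base_map X Y T"
  have "\<exists>\<alpha> a c O1 O2 O3. \<alpha> \<in> idx S \<and> a \<in> idx T \<and> c \<in> idx P \<and> O1 \<in> basics W \<and> O2 \<in> basics X \<and> O3 \<in> basics Y \<and>
      x \<in> O1 \<and> O1 \<subseteq> sdom S \<alpha> \<and> ?f ` O1 \<subseteq> O2 \<and> O2 \<subseteq> sdom T a \<and> ?g ` O2 \<subseteq> O3 \<and> O3 \<subseteq> sdom P c" if x: "x \<in> topspace (top_space W)" for x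
  proof -
    obtain \<alpha> where \<alpha>: "\<alpha> \<in> idx S" "x \<in> sdom S \<alpha>" using x S by (auto simp: system_def)
    have "?f x \<in> topspace (top_space X)"
      using WX.base_map_in_scod[OF FS \<alpha>] openin_subset[OF WX.Y.basics_open[OF WX.gf_charts(2)[OF FS \<alpha>(1)]]] by blast
    then have "?f x \<in> (\<Union>a\<in>idx T. sdom T a)" using T by (simp add: system_def)
    then obtain a where a: "a \<in> idx T" "?f x \<in> sdom T a" by blast
    have "?g (?f x) \<in> topspace (top_space Y)"
      using XY.base_map_in_scod[OF FT a] openin_subset[OF XY.Y.basics_open[OF XY.gf_charts(2)[OF FT a(1)]]] by blast
    then have "?g (?f x) \<in> (\<Union>c\<in>idx P. sdom P c)" using P by (simp add: system_def)
    then obtain c where c: "c \<in> idx P" "?g (?f x) \<in> sdom P c" by blast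
    note O3 = YZ.gf_charts(1)[OF FP c(1)]
    have "openin (top_space X) {y \<in> sdom T a. ?g y \<in> sdom P c}"
      by (rule XY.base_map_preimage_open[OF FT a(1) XY.Y.basics_open[OF O3]])
    moreover have "?f x \<in> {y \<in> sdom T a. ?g y \<in> sdom P c}" using a c by blast
    ultimately obtain O2 where O2: "O2 \<in> basics X" "?f x \<in> O2" "O2 \<subseteq> {y \<in> sdom T a. ?g y \<in> sdom P c}"
      using WX.Y.basics_base by blast
    have "openin (top_space W) {y \<in> sdom S \<alpha>. ?f y \<in> O2}"
      by (rule WX.base_map_preimage_open[OF FS \<alpha>(1) WX.Y.basics_open[OF O2(1)]])
    moreover have "x \<in> {y \<in> sdom S \<alpha>. ?f y \<in> O2}" using \<alpha> O2 by blast
    ultimately obtain O1 where O1: "O1 \<in> basics W" "x \<in> O1" "O1 \<subseteq> {y \<in> sdom S \<alpha>. ?f y \<in> O2}"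
      using WX.X.basics_base by blast
    show ?thesis
      by (rule exI[of _ \<alpha>], rule exI[of _ a], rule exI[of _ c], rule exI[of _ O1], rule exI[of _ O2], rule exI[of _ "sdom P c"])
        (use \<alpha> a c O3 O2 O1 in blast)
  qed
  then obtain \<alpha> a c O1 O2 O3 where
    i: "\<And>x. x \<in> topspace (top_space W) \<Longrightarrow> \<alpha> x \<in> idx S \<and> a x \<in> idx T \<and> c x \<in> idx P \<and> O1 x \<in> basics W \<and> O2 x \<in> basics X \<and> O3 x \<in> basics Y \<and>
      x \<in> O1 x \<and> O1 x \<subseteq> sdom S (\<alpha> x) \<and> ?f ` O1 x \<subseteq> O2 x \<and> O2 x \<subseteq> sdom T (a x) \<and> ?g ` O2 x \<subseteq> O3 x \<and> O3 x \<subseteq> sdom P (c x)"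
    by metis
  let ?I = "topspace (top_space W)"
  obtain A where A: "local_system W X A" "idx A = ?I" "sdom A = O1" "scod A = O2" "bridged W X A S"
    by (rule WX.refine_exists[OF LS, of ?I \<alpha> O1 O2]) (use i in blast)+
  obtain B where B: "local_system X Y B" "idx B = ?I" "sdom B = O2" "scod B = O3" "bridged X Y B T"
    by (rule XY.refine_exists[OF LT, of ?I a O2 O3]) (use i in blast)+
  obtain C where C: "local_system Y Z C" "idx C = ?I" "sdom C = O3" "scod C = (\<lambda>x. scod P (c x))" "bridged Y Z C P"
  proof (rule YZ.refine_exists[OF LP, of ?I c O3 "\<lambda>x. scod P (c x)"])
    fix x assume x: "x \<in> ?I"
    show "scod P (c x) \<in> basics Z" using YZ.gf_charts(2)[OF FP] i[OF x] by blast
    show "base_map Y Z P ` O3 x \<subseteq> scod P (c x)" using YZ.base_map_in_scod[OF FP, of "c x"] i[OF x] by blast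
  qed (use i in blast)+
  have "(\<Union>x\<in>?I. O1 x) = ?I"
  proof (intro equalityI subsetI)
    fix y assume "y \<in> (\<Union>x\<in>?I. O1 x)"
    then obtain x where "x \<in> ?I" "y \<in> O1 x" by blast
    then show "y \<in> ?I" using i[of x] openin_subset[OF WX.X.basics_open[of "O1 x"]] by blast
  qed (use i in blast)
  then have "system W X A" using A by (simp add: system_def)
  then show thesis by (rule that) (use A B C in \<open>auto simp: composable_def\<close>)
qed

section \<open>Identity morphisms\<close>

definition id_system :: "'i set \<Rightarrow> ('i \<Rightarrow> 'x set) \<Rightarrow> ('x, 'p, 't, 'i) system" where
  "id_system I U = \<lparr>idx = I, sdom = U, scod = U, smap = (\<lambda>i x. x), stran = (\<lambda>j i \<xi>. \<xi>)\<rparr>"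

lemma id_system_simps [simp]: "idx (id_system I U) = I" "sdom (id_system I U) = U" "scod (id_system I U) = U"
  "smap (id_system I U) i x = x" "stran (id_system I U) j i \<xi> = \<xi>"
  by (simp_all add: id_system_def)

lemma id_local_system:
  assumes O: "orbispace X" and U: "\<And>i. i \<in> I \<Longrightarrow> U i \<in> basics X"
  shows "local_system X X (id_system I U)"
proof -
  interpret XX: orbi_pair X X by (rule orbi_pairI[OF O O])
  have sar: "sar (id_system I U) j i a = a" if "dchart a = U i" "cchart a = U j" for i j a
    using that by (cases a) (simp add: sar_def)
  have F: "germ_functor X X (id_system I U)"
    unfolding germ_functor_def id_system_simps(1-3)
  proof (intro conjI ballI impI)
    fix i assume "i \<in> I"
    show "continuous_map (hat (chart X (U i))) (hat (chart X (U i))) (smap (id_system I U) i)"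
      by (simp add: id_system_def)
  next
    fix i j a assume "i \<in> I" "j \<in> I" and a: "a \<in> arrows X" "dchart a = U i" "cchart a = U j"
    then show "sar (id_system I U) j i a \<in> arrows X" "tgt X (sar (id_system I U) j i a) = (U j, smap (id_system I U) j (snd (tgt X a)))"
      using sar[OF a(2,3)] XX.X.arrow_pts(5)[OF a(1)] by simp_all
  next
    fix i j k a b assume ab: "a \<in> arrows X" "b \<in> arrows X" and a: "dchart a = U i" "cchart a = U j" "cchart b = U k" "src b = tgt X a"
    then have "dchart b = U j" by (simp add: src_eq_tgt)
    then show "sar (id_system I U) k i (b \<bullet>\<^bsub>X\<^esub> a) = sar (id_system I U) k j b \<bullet>\<^bsub>X\<^esub> sar (id_system I U) j i a"
      using sar[of a i j] sar[of b j k] sar[of "b \<bullet>\<^bsub>X\<^esub> a" i k] a by simp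
  qed (use U in auto)
  show ?thesis
  proof (rule XX.local_systemI[OF F]; simp only: id_system_simps)
    fix i assume i: "i \<in> I"
    interpret U: g_struct "subtopology XX.X.T (U i)" "chart X (U i)" by (rule XX.X.chart_gs[OF U[OF i]])
    have "sgrp X X (id_system I U) i g = g" if "g \<in> carrier (gp X (U i))" for g
      by (rule XX.sgrp_eqI) (use that U[OF i] in simp_all)
    then show "continuous_map (grp_top (chart X (U i))) (grp_top (chart X (U i))) (sgrp X X (id_system I U) i)"
      using continuous_map_eq[OF continuous_map_id] by (metis U.topspace_grp_top id_apply)
  qed
qed

text \<open>
  Two identity functors are restrictions of the one over the union of their charts.
\<close>

lemma id_systems_bridged:
  assumes O: "orbispace X" and "\<And>i. i \<in> I \<Longrightarrow> U i \<in> basics X" "\<And>i. i \<in> J \<Longrightarrow> V i \<in> basics X"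
  shows "bridged X X (id_system I U) (id_system J V)"
proof -
  interpret XX: orbi_pair X X by (rule orbi_pairI[OF O O])
  have "local_system X X (id_system (Inl ` I \<union> Inr ` J) (case_sum U V))"
    by (rule id_local_system[OF O]) (use assms in auto)
  then show ?thesis by (rule XX.bridgedI[where e=Inl and d=Inr]) (auto simp: embeds_def)
qed

text \<open>
  The two labels inside a node are fillers: an index only has to record the chart \<open>W\<close>.
\<close>

definition ident :: "('x, 'p, 'g, 't) orbispace \<Rightarrow> ('x, 'p, 't, ('x, 'l) index) system" where
  "ident X = id_system (Node (Label undefined) (Label undefined) ` basics X) (\<lambda>i. case i of Node \<alpha> a W \<Rightarrow> W | Label l \<Rightarrow> {})"

lemma ident_system:
  assumes O: "orbispace X"
  shows "system X X (ident X)"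
proof -
  interpret X: orbi X using O by (simp add: orbi_def)
  have "local_system X X (ident X)" unfolding ident_def by (rule id_local_system[OF O]) auto
  moreover have "(\<Union>W\<in>basics X. W) = topspace X.T"
    using X.basics_open openin_subset X.basics_base[OF openin_topspace] by fast
  ultimately show ?thesis by (simp add: system_def) (simp add: ident_def)
qed

lemma bridged_ident:
  assumes O: "orbispace X" and "\<And>i. i \<in> I \<Longrightarrow> U i \<in> basics X"
  shows "bridged X X (id_system I U) (ident X)"
  unfolding ident_def by (rule id_systems_bridged[OF O]) (use assms in auto)

section \<open>The category of orbispaces\<close>

lemma orbi_hom_cases:
  assumes "F \<in> orbi_hom X Y"
  obtains S where "system X Y S" "F = system_rel X Y `` {S}"
  using assms unfolding orbi_hom_def by (auto elim: quotientE)

lemma in_orbi_hom: "system X Y S \<Longrightarrow> system_rel X Y `` {S} \<in> orbi_hom X Y"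
  unfolding orbi_hom_def by (simp add: quotientI)

lemma orbi_comp_closed:
  assumes O: "orbispace X" "orbispace Y" "orbispace Z" and F: "F \<in> orbi_hom X Y" and G: "G \<in> orbi_hom Y Z"
  shows "orbi_comp X Y Z G F \<in> orbi_hom X Z"
proof -
  interpret XY: orbi_pair X Y by (rule orbi_pairI[OF O(1,2)])
  interpret XZ: orbi_pair X Z by (rule orbi_pairI[OF O(1,3)])
  obtain S where S: "system X Y S" "F = system_rel X Y `` {S}" using orbi_hom_cases[OF F] .
  obtain T where T: "system Y Z T" "G = system_rel Y Z `` {T}" using orbi_hom_cases[OF G] .
  obtain H where H: "is_composite X Y Z T S H" using composite_exists[OF O S(1) T(1)] .
  obtain R Q where *: "system X Y R" "local_system Y Z Q" "bridged X Y R S" "bridged Y Z Q T" "composable Q R"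
    "H = compose_systems Q R" using composite_data[OF O S(1) T(1) H] .
  note h = composite_bridged[OF O S(1) T(1) H *(3-5)]
  show ?thesis
    unfolding S(2) T(2) orbi_comp_eq[OF O S(1) T(1) *(1,3-5) h] by (rule in_orbi_hom[OF h(1)])
qed

text \<open>
  Let \<open>A\<close>, \<open>B\<close>, \<open>C\<close> be systems with matching charts that are bridged to representatives of \<open>F\<close>, \<open>G\<close>, \<open>H\<close>. Both
  sides are the class of a system bridged to \<open>C \<circ> B \<circ> A\<close>.
\<close>

lemma orbi_comp_assoc:
  assumes O: "orbispace W" "orbispace X" "orbispace Y" "orbispace Z"
    and F: "F \<in> orbi_hom W X" and G: "G \<in> orbi_hom X Y" and H: "H \<in> orbi_hom Y Z"
  shows "orbi_comp W Y Z H (orbi_comp W X Y G F) = orbi_comp W X Z (orbi_comp X Y Z H G) F"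
proof -
  interpret WX: orbi_pair W X by (rule orbi_pairI[OF O(1,2)])
  interpret XY: orbi_pair X Y by (rule orbi_pairI[OF O(2,3)])
  obtain S where S: "system W X S" "F = system_rel W X `` {S}" using orbi_hom_cases[OF F] .
  obtain T where T: "system X Y T" "G = system_rel X Y `` {T}" using orbi_hom_cases[OF G] .
  obtain P where P: "system Y Z P" "H = system_rel Y Z `` {P}" using orbi_hom_cases[OF H] .
  obtain A B C :: "('a, 'b, 'd, 'a) system" where A: "system W X A" "bridged W X A S"
    and B: "bridged X Y B T" and C: "bridged Y Z C P" and c: "composable B A" "composable C B"
    using composable_triple[OF O S(1) T(1) P(1)] .
  have LB: "local_system X Y B" and LC: "local_system Y Z C" and LA: "local_system W X A"
    using XY.bridged_local(1)[OF B] orbi_pair.bridged_local(1)[OF orbi_pairI[OF O(3,4)] C] WX.bridged_local(1)[OF A(2)] by auto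
  obtain K1 where K1: "is_composite W X Y T S K1" using composite_exists[OF O(1,2,3) S(1) T(1)] .
  obtain K2 where K2: "is_composite X Y Z P T K2" using composite_exists[OF O(2,3,4) T(1) P(1)] .
  note k1 = composite_bridged[OF O(1,2,3) S(1) T(1) K1 A(2) B c(1)]
    and k2 = composite_bridged[OF O(2,3,4) T(1) P(1) K2 B C c(2)]
  obtain K where K: "is_composite W Y Z P K1 K" using composite_exists[OF O(1,3,4) k1(1) P(1)] .
  have cc: "composable C (compose_systems B A)" "composable (compose_systems C B) A"
    using c by (auto simp: composable_def)
  have b1: "bridged W Y (compose_systems B A) K1" "bridged X Z (compose_systems C B) K2"
    using orbi_pair.bridged_sym[OF orbi_pairI[OF O(1,3)] k1(2)] orbi_pair.bridged_sym[OF orbi_pairI[OF O(2,4)] k2(2)] .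
  note k = composite_bridged[OF O(1,3,4) k1(1) P(1) K b1(1) C cc(1)]
  have BA: "system W Y (compose_systems B A)" by (rule compose_system[OF O(1-3) A(1) LB c(1)])
  have "orbi_comp W Y Z H (orbi_comp W X Y G F) = orbi_comp W Y Z H (system_rel W Y `` {K1})"
    unfolding S(2) T(2) orbi_comp_eq[OF O(1-3) S(1) T(1) A B c(1) k1] ..
  also have "\<dots> = system_rel W Z `` {K}"
    unfolding P(2) by (rule orbi_comp_eq[OF O(1,3,4) k1(1) P(1) BA b1(1) C cc(1) k])
  also have "\<dots> = orbi_comp W X Z (system_rel X Z `` {K2}) F"
    unfolding S(2)
    by (rule orbi_comp_eq[OF O(1,2,4) S(1) k2(1) A b1(2) cc(2) k(1) k(2)[folded compose_systems_assoc], symmetric])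
  also have "\<dots> = orbi_comp W X Z (orbi_comp X Y Z H G) F"
  proof -
    obtain R Q where *: "system X Y R" "local_system Y Z Q" "bridged X Y R T" "bridged Y Z Q P" "composable Q R"
      "K2 = compose_systems Q R" using composite_data[OF O(2-4) T(1) P(1) K2] .
    note h = composite_bridged[OF O(2-4) T(1) P(1) K2 *(3-5)]
    show ?thesis unfolding T(2) P(2) orbi_comp_eq[OF O(2-4) T(1) P(1) *(1,3-5) h] ..
  qed
  finally show ?thesis .
qed

text \<open>
  A representative \<open>S\<close> of \<open>F\<close> is composed with the identity functor over its own charts, which is bridged to
  \<open>ident X\<close>.
\<close>

lemma orbi_comp_ident_right:
  assumes O: "orbispace X" "orbispace Y" and F: "F \<in> orbi_hom X Y"
  shows "orbi_comp X X Y F (system_rel X X `` {ident X}) = F"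
proof -
  interpret XY: orbi_pair X Y by (rule orbi_pairI[OF O])
  obtain S where S: "system X Y S" "F = system_rel X Y `` {S}" using orbi_hom_cases[OF F] .
  have LS: "local_system X Y S" using S by (simp add: system_def)
  have U: "sdom S i \<in> basics X" if "i \<in> idx S" for i using XY.gf_charts(1)[OF XY.local_system_gf[OF LS] that] .
  let ?R = "id_system (idx S) (sdom S)"
  have "system X X ?R" using id_local_system[OF O(1) U] S(1) by (simp add: system_def)
  moreover have "bridged X X ?R (ident X)" by (rule bridged_ident[OF O(1) U])
  moreover have "composable S ?R" by (simp add: composable_def)
  moreover have "bridged X Y S (compose_systems S ?R)"
    by (rule XY.bridgedI[OF LS, where e="\<lambda>i. i" and d="\<lambda>i. i"]) (simp_all add: embeds_def)
  ultimately show ?thesis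
    unfolding S(2) using orbi_comp_eq[OF O(1,1,2) ident_system[OF O(1)] S(1) _ _ XY.bridged_refl[OF LS] _ S(1)] by blast
qed

lemma orbi_comp_ident_left:
  assumes O: "orbispace X" "orbispace Y" and F: "F \<in> orbi_hom X Y"
  shows "orbi_comp X Y Y (system_rel Y Y `` {ident Y}) F = F"
proof -
  interpret XY: orbi_pair X Y by (rule orbi_pairI[OF O])
  obtain S where S: "system X Y S" "F = system_rel X Y `` {S}" using orbi_hom_cases[OF F] .
  have LS: "local_system X Y S" using S by (simp add: system_def)
  have U: "scod S i \<in> basics Y" if "i \<in> idx S" for i using XY.gf_charts(2)[OF XY.local_system_gf[OF LS] that] .
  let ?Q = "id_system (idx S) (scod S)"
  have "bridged Y Y ?Q (ident Y)" by (rule bridged_ident[OF O(2) U])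
  moreover have "composable ?Q S" by (simp add: composable_def)
  moreover have "bridged X Y S (compose_systems ?Q S)"
    by (rule XY.bridgedI[OF LS, where e="\<lambda>i. i" and d="\<lambda>i. i"]) (simp_all add: embeds_def)
  ultimately show ?thesis
    unfolding S(2) using orbi_comp_eq[OF O(1,2,2) S(1) ident_system[OF O(2)] S(1) XY.bridged_refl[OF LS] _ _ S(1)] by blast
qed

theorem theorem2p2p7:
  shows "(\<forall>X X'. orbispace (X :: ('x, 'p, 'g, 't) orbispace) \<and> orbispace X' \<longrightarrow>
            equiv {S :: ('x, 'p, 't, ('x, 'l) index) system. system X X' S} (system_rel X X')) \<and>
         category {X :: ('x, 'p, 'g, 't) orbispace. orbispace X}
           (orbi_hom :: _ \<Rightarrow> _ \<Rightarrow> ('x, 'p, 't, ('x, 'l) index) system set set)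
           orbi_comp"
proof (intro conjI allI impI)
  fix X X' :: "('x, 'p, 'g, 't) orbispace"
  assume "orbispace X \<and> orbispace X'"
  then show "equiv {S :: ('x, 'p, 't, ('x, 'l) index) system. system X X' S} (system_rel X X')"
    using orbi_pair.equiv_system_rel[OF orbi_pairI] by blast
next
  show "category {X :: ('x, 'p, 'g, 't) orbispace. orbispace X}
           (orbi_hom :: _ \<Rightarrow> _ \<Rightarrow> ('x, 'p, 't, ('x, 'l) index) system set set) orbi_comp"
  proof
    fix X :: "('x, 'p, 'g, 't) orbispace"
    assume "X \<in> {X. orbispace X}"
    then have X: "orbispace X" by simp
    let ?e = "system_rel X X `` {ident X :: ('x, 'p, 't, ('x, 'l) index) system}"
    show "\<exists>e\<in>orbi_hom X X.
         (\<forall>Y\<in>{X :: ('x, 'p, 'g, 't) orbispace. orbispace X}. \<forall>f\<in>(orbi_hom X Y :: ('x, 'p, 't, ('x, 'l) index) system set set). orbi_comp X X Y f e = f) \<and>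
         (\<forall>Y\<in>{X :: ('x, 'p, 'g, 't) orbispace. orbispace X}. \<forall>f\<in>(orbi_hom Y X :: ('x, 'p, 't, ('x, 'l) index) system set set). orbi_comp Y X X e f = f)"
    proof (rule bexI[of _ ?e])
      show "?e \<in> orbi_hom X X" by (rule in_orbi_hom[OF ident_system[OF X]])
    qed (use X orbi_comp_ident_right orbi_comp_ident_left in blast)
  qed (use orbi_comp_closed orbi_comp_assoc in \<open>simp_all\<close>)
qed

end
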